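(* Let $f$ be a smooth diffeomorphism of a compact $d$-dimensional Riemannian manifold $M$ preserving a smooth probability measure $\mu$, let $r\ge1$, and suppose that $f$ is $(2r+1)$-fold exponentially mixing for Lipschitz observables. For $x,y\in M$ let $d_n^{(r)}(x,y)$ be the $r$-th smallest among $d(x,fy),\dots,d(x,f^ny)$. Then: (a) for $\mu$-a.e. $x$ and for $\mu$-a.e. $y$ (i.e. for all $x$ in a set of full measure, for a.e. $y$), $$\limsup_{n\to\infty}\frac{|\ln d_n^{(r)}(x,y)|-\frac1d\ln n}{\ln\ln n}=\frac1{rd};$$ (b) for $\mu$-a.e. $x$, $$\limsup_{n\to\infty}\frac{|\ln d_n^{(r)}(x,x)|-\frac1d\ln n}{\ln\ln n}=\frac1{rd}.$$
   Context: Smooth measure: a measure with smooth positive density with respect to Riemannian volume. For $p\ge1$, $(f,M,\mu)$ is $(p+1)$-fold exponentially mixing for Lipschitz observables if there are $C>0$ and $\theta<1$ such that for every Lipschitz $A:M^{p+1}\to\mathbb R$ and all integers $0=k_0\le k_1\le\dots\le k_p$ with $k_{j+1}-k_j\ge m$ for all $0\le j\le p-1$, $$\Big|\int_MA(x,f^{k_1}x,\dots,f^{k_p}x)\,d\mu(x)-\int_{M^{p+1}}A(x_0,\dots,x_p)\,d\mu(x_0)\cdots d\mu(x_p)\Big|\le C\theta^m\|A\|_{\mathrm{Lip}}.$$ Here $d(\cdot,\cdot)$ is the Riemannian distance. *)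

theory Defs
  imports "HOL-Probability.Probability"
begin

section \<open>Smooth maps between Euclidean spaces\<close>

text \<open>The set \<open>S\<close> is meant to be open. Class \<open>C\<^sup>k\<close> is expressed by iterated directional derivatives.\<close>

primrec Ck_on :: "nat \<Rightarrow> 'v::euclidean_space set \<Rightarrow> ('v \<Rightarrow> 'w::real_normed_vector) \<Rightarrow> bool" where
  "Ck_on 0 S h \<longleftrightarrow> continuous_on S h"
| "Ck_on (Suc k) S h \<longleftrightarrow>
     (\<forall>u\<in>S. h differentiable (at u)) \<and>
     (\<forall>v. Ck_on k S (\<lambda>u. frechet_derivative h (at u) v))"

definition smooth_on :: "'v::euclidean_space set \<Rightarrow> ('v \<Rightarrow> 'w::real_normed_vector) \<Rightarrow> bool" where
  "smooth_on S h \<longleftrightarrow> (\<forall>k. Ck_on k S h)"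


section \<open>Smooth manifolds\<close>

text \<open>
  The manifold is the whole type \<open>'a\<close>. A chart is a pair \<open>(U, \<phi>)\<close>; \<open>\<phi>\<close> is a total function of
  which only the values on \<open>U\<close> matter. The dimension of the manifold is \<open>CARD('d)\<close>.
\<close>

type_synonym ('a, 'd) chart = "'a set \<times> ('a \<Rightarrow> real ^ 'd)"

definition chart_inv :: "('a, 'd::finite) chart \<Rightarrow> real ^ 'd \<Rightarrow> 'a" where
  "chart_inv c = inv_into (fst c) (snd c)"

definition transition :: "('a, 'd::finite) chart \<Rightarrow> ('a, 'd) chart \<Rightarrow> real ^ 'd \<Rightarrow> real ^ 'd" where
  "transition c c' = snd c' \<circ> chart_inv c"

definition is_chart :: "('a::topological_space, 'd::finite) chart \<Rightarrow> bool" where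
  "is_chart c \<longleftrightarrow> open (fst c) \<and> open (snd c ` fst c) \<and>
     homeomorphism (fst c) (snd c ` fst c) (snd c) (chart_inv c)"

definition smooth_atlas ::
    "('a::{t2_space, second_countable_topology}, 'd::finite) chart set \<Rightarrow> bool" where
  "smooth_atlas \<A> \<longleftrightarrow>
     (\<forall>c\<in>\<A>. is_chart c) \<and> (\<Union>c\<in>\<A>. fst c) = UNIV \<and>
     (\<forall>c\<in>\<A>. \<forall>c'\<in>\<A>. smooth_on (snd c ` (fst c \<inter> fst c')) (transition c c'))"

definition smooth_map ::
    "('a::{t2_space, second_countable_topology}, 'd::finite) chart set \<Rightarrow> ('a \<Rightarrow> 'a) \<Rightarrow> bool" where
  "smooth_map \<A> f \<longleftrightarrow> continuous_on UNIV f \<and>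
     (\<forall>c\<in>\<A>. \<forall>c'\<in>\<A>. smooth_on (snd c ` (fst c \<inter> f -` fst c')) (snd c' \<circ> f \<circ> chart_inv c))"

definition smooth_diffeo ::
    "('a::{t2_space, second_countable_topology}, 'd::finite) chart set \<Rightarrow> ('a \<Rightarrow> 'a) \<Rightarrow> bool" where
  "smooth_diffeo \<A> f \<longleftrightarrow> bij f \<and> smooth_map \<A> f \<and> smooth_map \<A> (inv f)"

definition smooth_function ::
    "('a::{t2_space, second_countable_topology}, 'd::finite) chart set \<Rightarrow> ('a \<Rightarrow> real) \<Rightarrow> bool" where
  "smooth_function \<A> \<rho> \<longleftrightarrow> (\<forall>c\<in>\<A>. smooth_on (snd c ` fst c) (\<rho> \<circ> chart_inv c))"


section \<open>Riemannian metric, distance and volume\<close>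

text \<open>
  A metric tensor \<open>G\<close> is given by its coefficient matrices: \<open>G c x\<close> is the Gram matrix at the point
  \<open>x\<close> of the coordinate frame of the chart \<open>c\<close>. The last clause is the transformation law of a
  covariant symmetric 2-tensor under change of charts.
\<close>

definition riemannian_metric ::
    "('a::{t2_space, second_countable_topology}, 'd::finite) chart set
      \<Rightarrow> (('a, 'd) chart \<Rightarrow> 'a \<Rightarrow> real ^ 'd ^ 'd) \<Rightarrow> bool" where
  "riemannian_metric \<A> G \<longleftrightarrow>
     (\<forall>c\<in>\<A>. \<forall>x\<in>fst c. transpose (G c x) = G c x \<and> (\<forall>v. v \<noteq> 0 \<longrightarrow> v \<bullet> (G c x *v v) > 0)) \<and>
     (\<forall>c\<in>\<A>. \<forall>i j. smooth_on (snd c ` fst c) (\<lambda>u. G c (chart_inv c u) $ i $ j)) \<and>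
     (\<forall>c\<in>\<A>. \<forall>c'\<in>\<A>. \<forall>x\<in>fst c \<inter> fst c'.
        (let J = matrix (frechet_derivative (transition c c') (at (snd c x)))
         in G c x = transpose J ** G c' x ** J))"

text \<open>
  \<open>\<gamma>\<close> is continuously differentiable on \<open>{a..b}\<close>, with one-sided derivatives at the end points.
\<close>

definition C1_curve_on ::
    "('a::{t2_space, second_countable_topology}, 'd::finite) chart set
      \<Rightarrow> real \<Rightarrow> real \<Rightarrow> (real \<Rightarrow> 'a) \<Rightarrow> bool" where
  "C1_curve_on \<A> a b \<gamma> \<longleftrightarrow> continuous_on {a..b} \<gamma> \<and>
     (\<forall>c\<in>\<A>. \<exists>D. continuous_on ({a..b} \<inter> \<gamma> -` fst c) D \<and>
        (\<forall>t\<in>{a..b} \<inter> \<gamma> -` fst c. ((snd c \<circ> \<gamma>) has_vector_derivative D t) (at t within {a..b})))"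

text \<open>\<open>S\<close> is the set of break points; the curve is \<open>C\<^sup>1\<close> between consecutive ones.\<close>

definition piecewise_C1_curve ::
    "('a::{t2_space, second_countable_topology}, 'd::finite) chart set \<Rightarrow> (real \<Rightarrow> 'a) \<Rightarrow> bool" where
  "piecewise_C1_curve \<A> \<gamma> \<longleftrightarrow> continuous_on {0..1} \<gamma> \<and>
     (\<exists>S. finite S \<and> S \<subseteq> {0..1} \<and> {0, 1} \<subseteq> S \<and>
        (\<forall>a\<in>S. \<forall>b\<in>S. a < b \<and> S \<inter> {a<..<b} = {} \<longrightarrow> C1_curve_on \<A> a b \<gamma>))"

text \<open>
  The speed does not depend on the chart chosen at \<open>\<gamma> t\<close>, by the transformation law of the metric.
\<close>

definition curve_speed ::
    "('a::{t2_space, second_countable_topology}, 'd::finite) chart set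
      \<Rightarrow> (('a, 'd) chart \<Rightarrow> 'a \<Rightarrow> real ^ 'd ^ 'd) \<Rightarrow> (real \<Rightarrow> 'a) \<Rightarrow> real \<Rightarrow> real" where
  "curve_speed \<A> G \<gamma> t =
     (let c = (SOME c. c \<in> \<A> \<and> \<gamma> t \<in> fst c); v = vector_derivative (snd c \<circ> \<gamma>) (at t)
      in sqrt (v \<bullet> (G c (\<gamma> t) *v v)))"

definition curve_length ::
    "('a::{t2_space, second_countable_topology}, 'd::finite) chart set
      \<Rightarrow> (('a, 'd) chart \<Rightarrow> 'a \<Rightarrow> real ^ 'd ^ 'd) \<Rightarrow> (real \<Rightarrow> 'a) \<Rightarrow> ennreal" where
  "curve_length \<A> G \<gamma> = (\<integral>\<^sup>+ t\<in>{0..1}. ennreal (curve_speed \<A> G \<gamma> t) \<partial>lborel)"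

text \<open>
  The distance is an infimum over an empty set, hence infinite, between points of different
  connected components.
\<close>

definition rdist ::
    "('a::{t2_space, second_countable_topology}, 'd::finite) chart set
      \<Rightarrow> (('a, 'd) chart \<Rightarrow> 'a \<Rightarrow> real ^ 'd ^ 'd) \<Rightarrow> 'a \<Rightarrow> 'a \<Rightarrow> ennreal" where
  "rdist \<A> G x y =
     (INF \<gamma>\<in>{\<gamma>. piecewise_C1_curve \<A> \<gamma> \<and> \<gamma> 0 = x \<and> \<gamma> 1 = y}. curve_length \<A> G \<gamma>)"

text \<open>
  The Riemannian volume is the Borel measure which in every chart is \<open>sqrt (det G) du\<close>; as the
  charts cover a second countable space it is uniquely determined by this.
\<close>

definition is_riemannian_volume ::
    "('a::{t2_space, second_countable_topology}, 'd::finite) chart set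
      \<Rightarrow> (('a, 'd) chart \<Rightarrow> 'a \<Rightarrow> real ^ 'd ^ 'd) \<Rightarrow> 'a measure \<Rightarrow> bool" where
  "is_riemannian_volume \<A> G \<nu> \<longleftrightarrow> sets \<nu> = sets borel \<and>
     (\<forall>c\<in>\<A>. \<forall>B\<in>sets borel. B \<subseteq> fst c \<longrightarrow>
        emeasure \<nu> B = (\<integral>\<^sup>+ u\<in>snd c ` B. ennreal (sqrt (det (G c (chart_inv c u)))) \<partial>lborel))"

definition smooth_measure ::
    "('a::{t2_space, second_countable_topology}, 'd::finite) chart set
      \<Rightarrow> (('a, 'd) chart \<Rightarrow> 'a \<Rightarrow> real ^ 'd ^ 'd) \<Rightarrow> 'a measure \<Rightarrow> bool" where
  "smooth_measure \<A> G \<mu> \<longleftrightarrow>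
     (\<exists>\<nu> \<rho>. is_riemannian_volume \<A> G \<nu> \<and> smooth_function \<A> \<rho> \<and> (\<forall>x. \<rho> x > 0) \<and>
        \<mu> = density \<nu> (\<lambda>x. ennreal (\<rho> x)))"


section \<open>Lipschitz observables and multiple exponential mixing\<close>

text \<open>
  Points of the \<open>q\<close>-fold product \<open>M\<^sup>q\<close> are extensional functions on \<open>{..<q}\<close>, and \<open>M\<^sup>q\<close> carries the
  distance of the product Riemannian metric. Points at infinite distance impose no Lipschitz condition.
\<close>

definition prod_space :: "nat \<Rightarrow> (nat \<Rightarrow> 'a) set" where
  "prod_space q = (\<Pi>\<^sub>E i\<in>{..<q}. UNIV)"

definition has_lip_const :: "('a \<Rightarrow> 'a \<Rightarrow> ennreal) \<Rightarrow> nat \<Rightarrow> ((nat \<Rightarrow> 'a) \<Rightarrow> real) \<Rightarrow> real \<Rightarrow> bool" where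
  "has_lip_const \<delta> q A L \<longleftrightarrow> 0 \<le> L \<and>
     (\<forall>x\<in>prod_space q. \<forall>y\<in>prod_space q. (\<forall>i<q. \<delta> (x i) (y i) < \<infinity>) \<longrightarrow>
        \<bar>A x - A y\<bar> \<le> L * L2_set (\<lambda>i. enn2real (\<delta> (x i) (y i))) {..<q})"

definition lipschitz_observable :: "('a \<Rightarrow> 'a \<Rightarrow> ennreal) \<Rightarrow> nat \<Rightarrow> ((nat \<Rightarrow> 'a) \<Rightarrow> real) \<Rightarrow> bool" where
  "lipschitz_observable \<delta> q A \<longleftrightarrow> (\<exists>L. has_lip_const \<delta> q A L)"

definition lip_norm :: "('a \<Rightarrow> 'a \<Rightarrow> ennreal) \<Rightarrow> nat \<Rightarrow> ((nat \<Rightarrow> 'a) \<Rightarrow> real) \<Rightarrow> real" where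
  "lip_norm \<delta> q A = (SUP x\<in>prod_space q. \<bar>A x\<bar>) + Inf {L. has_lip_const \<delta> q A L}"

text \<open>\<open>q\<close>-fold exponential mixing, so \<open>q = p + 1\<close> for times \<open>0 = k\<^sub>0 \<le> k\<^sub>1 \<le> \<dots> \<le> k\<^sub>p\<close>.\<close>

definition fold_exp_mixing ::
    "('a \<Rightarrow> 'a \<Rightarrow> ennreal) \<Rightarrow> 'a measure \<Rightarrow> ('a \<Rightarrow> 'a) \<Rightarrow> nat \<Rightarrow> bool" where
  "fold_exp_mixing \<delta> \<mu> f q \<longleftrightarrow>
     (\<exists>C>0. \<exists>\<theta><1. \<forall>A. lipschitz_observable \<delta> q A \<longrightarrow>
        (\<forall>(k :: nat \<Rightarrow> nat) m. k 0 = 0 \<and> (\<forall>j. Suc j < q \<longrightarrow> k j + m \<le> k (Suc j)) \<longrightarrow>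
           \<bar>(\<integral>x. A (\<lambda>i\<in>{..<q}. (f ^^ k i) x) \<partial>\<mu>) - (\<integral>x. A x \<partial>(\<Pi>\<^sub>M i\<in>{..<q}. \<mu>))\<bar>
             \<le> C * \<theta> ^ m * lip_norm \<delta> q A))"


section \<open>Closest returns\<close>

text \<open>The \<open>r\<close>-th smallest, with multiplicity, of \<open>\<delta> x (f y), \<dots>, \<delta> x (f\<^sup>n y)\<close>; meaningful for
  \<open>1 \<le> r \<le> n\<close>.\<close>

definition closest_return ::
    "('a \<Rightarrow> 'a \<Rightarrow> ennreal) \<Rightarrow> ('a \<Rightarrow> 'a) \<Rightarrow> nat \<Rightarrow> nat \<Rightarrow> 'a \<Rightarrow> 'a \<Rightarrow> real" where
  "closest_return \<delta> f r n x y =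
     enn2real (sort (map (\<lambda>k. \<delta> x ((f ^^ k) y)) [1..<Suc n]) ! (r - 1))"

end

theory Submission
  imports Defs "HOL-Real_Asymp.Real_Asymp"
begin

text \<open>
  Fix an exponent \<open>s\<close> and put \<open>\<rho>\<^sub>m = 2\<^bsup>-m/d\<^esup> m\<^bsup>-s\<^esup>\<close>. A ball of radius \<open>\<rho>\<^sub>m\<close> has measure comparable to \<open>\<rho>\<^sub>m\<^sup>d\<close>,
  so about \<open>u = 2\<^sup>m \<rho>\<^sub>m\<^sup>d = m\<^bsup>-sd\<^esup>\<close> visits to it are expected among \<open>2\<^sup>m\<close> consecutive times. If visits
  behaved like independent events, \<open>r\<close> visits would have probability about \<open>u\<^sup>r\<close>, which is summable over \<open>m\<close> for
  \<open>s > 1/(r d)\<close> and equals \<open>1/m\<close> for \<open>s = 1/(r d)\<close>. By a Borel--Cantelli dichotomy the \<open>r\<close>-th smallest distance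
  up to time \<open>n \<approx> 2\<^sup>m\<close> is eventually above \<open>\<rho>\<^sub>m\<close> in the first case and infinitely often below a multiple of
  \<open>\<rho>\<^sub>m\<close> in the second. Since \<open>-ln \<rho>\<^sub>m = (1/d) m ln 2 + s ln m\<close> and \<open>ln m\<close> is asymptotic to \<open>ln ln n\<close>, this is
  the value \<open>1/(r d)\<close> of the upper limit (\<open>limsup_order_statistic\<close>). A bounded factor in the distance changes
  the numerator by a bounded amount only, which the divisor \<open>ln ln n\<close> makes invisible.

  Hitting and recurrence are treated together: the centre of the ball is \<open>b y\<close> for a nonexpansive map \<open>b\<close>. A
  constant \<open>b\<close> gives the hitting statement, the identity gives the recurrence statement. Because \<open>b y\<close> depends
  on \<open>y\<close> in a Lipschitz way, an observable of \<open>(b y, f\<^sup>k y)\<close> is an observable of \<open>(y, f\<^sup>k y)\<close>, and mixing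
  with \<open>2 r + 1\<close> points decouples \<open>y\<close> from up to \<open>2 r\<close> later times (\<open>mixing_times\<close>): \<open>r\<close> times for
  the probability of \<open>r\<close> visits, \<open>2 r\<close> for second moments.

  Mixing is useless in two regimes, and these need separate arguments. The error of mixing is
  \<open>\<theta>\<^sup>g\<close> for a gap \<open>g\<close> times a power of Lipschitz constants, which are exponential in \<open>m\<close>, so gaps must be
  at least a large multiple of \<open>m\<close>. Visits at early times, and two visits at close times, are therefore
  controlled by short returns: \<open>\<mu>{y. D y (f\<^sup>k y) \<le> \<alpha>\<^sup>m}\<close> is exponentially small in \<open>m\<close>, uniformly in
  \<open>k \<ge> 1\<close> (\<open>short_returns\<close>). The reason is that a return at a small time \<open>k\<close> forces approximate returns at all
  multiples of \<open>k\<close> that are not too large, and to one of those times mixing does apply. Integrating over the centre,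
  pairs of close visits are exponentially rarer than single visits, for almost every fixed centre as well as for
  the moving centre (\<open>admissible_id\<close>, \<open>admissible_const\<close>).

  The upper bound (\<open>eventually_few_visits\<close>) is then the first Borel--Cantelli lemma: an \<open>r\<close>-tuple of visits
  consists of times with large gaps, or contains an early time, or contains two close times. The lower bound
  (\<open>infinitely_often_many_visits\<close>) uses second moments. The times between \<open>2\<^sup>m\<close> and \<open>2\<^bsup>m+1\<^esup>\<close> contain
  \<open>r\<close> long windows; in each, blocks of \<open>m\<close> consecutive times are placed on a lattice of step \<open>P m\<close>, and one counts
  blocks that contain a visit. The steps make mixing effective, and since the blocks fill a positive proportion of all times no
  factor \<open>m\<close> is lost. The counting function \<open>X\<^sub>m\<close> is a product over the \<open>r\<close> windows of averages over blocks,
  each divided by its expectation given the centre; hence \<open>E X\<^sub>m \<approx> 1\<close> irrespective of the density of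
  \<open>\<mu>\<close> and of the correlation between ball and point, while \<open>E X\<^sub>m\<^sup>2\<close> is at most of order \<open>u\<^bsup>-r\<^esup> = m\<close>. For
  scales \<open>m < m'\<close> that differ enough, all times of \<open>X\<^sub>m\<close> are much smaller than the gaps in \<open>X\<^bsub>m'\<^esub>\<close>, so that \<open>X\<^sub>m\<close> and
  \<open>X\<^bsub>m'\<^esub>\<close> are almost uncorrelated. As \<open>\<Sum> 1/m\<close> diverges, Chebyshev's inequality for \<open>\<Sum> X\<^sub>m / m\<close> shows that
  almost surely \<open>X\<^sub>m > 0\<close> infinitely often (\<open>second_moment_frequently\<close>).

  The geometry enters through a metric \<open>D\<close> that is a finite sum of distances between cut-off chart coordinates. It is
  finite even when the manifold is disconnected, all balls of radius \<open>\<rho> \<le> 1\<close> have measure comparable to \<open>\<rho>\<^sup>d\<close>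
  (\<open>D_ball_measure\<close>), smooth maps are Lipschitz for it (\<open>smooth_map_lipschitz\<close>), and it is comparable to the
  Riemannian distance: \<open>D\<close> is bounded by a multiple of the length of any curve (\<open>D_le_rdist\<close>), and points that are
  close for \<open>D\<close> are joined by a coordinate segment of comparable length (\<open>rdist_le_D\<close>). Therefore bounded \<open>D\<close>-Lipschitz
  observables are Lipschitz observables for the Riemannian distance, with comparable norm.
\<close>

section \<open>Mixing at separated times\<close>

lemma abs_prod_diff_le:
  fixes a b :: "'i \<Rightarrow> real"
  assumes "finite I" "\<And>i. i \<in> I \<Longrightarrow> \<bar>a i\<bar> \<le> \<Lambda>" "\<And>i. i \<in> I \<Longrightarrow> \<bar>b i\<bar> \<le> \<Lambda>" "1 \<le> \<Lambda>"
  shows "\<bar>(\<Prod>i\<in>I. a i) - (\<Prod>i\<in>I. b i)\<bar> \<le> \<Lambda> ^ card I * (\<Sum>i\<in>I. \<bar>a i - b i\<bar>)"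
  using assms(1-3)
proof (induction I rule: finite_induct)
  case (insert i I)
  let ?A = "\<Prod>i\<in>I. a i" and ?B = "\<Prod>i\<in>I. b i" and ?S = "\<Sum>i\<in>I. \<bar>a i - b i\<bar>"
  have B: "\<bar>?B\<bar> \<le> \<Lambda> ^ card I"
    using prod_mono[of I "\<lambda>i. \<bar>b i\<bar>" "\<lambda>_. \<Lambda>"] insert by (simp add: abs_prod)
  have "\<bar>a i * ?A - b i * ?B\<bar> = \<bar>a i * (?A - ?B) + (a i - b i) * ?B\<bar>"
    by (simp add: algebra_simps)
  also have "\<dots> \<le> \<bar>a i\<bar> * \<bar>?A - ?B\<bar> + \<bar>a i - b i\<bar> * \<bar>?B\<bar>"
    by (metis abs_mult abs_triangle_ineq)
  also have "\<dots> \<le> \<Lambda> * (\<Lambda> ^ card I * ?S) + \<bar>a i - b i\<bar> * \<Lambda> ^ card I"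
    using insert B assms(4) by (intro add_mono mult_mono) (auto intro!: mult_nonneg_nonneg sum_nonneg)
  also have "\<dots> \<le> \<Lambda> * (\<Lambda> ^ card I * ?S) + \<bar>a i - b i\<bar> * (\<Lambda> * \<Lambda> ^ card I)"
    using assms(4) by (intro add_left_mono mult_left_mono) (auto simp: mult_le_cancel_right1)
  finally show ?case using insert by (simp add: algebra_simps)
qed simp

text \<open>
  The abstract setting of the dynamical argument: \<open>D\<close> is a finite pseudometric with \<open>d\<close>-dimensional balls and
  \<open>f\<close> is Lipschitz for it. Mixing is assumed for observables on \<open>M\<^bsup>2r+1\<^esup>\<close> that are bounded and Lipschitz with the same
  constant \<open>\<Lambda>\<close>; a single constant suffices because all Lipschitz constants in use exceed the bounds.
\<close>
locale mixing_system = prob_space \<mu>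
  for \<mu> :: "'a::second_countable_topology measure" +
  fixes D :: "'a \<Rightarrow> 'a \<Rightarrow> real" and f :: "'a \<Rightarrow> 'a" and d r :: nat and L c C K \<theta> :: real
  assumes sets_eq: "sets \<mu> = sets borel"
    and D_sym: "D x y = D y x"
    and D_triangle: "D x z \<le> D x y + D y z"
    and D_self [simp]: "D x x = 0"
    and D_cont: "continuous_on UNIV (D x)"
    and f_measurable [measurable]: "f \<in> borel \<rightarrow>\<^sub>M borel"
    and f_preserves: "distr \<mu> \<mu> f = \<mu>"
    and f_lipschitz: "D (f x) (f y) \<le> L * D x y"
    and L_ge_1: "1 \<le> L"
    and d_pos: "1 \<le> d" and r_pos: "1 \<le> r"
    and ball_lower: "0 < \<rho> \<Longrightarrow> \<rho> \<le> 1 \<Longrightarrow> c * \<rho> ^ d \<le> measure \<mu> {y. D x y \<le> \<rho>}"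
    and ball_upper: "0 < \<rho> \<Longrightarrow> measure \<mu> {y. D x y \<le> \<rho>} \<le> C * \<rho> ^ d"
    and c_pos: "0 < c" and K_nonneg: "0 \<le> K" and \<theta>_pos: "0 < \<theta>" and \<theta>_less_1: "\<theta> < 1"
    and mixing: "(\<And>x. \<bar>A x\<bar> \<le> \<Lambda>) \<Longrightarrow>
      (\<And>x y. \<bar>A x - A y\<bar> \<le> \<Lambda> * (\<Sum>i<2 * r + 1. D (x i) (y i))) \<Longrightarrow>
      k 0 = 0 \<Longrightarrow> (\<And>j. Suc j < 2 * r + 1 \<Longrightarrow> k j + m \<le> k (Suc j)) \<Longrightarrow>
      \<bar>(\<integral>x. A (\<lambda>i\<in>{..<2 * r + 1}. (f ^^ k i) x) \<partial>\<mu>) - (\<integral>x. A x \<partial>(\<Pi>\<^sub>M i\<in>{..<2 * r + 1}. \<mu>))\<bar>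
        \<le> K * \<theta> ^ m * \<Lambda>"
begin

lemma D_nonneg [simp]: "0 \<le> D x y"
  using D_triangle[of x x y] D_sym[of x y] by simp

lemma space_eq [simp]: "space \<mu> = UNIV"
  using sets_eq_imp_space_eq[OF sets_eq] by simp

lemma prob_UNIV [simp]: "prob UNIV = 1"
  using prob_space by simp

lemma measurable_\<mu> [measurable_cong]: "sets \<mu> = sets borel" by (rule sets_eq)

lemma D_triangle_diff: "\<bar>D x y - D x' y'\<bar> \<le> D x x' + D y y'"
  using D_triangle[of x y x'] D_triangle[of x' y y'] D_triangle[of x' y' x] D_triangle[of x y' y]
    D_sym[of x x'] D_sym[of y y'] by linarith

definition dlip :: "real \<Rightarrow> ('a \<Rightarrow> real) \<Rightarrow> bool" where
  "dlip \<Lambda> F \<longleftrightarrow> (\<forall>x y. \<bar>F x - F y\<bar> \<le> \<Lambda> * D x y)"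

definition lip1 :: "real \<Rightarrow> ('a \<Rightarrow> real) \<Rightarrow> bool" where
  "lip1 \<Lambda> F \<longleftrightarrow> (\<forall>x. \<bar>F x\<bar> \<le> \<Lambda>) \<and> dlip \<Lambda> F"

definition lip2 :: "real \<Rightarrow> ('a \<Rightarrow> 'a \<Rightarrow> real) \<Rightarrow> bool" where
  "lip2 \<Lambda> G \<longleftrightarrow> (\<forall>x y. \<bar>G x y\<bar> \<le> \<Lambda>) \<and>
     (\<forall>x y x' y'. \<bar>G x y - G x' y'\<bar> \<le> \<Lambda> * (D x x' + D y y'))"

text \<open>
  Base maps that send a point to the centre of the ball which its orbit is to visit. The identity and the constant maps are
  the two cases of interest.
\<close>
definition nonexpansive :: "('a \<Rightarrow> 'a) \<Rightarrow> bool" where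
  "nonexpansive b \<longleftrightarrow> (\<forall>x y. D (b x) (b y) \<le> D x y)"

lemma D_tendsto_0: "((\<lambda>y. D x y) \<longlongrightarrow> 0) (at x within S)"
  using D_cont[of x] unfolding continuous_on_def
  by (metis D_self iso_tuple_UNIV_I tendsto_within_subset top_greatest)

lemma dlip_continuous:
  assumes "dlip \<Lambda> F" shows "continuous_on UNIV F"
  unfolding continuous_on_def
proof safe
  fix x
  have "((\<lambda>y. F y - F x) \<longlongrightarrow> 0) (at x)"
  proof (rule Lim_null_comparison)
    show "\<forall>\<^sub>F y in at x. norm (F y - F x) \<le> \<Lambda> * D x y"
      using assms D_sym by (auto simp: dlip_def intro!: always_eventually)
    show "((\<lambda>y. \<Lambda> * D x y) \<longlongrightarrow> 0) (at x)"
      using D_tendsto_0 tendsto_mult_right_zero by blast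
  qed
  then show "(F \<longlongrightarrow> F x) (at x)" by (rule LIM_zero_cancel)
qed

lemma dlip_measurable: "dlip \<Lambda> F \<Longrightarrow> F \<in> borel_measurable \<mu>"
  using dlip_continuous borel_measurable_continuous_onI measurable_cong_sets[OF sets_eq refl] by blast

lemma lip2_measurable_borel:
  assumes "lip2 \<Lambda> G" shows "(\<lambda>p. G (fst p) (snd p)) \<in> borel_measurable (borel \<Otimes>\<^sub>M borel)"
proof -
  have "continuous_on UNIV (\<lambda>p. G (fst p) (snd p))"
    unfolding continuous_on_def
  proof safe
    fix p :: "'a \<times> 'a"
    let ?u = "\<lambda>q. D (fst p) (fst q)" and ?v = "\<lambda>q. D (snd p) (snd q)"
    have u: "(?u \<longlongrightarrow> 0) (at p)"
    proof -
      have "continuous_on UNIV (\<lambda>q :: 'a \<times> 'a. D (fst p) (fst q))"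
        by (rule continuous_on_compose2[OF D_cont]) (auto intro!: continuous_intros)
      then show ?thesis unfolding continuous_on_def by (metis D_self UNIV_I)
    qed
    have v: "(?v \<longlongrightarrow> 0) (at p)"
    proof -
      have "continuous_on UNIV (\<lambda>q :: 'a \<times> 'a. D (snd p) (snd q))"
        by (rule continuous_on_compose2[OF D_cont]) (auto intro!: continuous_intros)
      then show ?thesis unfolding continuous_on_def by (metis D_self UNIV_I)
    qed
    have "((\<lambda>q. G (fst q) (snd q) - G (fst p) (snd p)) \<longlongrightarrow> 0) (at p)"
    proof (rule Lim_null_comparison)
      show "\<forall>\<^sub>F q in at p. norm (G (fst q) (snd q) - G (fst p) (snd p)) \<le> \<Lambda> * (?u q + ?v q)"
        using assms D_sym by (auto simp: lip2_def intro!: always_eventually)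
      show "((\<lambda>q. \<Lambda> * (?u q + ?v q)) \<longlongrightarrow> 0) (at p)"
        using tendsto_mult_right_zero[OF tendsto_add_zero[OF u v]] .
    qed
    then show "((\<lambda>p. G (fst p) (snd p)) \<longlongrightarrow> G (fst p) (snd p)) (at p)"
      by (rule LIM_zero_cancel)
  qed
  then show ?thesis unfolding borel_prod by (rule borel_measurable_continuous_onI)
qed

lemma lip2_measurable:
  assumes "lip2 \<Lambda> G" "u \<in> N \<rightarrow>\<^sub>M borel" "v \<in> N \<rightarrow>\<^sub>M borel"
  shows "(\<lambda>x. G (u x) (v x)) \<in> borel_measurable N"
  using measurable_compose[OF measurable_Pair[OF assms(2,3)] lip2_measurable_borel[OF assms(1)]]
  by simp

lemma lip2_nonexpansive:
  assumes "lip2 \<Lambda> G" "nonexpansive b" "0 \<le> \<Lambda>" shows "lip2 \<Lambda> (\<lambda>x. G (b x))"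
  unfolding lip2_def
proof safe
  fix x y x' y'
  have "\<bar>G (b x) y - G (b x') y'\<bar> \<le> \<Lambda> * (D (b x) (b x') + D y y')"
    using assms by (auto simp: lip2_def)
  also have "\<dots> \<le> \<Lambda> * (D x x' + D y y')"
    using assms by (intro mult_left_mono) (auto simp: nonexpansive_def)
  finally show "\<bar>G (b x) y - G (b x') y'\<bar> \<le> \<Lambda> * (D x x' + D y y')" .
qed (use assms in \<open>auto simp: lip2_def\<close>)

lemma integrable_bounded:
  fixes F :: "'a \<Rightarrow> real"
  assumes "F \<in> borel_measurable \<mu>" "\<And>x. \<bar>F x\<bar> \<le> B" shows "integrable \<mu> F"
  using integrable_const_bound[of F B] assms by auto

text \<open>
  The observable is \<open>A(x\<^sub>0, \<dots>, x\<^sub>2\<^sub>r) = F x\<^sub>0 \<Prod>\<^sub>j G\<^sub>j x\<^sub>0 x\<^sub>j\<close>. For fixed \<open>x\<^sub>0\<close> the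
  integral over the other coordinates factorises, so the product structure survives although every factor depends on \<open>x\<^sub>0\<close>.
\<close>
lemma mixing_sorted:
  fixes \<Lambda> :: real
  assumes F: "lip1 \<Lambda> F" and G: "\<And>j. j \<in> {1..<2 * r + 1} \<Longrightarrow> lip2 \<Lambda> (G j)" and \<Lambda>: "1 \<le> \<Lambda>"
    and k: "k 0 = 0" "\<And>j. Suc j < 2 * r + 1 \<Longrightarrow> k j + m \<le> k (Suc j)"
  shows "\<bar>(\<integral>x. F x * (\<Prod>j\<in>{1..<2 * r + 1}. G j x ((f ^^ k j) x)) \<partial>\<mu>) -
          (\<integral>x. F x * (\<Prod>j\<in>{1..<2 * r + 1}. \<integral>z. G j x z \<partial>\<mu>) \<partial>\<mu>)\<bar>
         \<le> K * \<theta> ^ m * ((2 * r + 2) * \<Lambda> ^ (2 * r + 2))"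
proof -
  let ?I = "{1..<2 * r + 1}" and ?q = "2 * r + 1"
  define A where "A x = F (x 0) * (\<Prod>j\<in>?I. G j (x 0) (x j))" for x :: "nat \<Rightarrow> 'a"
  have Fb: "\<bar>F x\<bar> \<le> \<Lambda>" and Fl: "\<bar>F x - F y\<bar> \<le> \<Lambda> * D x y" for x y
    using F by (auto simp: lip1_def dlip_def)
  have Gb: "\<bar>G j x y\<bar> \<le> \<Lambda>" and Gl: "\<bar>G j x y - G j x' y'\<bar> \<le> \<Lambda> * (D x x' + D y y')"
    if "j \<in> ?I" for j x y x' y' using G[OF that] by (auto simp: lip2_def)
  have Pb: "\<bar>\<Prod>j\<in>?I. G j x (y j)\<bar> \<le> \<Lambda> ^ (2 * r)" for x y
  proof -
    have "\<bar>\<Prod>j\<in>?I. G j x (y j)\<bar> = (\<Prod>j\<in>?I. \<bar>G j x (y j)\<bar>)" by (rule abs_prod)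
    also have "\<dots> \<le> (\<Prod>j\<in>?I. \<Lambda>)" using Gb by (intro prod_mono) auto
    finally show ?thesis by simp
  qed
  have AbO: "\<bar>F x * (\<Prod>j\<in>?I. G j x (y j))\<bar> \<le> \<Lambda> ^ (2 * r + 1)" for x y
    unfolding abs_mult using mult_mono[OF Fb[of x] Pb[of x y]] \<Lambda> by simp
  have Ab': "\<bar>A x\<bar> \<le> \<Lambda> ^ (2 * r + 1)" for x unfolding A_def by (rule AbO)
  have pw: "\<Lambda> ^ (2 * r + 1) \<le> (2 * r + 2) * \<Lambda> ^ (2 * r + 2)"
  proof -
    have "\<Lambda> ^ (2 * r + 1) \<le> \<Lambda> ^ (2 * r + 2)" using \<Lambda> by (intro power_increasing) auto
    also have "\<dots> \<le> (2 * r + 2) * \<Lambda> ^ (2 * r + 2)"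
      using \<Lambda> mult_right_mono[of 1 "real (2*r+2)" "\<Lambda> ^ (2 * r + 2)"] by simp
    finally show ?thesis .
  qed
  have Al: "\<bar>A x - A y\<bar> \<le> (2 * r + 2) * \<Lambda> ^ (2 * r + 2) * (\<Sum>i<?q. D (x i) (y i))" for x y
  proof -
    define a where "a z j = (if j = 0 then F (z 0) else G j (z 0) (z j))" for z :: "nat \<Rightarrow> 'a" and j
    have q: "{..<?q} = insert 0 ?I" by auto
    have Aa: "A z = (\<Prod>j<?q. a z j)" for z
      unfolding q A_def by (subst prod.insert) (auto simp: a_def intro!: prod.cong)
    have "\<bar>A x - A y\<bar> \<le> \<Lambda> ^ card {..<?q} * (\<Sum>i<?q. \<bar>a x i - a y i\<bar>)"
      unfolding Aa using Fb Gb \<Lambda> by (intro abs_prod_diff_le) (auto simp: a_def)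
    also have "(\<Sum>i<?q. \<bar>a x i - a y i\<bar>) \<le> (\<Sum>i<?q. \<Lambda> * (D (x 0) (y 0) + D (x i) (y i)))"
      using Gl \<Lambda> by (intro sum_mono) (auto simp: a_def intro: order_trans[OF Fl])
    also have "\<dots> = \<Lambda> * (?q * D (x 0) (y 0) + (\<Sum>i<?q. D (x i) (y i)))"
      by (simp add: sum_distrib_left[symmetric] sum.distrib)
    also have "\<dots> \<le> \<Lambda> * (?q * (\<Sum>i<?q. D (x i) (y i)) + (\<Sum>i<?q. D (x i) (y i)))"
      using \<Lambda> by (intro mult_left_mono add_right_mono member_le_sum) auto
    finally show ?thesis using \<Lambda> by (simp add: algebra_simps mult_left_mono)
  qed
  have mix: "\<bar>(\<integral>x. A (\<lambda>i\<in>{..<?q}. (f ^^ k i) x) \<partial>\<mu>) - (\<integral>x. A x \<partial>(\<Pi>\<^sub>M i\<in>{..<?q}. \<mu>))\<bar>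
      \<le> K * \<theta> ^ m * ((2 * r + 2) * \<Lambda> ^ (2 * r + 2))"
    by (rule mixing[OF _ Al k]) (use Ab' pw order_trans in blast)+
  have left: "A (\<lambda>i\<in>{..<?q}. (f ^^ k i) x) = F x * (\<Prod>j\<in>?I. G j x ((f ^^ k j) x))" for x
    unfolding A_def using k(1) by (auto intro!: prod.cong)
  interpret P: product_sigma_finite "\<lambda>_::nat. \<mu>" by unfold_locales
  interpret PI: prob_space "\<Pi>\<^sub>M i\<in>?I. \<mu>" by (intro prob_space_PiM) unfold_locales
  interpret PP: pair_sigma_finite "\<Pi>\<^sub>M i\<in>?I. \<mu>" \<mu> by unfold_locales
  interpret PPP: pair_prob_space "\<Pi>\<^sub>M i\<in>?I. \<mu>" \<mu> by unfold_locales
  interpret PQ: prob_space "\<Pi>\<^sub>M i\<in>insert 0 ?I. \<mu>" by (intro prob_space_PiM) unfold_locales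
  have Fm [measurable]: "F \<in> borel_measurable borel"
    using F dlip_continuous borel_measurable_continuous_onI unfolding lip1_def by blast
  have q: "{..<?q} = insert 0 ?I" by auto
  have Am: "A \<in> borel_measurable (\<Pi>\<^sub>M i\<in>insert 0 ?I. \<mu>)"
  proof -
    have comp: "(\<lambda>x. x j) \<in> (\<Pi>\<^sub>M i\<in>insert 0 ?I. \<mu>) \<rightarrow>\<^sub>M borel" if "j \<in> insert 0 ?I" for j
      using measurable_component_singleton[OF that, of "\<lambda>_. \<mu>"] measurable_cong_sets[OF refl sets_eq] by blast
    show ?thesis unfolding A_def
      by (intro borel_measurable_times borel_measurable_prod lip2_measurable[OF G]
          measurable_compose[OF comp Fm] comp) auto
  qed
  have Ai: "integrable (\<Pi>\<^sub>M i\<in>insert 0 ?I. \<mu>) A"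
    by (rule PQ.integrable_const_bound[OF _ Am]) (use Ab' in auto)
  have "(\<integral>x. A x \<partial>(\<Pi>\<^sub>M i\<in>{..<?q}. \<mu>)) = (\<integral>x. \<integral>y. A (x(0 := y)) \<partial>\<mu> \<partial>(\<Pi>\<^sub>M i\<in>?I. \<mu>))"
    unfolding q by (rule P.product_integral_insert[OF _ _ Ai]) auto
  also have "\<dots> = (\<integral>x. \<integral>y. F y * (\<Prod>j\<in>?I. G j y (x j)) \<partial>\<mu> \<partial>(\<Pi>\<^sub>M i\<in>?I. \<mu>))"
    unfolding A_def by (intro Bochner_Integration.integral_cong refl arg_cong2[of _ _ _ _ "(*)"] prod.cong) auto
  also have "\<dots> = (\<integral>y. \<integral>x. F y * (\<Prod>j\<in>?I. G j y (x j)) \<partial>(\<Pi>\<^sub>M i\<in>?I. \<mu>) \<partial>\<mu>)"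
  proof (rule PP.Fubini_integral[symmetric])
    have comp: "(\<lambda>p. fst p j) \<in> (\<Pi>\<^sub>M i\<in>?I. \<mu>) \<Otimes>\<^sub>M \<mu> \<rightarrow>\<^sub>M borel" if "j \<in> ?I" for j
      using measurable_compose[OF measurable_fst measurable_component_singleton[OF that, of "\<lambda>_. \<mu>"]]
        measurable_cong_sets[OF refl sets_eq] by blast
    have sn: "(\<lambda>p. snd p) \<in> (\<Pi>\<^sub>M i\<in>?I. \<mu>) \<Otimes>\<^sub>M \<mu> \<rightarrow>\<^sub>M borel"
      using measurable_snd measurable_cong_sets[OF refl sets_eq] by blast
    have m: "(\<lambda>(x, y). F y * (\<Prod>j\<in>?I. G j y (x j))) \<in> borel_measurable ((\<Pi>\<^sub>M i\<in>?I. \<mu>) \<Otimes>\<^sub>M \<mu>)"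
      unfolding case_prod_beta
      by (intro borel_measurable_times borel_measurable_prod lip2_measurable[OF G]
          measurable_compose[OF sn Fm] comp sn) auto
    show "integrable ((\<Pi>\<^sub>M i\<in>?I. \<mu>) \<Otimes>\<^sub>M \<mu>) (\<lambda>(x, y). F y * (\<Prod>j\<in>?I. G j y (x j)))"
      by (rule PPP.integrable_const_bound[OF _ m, of "\<Lambda> ^ (2 * r + 1)"]) (use AbO in auto)
  qed
  also have "\<dots> = (\<integral>y. F y * (\<Prod>j\<in>?I. \<integral>z. G j y z \<partial>\<mu>) \<partial>\<mu>)"
  proof (rule Bochner_Integration.integral_cong[OF refl])
    fix y
    have ig: "integrable \<mu> (G j y)" if "j \<in> ?I" for j
      using integrable_bounded[OF lip2_measurable[OF G[OF that], of "\<lambda>_. y" \<mu> "\<lambda>z. z"]] Gb[OF that]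
      by (auto simp: measurable_ident_sets[OF sets_eq])
    show "(\<integral>x. F y * (\<Prod>j\<in>?I. G j y (x j)) \<partial>(\<Pi>\<^sub>M i\<in>?I. \<mu>)) = F y * (\<Prod>j\<in>?I. \<integral>z. G j y z \<partial>\<mu>)"
      using P.product_integral_prod[of ?I "\<lambda>j. G j y"] ig by simp
  qed
  finally show ?thesis using mix unfolding left by simp
qed

text \<open>
  Time \<open>0\<close> counts as a member: the first gap is the one between \<open>y\<close> itself and its first visit.
\<close>
definition separated :: "nat \<Rightarrow> nat set \<Rightarrow> bool" where
  "separated m T \<longleftrightarrow> (\<forall>k\<in>T. m \<le> k) \<and> (\<forall>k\<in>T. \<forall>k'\<in>T. k < k' \<longrightarrow> k + m \<le> k')"

definition mixing_const :: real where "mixing_const = K * (2 * r + 2)"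

lemma mixing_const_nonneg: "0 \<le> mixing_const"
  using K_nonneg by (simp add: mixing_const_def)

text \<open>
  The form in which mixing is used. The position \<open>b y\<close> of the ball is frozen while the points \<open>f\<^sup>k y\<close> become
  independent with law \<open>\<mu>\<close>. Fewer than \<open>2 r\<close> times are padded by further times at distance \<open>m\<close> that carry the
  factor \<open>1\<close>.
\<close>
lemma mixing_times:
  fixes \<Lambda> :: real
  assumes F: "lip1 \<Lambda> F" and G: "\<And>k. k \<in> T \<Longrightarrow> lip2 \<Lambda> (G k)" and \<Lambda>: "1 \<le> \<Lambda>"
    and b: "nonexpansive b" and T: "finite T" "card T \<le> 2 * r" "separated m T"
  shows "\<bar>(\<integral>x. F x * (\<Prod>k\<in>T. G k (b x) ((f ^^ k) x)) \<partial>\<mu>) -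
          (\<integral>x. F x * (\<Prod>k\<in>T. \<integral>z. G k (b x) z \<partial>\<mu>) \<partial>\<mu>)\<bar>
         \<le> mixing_const * \<theta> ^ m * \<Lambda> ^ (2 * r + 2)"
proof -
  define p where "p = card T"
  obtain e where e: "bij_betw e {..<p} T" "strict_mono_on {..<p} e"
    using ex_bij_betw_strict_mono_card[OF T(1)] unfolding p_def by blast
  \<comment> \<open>The times of \<open>T\<close> in increasing order, continued arithmetically with step \<open>m\<close> after the last one.\<close>
  define k where "k j = (if j = 0 then 0 else if j \<le> p then e (j - 1)
      else (if p = 0 then 0 else e (p - 1)) + (j - p) * m)" for j
  define G' where "G' j = (if j \<le> p then (\<lambda>x. G (e (j - 1)) (b x)) else (\<lambda>_ _. 1))" for j
  have eT: "e j \<in> T" if "j < p" for j using e(1) that by (auto simp: bij_betw_def)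
  have step: "k j + m \<le> k (Suc j)" for j
  proof -
    consider "j = 0" "p = 0" | "j = 0" "p > 0" | "j > 0" "Suc j \<le> p" | "j > 0" "j = p" | "j > 0" "p < j"
      by linarith
    then show ?thesis
    proof cases
      case 2
      then show ?thesis using eT[of 0] T(3) by (auto simp: k_def separated_def)
    next
      case 3
      then have "e (j - 1) < e j" using e(2) by (auto simp: strict_mono_on_def)
      then show ?thesis using 3 eT[of "j - 1"] eT[of j] T(3) by (auto simp: k_def separated_def)
    next
      case 5
      then have "Suc j - p = Suc (j - p)" by auto
      then show ?thesis using 5 by (auto simp: k_def)
    qed (auto simp: k_def)
  qed
  have G'l: "lip2 \<Lambda> (G' j)" if "j \<in> {1..<2 * r + 1}" for j
  proof (cases "j \<le> p")
    case True
    then show ?thesis unfolding G'_def using that G[OF eT[of "j - 1"]] lip2_nonexpansive[OF _ b] \<Lambda>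
      by auto
  next
    case False
    then show ?thesis unfolding G'_def using \<Lambda> by (auto simp: lip2_def)
  qed
  have reindex: "(\<Prod>j\<in>{1..<2 * r + 1}. if j \<le> p then u (e (j - 1)) else 1) = (\<Prod>k\<in>T. u k)"
    for u :: "nat \<Rightarrow> real"
  proof -
    have "(\<Prod>j\<in>{1..<2 * r + 1}. if j \<le> p then u (e (j - 1)) else 1) = (\<Prod>j\<in>{1..p}. u (e (j - 1)))"
      using T(2) unfolding p_def[symmetric] by (intro prod.mono_neutral_cong_right) auto
    also have "\<dots> = (\<Prod>j<p. u (e j))"
      by (rule prod.reindex_bij_witness[of _ Suc "\<lambda>j. j - 1"]) auto
    also have "\<dots> = (\<Prod>k\<in>T. u k)" using prod.reindex_bij_betw[OF e(1)] by auto
    finally show ?thesis .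
  qed
  have k0: "k 0 = 0" by (simp add: k_def)
  have "\<bar>(\<integral>x. F x * (\<Prod>j\<in>{1..<2 * r + 1}. G' j x ((f ^^ k j) x)) \<partial>\<mu>) -
          (\<integral>x. F x * (\<Prod>j\<in>{1..<2 * r + 1}. \<integral>z. G' j x z \<partial>\<mu>) \<partial>\<mu>)\<bar>
         \<le> K * \<theta> ^ m * ((2 * r + 2) * \<Lambda> ^ (2 * r + 2))"
    by (rule mixing_sorted[OF F G'l \<Lambda> k0 step]) auto
  moreover have "(\<Prod>j\<in>{1..<2 * r + 1}. G' j x ((f ^^ k j) x)) = (\<Prod>k\<in>T. G k (b x) ((f ^^ k) x))" for x
    by (subst reindex[symmetric], intro prod.cong) (auto simp: G'_def k_def)
  moreover have "(\<Prod>j\<in>{1..<2 * r + 1}. \<integral>z. G' j x z \<partial>\<mu>) = (\<Prod>k\<in>T. \<integral>z. G k (b x) z \<partial>\<mu>)" for x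
    by (subst reindex[symmetric], intro prod.cong) (auto simp: G'_def k_def prob_space)
  ultimately show ?thesis by (simp add: mixing_const_def mult_ac)
qed

end

section \<open>Short returns are rare\<close>

text \<open>
  A Lipschitz substitute for the indicator of \<open>t \<le> \<rho>\<close>, supported on \<open>t \<le> 2 \<rho>\<close>.
\<close>
definition bump :: "real \<Rightarrow> real \<Rightarrow> real" where
  "bump \<rho> t = max 0 (min 1 (2 - t / \<rho>))"

lemma bump_nonneg [simp]: "0 \<le> bump \<rho> t" and bump_le_1 [simp]: "bump \<rho> t \<le> 1"
  by (auto simp: bump_def)

lemma bump_eq_1: "0 < \<rho> \<Longrightarrow> t \<le> \<rho> \<Longrightarrow> bump \<rho> t = 1"
  by (simp add: bump_def min_def field_simps)

lemma bump_eq_0: "0 < \<rho> \<Longrightarrow> 2 * \<rho> \<le> t \<Longrightarrow> bump \<rho> t = 0"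
  by (simp add: bump_def min_def field_simps)

lemma bump_diff_le:
  assumes "0 < \<rho>" shows "\<bar>bump \<rho> s - bump \<rho> t\<bar> \<le> \<bar>s - t\<bar> / \<rho>"
proof -
  have "\<bar>bump \<rho> s - bump \<rho> t\<bar> \<le> \<bar>s / \<rho> - t / \<rho>\<bar>" by (auto simp: bump_def)
  also have "\<dots> = \<bar>s - t\<bar> / \<rho>" using assms by (simp add: diff_divide_distrib[symmetric])
  finally show ?thesis .
qed

lemma powr_inverse_less_one:
  fixes x :: real
  assumes "0 < x" "x < 1" "0 < n" shows "x powr (1 / real n) < 1"
  using powr_less_mono2[of "1 / real n" x 1] assms by simp

lemma poly_times_power_tendsto_0:
  fixes \<beta> :: real
  assumes "0 \<le> \<beta>" "\<beta> < 1" shows "(\<lambda>m. real m ^ j * \<beta> ^ m) \<longlonglongrightarrow> 0"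
proof (cases "\<beta> = 0")
  case False
  define \<gamma> where "\<gamma> = \<beta> powr (1 / Suc j)"
  have \<gamma>: "0 < \<gamma>" "\<gamma> < 1" using False assms powr_inverse_less_one[of \<beta> "Suc j"] by (auto simp: \<gamma>_def)
  have \<beta>: "\<gamma> ^ Suc j = \<beta>" using False assms unfolding \<gamma>_def by (simp add: powr_power del: power_Suc)
  have 1: "(\<lambda>m. real m * \<gamma> ^ m) \<longlonglongrightarrow> 0" using powser_times_n_limit_0[of \<gamma>] \<gamma> by simp
  have 2: "(\<lambda>m. \<gamma> ^ m) \<longlonglongrightarrow> 0" using \<gamma> by (intro LIMSEQ_power_zero) auto
  have "(\<lambda>m. (real m * \<gamma> ^ m) ^ j * \<gamma> ^ m) \<longlonglongrightarrow> 0 ^ j * 0"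
    by (intro tendsto_mult tendsto_power 1 2)
  moreover have "(real m * \<gamma> ^ m) ^ j * \<gamma> ^ m = real m ^ j * \<beta> ^ m" for m
    unfolding \<beta>[symmetric] by (simp add: power_mult_distrib power_mult[symmetric] mult_ac power_add[symmetric])
  ultimately show ?thesis by simp
next
  case True
  have "\<forall>\<^sub>F m in sequentially. real m ^ j * \<beta> ^ m = 0"
    using eventually_gt_at_top[of 0] by eventually_elim (simp add: True)
  then show ?thesis by (rule tendsto_eventually)
qed

lemma eventually_poly_times_power_le:
  fixes \<beta> \<gamma> B :: real
  assumes "0 \<le> \<beta>" "\<beta> < \<gamma>"
  shows "\<forall>\<^sub>F m in sequentially. B * real m ^ j * \<beta> ^ m \<le> \<gamma> ^ m"
proof -
  have "(\<lambda>m. B * (real m ^ j * (\<beta> / \<gamma>) ^ m)) \<longlonglongrightarrow> 0"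
    using assms by (intro tendsto_mult_right_zero poly_times_power_tendsto_0) auto
  then have "\<forall>\<^sub>F m in sequentially. B * (real m ^ j * (\<beta> / \<gamma>) ^ m) < 1"
    by (rule order_tendstoD) simp
  then show ?thesis
  proof eventually_elim
    case (elim m)
    then show ?case using assms by (auto simp: power_divide field_simps)
  qed
qed

lemma eventually_const_times_power_le:
  fixes \<beta> \<gamma> B :: real
  assumes "0 \<le> \<beta>" "\<beta> < \<gamma>"
  shows "\<forall>\<^sub>F m in sequentially. B * \<beta> ^ m \<le> \<gamma> ^ m"
  using eventually_poly_times_power_le[OF assms, of B 0] by simp

context mixing_system
begin

lemma C_nonneg: "0 \<le> C"
  using ball_upper[of 1] order_trans[OF measure_nonneg] by fastforce

lemma prob_le_integral:
  fixes u :: "'a \<Rightarrow> real"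
  assumes "A \<in> sets borel" "u \<in> borel_measurable \<mu>" "\<And>y. 0 \<le> u y" "\<And>y. u y \<le> B"
    "\<And>y. y \<in> A \<Longrightarrow> 1 \<le> u y"
  shows "prob A \<le> (\<integral>y. u y \<partial>\<mu>)"
proof -
  have "prob A = (\<integral>y. indicator A y \<partial>\<mu>)" using assms(1) by simp
  also have "\<dots> \<le> (\<integral>y. u y \<partial>\<mu>)"
    using assms by (intro integral_mono integrable_bounded[of u B] integrable_bounded[of "indicator A" 1])
      (auto simp: indicator_def sets_eq intro!: borel_measurable_indicator)
  finally show ?thesis .
qed

lemma integral_le_prob:
  fixes u :: "'a \<Rightarrow> real"
  assumes "A \<in> sets borel" "u \<in> borel_measurable \<mu>" "\<And>y. 0 \<le> u y" "\<And>y. u y \<le> 1"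
    "\<And>y. y \<notin> A \<Longrightarrow> u y \<le> 0"
  shows "(\<integral>y. u y \<partial>\<mu>) \<le> prob A"
proof -
  have "(\<integral>y. u y \<partial>\<mu>) \<le> (\<integral>y. indicator A y \<partial>\<mu>)"
    using assms by (intro integral_mono integrable_bounded[of u 1] integrable_bounded[of "indicator A" 1])
      (auto simp: indicator_def sets_eq intro!: borel_measurable_indicator)
  also have "\<dots> = prob A" using assms(1) by simp
  finally show ?thesis .
qed

lemma iterate_lipschitz: "D ((f ^^ k) x) ((f ^^ k) y) \<le> L ^ k * D x y"
proof (induction k)
  case (Suc k)
  have "D ((f ^^ Suc k) x) ((f ^^ Suc k) y) \<le> L * D ((f ^^ k) x) ((f ^^ k) y)"
    using f_lipschitz by simp
  also have "\<dots> \<le> L * (L ^ k * D x y)" using Suc L_ge_1 by (intro mult_left_mono) auto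
  finally show ?case by simp
qed simp

lemma iterate_measurable [measurable]: "(f ^^ k) \<in> borel \<rightarrow>\<^sub>M borel"
  by (induction k) (auto intro: measurable_comp simp: id_def)

lemma iterate_preserves: "distr \<mu> \<mu> (f ^^ k) = \<mu>"
proof (induction k)
  case 0
  then show ?case by (simp add: id_def)
next
  case (Suc k)
  have [measurable]: "f \<in> \<mu> \<rightarrow>\<^sub>M \<mu>" "(f ^^ k) \<in> \<mu> \<rightarrow>\<^sub>M \<mu>"
    using iterate_measurable[of k] f_measurable measurable_cong_sets[OF sets_eq sets_eq] by blast+
  have "distr \<mu> \<mu> (f ^^ Suc k) = distr (distr \<mu> \<mu> (f ^^ k)) \<mu> f"
    by (subst distr_distr) auto
  then show ?case using Suc f_preserves by (simp add: comp_def)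
qed

lemma iterate_measurable_\<mu>: "(f ^^ k) \<in> \<mu> \<rightarrow>\<^sub>M \<mu>"
  using iterate_measurable[of k] measurable_cong_sets[OF sets_eq sets_eq] by blast

lemma integral_iterate:
  fixes F :: "'a \<Rightarrow> real"
  assumes "F \<in> borel_measurable \<mu>"
  shows "(\<integral>y. F ((f ^^ k) y) \<partial>\<mu>) = (\<integral>y. F y \<partial>\<mu>)"
  using integral_distr[OF iterate_measurable_\<mu>[of k] assms] iterate_preserves[of k] by simp

lemma lip2_mono: "lip2 \<Lambda> G \<Longrightarrow> \<Lambda> \<le> \<Lambda>' \<Longrightarrow> lip2 \<Lambda>' G"
  unfolding lip2_def by (meson D_nonneg add_nonneg_nonneg mult_right_mono order_trans)

lemma lip2_mult:
  assumes G: "lip2 \<Lambda>\<^sub>1 G" and H: "lip2 \<Lambda>\<^sub>2 H" and "1 \<le> \<Lambda>\<^sub>1" "1 \<le> \<Lambda>\<^sub>2"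
  shows "lip2 (2 * \<Lambda>\<^sub>1 * \<Lambda>\<^sub>2) (\<lambda>x y. G x y * H x y)"
  unfolding lip2_def
proof safe
  fix x y
  have "\<bar>G x y * H x y\<bar> \<le> \<Lambda>\<^sub>1 * \<Lambda>\<^sub>2"
    unfolding abs_mult using assms by (intro mult_mono) (auto simp: lip2_def)
  also have "\<dots> \<le> 2 * \<Lambda>\<^sub>1 * \<Lambda>\<^sub>2" using assms by simp
  finally show "\<bar>G x y * H x y\<bar> \<le> 2 * \<Lambda>\<^sub>1 * \<Lambda>\<^sub>2" .
  fix x' y'
  let ?\<delta> = "D x x' + D y y'"
  have "\<bar>G x y * H x y - G x' y' * H x' y'\<bar> = \<bar>G x y * (H x y - H x' y') + (G x y - G x' y') * H x' y'\<bar>"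
    by (simp add: algebra_simps)
  also have "\<dots> \<le> \<bar>G x y\<bar> * \<bar>H x y - H x' y'\<bar> + \<bar>G x y - G x' y'\<bar> * \<bar>H x' y'\<bar>"
    by (metis abs_mult abs_triangle_ineq)
  also have "\<dots> \<le> \<Lambda>\<^sub>1 * (\<Lambda>\<^sub>2 * ?\<delta>) + (\<Lambda>\<^sub>1 * ?\<delta>) * \<Lambda>\<^sub>2"
    using assms by (intro add_mono mult_mono) (auto simp: lip2_def)
  finally show "\<bar>G x y * H x y - G x' y' * H x' y'\<bar> \<le> 2 * \<Lambda>\<^sub>1 * \<Lambda>\<^sub>2 * ?\<delta>"
    by (simp add: algebra_simps)
qed

lemma lip2_iterate:
  assumes "lip2 \<Lambda> G" "0 \<le> \<Lambda>" shows "lip2 (\<Lambda> * L ^ k) (\<lambda>x y. G x ((f ^^ k) y))"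
  unfolding lip2_def
proof safe
  fix x y
  have Lk: "1 \<le> L ^ k" using L_ge_1 by simp
  have "\<Lambda> * 1 \<le> \<Lambda> * L ^ k" using Lk assms by (intro mult_left_mono) auto
  then show "\<bar>G x ((f ^^ k) y)\<bar> \<le> \<Lambda> * L ^ k" using assms(1) unfolding lip2_def
    by (metis mult.right_neutral order_trans)
  fix x' y'
  have "\<bar>G x ((f ^^ k) y) - G x' ((f ^^ k) y')\<bar> \<le> \<Lambda> * (D x x' + D ((f ^^ k) y) ((f ^^ k) y'))"
    using assms by (auto simp: lip2_def)
  also have "\<dots> \<le> \<Lambda> * (L ^ k * D x x' + L ^ k * D y y')"
    using assms Lk mult_right_mono[OF Lk, of "D x x'"]
    by (intro mult_left_mono add_mono iterate_lipschitz) auto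
  finally show "\<bar>G x ((f ^^ k) y) - G x' ((f ^^ k) y')\<bar> \<le> \<Lambda> * L ^ k * (D x x' + D y y')"
    by (simp add: algebra_simps)
qed

lemma lip2_integral:
  assumes G: "lip2 \<Lambda> G" and "0 \<le> \<Lambda>" shows "lip1 \<Lambda> (\<lambda>x. \<integral>y. G x y \<partial>\<mu>)"
proof -
  have ig: "integrable \<mu> (G x)" for x
    using integrable_bounded[OF lip2_measurable[OF G, of "\<lambda>_. x" \<mu> "\<lambda>z. z"], of \<Lambda>] G
    by (auto simp: measurable_ident_sets[OF sets_eq] lip2_def)
  have avg: "\<bar>\<integral>y. u y \<partial>\<mu>\<bar> \<le> B" if "integrable \<mu> u" "\<And>y. \<bar>u y\<bar> \<le> B" for u :: "'a \<Rightarrow> real" and B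
  proof -
    have "\<bar>\<integral>y. u y \<partial>\<mu>\<bar> \<le> (\<integral>y. \<bar>u y\<bar> \<partial>\<mu>)" by (rule integral_abs_bound)
    also have "\<dots> \<le> (\<integral>y. B \<partial>\<mu>)" using that by (intro integral_mono) auto
    finally show ?thesis by simp
  qed
  have "\<bar>(\<integral>y. G x y \<partial>\<mu>) - (\<integral>y. G x' y \<partial>\<mu>)\<bar> \<le> \<Lambda> * D x x'" for x x'
  proof -
    have "\<bar>G x y - G x' y\<bar> \<le> \<Lambda> * D x x'" for y
      using G D_self[of y] unfolding lip2_def by (metis add.right_neutral)
    then show ?thesis
      using avg[of "\<lambda>y. G x y - G x' y"] ig Bochner_Integration.integral_diff[OF ig ig] by simp
  qed
  moreover have "\<bar>\<integral>y. G x y \<partial>\<mu>\<bar> \<le> \<Lambda>" for x using avg[OF ig] G by (auto simp: lip2_def)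
  ultimately show ?thesis by (auto simp: lip1_def dlip_def)
qed

lemma lip1_const: "\<bar>a\<bar> \<le> \<Lambda> \<Longrightarrow> lip1 \<Lambda> (\<lambda>_. a)"
  using order_trans[OF abs_ge_zero] by (fastforce simp: lip1_def dlip_def)

lemma nonexpansive_id: "nonexpansive (\<lambda>x. x)" and nonexpansive_const: "nonexpansive (\<lambda>_. x)"
  by (auto simp: nonexpansive_def)

definition near :: "real \<Rightarrow> 'a \<Rightarrow> 'a \<Rightarrow> real" where
  "near \<rho> x y = bump \<rho> (D x y)"

lemma near_nonneg [simp]: "0 \<le> near \<rho> x y" and near_le_1 [simp]: "near \<rho> x y \<le> 1"
  by (auto simp: near_def)

lemma near_eq_1: "0 < \<rho> \<Longrightarrow> D x y \<le> \<rho> \<Longrightarrow> near \<rho> x y = 1"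
  by (simp add: near_def bump_eq_1)

lemma near_eq_0: "0 < \<rho> \<Longrightarrow> \<not> D x y \<le> 2 * \<rho> \<Longrightarrow> near \<rho> x y = 0"
  by (simp add: near_def bump_eq_0)

text \<open>
  Stated for all larger radii, so that bumps of radius \<open>2 \<rho>\<close> and \<open>4 \<rho>\<close> have the constant \<open>1 / \<rho>\<close> too.
\<close>
lemma near_lip2:
  assumes "0 < \<rho>" "\<rho> \<le> 1" "\<rho> \<le> \<rho>'" shows "lip2 (1 / \<rho>) (near \<rho>')"
  unfolding lip2_def
proof safe
  fix x y x' y'
  have "1 \<le> 1 / \<rho>" using assms by (simp add: field_simps)
  then show "\<bar>near \<rho>' x y\<bar> \<le> 1 / \<rho>" using near_le_1[of \<rho>' x y] near_nonneg[of \<rho>' x y] by linarith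
  have "\<bar>near \<rho>' x y - near \<rho>' x' y'\<bar> \<le> \<bar>D x y - D x' y'\<bar> / \<rho>'"
    unfolding near_def using assms by (intro bump_diff_le) auto
  also have "\<dots> \<le> \<bar>D x y - D x' y'\<bar> / \<rho>" using assms by (intro divide_left_mono) auto
  also have "\<dots> \<le> (D x x' + D y y') / \<rho>" using assms D_triangle_diff by (intro divide_right_mono) auto
  finally show "\<bar>near \<rho>' x y - near \<rho>' x' y'\<bar> \<le> 1 / \<rho> * (D x x' + D y y')" by simp
qed

lemma near_measurable:
  assumes "0 < \<rho>" "u \<in> N \<rightarrow>\<^sub>M borel" "v \<in> N \<rightarrow>\<^sub>M borel"
  shows "(\<lambda>x. near \<rho> (u x) (v x)) \<in> borel_measurable N"
  by (rule lip2_measurable[OF near_lip2[of "min 1 \<rho>" \<rho>] assms(2,3)]) (use assms in auto)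

lemma D_measurable [measurable]:
  assumes u: "u \<in> N \<rightarrow>\<^sub>M borel" and v: "v \<in> N \<rightarrow>\<^sub>M borel"
  shows "(\<lambda>x. D (u x) (v x)) \<in> borel_measurable N"
proof -
  have "lip2 1 (\<lambda>x y. min 1 (max 0 (t - D x y)))" for t
    unfolding lip2_def
  proof safe
    fix x y x' y'
    show "\<bar>min 1 (max 0 (t - D x y)) - min 1 (max 0 (t - D x' y'))\<bar> \<le> 1 * (D x x' + D y y')"
      using D_triangle_diff[of x y x' y'] by (simp add: min_def max_def abs_le_iff)
  qed (simp add: min_def max_def)
  from lip2_measurable[OF this u v]
  have [measurable]: "(\<lambda>x. min 1 (max 0 (t - D (u x) (v x)))) \<in> borel_measurable N" for t .
  have "{x \<in> space N. D (u x) (v x) < t} \<in> sets N" for t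
  proof -
    have "{x \<in> space N. D (u x) (v x) < t} = {x \<in> space N. 0 < min 1 (max 0 (t - D (u x) (v x)))}"
      by auto
    also have "\<dots> \<in> sets N" by measurable
    finally show ?thesis .
  qed
  then show ?thesis by (simp add: borel_measurable_iff_less)
qed

lemma ball_sets [measurable]: "{y. D x y \<le> \<rho>} \<in> sets borel"
proof -
  have "(\<lambda>y. D x y) \<in> borel_measurable borel" by measurable
  then have "{y \<in> space borel. D x y \<le> \<rho>} \<in> sets borel" by measurable
  then show ?thesis by simp
qed

lemma nonexpansive_measurable:
  assumes "nonexpansive b" shows "{y. D (b y) ((f ^^ k) y) \<le> \<rho>} \<in> sets borel"
proof -
  have "dlip (1 + L ^ k) (\<lambda>y. D (b y) ((f ^^ k) y))"
    unfolding dlip_def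
  proof safe
    fix x y
    have "\<bar>D (b x) ((f ^^ k) x) - D (b y) ((f ^^ k) y)\<bar> \<le> D (b x) (b y) + D ((f ^^ k) x) ((f ^^ k) y)"
      by (rule D_triangle_diff)
    also have "\<dots> \<le> D x y + L ^ k * D x y"
      using assms iterate_lipschitz by (intro add_mono) (auto simp: nonexpansive_def)
    finally show "\<bar>D (b x) ((f ^^ k) x) - D (b y) ((f ^^ k) y)\<bar> \<le> (1 + L ^ k) * D x y"
      by (simp add: algebra_simps)
  qed
  from dlip_measurable[OF this] have "{y \<in> space \<mu>. D (b y) ((f ^^ k) y) \<le> \<rho>} \<in> sets \<mu>"
    by measurable
  then show ?thesis using sets_eq by simp
qed

lemma near_integral_lower:
  assumes "0 < \<rho>" "\<rho> \<le> 1" shows "c * \<rho> ^ d \<le> (\<integral>y. near \<rho> x y \<partial>\<mu>)"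
proof -
  have "c * \<rho> ^ d \<le> prob {y. D x y \<le> \<rho>}" using assms by (rule ball_lower)
  also have "\<dots> \<le> (\<integral>y. near \<rho> x y \<partial>\<mu>)"
    using assms by (intro prob_le_integral[of _ _ 1]) (auto intro!: near_measurable simp: near_eq_1)
  finally show ?thesis .
qed

lemma near_integral_upper:
  assumes "0 < \<rho>" shows "(\<integral>y. near \<rho> x y \<partial>\<mu>) \<le> C * (2 * \<rho>) ^ d"
proof -
  have "(\<integral>y. near \<rho> x y \<partial>\<mu>) \<le> prob {y. D x y \<le> 2 * \<rho>}"
    using assms by (intro integral_le_prob) (auto intro!: near_measurable simp: near_eq_0)
  also have "\<dots> \<le> C * (2 * \<rho>) ^ d" using assms by (intro ball_upper) auto
  finally show ?thesis .
qed

text \<open>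
  A return after time \<open>k\<close> can be iterated, at the price of the expansion of \<open>f\<close> along the way.
\<close>
lemma return_multiple:
  assumes "1 \<le> k" shows "D y ((f ^^ (j * k)) y) \<le> (2 * L) ^ (j * k) * D y ((f ^^ k) y)"
proof (induction j)
  case (Suc j)
  have "D y ((f ^^ (Suc j * k)) y) \<le> D y ((f ^^ (j * k)) y) + D ((f ^^ (j * k)) y) ((f ^^ (j * k)) ((f ^^ k) y))"
    using D_triangle[of y "(f ^^ (j * k + k)) y" "(f ^^ (j * k)) y"]
    by (metis Suc_eq_plus1 comp_apply funpow_add mult.commute mult_Suc_right add.commute)
  also have "\<dots> \<le> (2 * L) ^ (j * k) * D y ((f ^^ k) y) + L ^ (j * k) * D y ((f ^^ k) y)"
    using Suc iterate_lipschitz by (intro add_mono) auto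
  also have "\<dots> \<le> (2 * L) ^ (j * k) * D y ((f ^^ k) y) + (2 * L) ^ (j * k) * D y ((f ^^ k) y)"
    using L_ge_1 by (intro add_left_mono mult_right_mono power_mono) auto
  also have "\<dots> = (2 * L) ^ (j * k) * (2 * D y ((f ^^ k) y))" by simp
  also have "\<dots> \<le> (2 * L) ^ (j * k) * ((2 * L) ^ k * D y ((f ^^ k) y))"
  proof -
    have "2 \<le> (2 * L) ^ 1" using L_ge_1 by simp
    also have "\<dots> \<le> (2 * L) ^ k" using L_ge_1 assms by (intro power_increasing) auto
    finally show ?thesis using L_ge_1 by (intro mult_left_mono mult_right_mono) auto
  qed
  finally show ?case by (simp add: power_add mult_ac)
qed (use D_self in simp)

text \<open>
  For \<open>k\<close> at least proportional to \<open>m\<close>, two-point mixing bounds the probability of a return by the measure of a ball, up to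
  an error which is small if the radius shrinks slowly enough. A smaller \<open>k\<close> is replaced by a multiple \<open>j k\<close> between \<open>p\<close>
  and \<open>2 p\<close>, where \<open>p\<close> is a small proportion of \<open>m\<close>; over a time of at most \<open>2 p\<close> the return distance grows at most by
  \<open>(2 L)\<^bsup>2p\<^esup>\<close>, which \<open>\<alpha>\<^sup>m\<close> absorbs.
\<close>
lemma short_returns:
  assumes "0 < \<alpha>" "\<alpha> < 1"
  obtains B \<beta> where "0 < B" "0 < \<beta>" "\<beta> < 1"
    "\<And>m k. 1 \<le> k \<Longrightarrow> prob {y. D y ((f ^^ k) y) \<le> \<alpha> ^ m} \<le> B * \<beta> ^ m"
proof -
  \<comment> \<open>Among the \<open>m \<ge> 2 n p\<close> factors \<open>\<alpha>\<close>, one half absorbs the expansion over the time \<open>2 p\<close> and the other half remains small.\<close>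
  obtain n where n: "\<alpha> ^ n < 1 / (2 * L) ^ 2"
    using real_arch_pow_inv[of "1 / (2 * L) ^ 2" \<alpha>] assms L_ge_1 by auto
  have "n \<noteq> 0"
  proof
    assume "n = 0"
    then have "(2 * L) ^ 2 < 1" using n L_ge_1 by (simp add: field_simps)
    moreover have "1 \<le> (2 * L) ^ 2" using L_ge_1 by (intro one_le_power) auto
    ultimately show False by simp
  qed
  define N where "N = 2 * n"
  have N: "N > 0" using \<open>n \<noteq> 0\<close> by (simp add: N_def)
  define e where "e = 2 * r + 3"
  \<comment> \<open>The radius \<open>\<sigma>\<^sup>p\<close> dominates what is left of the return distance, and \<open>\<theta>\<^sup>p\<close> beats the Lipschitz constant
    \<open>\<sigma>\<^bsup>-p\<^esup>\<close> to the power \<open>2 r + 2\<close> with one factor \<open>\<sigma>\<^sup>p\<close> to spare.\<close>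
  define \<sigma> where "\<sigma> = max (\<alpha> ^ n) (\<theta> powr (1 / e))"
  have \<sigma>: "0 < \<sigma>" "\<sigma> < 1" "\<alpha> ^ n \<le> \<sigma>"
    using assms \<theta>_pos \<theta>_less_1 \<open>n \<noteq> 0\<close> powr_inverse_less_one[of \<theta> e]
    by (auto simp: \<sigma>_def e_def power_less_one_iff less_max_iff_disj)
  have \<theta>\<sigma>: "\<theta> \<le> \<sigma> ^ e"
  proof -
    have "\<theta> = (\<theta> powr (1 / e)) ^ e" using \<theta>_pos by (simp add: powr_power e_def)
    also have "\<dots> \<le> \<sigma> ^ e" by (intro power_mono) (auto simp: \<sigma>_def)
    finally show ?thesis .
  qed
  define \<beta> where "\<beta> = \<sigma> powr (1 / N)"
  have \<beta>: "0 < \<beta>" "\<beta> < 1" "\<beta> ^ N = \<sigma>"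
    using \<sigma> N powr_inverse_less_one[of \<sigma> N] by (auto simp: \<beta>_def powr_power)
  define B where "B = (C * 2 ^ d + mixing_const) + 1"
  have B: "B > 0" using C_nonneg mixing_const_nonneg by (auto simp: B_def add_nonneg_pos)
  have key: "prob {y. D y ((f ^^ k) y) \<le> \<alpha> ^ m} \<le> B * \<sigma> ^ (m div N)" if k: "1 \<le> k" for m k
  proof -
    define p where "p = m div N"
    \<comment> \<open>The least multiple above \<open>p\<close> overshoots by at most \<open>k < p\<close>.\<close>
    obtain j where j: "p \<le> j * k" "j = 1 \<or> j * k \<le> 2 * p"
    proof (cases "p \<le> k")
      case True
      then show ?thesis using that[of 1] by auto
    next
      case False
      have "p \<le> (p div k + 1) * k" using k dividend_less_div_times[of k p]
        by (simp add: algebra_simps)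
      moreover have "(p div k + 1) * k = k * (p div k) + k" by (simp add: algebra_simps)
      then have "(p div k + 1) * k \<le> 2 * p"
        using False times_div_less_eq_dividend[of k p] by linarith
      ultimately show ?thesis using that by blast
    qed
    define k' where "k' = j * k"
    define \<rho> where "\<rho> = \<sigma> ^ p"
    have \<rho>: "0 < \<rho>" "\<rho> \<le> 1" using \<sigma> by (auto simp: \<rho>_def power_le_one)
    have pm: "p * N \<le> m" by (simp add: p_def)
    have "\<alpha> ^ m \<le> \<alpha> ^ (p * N)" using assms pm by (intro power_decreasing) auto
    also have "\<dots> = (\<alpha> ^ n) ^ p * (\<alpha> ^ n) ^ p"
    proof -
      have "p * N = n * p + n * p" by (simp add: N_def)
      then show ?thesis by (simp only: power_mult power_add)
    qed
    finally have \<alpha>m: "\<alpha> ^ m \<le> (\<alpha> ^ n) ^ p * (\<alpha> ^ n) ^ p" .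
    have sub: "D y ((f ^^ k') y) \<le> \<rho>" if y: "D y ((f ^^ k) y) \<le> \<alpha> ^ m" for y
      using j(2)
    proof
      assume "j = 1"
      have "(\<alpha> ^ n) ^ p * (\<alpha> ^ n) ^ p \<le> (\<alpha> ^ n) ^ p * 1"
        using assms by (intro mult_left_mono power_le_one) auto
      also have "\<dots> \<le> \<rho>" unfolding \<rho>_def using \<sigma> assms by (auto intro: power_mono)
      finally show ?thesis using \<open>j = 1\<close> y \<alpha>m by (simp add: k'_def)
    next
      assume jk: "j * k \<le> 2 * p"
      have "D y ((f ^^ k') y) \<le> (2 * L) ^ k' * D y ((f ^^ k) y)"
        unfolding k'_def using k by (rule return_multiple)
      also have "\<dots> \<le> (2 * L) ^ (2 * p) * ((\<alpha> ^ n) ^ p * (\<alpha> ^ n) ^ p)"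
        using y \<alpha>m jk L_ge_1 assms
        by (intro mult_mono power_increasing) (auto simp: k'_def)
      also have "\<dots> = ((2 * L) ^ 2 * \<alpha> ^ n) ^ p * (\<alpha> ^ n) ^ p"
        by (simp only: power_mult power_mult_distrib mult.assoc)
      also have "\<dots> \<le> 1 * \<sigma> ^ p"
      proof (intro mult_mono power_le_one power_mono)
        show "(2 * L) ^ 2 * \<alpha> ^ n \<le> 1" using n L_ge_1 by (simp add: field_simps)
      qed (use \<sigma> assms in auto)
      finally show ?thesis by (simp add: \<rho>_def)
    qed
    have lip: "lip2 (1 / \<rho>) (near \<rho>)" using \<rho> by (intro near_lip2) auto
    have "prob {y. D y ((f ^^ k) y) \<le> \<alpha> ^ m} \<le> (\<integral>y. near \<rho> y ((f ^^ k') y) \<partial>\<mu>)"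
    proof (rule prob_le_integral[of _ _ 1])
      show "{y. D y ((f ^^ k) y) \<le> \<alpha> ^ m} \<in> sets borel"
        using nonexpansive_measurable[OF nonexpansive_id] .
      show "(\<lambda>y. near \<rho> y ((f ^^ k') y)) \<in> borel_measurable \<mu>"
        using \<rho> by (intro near_measurable) auto
    qed (use sub \<rho> in \<open>auto simp: near_def bump_eq_1\<close>)
    also have "\<dots> \<le> (\<integral>y. (\<integral>z. near \<rho> y z \<partial>\<mu>) \<partial>\<mu>) + mixing_const * \<theta> ^ p * (1 / \<rho>) ^ (2 * r + 2)"
      using mixing_times[of "1 / \<rho>" "\<lambda>_. 1" "{k'}" "\<lambda>_. near \<rho>" "\<lambda>x. x" p] lip \<rho> j(1) r_pos
        lip1_const[of 1 "1 / \<rho>"] nonexpansive_id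
      by (simp add: separated_def k'_def abs_le_iff)
    also have "(\<integral>y. (\<integral>z. near \<rho> y z \<partial>\<mu>) \<partial>\<mu>) \<le> (\<integral>y. C * (2 * \<rho>) ^ d \<partial>\<mu>)"
    proof (rule integral_mono)
      show "integrable \<mu> (\<lambda>y. \<integral>z. near \<rho> y z \<partial>\<mu>)"
        using lip2_integral[OF lip] \<rho> dlip_measurable
        by (intro integrable_bounded[of _ "1/\<rho>"]) (auto simp: lip1_def)
    qed (use near_integral_upper[OF \<rho>(1)] in auto)
    also have "(\<integral>y. C * (2 * \<rho>) ^ d \<partial>\<mu>) \<le> C * 2 ^ d * \<rho>"
    proof -
      have "\<rho> ^ d \<le> \<rho> ^ 1" using \<rho> d_pos by (intro power_decreasing) auto
      then have "(C * 2 ^ d) * \<rho> ^ d \<le> (C * 2 ^ d) * \<rho>"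
        using C_nonneg by (intro mult_left_mono) auto
      then show ?thesis by (simp add: power_mult_distrib mult_ac)
    qed
    also have "mixing_const * \<theta> ^ p * (1 / \<rho>) ^ (2 * r + 2) \<le> mixing_const * \<rho>"
    proof -
      have "\<theta> ^ p \<le> (\<sigma> ^ e) ^ p" using \<theta>_pos \<theta>\<sigma> by (intro power_mono) auto
      also have "\<dots> = \<rho> * \<rho> ^ (2 * r + 2)"
        by (simp add: \<rho>_def e_def power_mult[symmetric] power_add[symmetric] algebra_simps)
      finally have "\<theta> ^ p / \<rho> ^ (2 * r + 2) \<le> \<rho>" using \<rho> by (simp add: divide_le_eq)
      then have "mixing_const * (\<theta> ^ p / \<rho> ^ (2 * r + 2)) \<le> mixing_const * \<rho>"
        using mixing_const_nonneg by (rule mult_left_mono)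
      then show ?thesis by (simp only: power_one_over times_divide_eq_right mult_1_right mult.assoc divide_inverse mult_1_left power_inverse)
    qed
    finally have "prob {y. D y ((f ^^ k) y) \<le> \<alpha> ^ m} \<le> (C * 2 ^ d + mixing_const) * \<rho>"
      by (simp add: algebra_simps)
    also have "\<dots> \<le> B * \<rho>" using \<rho> by (intro mult_right_mono) (auto simp: B_def)
    finally show ?thesis by (simp add: \<rho>_def p_def)
  qed
  show thesis
  proof (rule that[of "B / \<sigma>" \<beta>])
    fix m k :: nat assume "1 \<le> k"
    have "\<sigma> * \<sigma> ^ (m div N) = \<beta> ^ (N * Suc (m div N))"
      unfolding power_mult \<beta>(3) by simp
    have "N * Suc (m div N) \<ge> m" using N dividend_less_times_div[of N m] by (simp add: algebra_simps)
    then have "\<beta> ^ (N * Suc (m div N)) \<le> \<beta> ^ m" using \<beta> by (intro power_decreasing) auto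
    then have "\<sigma> ^ (m div N) \<le> \<beta> ^ m / \<sigma>"
      using \<sigma> \<open>\<sigma> * \<sigma> ^ (m div N) = _\<close> by (simp add: field_simps)
    then have le: "B * \<sigma> ^ (m div N) \<le> B * (\<beta> ^ m / \<sigma>)" using B by (intro mult_left_mono) auto
    have "prob {y. D y ((f ^^ k) y) \<le> \<alpha> ^ m} \<le> B * \<sigma> ^ (m div N)" using key[OF \<open>1 \<le> k\<close>] .
    also note le
    finally show "prob {y. D y ((f ^^ k) y) \<le> \<alpha> ^ m} \<le> B / \<sigma> * \<beta> ^ m" by simp
  qed (use B \<sigma> \<beta> in auto)
qed

end

section \<open>Pairs of close visits\<close>

lemma summable_poly_times_power:
  fixes \<beta> B :: real
  assumes "0 \<le> \<beta>" "\<beta> < 1" shows "summable (\<lambda>m. B * real m ^ j * \<beta> ^ m)"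
proof -
  obtain \<gamma> where \<gamma>: "\<beta> < \<gamma>" "\<gamma> < 1" using dense[OF assms(2)] by blast
  show ?thesis
  proof (rule summable_comparison_test_ev)
    show "\<forall>\<^sub>F m in sequentially. norm (B * real m ^ j * \<beta> ^ m) \<le> \<gamma> ^ m"
      using eventually_poly_times_power_le[OF assms(1) \<gamma>(1), of "\<bar>B\<bar>" j] assms
      by (simp add: abs_mult)
    show "summable (\<lambda>m. \<gamma> ^ m)" using assms \<gamma> by (intro summable_geometric) auto
  qed
qed

context mixing_system
begin

text \<open>
  If \<open>z = f\<^sup>k y\<close> and \<open>f\<^sup>l z\<close> both lie within \<open>2 \<rho>\<close> of the centre, then \<open>z\<close> returns within \<open>4 \<rho>\<close> after time
  \<open>l\<close>. In the second factor the centre has disappeared, so the return can be integrated separately from the position.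
\<close>
definition close_pair :: "real \<Rightarrow> nat \<Rightarrow> 'a \<Rightarrow> 'a \<Rightarrow> real" where
  "close_pair \<rho> l x y = near (2 * \<rho>) x y * near (4 * \<rho>) y ((f ^^ l) y)"

definition pair_rate :: "real \<Rightarrow> nat \<Rightarrow> 'a \<Rightarrow> real" where
  "pair_rate \<rho> l x = (\<integral>y. close_pair \<rho> l x y \<partial>\<mu>)"

lemma close_pair_nonneg [simp]: "0 \<le> close_pair \<rho> l x y" and close_pair_le_1 [simp]: "close_pair \<rho> l x y \<le> 1"
  by (auto simp: close_pair_def intro: mult_le_one)

lemma close_pair_eq_1:
  assumes "0 < \<rho>" "D x y \<le> 2 * \<rho>" "D x ((f ^^ l) y) \<le> 2 * \<rho>"
  shows "close_pair \<rho> l x y = 1"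
  using assms D_triangle[of y "(f ^^ l) y" x] D_sym[of x y] by (simp add: close_pair_def near_eq_1)

lemma close_pair_lip2:
  assumes \<rho>: "0 < \<rho>" "\<rho> \<le> 1" shows "lip2 (4 * L ^ l / \<rho> ^ 2) (close_pair \<rho> l)"
proof -
  have Ll: "1 \<le> L ^ l" using L_ge_1 by simp
  have \<rho>1: "1 \<le> 1 / \<rho>" using \<rho> by simp
  have "lip2 (1 / \<rho> * (1 + L ^ l)) (\<lambda>x y. near (4 * \<rho>) y ((f ^^ l) y))"
    unfolding lip2_def
  proof safe
    fix x y x' y' :: 'a
    have n: "lip2 (1 / \<rho>) (near (4 * \<rho>))" using \<rho> by (intro near_lip2) auto
    have "\<bar>near (4 * \<rho>) y ((f ^^ l) y)\<bar> \<le> 1" by (simp add: abs_le_iff)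
    also have "1 \<le> 1 / \<rho> * (1 + L ^ l)" using mult_mono[OF \<rho>1, of 1 "1 + L ^ l"] Ll \<rho> by simp
    finally show "\<bar>near (4 * \<rho>) y ((f ^^ l) y)\<bar> \<le> 1 / \<rho> * (1 + L ^ l)" .
    have "\<bar>near (4 * \<rho>) y ((f ^^ l) y) - near (4 * \<rho>) y' ((f ^^ l) y')\<bar>
        \<le> 1 / \<rho> * (D y y' + D ((f ^^ l) y) ((f ^^ l) y'))"
      using n by (auto simp: lip2_def)
    also have "\<dots> \<le> 1 / \<rho> * (D y y' + L ^ l * D y y')"
      using \<rho> iterate_lipschitz by (intro mult_left_mono add_left_mono) auto
    also have "\<dots> = 1 / \<rho> * (1 + L ^ l) * D y y'" by (simp add: algebra_simps)
    also have "\<dots> \<le> 1 / \<rho> * (1 + L ^ l) * (D x x' + D y y')"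
      using \<rho> Ll by (intro mult_left_mono) auto
    finally show "\<bar>near (4 * \<rho>) y ((f ^^ l) y) - near (4 * \<rho>) y' ((f ^^ l) y')\<bar>
        \<le> 1 / \<rho> * (1 + L ^ l) * (D x x' + D y y')" .
  qed
  then have "lip2 (2 * L ^ l / \<rho>) (\<lambda>x y. near (4 * \<rho>) y ((f ^^ l) y))"
    by (rule lip2_mono) (use \<rho> Ll in \<open>simp add: field_simps\<close>)
  moreover have "lip2 (1 / \<rho>) (near (2 * \<rho>))" using \<rho> by (intro near_lip2) auto
  moreover have "1 \<le> 2 * L ^ l / \<rho>" using \<rho> Ll by (simp add: field_simps)
  ultimately have "lip2 (2 * (1 / \<rho>) * (2 * L ^ l / \<rho>)) (close_pair \<rho> l)"
    unfolding close_pair_def using \<rho>1 by (intro lip2_mult)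
  then show ?thesis by (simp add: power2_eq_square)
qed

lemma pair_rate_nonneg [simp]: "0 \<le> pair_rate \<rho> l x"
  by (simp add: pair_rate_def integral_nonneg_AE)

lemma pair_rate_lip1: "0 < \<rho> \<Longrightarrow> \<rho> \<le> 1 \<Longrightarrow> lip1 (4 * L ^ l / \<rho> ^ 2) (pair_rate \<rho> l)"
  unfolding pair_rate_def using L_ge_1 by (intro lip2_integral close_pair_lip2) auto

lemma pair_rate_measurable: "0 < \<rho> \<Longrightarrow> \<rho> \<le> 1 \<Longrightarrow> pair_rate \<rho> l \<in> borel_measurable \<mu>"
  using pair_rate_lip1 dlip_measurable unfolding lip1_def by blast

lemma lip1_compose_nonexpansive: "lip1 \<Lambda> F \<Longrightarrow> nonexpansive b \<Longrightarrow> 0 \<le> \<Lambda> \<Longrightarrow> lip1 \<Lambda> (\<lambda>x. F (b x))"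
  unfolding lip1_def dlip_def nonexpansive_def by (meson mult_left_mono order_trans)

lemma pair_rate_le_1:
  assumes "0 < \<rho>" "\<rho> \<le> 1" shows "pair_rate \<rho> l x \<le> 1"
proof -
  have "pair_rate \<rho> l x \<le> (\<integral>y. 1 \<partial>\<mu>)" unfolding pair_rate_def
  proof (rule integral_mono)
    show "integrable \<mu> (close_pair \<rho> l x)"
      using lip2_measurable[OF close_pair_lip2[OF assms], of "\<lambda>_. x" \<mu> "\<lambda>z. z"]
      by (intro integrable_bounded[of _ 1]) (auto simp: measurable_ident_sets[OF sets_eq])
  qed auto
  then show ?thesis by simp
qed

text \<open>
  By Fubini the centre is integrated first: this yields the measure of a ball around the visiting point, and what
  remains is the probability of a return after time \<open>l\<close>.
\<close>
lemma integral_pair_rate_le: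
  assumes \<rho>: "0 < \<rho>" "\<rho> \<le> 1"
  shows "(\<integral>x. pair_rate \<rho> l x \<partial>\<mu>) \<le> C * (4 * \<rho>) ^ d * prob {y. D y ((f ^^ l) y) \<le> 8 * \<rho>}"
proof -
  interpret pair_sigma_finite \<mu> \<mu> by unfold_locales
  interpret PP: pair_prob_space \<mu> \<mu> by unfold_locales
  have idm: "(\<lambda>z. z) \<in> \<mu> \<rightarrow>\<^sub>M borel" by (simp add: measurable_ident_sets[OF sets_eq])
  have cm: "(\<lambda>p. close_pair \<rho> l (fst p) (snd p)) \<in> borel_measurable (\<mu> \<Otimes>\<^sub>M \<mu>)"
    using lip2_measurable[OF close_pair_lip2[OF \<rho>] measurable_compose[OF measurable_fst idm]
        measurable_compose[OF measurable_snd idm]] .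
  have "(\<integral>x. pair_rate \<rho> l x \<partial>\<mu>) = (\<integral>y. \<integral>x. close_pair \<rho> l x y \<partial>\<mu> \<partial>\<mu>)"
    unfolding pair_rate_def
    by (rule Fubini_integral[symmetric], rule PP.integrable_const_bound[of _ 1]) (use cm in \<open>auto simp: case_prod_beta\<close>)
  also have "\<dots> \<le> (\<integral>y. C * (4 * \<rho>) ^ d * near (4 * \<rho>) y ((f ^^ l) y) \<partial>\<mu>)"
  proof (rule integral_mono)
    have nm: "close_pair \<rho> l x y = near (4 * \<rho>) y ((f ^^ l) y) * near (2 * \<rho>) y x" for x y
      by (simp add: close_pair_def near_def D_sym[of x y])
    have eq: "(\<integral>x. close_pair \<rho> l x y \<partial>\<mu>) = near (4 * \<rho>) y ((f ^^ l) y) * (\<integral>x. near (2 * \<rho>) y x \<partial>\<mu>)" for y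
      unfolding nm by simp
    show "(\<integral>x. close_pair \<rho> l x y \<partial>\<mu>) \<le> C * (4 * \<rho>) ^ d * near (4 * \<rho>) y ((f ^^ l) y)" for y
      using near_integral_upper[of "2 * \<rho>" y] \<rho> mult_left_mono[OF _ near_nonneg[of "4 * \<rho>" y "(f ^^ l) y"]]
      unfolding eq by (simp add: mult.commute)
    have nl: "lip2 (1 / \<rho>) (near (2 * \<rho>))" using \<rho> by (intro near_lip2) auto
    have [measurable]: "(\<lambda>y. near (4 * \<rho>) y ((f ^^ l) y)) \<in> borel_measurable \<mu>"
      using \<rho> by (intro near_measurable) auto
    have [measurable]: "(\<lambda>y. \<integral>x. near (2 * \<rho>) y x \<partial>\<mu>) \<in> borel_measurable \<mu>"
      using lip2_integral[OF nl] \<rho> dlip_measurable by (auto simp: lip1_def)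
    have bd: "\<bar>\<integral>x. near (2 * \<rho>) y x \<partial>\<mu>\<bar> \<le> 1 / \<rho>" for y
      using lip2_integral[OF nl] \<rho> by (auto simp: lip1_def)
    show "integrable \<mu> (\<lambda>y. \<integral>x. close_pair \<rho> l x y \<partial>\<mu>)"
      unfolding eq
    proof (rule integrable_bounded[of _ "1 / \<rho>"])
      show "\<bar>near (4 * \<rho>) y ((f ^^ l) y) * (\<integral>x. near (2 * \<rho>) y x \<partial>\<mu>)\<bar> \<le> 1 / \<rho>" for y
        unfolding abs_mult using mult_mono[of "\<bar>near (4 * \<rho>) y ((f ^^ l) y)\<bar>" 1, OF _ bd[of y]]
        by (simp add: abs_le_iff)
    qed measurable
    show "integrable \<mu> (\<lambda>y. C * (4 * \<rho>) ^ d * near (4 * \<rho>) y ((f ^^ l) y))"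
      by (intro integrable_mult_right integrable_bounded[of _ 1]) (auto simp: abs_le_iff)
  qed
  also have "\<dots> = C * (4 * \<rho>) ^ d * (\<integral>y. near (4 * \<rho>) y ((f ^^ l) y) \<partial>\<mu>)" by simp
  also have "\<dots> \<le> C * (4 * \<rho>) ^ d * prob {y. D y ((f ^^ l) y) \<le> 8 * \<rho>}"
  proof (intro mult_left_mono integral_le_prob)
    show "{y. D y ((f ^^ l) y) \<le> 8 * \<rho>} \<in> sets borel"
      using nonexpansive_measurable[OF nonexpansive_id] .
    show "(\<lambda>y. near (4 * \<rho>) y ((f ^^ l) y)) \<in> borel_measurable \<mu>"
      using \<rho> by (intro near_measurable) auto
    show "near (4 * \<rho>) y ((f ^^ l) y) \<le> 0" if "y \<notin> {y. D y ((f ^^ l) y) \<le> 8 * \<rho>}" for y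
      using near_eq_0[of "4 * \<rho>" y "(f ^^ l) y"] that \<rho> by simp
  qed (use \<rho> C_nonneg in auto)
  finally show ?thesis .
qed

text \<open>
  Exponential bounds in both directions: from above to make returns rare, from below to keep Lipschitz constants exponential in \<open>m\<close>.
\<close>
definition radius_scale :: "(nat \<Rightarrow> real) \<Rightarrow> bool" where
  "radius_scale \<rho> \<longleftrightarrow> (\<forall>m. 0 < \<rho> m \<and> \<rho> m \<le> 1) \<and>
     (\<exists>\<alpha>\<^sub>1 \<alpha>\<^sub>2. 0 < \<alpha>\<^sub>1 \<and> \<alpha>\<^sub>1 < 1 \<and> 0 < \<alpha>\<^sub>2 \<and> \<alpha>\<^sub>2 < 1 \<and> (\<forall>\<^sub>F m in sequentially. \<alpha>\<^sub>1 ^ m \<le> \<rho> m \<and> \<rho> m \<le> \<alpha>\<^sub>2 ^ m))"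

text \<open>
  What the counting arguments need to know about a base map at times that are too short for mixing: early visits are
  exponentially rare, and a second visit soon after a first one is exponentially rarer than a single visit, whose
  probability is of order \<open>\<rho>\<^sub>m\<^sup>d\<close>. The range \<open>k \<le> m\<^sup>2\<close> is long enough for mixing to take over, because
  \<open>\<theta>\<^bsup>m\<^sup>2\<^esup>\<close> beats every exponential in \<open>m\<close>.
\<close>
definition admissible :: "(nat \<Rightarrow> real) \<Rightarrow> ('a \<Rightarrow> 'a) \<Rightarrow> bool" where
  "admissible \<rho> b \<longleftrightarrow> nonexpansive b \<and> (\<exists>\<beta>. 0 < \<beta> \<and> \<beta> < 1 \<and>
     (\<forall>\<^sub>F m in sequentially. \<forall>k\<in>{1..m\<^sup>2}.
        prob {y. D (b y) ((f ^^ k) y) \<le> \<rho> m} \<le> \<beta> ^ m \<and>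
        (\<integral>y. pair_rate (\<rho> m) k (b y) \<partial>\<mu>) \<le> \<beta> ^ m * \<rho> m ^ d))"

lemma radius_scaleD:
  assumes "radius_scale \<rho>" shows "0 < \<rho> m" "\<rho> m \<le> 1"
  using assms by (auto simp: radius_scale_def)

lemma borel_cantelli_prob:
  assumes A: "\<And>m. A m \<in> sets borel" and "\<forall>\<^sub>F m in sequentially. prob (A m) \<le> u m" "summable u"
  shows "AE y in \<mu>. \<forall>\<^sub>F m in sequentially. y \<notin> A m"
proof -
  have "summable (\<lambda>m. prob (A m))"
    by (rule summable_comparison_test_ev[OF _ assms(3)]) (use assms(2) in simp)
  from borel_cantelli_AE1[OF _ _ this] A show ?thesis
    by (simp add: sets_eq emeasure_eq_measure)
qed

text \<open>
  For the moving centre both conditions are consequences of short returns. The second conclusion, for all \<open>k \<ge> 1\<close>, is what the case of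
  a fixed centre starts from.
\<close>
lemma admissible_id:
  assumes \<rho>: "radius_scale \<rho>"
  shows "admissible \<rho> (\<lambda>x. x)"
    and "\<exists>\<beta>. 0 < \<beta> \<and> \<beta> < 1 \<and>
     (\<forall>\<^sub>F m in sequentially. \<forall>k\<ge>1. (\<integral>y. pair_rate (\<rho> m) k y \<partial>\<mu>) \<le> \<beta> ^ m * \<rho> m ^ d)"
proof -
  obtain a1 a2 where a2: "0 < a2" "a2 < 1" and ev: "\<forall>\<^sub>F m in sequentially. a1 ^ m \<le> \<rho> m \<and> \<rho> m \<le> a2 ^ m"
    using \<rho> by (auto simp: radius_scale_def)
  \<comment> \<open>A slightly larger base \<open>\<alpha>\<close> absorbs the constant factor \<open>8\<close> in the radius.\<close>
  obtain \<alpha> where \<alpha>: "a2 < \<alpha>" "\<alpha> < 1" using dense[OF a2(2)] by blast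
  obtain B \<beta> where B: "0 < B" "0 < \<beta>" "\<beta> < 1"
    and sr: "\<And>m k. 1 \<le> k \<Longrightarrow> prob {y. D y ((f ^^ k) y) \<le> \<alpha> ^ m} \<le> B * \<beta> ^ m"
    by (rule short_returns[of \<alpha>]) (use \<alpha> a2 that in auto)
  obtain \<gamma> where \<gamma>: "\<beta> < \<gamma>" "\<gamma> < 1" using dense[OF B(3)] by blast
  have ev2: "\<forall>\<^sub>F m in sequentially. 8 * a2 ^ m \<le> \<alpha> ^ m"
    using eventually_const_times_power_le[of a2 \<alpha> 8] \<alpha> a2 by auto
  have ev3: "\<forall>\<^sub>F m in sequentially. (B + C * 4 ^ d * B) * \<beta> ^ m \<le> \<gamma> ^ m"
    using eventually_const_times_power_le[of \<beta> \<gamma> "B + C * 4 ^ d * B"] \<gamma> B by auto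
  have both: "\<forall>\<^sub>F m in sequentially. \<forall>k\<ge>1. prob {y. D y ((f ^^ k) y) \<le> \<rho> m} \<le> \<gamma> ^ m \<and>
        (\<integral>y. pair_rate (\<rho> m) k y \<partial>\<mu>) \<le> \<gamma> ^ m * \<rho> m ^ d"
    using ev ev2 ev3
  proof eventually_elim
    case (elim m)
    have r: "0 < \<rho> m" "\<rho> m \<le> 1" using radius_scaleD[OF \<rho>] by auto
    have le: "8 * \<rho> m \<le> \<alpha> ^ m" using elim by auto
    have nn: "0 \<le> C * 4 ^ d * B * \<beta> ^ m" using C_nonneg B by auto
    have nn': "0 \<le> B * \<beta> ^ m" using B by auto
    show ?case
    proof safe
      fix k :: nat assume k: "1 \<le> k"
      have p: "prob {y. D y ((f ^^ k) y) \<le> t} \<le> B * \<beta> ^ m" if "t \<le> \<alpha> ^ m" for t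
      proof -
        have "prob {y. D y ((f ^^ k) y) \<le> t} \<le> prob {y. D y ((f ^^ k) y) \<le> \<alpha> ^ m}"
          using nonexpansive_measurable[OF nonexpansive_id] that
          by (intro finite_measure_mono) (auto simp: sets_eq)
        then show ?thesis using sr[OF k, of m] by linarith
      qed
      show "prob {y. D y ((f ^^ k) y) \<le> \<rho> m} \<le> \<gamma> ^ m"
        using p[of "\<rho> m"] le r elim nn by (simp add: algebra_simps)
      have "(\<integral>y. pair_rate (\<rho> m) k y \<partial>\<mu>) \<le> C * (4 * \<rho> m) ^ d * prob {y. D y ((f ^^ k) y) \<le> 8 * \<rho> m}"
        using r by (rule integral_pair_rate_le)
      also have "\<dots> \<le> C * (4 * \<rho> m) ^ d * (B * \<beta> ^ m)"
        using C_nonneg r by (intro mult_left_mono p le) auto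
      also have "\<dots> = (C * 4 ^ d * B * \<beta> ^ m) * \<rho> m ^ d" by (simp add: power_mult_distrib mult_ac)
      also have "\<dots> \<le> \<gamma> ^ m * \<rho> m ^ d"
        using elim nn nn' r by (intro mult_right_mono) (auto simp: algebra_simps)
      finally show "(\<integral>y. pair_rate (\<rho> m) k y \<partial>\<mu>) \<le> \<gamma> ^ m * \<rho> m ^ d" .
    qed
  qed
  have \<gamma>0: "0 < \<gamma>" using B \<gamma> by auto
  show "admissible \<rho> (\<lambda>x. x)"
    unfolding admissible_def using nonexpansive_id \<gamma>0 \<gamma>(2) eventually_mono[OF both]
    by (intro conjI exI[of _ \<gamma>]) auto
  show "\<exists>\<beta>. 0 < \<beta> \<and> \<beta> < 1 \<and>
     (\<forall>\<^sub>F m in sequentially. \<forall>k\<ge>1. (\<integral>y. pair_rate (\<rho> m) k y \<partial>\<mu>) \<le> \<beta> ^ m * \<rho> m ^ d)"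
    using \<gamma>0 \<gamma>(2) eventually_mono[OF both] by (intro exI[of _ \<gamma>]) auto
qed

text \<open>
  The mean over all centres is exponentially small compared to \<open>\<rho>\<^sub>m\<^sup>d\<close>, so Markov's inequality and the
  Borel--Cantelli lemma give the same for almost every single centre, with a slightly worse rate. Early visits to a fixed ball are rare
  by invariance of \<open>\<mu>\<close> alone.
\<close>
lemma admissible_const:
  assumes \<rho>: "radius_scale \<rho>"
  shows "AE x in \<mu>. admissible \<rho> (\<lambda>_. x)"
proof -
  obtain \<beta> where \<beta>: "0 < \<beta>" "\<beta> < 1"
    and ev: "\<forall>\<^sub>F m in sequentially. \<forall>k\<ge>1. (\<integral>y. pair_rate (\<rho> m) k y \<partial>\<mu>) \<le> \<beta> ^ m * \<rho> m ^ d"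
    using admissible_id(2)[OF \<rho>] by blast
  obtain a1 a2 where a2: "0 < a2" "a2 < 1" and ev2: "\<forall>\<^sub>F m in sequentially. a1 ^ m \<le> \<rho> m \<and> \<rho> m \<le> a2 ^ m"
    using \<rho> by (auto simp: radius_scale_def)
  obtain \<gamma>' where \<gamma>': "\<beta> < \<gamma>'" "\<gamma>' < 1" using dense[OF \<beta>(2)] by blast
  obtain a3 where a3: "a2 < a3" "a3 < 1" using dense[OF a2(2)] by blast
  define \<gamma> where "\<gamma> = max \<gamma>' a3"
  have \<gamma>: "0 < \<gamma>" "\<gamma> < 1" "\<gamma>' \<le> \<gamma>" "a3 \<le> \<gamma>" using \<gamma>' \<beta> a3 by (auto simp: \<gamma>_def)
  have r: "0 < \<rho> m" "\<rho> m \<le> 1" for m using radius_scaleD[OF \<rho>] by auto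
  define S where "S m x = (\<Sum>l\<in>{1..m\<^sup>2}. pair_rate (\<rho> m) l x)" for m x
  have Sm [measurable]: "S m \<in> borel_measurable \<mu>" for m
    unfolding S_def using pair_rate_measurable r by measurable
  have Qi: "integrable \<mu> (pair_rate (\<rho> m) l)" for m l
    using pair_rate_measurable[OF r] pair_rate_le_1[OF r] by (intro integrable_bounded[of _ 1]) auto
  have Si: "integrable \<mu> (S m)" for m unfolding S_def using Qi by auto
  have "AE x in \<mu>. \<forall>\<^sub>F m in sequentially. x \<notin> {x. S m x \<ge> \<gamma> ^ m * \<rho> m ^ d}"
  proof (rule borel_cantelli_prob)
    show "{x. S m x \<ge> \<gamma> ^ m * \<rho> m ^ d} \<in> sets borel" for m
    proof -
      have "{x \<in> space \<mu>. S m x \<ge> \<gamma> ^ m * \<rho> m ^ d} \<in> sets \<mu>" by measurable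
      then show ?thesis by (simp add: sets_eq)
    qed
    show "summable (\<lambda>m. 1 * real m ^ 2 * (\<beta> / \<gamma>) ^ m)"
      using \<beta> \<gamma> \<gamma>' by (intro summable_poly_times_power) auto
    show "\<forall>\<^sub>F m in sequentially. prob {x. S m x \<ge> \<gamma> ^ m * \<rho> m ^ d} \<le> 1 * real m ^ 2 * (\<beta> / \<gamma>) ^ m"
      using ev
    proof eventually_elim
      case (elim m)
      have pos: "0 < \<gamma> ^ m * \<rho> m ^ d" using \<gamma> r by auto
      have "prob {x \<in> space \<mu>. S m x \<ge> \<gamma> ^ m * \<rho> m ^ d} \<le> (\<integral>x. S m x \<partial>\<mu>) / (\<gamma> ^ m * \<rho> m ^ d)"
        using integral_Markov_inequality_measure[OF Si sets.empty_sets, of m] pos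
        by (simp add: S_def sum_nonneg)
      also have "(\<integral>x. S m x \<partial>\<mu>) = (\<Sum>l\<in>{1..m\<^sup>2}. \<integral>x. pair_rate (\<rho> m) l x \<partial>\<mu>)"
        unfolding S_def using Qi by (intro Bochner_Integration.integral_sum) auto
      also have "\<dots> \<le> (\<Sum>l\<in>{1..m\<^sup>2}. \<beta> ^ m * \<rho> m ^ d)" using elim by (intro sum_mono) auto
      also have "\<dots> = real m ^ 2 * (\<beta> ^ m * \<rho> m ^ d)" by simp
      finally have "prob {x. S m x \<ge> \<gamma> ^ m * \<rho> m ^ d} \<le> real m ^ 2 * (\<beta> ^ m * \<rho> m ^ d) / (\<gamma> ^ m * \<rho> m ^ d)"
        using pos by (simp add: divide_right_mono)
      then show ?case using pos r(1)[of m] by (simp add: power_divide)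
    qed
  qed
  then show ?thesis
  proof (rule AE_mp, intro AE_I2 impI)
    fix x assume x: "\<forall>\<^sub>F m in sequentially. x \<notin> {x. S m x \<ge> \<gamma> ^ m * \<rho> m ^ d}"
    have ev4: "\<forall>\<^sub>F m in sequentially. C * a2 ^ m \<le> \<gamma> ^ m"
      using eventually_const_times_power_le[of a2 \<gamma> C] a2 a3 \<gamma> by auto
    have "\<forall>\<^sub>F m in sequentially. \<forall>k\<in>{1..m\<^sup>2}.
        prob {y. D x ((f ^^ k) y) \<le> \<rho> m} \<le> \<gamma> ^ m \<and> (\<integral>y. pair_rate (\<rho> m) k x \<partial>\<mu>) \<le> \<gamma> ^ m * \<rho> m ^ d"
      using x ev2 ev4
    proof eventually_elim
      case (elim m)
      show ?case
      proof
        fix k assume k: "k \<in> {1..m\<^sup>2}"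
        have "pair_rate (\<rho> m) k x \<le> S m x" unfolding S_def using k by (intro member_le_sum) auto
        then have 1: "(\<integral>y. pair_rate (\<rho> m) k x \<partial>\<mu>) \<le> \<gamma> ^ m * \<rho> m ^ d" using elim by simp
        have "prob {y. D x ((f ^^ k) y) \<le> \<rho> m} = prob ((f ^^ k) -` {y. D x y \<le> \<rho> m} \<inter> space \<mu>)"
          by (simp add: vimage_def)
        also have "\<dots> = measure (distr \<mu> \<mu> (f ^^ k)) {y. D x y \<le> \<rho> m}"
          using ball_sets sets_eq by (subst measure_distr[OF iterate_measurable_\<mu>]) auto
        also have "\<dots> = prob {y. D x y \<le> \<rho> m}" by (simp add: iterate_preserves)
        also have "\<dots> \<le> C * \<rho> m ^ d" using r by (rule_tac ball_upper)
        also have "\<dots> \<le> C * \<rho> m ^ 1"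
          using r d_pos C_nonneg by (intro mult_left_mono power_decreasing) (auto intro: less_imp_le)
        also have "\<dots> \<le> C * a2 ^ m" using elim C_nonneg by (intro mult_left_mono) auto
        finally show "prob {y. D x ((f ^^ k) y) \<le> \<rho> m} \<le> \<gamma> ^ m \<and> (\<integral>y. pair_rate (\<rho> m) k x \<partial>\<mu>) \<le> \<gamma> ^ m * \<rho> m ^ d"
          using 1 elim by auto
      qed
    qed
    then show "admissible \<rho> (\<lambda>_. x)"
      unfolding admissible_def using nonexpansive_const \<gamma> by (intro conjI exI[of _ \<gamma>]) auto
  qed
qed

end

section \<open>Few visits: the upper bound\<close>

context mixing_system
begin

text \<open>
  Here mixing is applied once, between \<open>y\<close> and the first visit at time \<open>k\<close>; the pair of visits is a single observable of
  \<open>f\<^sup>k y\<close>, with a Lipschitz constant that grows like \<open>L\<^sup>l\<close>.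
\<close>
lemma close_visits_prob:
  assumes \<rho>: "0 < \<rho>" "\<rho> \<le> 1" and b: "nonexpansive b" and k: "m \<le> k"
  shows "prob ({y. D (b y) ((f ^^ k) y) \<le> \<rho>} \<inter> {y. D (b y) ((f ^^ (k + l)) y) \<le> \<rho>})
    \<le> (\<integral>y. pair_rate \<rho> l (b y) \<partial>\<mu>) + mixing_const * \<theta> ^ m * (4 * L ^ l / \<rho>\<^sup>2) ^ (2 * r + 2)"
proof -
  let ?\<Lambda> = "4 * L ^ l / \<rho>\<^sup>2"
  have \<Lambda>: "1 \<le> ?\<Lambda>"
  proof -
    have "\<rho>\<^sup>2 \<le> 1" using \<rho> by (simp add: power_le_one)
    moreover have "1 \<le> L ^ l" using L_ge_1 by simp
    ultimately show ?thesis using \<rho> by (simp add: le_divide_eq)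
  qed
  have "prob ({y. D (b y) ((f ^^ k) y) \<le> \<rho>} \<inter> {y. D (b y) ((f ^^ (k + l)) y) \<le> \<rho>})
      \<le> (\<integral>y. close_pair \<rho> l (b y) ((f ^^ k) y) \<partial>\<mu>)"
  proof (rule prob_le_integral[of _ _ 1])
    show "{y. D (b y) ((f ^^ k) y) \<le> \<rho>} \<inter> {y. D (b y) ((f ^^ (k + l)) y) \<le> \<rho>} \<in> sets borel"
      using nonexpansive_measurable[OF b] by blast
    show "(\<lambda>y. close_pair \<rho> l (b y) ((f ^^ k) y)) \<in> borel_measurable \<mu>"
      using lip2_measurable[OF lip2_nonexpansive[OF close_pair_lip2[OF \<rho>] b], of l "\<lambda>z. z" \<mu> "f ^^ k"]
        \<Lambda> iterate_measurable measurable_cong_sets[OF sets_eq refl]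
      by (auto simp: measurable_ident_sets[OF sets_eq])
    show "1 \<le> close_pair \<rho> l (b y) ((f ^^ k) y)"
      if "y \<in> {y. D (b y) ((f ^^ k) y) \<le> \<rho>} \<inter> {y. D (b y) ((f ^^ (k + l)) y) \<le> \<rho>}" for y
    proof -
      have "(f ^^ (k + l)) y = (f ^^ l) ((f ^^ k) y)" by (metis add.commute comp_apply funpow_add)
      then show ?thesis using that \<rho> close_pair_eq_1[of \<rho> "b y" "(f ^^ k) y" l] by auto
    qed
  qed auto
  also have "\<dots> \<le> (\<integral>y. pair_rate \<rho> l (b y) \<partial>\<mu>) + mixing_const * \<theta> ^ m * ?\<Lambda> ^ (2 * r + 2)"
    using mixing_times[of ?\<Lambda> "\<lambda>_. 1" "{k}" "\<lambda>_. close_pair \<rho> l" b m]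
      close_pair_lip2[OF \<rho>] \<Lambda> k r_pos lip1_const[of 1 ?\<Lambda>] b
    by (simp add: separated_def pair_rate_def abs_le_iff)
  finally show ?thesis .
qed

lemma separated_visits_prob:
  assumes \<rho>: "0 < \<rho>" "\<rho> \<le> 1" and b: "nonexpansive b"
    and T: "finite T" "T \<noteq> {}" "card T \<le> 2 * r" "separated m T"
  shows "prob (\<Inter>k\<in>T. {y. D (b y) ((f ^^ k) y) \<le> \<rho>})
    \<le> (C * (2 * \<rho>) ^ d) ^ card T + mixing_const * \<theta> ^ m * (1 / \<rho>) ^ (2 * r + 2)"
proof -
  have lip: "lip2 (1 / \<rho>) (near \<rho>)" using \<rho> by (intro near_lip2) auto
  have \<Lambda>: "1 \<le> 1 / \<rho>" using \<rho> by simp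
  have idm: "(\<lambda>z. z) \<in> \<mu> \<rightarrow>\<^sub>M borel" by (simp add: measurable_ident_sets[OF sets_eq])
  have nonneg: "0 \<le> (\<integral>z. near \<rho> x z \<partial>\<mu>)" for x by (intro integral_nonneg_AE) auto
  have "prob (\<Inter>k\<in>T. {y. D (b y) ((f ^^ k) y) \<le> \<rho>}) \<le> (\<integral>y. (\<Prod>k\<in>T. near \<rho> (b y) ((f ^^ k) y)) \<partial>\<mu>)"
  proof (rule prob_le_integral[of _ _ 1])
    show "(\<Inter>k\<in>T. {y. D (b y) ((f ^^ k) y) \<le> \<rho>}) \<in> sets borel"
      using T nonexpansive_measurable[OF b] by (intro sets.finite_INT) auto
    show "(\<lambda>y. \<Prod>k\<in>T. near \<rho> (b y) ((f ^^ k) y)) \<in> borel_measurable \<mu>"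
      using lip2_measurable[OF lip2_nonexpansive[OF lip b] idm measurable_compose[OF idm iterate_measurable]] \<Lambda> \<rho>
      by (intro borel_measurable_prod) auto
    show "1 \<le> (\<Prod>k\<in>T. near \<rho> (b y) ((f ^^ k) y))"
      if "y \<in> (\<Inter>k\<in>T. {y. D (b y) ((f ^^ k) y) \<le> \<rho>})" for y
      using that \<rho> near_eq_1 by (auto intro!: prod_ge_1)
  qed (auto intro!: prod_nonneg prod_le_1)
  also have "\<dots> \<le> (\<integral>y. (\<Prod>k\<in>T. \<integral>z. near \<rho> (b y) z \<partial>\<mu>) \<partial>\<mu>) + mixing_const * \<theta> ^ m * (1 / \<rho>) ^ (2 * r + 2)"
    using mixing_times[of "1 / \<rho>" "\<lambda>_. 1" T "\<lambda>_. near \<rho>" b m] lip \<Lambda> T b lip1_const[of 1 "1 / \<rho>"]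
    by (simp add: abs_le_iff)
  also have "(\<integral>y. (\<Prod>k\<in>T. \<integral>z. near \<rho> (b y) z \<partial>\<mu>) \<partial>\<mu>) \<le> (\<integral>y. (C * (2 * \<rho>) ^ d) ^ card T \<partial>\<mu>)"
  proof (rule integral_mono)
    have l1: "lip1 (1 / \<rho>) (\<lambda>y. \<integral>z. near \<rho> (b y) z \<partial>\<mu>)"
      using lip2_integral[OF lip2_nonexpansive[OF lip b]] \<rho> by auto
    have [measurable]: "(\<lambda>y. \<integral>z. near \<rho> (b y) z \<partial>\<mu>) \<in> borel_measurable \<mu>"
      using l1 dlip_measurable by (auto simp: lip1_def)
    show "(\<Prod>k\<in>T. \<integral>z. near \<rho> (b y) z \<partial>\<mu>) \<le> (C * (2 * \<rho>) ^ d) ^ card T" for y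
      using near_integral_upper[OF \<rho>(1), of "b y"] nonneg by (simp add: power_mono)
    show "integrable \<mu> (\<lambda>y. \<Prod>k\<in>T. \<integral>z. near \<rho> (b y) z \<partial>\<mu>)"
    proof (rule integrable_bounded)
      show "\<bar>\<Prod>k\<in>T. \<integral>z. near \<rho> (b y) z \<partial>\<mu>\<bar> \<le> (C * (2 * \<rho>) ^ d) ^ card T" for y
        using near_integral_upper[OF \<rho>(1), of "b y"] nonneg[of "b y"]
        by (simp add: power_mono)
    qed measurable
  qed auto
  finally show ?thesis by simp
qed

text \<open>
  \<open>\<Gamma>\<^sup>m\<close> stands for the Lipschitz constants of close pairs; the bound \<open>4\<^bsup>-m\<^esup>\<close> leaves room for the \<open>2\<^sup>m\<close> possible times.
\<close>
lemma super_exponential: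
  fixes \<Gamma> :: real
  assumes "0 \<le> \<Gamma>" shows "\<forall>\<^sub>F m in sequentially. \<theta> ^ (m\<^sup>2) * \<Gamma> ^ m \<le> (1 / 4) ^ m"
proof -
  have "(\<lambda>m. \<theta> ^ m * \<Gamma>) \<longlonglongrightarrow> 0"
    using \<theta>_pos \<theta>_less_1 by (intro tendsto_mult_left_zero LIMSEQ_power_zero) auto
  then have "\<forall>\<^sub>F m in sequentially. \<theta> ^ m * \<Gamma> < 1 / 4" by (rule order_tendstoD) simp
  then show ?thesis
  proof eventually_elim
    case (elim m)
    have "\<theta> ^ (m\<^sup>2) * \<Gamma> ^ m = (\<theta> ^ m * \<Gamma>) ^ m" by (simp add: power_mult_distrib power_mult power2_eq_square)
    also have "\<dots> \<le> (1 / 4) ^ m" using elim assms \<theta>_pos by (intro power_mono) auto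
    finally show ?case .
  qed
qed

text \<open>
  An \<open>r\<close>-tuple of visits up to time \<open>2\<^bsup>m+1\<^esup>\<close> either has all gaps at least \<open>R m\<close>, or contains a time below \<open>m\<^sup>2\<close>, or
  contains two times above \<open>m\<^sup>2\<close> with a gap below \<open>R m\<close>. The three events \<open>E1\<close>, \<open>E2\<close>, \<open>E3\<close> have summable probabilities: the
  first is of order \<open>(2\<^sup>m \<rho>\<^sub>m\<^sup>d)\<^sup>r\<close> by independence, the other two are exponentially small by admissibility.
\<close>
theorem eventually_few_visits:
  assumes \<rho>: "radius_scale \<rho>" and adm: "admissible \<rho> b"
    and small: "\<forall>\<^sub>F m in sequentially. 2 ^ m * \<rho> m ^ d \<le> 1"
    and sum: "summable (\<lambda>m. (2 ^ m * \<rho> m ^ d) ^ r)"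
  shows "AE y in \<mu>. \<forall>\<^sub>F m in sequentially. card {k \<in> {1..2 ^ (m + 1)}. D (b y) ((f ^^ k) y) \<le> \<rho> m} < r"
proof -
  have rh: "0 < \<rho> m" "\<rho> m \<le> 1" for m using radius_scaleD[OF \<rho>] by auto
  have b: "nonexpansive b" using adm by (simp add: admissible_def)
  obtain \<beta> where \<beta>: "0 < \<beta>" "\<beta> < 1" and H: "\<forall>\<^sub>F m in sequentially. \<forall>k\<in>{1..m\<^sup>2}.
        prob {y. D (b y) ((f ^^ k) y) \<le> \<rho> m} \<le> \<beta> ^ m \<and>
        (\<integral>y. pair_rate (\<rho> m) k (b y) \<partial>\<mu>) \<le> \<beta> ^ m * \<rho> m ^ d"
    using adm by (auto simp: admissible_def)
  obtain \<alpha> where \<alpha>: "0 < \<alpha>" "\<alpha> < 1" and ev\<alpha>: "\<forall>\<^sub>F m in sequentially. \<alpha> ^ m \<le> \<rho> m"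
  proof -
    obtain a1 a2 where a: "0 < a1" "a1 < 1" and ev: "\<forall>\<^sub>F m in sequentially. a1 ^ m \<le> \<rho> m \<and> \<rho> m \<le> a2 ^ m"
      using \<rho> by (auto simp: radius_scale_def)
    show thesis by (rule that[OF a eventually_mono[OF ev]]) simp
  qed
  define q where "q = 2 * r + 2"
  \<comment> \<open>With gaps \<open>R m\<close> the mixing error beats both the Lipschitz constant \<open>\<alpha>\<^bsup>-mq\<^esup>\<close> and the number \<open>2\<^bsup>(m+1)r\<^esup>\<close> of tuples.\<close>
  obtain R where R: "\<theta> ^ R < \<alpha> ^ q / 2 ^ (r + 1)"
    using real_arch_pow_inv[of "\<alpha> ^ q / 2 ^ (r + 1)" \<theta>] \<alpha> \<theta>_less_1 by auto
  define V where "V m k = {y. D (b y) ((f ^^ k) y) \<le> \<rho> m}" for m k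
  have V [measurable]: "V m k \<in> sets borel" for m k unfolding V_def by (rule nonexpansive_measurable[OF b])
  have V\<mu>: "V m k \<in> sets \<mu>" for m k using V sets_eq by simp
  define \<T> where "\<T> m = {T. T \<subseteq> {1..2 ^ (m + 1)} \<and> card T = r \<and> separated (R * m) T}" for m :: nat
  define E1 where "E1 m = (\<Union>T\<in>\<T> m. \<Inter>k\<in>T. V m k)" for m
  define E2 where "E2 m = (\<Union>k\<in>{1..m\<^sup>2}. V m k)" for m
  define E3 where "E3 m = (\<Union>p\<in>{m\<^sup>2..2 ^ (m + 1)} \<times> {1..R * m}. V m (fst p) \<inter> V m (fst p + snd p))" for m
  have \<T>: "finite (\<T> m)" "card (\<T> m) \<le> (2 ^ (m + 1)) ^ r" for m
  proof -
    have sub: "\<T> m \<subseteq> {T. T \<subseteq> {1..2 ^ (m + 1)} \<and> card T = r}" by (auto simp: \<T>_def)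
    have fin: "finite {T. T \<subseteq> {1..2 ^ (m + 1) :: nat} \<and> card T = r}" by (rule finite_subset[of _ "Pow {1..2 ^ (m + 1)}"]) auto
    show "finite (\<T> m)" using finite_subset[OF sub fin] .
    have "card (\<T> m) \<le> card {T. T \<subseteq> {1..2 ^ (m + 1) :: nat} \<and> card T = r}" by (rule card_mono[OF fin sub])
    also have "\<dots> = (2 ^ (m + 1) choose r)" by (subst n_subsets) auto
    also have "\<dots> \<le> (2 ^ (m + 1)) ^ r"
      by (cases "r \<le> 2 ^ (m + 1)") (use binomial_le_pow in blast, simp add: binomial_eq_0)
    finally show "card (\<T> m) \<le> (2 ^ (m + 1)) ^ r" .
  qed
  have Tprop: "finite T" "T \<noteq> {}" "card T \<le> 2 * r" "separated (R * m) T" "card T = r" if "T \<in> \<T> m" for T m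
    using that r_pos finite_subset[of T "{1..2 ^ (m + 1)}"] unfolding \<T>_def by auto
  have E1s: "(\<Inter>k\<in>T. V m k) \<in> sets \<mu>" if "T \<in> \<T> m" for T m
    using Tprop[OF that] V\<mu> by (intro sets.finite_INT) auto
  define A1 where "A1 = (2 * C * 2 ^ d) ^ r"
  define A2 where "A2 = 2 ^ r * mixing_const"
  define A3 where "A3 = 4 * real R"
  define A4 where "A4 = 4 * real R * mixing_const * 4 ^ q"
  define \<Gamma> where "\<Gamma> = 2 * (L ^ R / \<alpha>\<^sup>2) ^ q"
  define u where "u m = A1 * (2 ^ m * \<rho> m ^ d) ^ r + A2 * (1 / 2) ^ m + 1 * real m ^ 2 * \<beta> ^ m
      + A3 * real m ^ 1 * \<beta> ^ m + A4 * real m ^ 1 * (1 / 4) ^ m" for m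
  have \<Gamma>0: "0 \<le> \<Gamma>" using L_ge_1 by (simp add: \<Gamma>_def)
  have P1: "prob (E1 m) \<le> A1 * (2 ^ m * \<rho> m ^ d) ^ r + A2 * (1 / 2) ^ m" if \<alpha>m: "\<alpha> ^ m \<le> \<rho> m" for m
  proof -
    have err: "(2 ^ (m + 1)) ^ r * (mixing_const * \<theta> ^ (R * m) * (1 / \<rho> m) ^ q) \<le> A2 * (1 / 2) ^ m"
    proof -
      have "(1 / \<rho> m) ^ q \<le> (1 / \<alpha> ^ m) ^ q" using \<alpha>m \<alpha> rh[of m] by (intro power_mono divide_left_mono) (auto simp: less_imp_le)
      then have "\<theta> ^ (R * m) * (1 / \<rho> m) ^ q \<le> \<theta> ^ (R * m) * (1 / \<alpha> ^ m) ^ q"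
        using \<theta>_pos by (intro mult_left_mono) auto
      also have "\<dots> = (\<theta> ^ R / \<alpha> ^ q) ^ m"
        by (simp add: power_divide power_mult[symmetric] mult.commute)
      also have "\<dots> \<le> (1 / 2 ^ (r + 1)) ^ m"
        using R \<alpha> \<theta>_pos by (intro power_mono) (auto simp: field_simps)
      finally have 1: "\<theta> ^ (R * m) * (1 / \<rho> m) ^ q \<le> (1 / 2 ^ (r + 1)) ^ m" .
      have "(2 ^ (m + 1)) ^ r * (mixing_const * \<theta> ^ (R * m) * (1 / \<rho> m) ^ q)
          = (2 ^ (m + 1)) ^ r * mixing_const * (\<theta> ^ (R * m) * (1 / \<rho> m) ^ q)" by simp
      also have "\<dots> \<le> (2 ^ (m + 1)) ^ r * mixing_const * (1 / 2 ^ (r + 1)) ^ m"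
        using 1 mixing_const_nonneg by (intro mult_left_mono) auto
      also have "\<dots> = A2 * (1 / 2) ^ m"
      proof -
        have "((2::real) ^ (m + 1)) ^ r = 2 ^ r * (2 ^ r) ^ m"
          by (simp add: power_mult[symmetric] power_add[symmetric] algebra_simps)
        moreover have "(1 / (2::real) ^ (r + 1)) ^ m = (1 / 2) ^ m * (1 / (2 ^ r) ^ m)"
          by (simp add: power_divide power_mult_distrib)
        ultimately show ?thesis by (simp add: A2_def)
      qed
      finally show ?thesis .
    qed
    have "prob (E1 m) \<le> (\<Sum>T\<in>\<T> m. prob (\<Inter>k\<in>T. V m k))"
      unfolding E1_def using \<T> E1s by (intro finite_measure_subadditive_finite) auto
    also have "\<dots> \<le> (\<Sum>T\<in>\<T> m. (C * (2 * \<rho> m) ^ d) ^ r + mixing_const * \<theta> ^ (R * m) * (1 / \<rho> m) ^ q)"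
    proof (rule sum_mono)
      fix T assume T: "T \<in> \<T> m"
      show "prob (\<Inter>k\<in>T. V m k) \<le> (C * (2 * \<rho> m) ^ d) ^ r + mixing_const * \<theta> ^ (R * m) * (1 / \<rho> m) ^ q"
        using separated_visits_prob[OF rh b Tprop(1-4)[OF T]] Tprop(5)[OF T] by (simp add: V_def q_def)
    qed
    also have "\<dots> = real (card (\<T> m)) * ((C * (2 * \<rho> m) ^ d) ^ r + mixing_const * \<theta> ^ (R * m) * (1 / \<rho> m) ^ q)"
      by simp
    also have "\<dots> \<le> (2 ^ (m + 1)) ^ r * ((C * (2 * \<rho> m) ^ d) ^ r + mixing_const * \<theta> ^ (R * m) * (1 / \<rho> m) ^ q)"
    proof (rule mult_right_mono)
      have "real (card (\<T> m)) \<le> real ((2 ^ (m + 1)) ^ r)" using \<T>(2)[of m] of_nat_mono by blast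
      then show "real (card (\<T> m)) \<le> (2 ^ (m + 1)) ^ r" by simp
      show "0 \<le> (C * (2 * \<rho> m) ^ d) ^ r + mixing_const * \<theta> ^ (R * m) * (1 / \<rho> m) ^ q"
        using C_nonneg rh[of m] mixing_const_nonneg \<theta>_pos by (intro add_nonneg_nonneg mult_nonneg_nonneg) (auto simp: less_imp_le)
    qed
    also have "\<dots> = A1 * (2 ^ m * \<rho> m ^ d) ^ r + (2 ^ (m + 1)) ^ r * (mixing_const * \<theta> ^ (R * m) * (1 / \<rho> m) ^ q)"
      by (simp add: A1_def distrib_left power_mult_distrib mult_ac)
    finally show ?thesis using err by simp
  qed
  have ev: "\<forall>\<^sub>F m in sequentially. prob (E1 m \<union> E2 m \<union> E3 m) \<le> u m"
    using H small ev\<alpha> super_exponential[OF \<Gamma>0] eventually_ge_at_top[of R]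
  proof eventually_elim
    case (elim m)
    have Rm: "R * m \<le> m\<^sup>2" using elim by (simp add: power2_eq_square)
    have P2: "prob (E2 m) \<le> 1 * real m ^ 2 * \<beta> ^ m"
    proof -
      have "prob (E2 m) \<le> (\<Sum>k\<in>{1..m\<^sup>2}. prob (V m k))"
        unfolding E2_def using V\<mu> by (intro finite_measure_subadditive_finite) auto
      also have "\<dots> \<le> (\<Sum>k\<in>{1..m\<^sup>2}. \<beta> ^ m)" using elim by (intro sum_mono) (auto simp: V_def)
      finally show ?thesis by simp
    qed
    \<comment> \<open>There are about \<open>2\<^sup>m R m\<close> pairs of times, each of probability at most \<open>\<beta>\<^sup>m \<rho>\<^sub>m\<^sup>d\<close> up to a super-exponentially small
      error, and \<open>2\<^sup>m \<rho>\<^sub>m\<^sup>d \<le> 1\<close>.\<close>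
    have P3: "prob (E3 m) \<le> A3 * real m ^ 1 * \<beta> ^ m + A4 * real m ^ 1 * (1 / 4) ^ m"
    proof -
      let ?I = "{m\<^sup>2..2 ^ (m + 1)} \<times> {1..R * m}"
      let ?e = "mixing_const * (\<theta> ^ (m\<^sup>2) * (4 ^ q * ((L ^ R / \<alpha>\<^sup>2) ^ q) ^ m))"
      have "prob (E3 m) \<le> (\<Sum>p\<in>?I. prob (V m (fst p) \<inter> V m (fst p + snd p)))"
        unfolding E3_def using V\<mu> by (intro finite_measure_subadditive_finite) auto
      also have "\<dots> \<le> (\<Sum>p\<in>?I. \<beta> ^ m * \<rho> m ^ d + ?e)"
      proof (rule sum_mono)
        fix p assume p: "p \<in> ?I"
        have "prob (V m (fst p) \<inter> V m (fst p + snd p)) \<le> (\<integral>y. pair_rate (\<rho> m) (snd p) (b y) \<partial>\<mu>)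
            + mixing_const * \<theta> ^ (m\<^sup>2) * (4 * L ^ snd p / (\<rho> m)\<^sup>2) ^ q"
          unfolding V_def q_def using p by (intro close_visits_prob rh b) auto
        also have "(\<integral>y. pair_rate (\<rho> m) (snd p) (b y) \<partial>\<mu>) \<le> \<beta> ^ m * \<rho> m ^ d"
          using elim p Rm by auto
        also have "mixing_const * \<theta> ^ (m\<^sup>2) * (4 * L ^ snd p / (\<rho> m)\<^sup>2) ^ q \<le> ?e"
        proof -
          have "4 * L ^ snd p / (\<rho> m)\<^sup>2 \<le> 4 * L ^ (R * m) / (\<alpha> ^ m)\<^sup>2"
            using p L_ge_1 elim \<alpha> rh[of m]
            by (intro frac_le mult_left_mono power_increasing power_mono) (auto simp: less_imp_le)
          then have "(4 * L ^ snd p / (\<rho> m)\<^sup>2) ^ q \<le> (4 * L ^ (R * m) / (\<alpha> ^ m)\<^sup>2) ^ q"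
            using L_ge_1 by (intro power_mono) auto
          also have "\<dots> = 4 ^ q * ((L ^ R / \<alpha>\<^sup>2) ^ q) ^ m"
            by (simp add: power_mult_distrib power_divide power_mult[symmetric] mult_ac)
          finally show ?thesis
            using mixing_const_nonneg \<theta>_pos unfolding mult.assoc by (intro mult_left_mono) auto
        qed
        finally show "prob (V m (fst p) \<inter> V m (fst p + snd p)) \<le> \<beta> ^ m * \<rho> m ^ d + ?e" by simp
      qed
      also have "\<dots> = real (card ?I) * (\<beta> ^ m * \<rho> m ^ d + ?e)" by simp
      also have "\<dots> \<le> (4 * 2 ^ m * (real R * real m)) * (\<beta> ^ m * \<rho> m ^ d + ?e)"
      proof (rule mult_right_mono)
        have "card {m\<^sup>2..2 ^ (m + 1)} \<le> 2 ^ (m + 1) + 1" by simp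
        then have "card {m\<^sup>2..2 ^ (m + 1)} * card {1..R * m} \<le> (2 ^ (m + 1) + 1) * (R * m)"
          by (intro mult_le_mono) simp_all
        then have "card ?I \<le> (2 ^ (m + 1) + 1) * (R * m)" by (simp only: card_cartesian_product)
        also have "\<dots> \<le> (4 * 2 ^ m) * (R * m)"
        proof (rule mult_right_mono)
          have "(1::nat) \<le> 2 ^ m" by simp
          then show "2 ^ (m + 1) + 1 \<le> 4 * (2 ^ m :: nat)" by simp
        qed simp
        finally have "real (card ?I) \<le> real ((4 * 2 ^ m) * (R * m))" using of_nat_mono by blast
        then show "real (card ?I) \<le> 4 * 2 ^ m * (real R * real m)" by simp
        show "0 \<le> \<beta> ^ m * \<rho> m ^ d + ?e"
          using \<beta> rh[of m] mixing_const_nonneg \<theta>_pos L_ge_1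
          by (intro add_nonneg_nonneg mult_nonneg_nonneg) (auto simp: less_imp_le)
      qed
      also have "\<dots> = A3 * real m * \<beta> ^ m * (2 ^ m * \<rho> m ^ d) + A4 * real m * (\<theta> ^ (m\<^sup>2) * \<Gamma> ^ m)"
        by (simp add: A3_def A4_def \<Gamma>_def power_mult_distrib algebra_simps)
      also have "\<dots> \<le> A3 * real m * \<beta> ^ m * 1 + A4 * real m * (1 / 4) ^ m"
        using elim \<beta> mixing_const_nonneg L_ge_1
        by (intro add_mono mult_left_mono) (auto simp: A3_def A4_def \<Gamma>_def)
      finally show ?thesis by simp
    qed
    have "prob (E1 m \<union> E2 m \<union> E3 m) \<le> prob (E1 m \<union> E2 m) + prob (E3 m)"
      unfolding E1_def E2_def E3_def using V\<mu> E1s \<T> by (intro measure_Un_le sets.Un sets.finite_UN) auto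
    also have "prob (E1 m \<union> E2 m) \<le> prob (E1 m) + prob (E2 m)"
      unfolding E1_def E2_def using V\<mu> E1s \<T> by (intro measure_Un_le sets.Un sets.finite_UN) auto
    finally show ?case using P1[of m] P2 P3 elim unfolding u_def by linarith
  qed
  have "AE y in \<mu>. \<forall>\<^sub>F m in sequentially. y \<notin> E1 m \<union> E2 m \<union> E3 m"
  proof (rule borel_cantelli_prob[OF _ ev])
    show "E1 m \<union> E2 m \<union> E3 m \<in> sets borel" for m
      unfolding E1_def E2_def E3_def using V\<mu> E1s \<T> by (subst sets_eq[symmetric], intro sets.Un sets.finite_UN) auto
    show "summable u"
      unfolding u_def using \<beta> by (intro summable_add summable_poly_times_power summable_mult sum summable_geometric) auto
  qed
  then show ?thesis
  proof (rule AE_mp, intro AE_I2 impI)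
    fix y assume "\<forall>\<^sub>F m in sequentially. y \<notin> E1 m \<union> E2 m \<union> E3 m"
    then show "\<forall>\<^sub>F m in sequentially. card {k \<in> {1..2 ^ (m + 1)}. D (b y) ((f ^^ k) y) \<le> \<rho> m} < r"
      using eventually_ge_at_top[of R]
    proof eventually_elim
      case (elim m)
      have Rm: "R * m \<le> m\<^sup>2" using elim by (simp add: power2_eq_square)
      let ?V = "{k \<in> {1..2 ^ (m + 1)}. D (b y) ((f ^^ k) y) \<le> \<rho> m}"
      show ?case
      proof (rule ccontr)
        assume "\<not> ?thesis"
        then obtain T where T: "T \<subseteq> ?V" "card T = r"
          using obtain_subset_with_card_n[of r ?V] by auto
        have late: "m\<^sup>2 < k" if "k \<in> T" for k
        proof (rule ccontr)
          assume "\<not> m\<^sup>2 < k"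
          then have "k \<in> {1..m\<^sup>2}" "y \<in> V m k" using T that by (auto simp: V_def)
          then have "y \<in> E2 m" unfolding E2_def by blast
          then show False using elim by auto
        qed
        show False
        proof (cases "separated (R * m) T")
          case True
          then have "T \<in> \<T> m" using T by (auto simp: \<T>_def)
          then have "y \<in> E1 m" using T by (auto simp: E1_def V_def)
          then show False using elim by auto
        next
          case False
          have "R * m \<le> k" if "k \<in> T" for k using late[OF that] Rm by simp
          then obtain k k' where k: "k \<in> T" "k' \<in> T" "k < k'" "k' < k + R * m"
            using False unfolding separated_def by (meson not_le)
          then have "(k, k' - k) \<in> {m\<^sup>2..2 ^ (m + 1)} \<times> {1..R * m}" using late[of k] T by auto
          moreover have "y \<in> V m (fst (k, k' - k)) \<inter> V m (fst (k, k' - k) + snd (k, k' - k))"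
            using k T by (auto simp: V_def)
          ultimately have "y \<in> E3 m" unfolding E3_def by blast
          then show False using elim by auto
        qed
      qed
    qed
  qed
qed

end

section \<open>A second moment criterion\<close>

lemma harmonic_tail_unbounded:
  assumes "1 \<le> (n\<^sub>0::nat)" shows "\<exists>n. B \<le> (\<Sum>j\<in>{n\<^sub>0..n}. 1 / real j)"
proof -
  have "\<forall>\<^sub>F n in sequentially. B + harm (n\<^sub>0 - 1) \<le> (harm n :: real)"
    using harm_at_top by (auto simp: filterlim_at_top)
  then obtain n where n: "B + harm (n\<^sub>0 - 1) \<le> (harm n :: real)" "n \<ge> n\<^sub>0"
    using eventually_ge_at_top[of n\<^sub>0] by (metis (mono_tags, lifting) eventually_conj eventually_sequentially order_refl)
  have "{1..n} = {1..n\<^sub>0 - 1} \<union> {n\<^sub>0..n}" using n assms by auto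
  then have "harm n = (harm (n\<^sub>0 - 1) :: real) + (\<Sum>j\<in>{n\<^sub>0..n}. 1 / real j)"
    unfolding harm_def using assms by (simp only:) (subst sum.union_disjoint, auto simp: divide_inverse)
  then show ?thesis using n by (intro exI[of _ n]) simp
qed

text \<open>
  A divergent Borel--Cantelli lemma for functions with growing second moments. In \<open>S = \<Sum> X\<^sub>j / j\<close> the mean is about
  \<open>H = \<Sum> 1/j\<close>, the diagonal contributes at most \<open>A \<Sum> j / j\<^sup>2 = A H\<close>, which is negligible against \<open>H\<^sup>2\<close>, and the
  correlations contribute at most \<open>(1 + \<epsilon>) H\<^sup>2\<close>. By Chebyshev's inequality \<open>S = 0\<close> has probability of order \<open>\<epsilon>\<close>.
\<close>
lemma (in prob_space) second_moment_frequently: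
  fixes X :: "nat \<Rightarrow> 'a \<Rightarrow> real"
  assumes meas [measurable]: "\<And>j. X j \<in> borel_measurable M"
    and nonneg: "\<And>j x. 0 \<le> X j x" and bdd: "\<And>j. \<exists>B. \<forall>x. X j x \<le> B"
    and "\<And>\<epsilon>. 0 < \<epsilon> \<Longrightarrow> \<forall>\<^sub>F n in sequentially. \<forall>j\<ge>n. \<bar>expectation (X j) - 1\<bar> \<le> \<epsilon> \<and>
      expectation (\<lambda>x. (X j x)\<^sup>2) \<le> A * real j \<and>
      (\<forall>i. n \<le> i \<and> i < j \<longrightarrow> expectation (\<lambda>x. X i x * X j x) \<le> 1 + \<epsilon>)"
  shows "AE x in M. \<exists>\<^sub>F j in sequentially. 0 < X j x"
proof -
  define Z where "Z n = {x \<in> space M. \<forall>j\<ge>n. X j x \<le> 0}" for n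
  have Zm [measurable]: "Z n \<in> sets M" for n unfolding Z_def by measurable
  have intg: "integrable M (\<lambda>x. X i x * X j x)" and intg1: "integrable M (X i)" for i j
  proof -
    obtain B B' where B: "\<And>x. X i x \<le> B" "\<And>x. X j x \<le> B'" using bdd[of i] bdd[of j] by blast
    show "integrable M (X i)" using B nonneg by (intro integrable_const_bound[of _ B]) auto
    show "integrable M (\<lambda>x. X i x * X j x)"
      using B nonneg order_trans[OF nonneg B(1)]
      by (intro integrable_const_bound[of _ "B * B'"]) (auto simp: abs_mult intro!: mult_mono)
  qed
  have small: "prob (Z n) \<le> 16 * \<epsilon>" if \<epsilon>: "0 < \<epsilon>" "\<epsilon> \<le> 1 / 2" for n \<epsilon>
  proof -
    obtain n1 where n1: "\<And>m j. m \<ge> n1 \<Longrightarrow> j \<ge> m \<Longrightarrow> \<bar>expectation (X j) - 1\<bar> \<le> \<epsilon> \<and>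
        expectation (\<lambda>x. (X j x)\<^sup>2) \<le> A * real j \<and>
        (\<forall>i. m \<le> i \<and> i < j \<longrightarrow> expectation (\<lambda>x. X i x * X j x) \<le> 1 + \<epsilon>)"
      using assms(4)[OF \<epsilon>(1)] unfolding eventually_sequentially by blast
    define n0 where "n0 = max 1 (max n n1)"
    have n0: "1 \<le> n0" "n \<le> n0" "n1 \<le> n0" by (auto simp: n0_def)
    have A: "0 \<le> A"
    proof -
      have "0 \<le> expectation (\<lambda>x. (X n0 x)\<^sup>2)" by (intro integral_nonneg_AE) auto
      also have "\<dots> \<le> A * real n0" using n1[of n0 n0] n0 by auto
      finally show ?thesis using n0 by (simp add: zero_le_mult_iff)
    qed
    obtain N where N: "max 1 (A / \<epsilon>) \<le> (\<Sum>j\<in>{n0..N}. 1 / real j)"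
      using harmonic_tail_unbounded[OF n0(1)] by blast
    define H where "H = (\<Sum>j\<in>{n0..N}. 1 / real j)"
    have H: "1 \<le> H" "A / \<epsilon> \<le> H" using N by (auto simp: H_def)
    define S where "S x = (\<Sum>j\<in>{n0..N}. X j x / real j)" for x
    have Sm [measurable]: "S \<in> borel_measurable M" unfolding S_def by measurable
    have Si: "integrable M S" unfolding S_def using intg1 by auto
    have S2: "(S x)\<^sup>2 = (\<Sum>i\<in>{n0..N}. \<Sum>j\<in>{n0..N}. X i x * X j x / (real i * real j))" for x
      unfolding S_def power2_eq_square sum_product by simp
    have S2i: "integrable M (\<lambda>x. (S x)\<^sup>2)" unfolding S2 using intg by auto
    have ES: "(1 - \<epsilon>) * H \<le> expectation S"
    proof -
      have "(1 - \<epsilon>) * H = (\<Sum>j\<in>{n0..N}. (1 - \<epsilon>) / real j)" by (simp add: H_def sum_distrib_left)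
      also have "\<dots> \<le> (\<Sum>j\<in>{n0..N}. expectation (X j) / real j)"
      proof (intro sum_mono divide_right_mono)
        fix j assume "j \<in> {n0..N}"
        then show "1 - \<epsilon> \<le> expectation (X j)" using n1[OF n0(3), of j] by (auto simp: abs_le_iff)
      qed simp
      also have "\<dots> = expectation S" unfolding S_def using intg1 by simp
      finally show ?thesis .
    qed
    have ES2: "expectation (\<lambda>x. (S x)\<^sup>2) \<le> (1 + \<epsilon>) * H\<^sup>2 + A * H"
    proof -
      have "expectation (\<lambda>x. (S x)\<^sup>2) = (\<Sum>i\<in>{n0..N}. \<Sum>j\<in>{n0..N}. expectation (\<lambda>x. X i x * X j x) / (real i * real j))"
        unfolding S2 using intg by simp
      also have "\<dots> \<le> (\<Sum>i\<in>{n0..N}. \<Sum>j\<in>{n0..N}. (1 + \<epsilon>) * (1 / real i * (1 / real j)) + (if j = i then A / real i else 0))"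
      proof (intro sum_mono)
        fix i j assume ij: "i \<in> {n0..N}" "j \<in> {n0..N}"
        consider "i = j" | "i < j" | "j < i" by linarith
        then show "expectation (\<lambda>x. X i x * X j x) / (real i * real j)
            \<le> (1 + \<epsilon>) * (1 / real i * (1 / real j)) + (if j = i then A / real i else 0)"
        proof cases
          case 1
          have "expectation (\<lambda>x. X i x * X j x) \<le> A * real i"
            using n1[OF n0(3), of i] ij 1 by (auto simp: power2_eq_square)
          then have "expectation (\<lambda>x. X i x * X j x) / (real i * real j) \<le> A * real i / (real i * real j)"
            by (intro divide_right_mono) auto
          also have "\<dots> = A / real i" using 1 ij n0 by simp
          finally show ?thesis using 1 \<epsilon> by (simp add: add_increasing)
        next
          case 2
          then have "expectation (\<lambda>x. X i x * X j x) \<le> 1 + \<epsilon>" using n1[OF n0(3), of j] ij by auto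
          then show ?thesis using 2 by (simp add: divide_right_mono)
        next
          case 3
          then have "expectation (\<lambda>x. X j x * X i x) \<le> 1 + \<epsilon>" using n1[OF n0(3), of i] ij by auto
          then show ?thesis using 3 by (simp add: divide_right_mono mult.commute)
        qed
      qed
      also have "\<dots> = (1 + \<epsilon>) * H\<^sup>2 + A * H"
      proof -
        have "H\<^sup>2 = (\<Sum>i\<in>{n0..N}. \<Sum>j\<in>{n0..N}. 1 / real i * (1 / real j))"
          by (simp only: H_def power2_eq_square sum_product)
        then have "(1 + \<epsilon>) * H\<^sup>2 = (\<Sum>i\<in>{n0..N}. \<Sum>j\<in>{n0..N}. (1 + \<epsilon>) * (1 / real i * (1 / real j)))"
          by (simp only: sum_distrib_left)
        moreover have "A * H = (\<Sum>i\<in>{n0..N}. \<Sum>j\<in>{n0..N}. if j = i then A / real i else 0)"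
          by (simp add: H_def sum_distrib_left)
        ultimately show ?thesis by (simp only: sum.distrib)
      qed
      finally show ?thesis .
    qed
    define E where "E = expectation S"
    have E: "(1 - \<epsilon>) * H \<le> E" "0 < E"
    proof -
      show "(1 - \<epsilon>) * H \<le> E" using ES by (simp add: E_def)
      have "0 < (1 - \<epsilon>) * H" using \<epsilon> H by auto
      then show "0 < E" using \<open>(1 - \<epsilon>) * H \<le> E\<close> by linarith
    qed
    \<comment> \<open>Chebyshev's inequality: on \<open>Z n\<close> the sum \<open>S\<close> vanishes, hence differs from its mean by \<open>E\<close>.\<close>
    have "E\<^sup>2 * prob (Z n) = (\<integral>x. E\<^sup>2 * indicator (Z n) x \<partial>M)" by simp
    also have "\<dots> \<le> (\<integral>x. (S x)\<^sup>2 - 2 * E * S x + E\<^sup>2 \<partial>M)"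
    proof (rule integral_mono)
      show "integrable M (\<lambda>x. (S x)\<^sup>2 - 2 * E * S x + E\<^sup>2)" using Si S2i by auto
      show "E\<^sup>2 * indicator (Z n) x \<le> (S x)\<^sup>2 - 2 * E * S x + E\<^sup>2" for x
      proof (cases "x \<in> Z n")
        case True
        then have "X j x = 0" if "j \<in> {n0..N}" for j
          using that n0 by (intro antisym nonneg) (auto simp: Z_def)
        then have "S x = 0" by (simp add: S_def)
        then show ?thesis using True by simp
      next
        case False
        have "(S x)\<^sup>2 - 2 * E * S x + E\<^sup>2 = (S x - E)\<^sup>2" by (simp add: power2_eq_square algebra_simps)
        then show ?thesis using False by simp
      qed
    qed (auto simp: emeasure_eq_measure)
    also have "\<dots> = expectation (\<lambda>x. (S x)\<^sup>2) - E\<^sup>2"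
      using Si S2i by (simp add: prob_space E_def[symmetric] power2_eq_square)
    also have "\<dots> \<le> (1 + \<epsilon>) * H\<^sup>2 + \<epsilon> * H\<^sup>2 - E\<^sup>2"
    proof -
      have "A * H \<le> \<epsilon> * H * H" using H \<epsilon> by (intro mult_right_mono) (auto simp: field_simps)
      then show ?thesis using ES2 by (simp add: power2_eq_square)
    qed
    finally have 1: "E\<^sup>2 * prob (Z n) \<le> (1 + 2 * \<epsilon>) * H\<^sup>2 - E\<^sup>2" by (simp add: algebra_simps)
    have EH: "((1 - \<epsilon>) * H)\<^sup>2 \<le> E\<^sup>2" using E H \<epsilon> by (intro power_mono) auto
    have "((1 - \<epsilon>) * H)\<^sup>2 * prob (Z n) \<le> E\<^sup>2 * prob (Z n)" by (intro mult_right_mono EH) auto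
    also have "\<dots> \<le> (1 + 2 * \<epsilon>) * H\<^sup>2 - ((1 - \<epsilon>) * H)\<^sup>2" using 1 EH by linarith
    also have "\<dots> = (4 * \<epsilon> - \<epsilon>\<^sup>2) * H\<^sup>2" by (simp add: power2_eq_square algebra_simps)
    also have "\<dots> \<le> 4 * \<epsilon> * H\<^sup>2" by (intro mult_right_mono) auto
    finally have "H\<^sup>2 * ((1 - \<epsilon>)\<^sup>2 * prob (Z n)) \<le> H\<^sup>2 * (4 * \<epsilon>)" by (simp add: power_mult_distrib mult_ac)
    then have 2: "(1 - \<epsilon>)\<^sup>2 * prob (Z n) \<le> 4 * \<epsilon>" using H by simp
    have "(1 / 2)\<^sup>2 \<le> (1 - \<epsilon>)\<^sup>2" using \<epsilon> by (intro power_mono) auto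
    then have "(1 / 2)\<^sup>2 * prob (Z n) \<le> (1 - \<epsilon>)\<^sup>2 * prob (Z n)" by (intro mult_right_mono) auto
    then show ?thesis using 2 by (simp add: power2_eq_square)
  qed
  have Z0: "prob (Z n) = 0" for n
  proof (rule ccontr)
    assume "prob (Z n) \<noteq> 0"
    then have pos: "0 < prob (Z n)" by (simp add: zero_less_measure_iff)
    have "prob (Z n) \<le> 16 * (prob (Z n) / 32)"
      by (intro small) (use pos prob_le_1[of "Z n"] in linarith)+
    then show False using pos by simp
  qed
  have "AE x in M. \<forall>n. x \<notin> Z n"
    unfolding AE_all_countable using Z0 by (auto intro!: AE_not_in simp: emeasure_eq_measure null_setsI)
  then show ?thesis
  proof (rule AE_mp, intro AE_I2 impI)
    fix x assume "x \<in> space M" "\<forall>n. x \<notin> Z n"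
    then show "\<exists>\<^sub>F j in sequentially. 0 < X j x"
      unfolding frequently_sequentially Z_def by (auto simp: not_le)
  qed
qed

section \<open>Hitting a ball within a block of consecutive times\<close>

text \<open>
  The second Bonferroni inequality, for numbers instead of indicators.
\<close>
lemma bonferroni:
  fixes a :: "nat \<Rightarrow> real"
  assumes "\<And>i. 0 \<le> a i" "\<And>i. a i \<le> 1"
  shows "(\<Sum>i<m. a i) - (\<Sum>i<m. \<Sum>j<i. a j * a i) \<le> 1 - (\<Prod>i<m. 1 - a i)"
proof (induction m)
  case (Suc m)
  have "1 - (\<Sum>i<m. a i) \<le> (\<Prod>i<m. 1 - a i)"
  proof (induction m)
    case (Suc m)
    have "0 \<le> a m * (1 - (\<Prod>i<m. 1 - a i))"
      using assms by (intro mult_nonneg_nonneg) (auto intro!: prod_le_1)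
    then show ?case using Suc by (simp add: algebra_simps)
  qed simp
  then have "a m * (1 - (\<Sum>i<m. a i)) \<le> a m * (\<Prod>i<m. 1 - a i)" using assms by (intro mult_left_mono) auto
  then show ?case using Suc by (simp add: algebra_simps sum_distrib_left sum_distrib_right)
qed simp

context mixing_system
begin

text \<open>
  A smooth version of the indicator that one of the points \<open>y, f y, \<dots>, f\<^bsup>m-1\<^esup> y\<close> is near \<open>x\<close>.
\<close>
definition hit :: "real \<Rightarrow> nat \<Rightarrow> 'a \<Rightarrow> 'a \<Rightarrow> real" where
  "hit \<rho> m x y = 1 - (\<Prod>i<m. 1 - near \<rho> x ((f ^^ i) y))"

lemma hit_nonneg [simp]: "0 \<le> hit \<rho> m x y" and hit_le_1 [simp]: "hit \<rho> m x y \<le> 1"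
  by (auto simp: hit_def intro!: prod_le_1 prod_nonneg)

lemma hit_pos:
  assumes "0 < \<rho>" "0 < hit \<rho> m x y" shows "\<exists>i<m. D x ((f ^^ i) y) \<le> 2 * \<rho>"
proof (rule ccontr)
  assume "\<not> ?thesis"
  then have "near \<rho> x ((f ^^ i) y) = 0" if "i < m" for i using that assms near_eq_0 by auto
  then have "hit \<rho> m x y = 0" by (simp add: hit_def)
  then show False using assms by simp
qed

lemma hit_ge_near: assumes "1 \<le> m" shows "near \<rho> x y \<le> hit \<rho> m x y"
proof -
  let ?P = "\<Prod>i\<in>{1..<m}. 1 - near \<rho> x ((f ^^ i) y)"
  have "{..<m} = insert 0 {1..<m}" using assms by auto
  then have "(\<Prod>i<m. 1 - near \<rho> x ((f ^^ i) y)) = (1 - near \<rho> x y) * ?P" by simp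
  also have "\<dots> \<le> (1 - near \<rho> x y) * 1" by (intro mult_left_mono prod_le_1) auto
  finally show ?thesis by (simp add: hit_def)
qed

lemma hit_lip2:
  assumes \<rho>: "0 < \<rho>" "\<rho> \<le> 1" and m: "1 \<le> m"
  shows "lip2 (real m * L ^ m / \<rho>) (hit \<rho> m)"
  unfolding lip2_def
proof safe
  fix x y x' y'
  have \<rho>1: "1 \<le> 1 / \<rho>" using \<rho> by simp
  have Lm: "1 \<le> L ^ m" using L_ge_1 by simp
  have "1 * 1 * 1 \<le> real m * L ^ m * (1 / \<rho>)" using \<rho>1 Lm m by (intro mult_mono) auto
  then have one: "1 \<le> real m * L ^ m / \<rho>" by simp
  show "\<bar>hit \<rho> m x y\<bar> \<le> real m * L ^ m / \<rho>"
    using one hit_le_1[of \<rho> m x y] hit_nonneg[of \<rho> m x y] by linarith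
  have "\<bar>hit \<rho> m x y - hit \<rho> m x' y'\<bar>
      = norm ((\<Prod>i<m. 1 - near \<rho> x ((f ^^ i) y)) - (\<Prod>i<m. 1 - near \<rho> x' ((f ^^ i) y')))"
    by (simp add: hit_def abs_minus_commute)
  also have "\<dots> \<le> (\<Sum>i<m. norm ((1 - near \<rho> x ((f ^^ i) y)) - (1 - near \<rho> x' ((f ^^ i) y'))))"
    by (intro norm_prod_diff) auto
  also have "\<dots> \<le> (\<Sum>i<m. (1 / \<rho> * L ^ m) * (D x x' + D y y'))"
  proof (rule sum_mono)
    fix i assume i: "i \<in> {..<m}"
    have "lip2 (1 / \<rho>) (near \<rho>)" using \<rho> by (intro near_lip2) auto
    then have "lip2 (1 / \<rho> * L ^ i) (\<lambda>x y. near \<rho> x ((f ^^ i) y))" using \<rho> by (intro lip2_iterate) auto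
    then have "lip2 (1 / \<rho> * L ^ m) (\<lambda>x y. near \<rho> x ((f ^^ i) y))"
      by (rule lip2_mono) (use \<rho> i L_ge_1 in \<open>auto intro!: mult_left_mono divide_right_mono power_increasing\<close>)
    then have "\<bar>near \<rho> x ((f ^^ i) y) - near \<rho> x' ((f ^^ i) y')\<bar> \<le> (1 / \<rho> * L ^ m) * (D x x' + D y y')"
      unfolding lip2_def by blast
    then show "norm ((1 - near \<rho> x ((f ^^ i) y)) - (1 - near \<rho> x' ((f ^^ i) y')))
        \<le> (1 / \<rho> * L ^ m) * (D x x' + D y y')"
      unfolding real_norm_def by linarith
  qed
  also have "\<dots> = real m * L ^ m / \<rho> * (D x x' + D y y')" by simp
  finally show "\<bar>hit \<rho> m x y - hit \<rho> m x' y'\<bar> \<le> real m * L ^ m / \<rho> * (D x x' + D y y')" .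
qed

definition hit_prob :: "real \<Rightarrow> nat \<Rightarrow> 'a \<Rightarrow> real" where
  "hit_prob \<rho> m x = (\<integral>y. hit \<rho> m x y \<partial>\<mu>)"

lemma lip2_section_integrable:
  assumes "lip2 \<Lambda> G" shows "integrable \<mu> (G x)"
  using integrable_bounded[OF lip2_measurable[OF assms, of "\<lambda>_. x" \<mu> "\<lambda>z. z"], of \<Lambda>] assms
  by (auto simp: measurable_ident_sets[OF sets_eq] lip2_def)

lemma hit_prob_lower:
  assumes \<rho>: "0 < \<rho>" "\<rho> \<le> 1" and m: "1 \<le> m"
  shows "c * \<rho> ^ d \<le> hit_prob \<rho> m x"
proof -
  have "c * \<rho> ^ d \<le> (\<integral>y. near \<rho> x y \<partial>\<mu>)" using \<rho> by (rule near_integral_lower)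
  also have "\<dots> \<le> hit_prob \<rho> m x" unfolding hit_prob_def
    using \<rho> m hit_ge_near
    by (intro integral_mono lip2_section_integrable[OF hit_lip2] lip2_section_integrable[OF near_lip2[of \<rho>]]) auto
  finally show ?thesis .
qed

text \<open>
  When pairs of visits within the block are rare, the events of visiting at the \<open>m\<close> single times are nearly disjoint and their
  probabilities add up. The gain of the factor \<open>m\<close> over \<open>hit_prob_lower\<close> is what makes a block worth its length.
\<close>
lemma hit_prob_lower_good:
  assumes \<rho>: "0 < \<rho>" "\<rho> \<le> 1" and m: "1 \<le> m"
    and good: "(\<Sum>l\<in>{1..m}. pair_rate \<rho> l x) \<le> c * \<rho> ^ d / 2"
  shows "real m * (c * \<rho> ^ d / 2) \<le> hit_prob \<rho> m x"
proof -
  let ?a = "\<lambda>i y. near \<rho> x ((f ^^ i) y)"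
  have am [measurable]: "?a i \<in> borel_measurable \<mu>" for i using \<rho> by (intro near_measurable) auto
  have ai: "integrable \<mu> (?a i)" for i by (intro integrable_bounded[of _ 1]) auto
  have aai: "integrable \<mu> (\<lambda>y. ?a j y * ?a i y)" for i j
    by (intro integrable_bounded[of _ 1]) (auto simp: abs_mult intro!: mult_le_one)
  have single: "c * \<rho> ^ d \<le> (\<integral>y. ?a i y \<partial>\<mu>)" for i
  proof -
    have "(\<integral>y. ?a i y \<partial>\<mu>) = (\<integral>y. near \<rho> x y \<partial>\<mu>)"
      using \<rho> by (intro integral_iterate near_measurable) auto
    then show ?thesis using near_integral_lower[OF \<rho>] by simp
  qed
  have pair: "(\<integral>y. ?a j y * ?a i y \<partial>\<mu>) \<le> pair_rate \<rho> (i - j) x" if ji: "j < i" for i j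
  proof -
    have cm: "close_pair \<rho> (i - j) x \<in> borel_measurable \<mu>"
      using lip2_section_integrable[OF close_pair_lip2[OF \<rho>]] by (rule borel_measurable_integrable)
    have "(\<integral>y. ?a j y * ?a i y \<partial>\<mu>) \<le> (\<integral>y. close_pair \<rho> (i - j) x ((f ^^ j) y) \<partial>\<mu>)"
    proof (rule integral_mono[OF aai])
      show "integrable \<mu> (\<lambda>y. close_pair \<rho> (i - j) x ((f ^^ j) y))"
        using measurable_compose[OF iterate_measurable_\<mu> cm]
        by (intro integrable_bounded[of _ 1]) auto
      fix y
      have fi: "(f ^^ i) y = (f ^^ (i - j)) ((f ^^ j) y)"
        using ji by (metis comp_apply funpow_add le_add_diff_inverse2 less_imp_le)
      show "?a j y * ?a i y \<le> close_pair \<rho> (i - j) x ((f ^^ j) y)"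
      proof (cases "D x ((f ^^ j) y) \<le> 2 * \<rho> \<and> D x ((f ^^ i) y) \<le> 2 * \<rho>")
        case True
        then have "close_pair \<rho> (i - j) x ((f ^^ j) y) = 1"
          using fi \<rho> by (intro close_pair_eq_1) auto
        then show ?thesis by (simp add: mult_le_one)
      next
        case False
        then have "?a j y * ?a i y = 0" using near_eq_0 \<rho> by auto
        then show ?thesis by (simp only: close_pair_nonneg)
      qed
    qed
    also have "\<dots> = pair_rate \<rho> (i - j) x" unfolding pair_rate_def using cm by (rule integral_iterate)
    finally show ?thesis .
  qed
  have "real m * (c * \<rho> ^ d / 2) \<le> real m * (c * \<rho> ^ d - (\<Sum>l\<in>{1..m}. pair_rate \<rho> l x))"
    using good by (intro mult_left_mono) auto
  also have "\<dots> = (\<Sum>i<m. c * \<rho> ^ d) - (\<Sum>i<m. \<Sum>l\<in>{1..m}. pair_rate \<rho> l x)" by (simp add: algebra_simps)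
  also have "\<dots> \<le> (\<Sum>i<m. \<integral>y. ?a i y \<partial>\<mu>) - (\<Sum>i<m. \<Sum>j<i. \<integral>y. ?a j y * ?a i y \<partial>\<mu>)"
  proof (intro diff_mono sum_mono single)
    fix i assume i: "i \<in> {..<m}"
    have "(\<Sum>j<i. \<integral>y. ?a j y * ?a i y \<partial>\<mu>) \<le> (\<Sum>j<i. pair_rate \<rho> (i - j) x)" using pair by (intro sum_mono) auto
    also have "\<dots> = (\<Sum>l\<in>{1..i}. pair_rate \<rho> l x)"
      by (rule sum.reindex_bij_witness[of _ "\<lambda>l. i - l" "\<lambda>j. i - j"]) auto
    also have "\<dots> \<le> (\<Sum>l\<in>{1..m}. pair_rate \<rho> l x)" using i by (intro sum_mono2) auto
    finally show "(\<Sum>j<i. \<integral>y. ?a j y * ?a i y \<partial>\<mu>) \<le> (\<Sum>l\<in>{1..m}. pair_rate \<rho> l x)" .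
  qed
  also have "\<dots> = (\<integral>y. (\<Sum>i<m. ?a i y) - (\<Sum>i<m. \<Sum>j<i. ?a j y * ?a i y) \<partial>\<mu>)"
    using ai aai by simp
  also have "\<dots> \<le> hit_prob \<rho> m x" unfolding hit_prob_def
  proof (rule integral_mono)
    show "integrable \<mu> (\<lambda>y. (\<Sum>i<m. ?a i y) - (\<Sum>i<m. \<Sum>j<i. ?a j y * ?a i y))" using ai aai by auto
    show "integrable \<mu> (hit \<rho> m x)" using lip2_section_integrable[OF hit_lip2[OF \<rho> m]] .
    show "(\<Sum>i<m. ?a i y) - (\<Sum>i<m. \<Sum>j<i. ?a j y * ?a i y) \<le> hit \<rho> m x y" for y
      unfolding hit_def by (rule bonferroni) auto
  qed
  finally show ?thesis .
qed

text \<open>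
  Division by the probability of a hit makes the mean equal to \<open>1\<close> for every centre \<open>x\<close>. Products of such functions
  then have mean about \<open>1\<close> even when the centre is correlated with other factors.
\<close>
definition normalised_hit :: "real \<Rightarrow> nat \<Rightarrow> 'a \<Rightarrow> 'a \<Rightarrow> real" where
  "normalised_hit \<rho> m x y = hit \<rho> m x y / hit_prob \<rho> m x"

lemma c_le_1: "c \<le> 1"
  using order_trans[OF ball_lower[of 1 undefined] prob_le_1] by simp

lemma normalised_hit_lip2:
  assumes \<rho>: "0 < \<rho>" "\<rho> \<le> 1" and m: "1 \<le> m"
  shows "lip2 (2 * (real m * L ^ m / \<rho>) / (c * \<rho> ^ d)\<^sup>2) (normalised_hit \<rho> m)"
proof -
  define v where "v = c * \<rho> ^ d"
  define \<Lambda> where "\<Lambda> = real m * L ^ m / \<rho>"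
  have v: "0 < v" "v \<le> 1"
    using \<rho> c_pos c_le_1 by (auto simp: v_def power_le_one intro!: mult_le_one)
  have Vv: "v \<le> hit_prob \<rho> m x" for x unfolding v_def using hit_prob_lower[OF \<rho> m] .
  have Vp: "0 < hit_prob \<rho> m x" for x using Vv[of x] v by linarith
  have hl: "lip2 \<Lambda> (hit \<rho> m)" unfolding \<Lambda>_def using hit_lip2[OF \<rho> m] .
  have \<Lambda>: "0 \<le> \<Lambda>" using \<rho> L_ge_1 by (simp add: \<Lambda>_def)
  have Vl: "\<bar>hit_prob \<rho> m x - hit_prob \<rho> m x'\<bar> \<le> \<Lambda> * D x x'" for x x'
    using lip2_integral[OF hl \<Lambda>] by (auto simp: hit_prob_def lip1_def dlip_def)
  have inv1: "1 / v \<le> 1 / v\<^sup>2"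
    using v by (simp add: power2_eq_square field_simps)
  show ?thesis
    unfolding lip2_def v_def[symmetric] \<Lambda>_def[symmetric]
  proof safe
    fix x y x' y'
    have one: "1 \<le> \<Lambda>"
    proof -
      have "1 * 1 * 1 \<le> real m * L ^ m * (1 / \<rho>)" using \<rho> m L_ge_1 by (intro mult_mono) auto
      then show ?thesis by (simp add: \<Lambda>_def)
    qed
    have "\<bar>normalised_hit \<rho> m x y\<bar> = hit \<rho> m x y / hit_prob \<rho> m x" using Vp[of x] by (simp add: normalised_hit_def)
    also have "\<dots> \<le> 1 / v" using v Vv by (intro frac_le) auto
    also have "\<dots> \<le> 2 * \<Lambda> / v\<^sup>2" using inv1 one v divide_right_mono[of 1 "2 * \<Lambda>" "v\<^sup>2"] by simp
    finally show "\<bar>normalised_hit \<rho> m x y\<bar> \<le> 2 * \<Lambda> / v\<^sup>2" .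
    let ?\<delta> = "D x x' + D y y'"
    have "normalised_hit \<rho> m x y - normalised_hit \<rho> m x' y' = (hit \<rho> m x y - hit \<rho> m x' y') / hit_prob \<rho> m x
        + hit \<rho> m x' y' * (hit_prob \<rho> m x' - hit_prob \<rho> m x) / (hit_prob \<rho> m x * hit_prob \<rho> m x')"
      using Vp[of x] Vp[of x'] by (simp add: normalised_hit_def field_simps)
    then have "\<bar>normalised_hit \<rho> m x y - normalised_hit \<rho> m x' y'\<bar> \<le> \<bar>(hit \<rho> m x y - hit \<rho> m x' y') / hit_prob \<rho> m x\<bar>
        + \<bar>hit \<rho> m x' y' * (hit_prob \<rho> m x' - hit_prob \<rho> m x) / (hit_prob \<rho> m x * hit_prob \<rho> m x')\<bar>"
      by (metis abs_triangle_ineq)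
    also have "\<bar>(hit \<rho> m x y - hit \<rho> m x' y') / hit_prob \<rho> m x\<bar> = \<bar>hit \<rho> m x y - hit \<rho> m x' y'\<bar> / hit_prob \<rho> m x"
      using Vp[of x] by (simp add: abs_divide)
    also have "\<dots> \<le> \<Lambda> * ?\<delta> / v"
      using hl Vv v by (intro frac_le) (auto simp: lip2_def intro!: mult_nonneg_nonneg \<Lambda>)
    also have "\<bar>hit \<rho> m x' y' * (hit_prob \<rho> m x' - hit_prob \<rho> m x) / (hit_prob \<rho> m x * hit_prob \<rho> m x')\<bar>
        = hit \<rho> m x' y' * \<bar>hit_prob \<rho> m x' - hit_prob \<rho> m x\<bar> / (hit_prob \<rho> m x * hit_prob \<rho> m x')"
      using Vp[of x] Vp[of x'] by (simp add: abs_divide abs_mult)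
    also have "\<dots> \<le> 1 * (\<Lambda> * D x x') / (v * v)"
      using Vl[of x x'] Vv v Vp less_imp_le by (intro frac_le mult_mono) (auto simp: abs_minus_commute intro!: mult_nonneg_nonneg \<Lambda>)
    also have "1 * (\<Lambda> * D x x') / (v * v) \<le> \<Lambda> * ?\<delta> / v\<^sup>2"
      using \<Lambda> by (auto simp: power2_eq_square intro!: divide_right_mono mult_left_mono)
    also have "\<Lambda> * ?\<delta> / v \<le> \<Lambda> * ?\<delta> / v\<^sup>2"
      using mult_left_mono[OF inv1, of "\<Lambda> * ?\<delta>"] \<Lambda> by simp
    finally show "\<bar>normalised_hit \<rho> m x y - normalised_hit \<rho> m x' y'\<bar> \<le> 2 * \<Lambda> / v\<^sup>2 * ?\<delta>" by (simp add: add_divide_distrib algebra_simps)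
  qed
qed

lemma hit_prob_pos:
  assumes "0 < \<rho>" "\<rho> \<le> 1" "1 \<le> m" shows "0 < hit_prob \<rho> m x"
proof -
  have "0 < c * \<rho> ^ d" using assms c_pos by simp
  then show ?thesis using hit_prob_lower[OF assms, of x] by linarith
qed

lemma normalised_hit_nonneg: "0 < \<rho> \<Longrightarrow> \<rho> \<le> 1 \<Longrightarrow> 1 \<le> m \<Longrightarrow> 0 \<le> normalised_hit \<rho> m x y"
  using hit_prob_pos[of \<rho> m x] by (simp add: normalised_hit_def)

lemma normalised_hit_integral:
  assumes "0 < \<rho>" "\<rho> \<le> 1" "1 \<le> m" shows "(\<integral>y. normalised_hit \<rho> m x y \<partial>\<mu>) = 1"
  using hit_prob_pos[OF assms, of x] by (simp add: normalised_hit_def hit_prob_def)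

text \<open>
  As \<open>hit\<close> takes values in \<open>[0, 1]\<close>, its square is at most itself.
\<close>
lemma normalised_hit_square_integral:
  assumes "0 < \<rho>" "\<rho> \<le> 1" "1 \<le> m"
  shows "(\<integral>y. normalised_hit \<rho> m x y * normalised_hit \<rho> m x y \<partial>\<mu>) \<le> 1 / hit_prob \<rho> m x"
proof -
  have Vp: "0 < hit_prob \<rho> m x" using hit_prob_pos[OF assms] .
  have ig: "integrable \<mu> (normalised_hit \<rho> m x)" using lip2_section_integrable[OF normalised_hit_lip2[OF assms]] .
  have le: "normalised_hit \<rho> m x y \<le> 1 / hit_prob \<rho> m x" for y unfolding normalised_hit_def using Vp by (intro divide_right_mono) auto
  have "(\<integral>y. normalised_hit \<rho> m x y * normalised_hit \<rho> m x y \<partial>\<mu>) \<le> (\<integral>y. 1 / hit_prob \<rho> m x * normalised_hit \<rho> m x y \<partial>\<mu>)"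
  proof (rule integral_mono)
    show "integrable \<mu> (\<lambda>y. normalised_hit \<rho> m x y * normalised_hit \<rho> m x y)"
    proof (rule integrable_bounded)
      show "\<bar>normalised_hit \<rho> m x y * normalised_hit \<rho> m x y\<bar> \<le> 1 / hit_prob \<rho> m x * (1 / hit_prob \<rho> m x)" for y
        using mult_mono[OF le le _ normalised_hit_nonneg[OF assms], of y y] normalised_hit_nonneg[OF assms, of x y] Vp
        by (simp add: abs_mult)
      show "(\<lambda>y. normalised_hit \<rho> m x y * normalised_hit \<rho> m x y) \<in> borel_measurable \<mu>" using ig by measurable
    qed
    show "integrable \<mu> (\<lambda>y. 1 / hit_prob \<rho> m x * normalised_hit \<rho> m x y)" using ig by auto
    show "normalised_hit \<rho> m x y * normalised_hit \<rho> m x y \<le> 1 / hit_prob \<rho> m x * normalised_hit \<rho> m x y" for y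
      using le normalised_hit_nonneg[OF assms] by (intro mult_right_mono) auto
  qed
  also have "\<dots> = 1 / hit_prob \<rho> m x" using normalised_hit_integral[OF assms, of x] by simp
  finally show ?thesis .
qed

end

section \<open>Averages over tuples of times\<close>

context mixing_system
begin

definition tuple_average :: "(nat \<Rightarrow> nat set) \<Rightarrow> nat \<Rightarrow> ('a \<Rightarrow> 'a \<Rightarrow> real) \<Rightarrow> ('a \<Rightarrow> 'a) \<Rightarrow> 'a \<Rightarrow> real" where
  "tuple_average J N H b y = (\<Prod>i<r. (1 / real N) * (\<Sum>k\<in>J i. H (b y) ((f ^^ k) y)))"

text \<open>
  \<open>r\<close> sets of \<open>N\<close> times each; inside a set the times are \<open>s\<close> apart, while different sets are \<open>w\<close> apart and all times are at least \<open>w\<close>.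
  Choosing one time from each set thus gives gaps of the larger size \<open>w\<close>; choosing two gives gaps of size \<open>s\<close>.
\<close>
definition spread_family :: "(nat \<Rightarrow> nat set) \<Rightarrow> nat \<Rightarrow> nat \<Rightarrow> nat \<Rightarrow> bool" where
  "spread_family J N s w \<longleftrightarrow> 1 \<le> N \<and> 1 \<le> s \<and> s \<le> w \<and>
     (\<forall>i<r. finite (J i) \<and> card (J i) = N \<and> (\<forall>k\<in>J i. w \<le> k)) \<and>
     (\<forall>i<r. \<forall>k\<in>J i. \<forall>k'\<in>J i. k < k' \<longrightarrow> k + s \<le> k') \<and>
     (\<forall>i<r. \<forall>i'<r. i < i' \<longrightarrow> (\<forall>k\<in>J i. \<forall>k'\<in>J i'. k + w \<le> k'))"

lemma observable_measurable:
  assumes "lip2 \<Lambda> H" "0 \<le> \<Lambda>" "nonexpansive b"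
  shows "(\<lambda>y. H (b y) ((f ^^ k) y)) \<in> borel_measurable \<mu>"
  using lip2_measurable[OF lip2_nonexpansive[OF assms(1,3,2)], of "\<lambda>z. z" \<mu> "f ^^ k"]
    iterate_measurable measurable_cong_sets[OF sets_eq refl]
  by (auto simp: measurable_ident_sets[OF sets_eq])

text \<open>
  Expanding the product, every term involves one time from each set, hence \<open>r\<close> times with gaps \<open>w\<close>. The factor \<open>F\<close>, which
  will be a tuple average at a smaller scale, is an observable at time \<open>0\<close>; its large Lipschitz constant is the reason for
  the larger gap.
\<close>
lemma tuple_average_mean:
  fixes \<Lambda> :: real
  assumes J: "spread_family J N s w" and F: "lip1 \<Lambda> F" and H: "lip2 \<Lambda> H" and \<Lambda>: "1 \<le> \<Lambda>"
    and b: "nonexpansive b" and one: "\<And>x. (\<integral>y. H x y \<partial>\<mu>) = 1"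
  shows "\<bar>(\<integral>y. F y * tuple_average J N H b y \<partial>\<mu>) - (\<integral>y. F y \<partial>\<mu>)\<bar>
    \<le> mixing_const * \<theta> ^ w * \<Lambda> ^ (2 * r + 2)"
proof -
  define \<G> where "\<G> = PiE {..<r} J"
  define err where "err = mixing_const * \<theta> ^ w * \<Lambda> ^ (2 * r + 2)"
  define W where "W g y = F y * (\<Prod>i<r. H (b y) ((f ^^ g i) y))" for g :: "nat \<Rightarrow> nat" and y
  have N: "1 \<le> N" and s: "1 \<le> s" "s \<le> w" using J by (auto simp: spread_family_def)
  have Jf: "finite (J i)" "card (J i) = N" if "i < r" for i using J that by (auto simp: spread_family_def)
  have Hm: "(\<lambda>y. H (b y) ((f ^^ k) y)) \<in> borel_measurable \<mu>" for k
    using observable_measurable[OF H _ b] \<Lambda> by simp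
  have Fm: "F \<in> borel_measurable \<mu>" using F dlip_measurable by (auto simp: lip1_def)
  have Wi: "integrable \<mu> (W g)" for g
  proof (rule integrable_bounded)
    show "W g \<in> borel_measurable \<mu>" unfolding W_def using Hm Fm by measurable
    show "\<bar>W g y\<bar> \<le> \<Lambda> * \<Lambda> ^ r" for y
    proof -
      have "(\<Prod>i<r. \<bar>H (b y) ((f ^^ g i) y)\<bar>) \<le> (\<Prod>i<r. \<Lambda>)"
        using H by (intro prod_mono) (auto simp: lip2_def)
      then show ?thesis unfolding W_def abs_mult abs_prod
        using F \<Lambda> by (intro mult_mono) (auto simp: lip1_def intro!: prod_nonneg)
    qed
  qed
  have card\<G>: "card \<G> = N ^ r" "finite \<G>"
    using Jf by (auto simp: \<G>_def card_PiE intro!: finite_PiE)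
  have avg: "F y * tuple_average J N H b y = (1 / real N) ^ r * (\<Sum>g\<in>\<G>. W g y)" for y
  proof -
    have "(\<Prod>i<r. \<Sum>k\<in>J i. H (b y) ((f ^^ k) y)) = (\<Sum>g\<in>\<G>. \<Prod>i<r. H (b y) ((f ^^ g i) y))"
      unfolding \<G>_def using Jf by (subst prod_sum_PiE) auto
    then have "tuple_average J N H b y = (1 / real N) ^ r * (\<Sum>g\<in>\<G>. \<Prod>i<r. H (b y) ((f ^^ g i) y))"
      unfolding tuple_average_def prod.distrib by simp
    then show ?thesis by (simp add: W_def sum_distrib_left mult_ac)
  qed
  have each: "\<bar>(\<integral>y. W g y \<partial>\<mu>) - (\<integral>y. F y \<partial>\<mu>)\<bar> \<le> err" if g: "g \<in> \<G>" for g
  proof -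
    define T where "T = g ` {..<r}"
    have gJ: "g i \<in> J i" if "i < r" for i using g that by (auto simp: \<G>_def)
    have gap: "g i + w \<le> g i'" if "i < i'" "i' < r" for i i'
      using J gJ[of i] gJ[of i'] that less_trans[of i i' r] unfolding spread_family_def by blast
    have less: "g i < g i'" if "i < i'" "i' < r" for i i' using gap[OF that] s by linarith
    have inj: "inj_on g {..<r}"
    proof (rule inj_onI)
      fix i i' assume "i \<in> {..<r}" "i' \<in> {..<r}" "g i = g i'"
      then show "i = i'" using less[of i i'] less[of i' i] by (cases i i' rule: linorder_cases) auto
    qed
    have sep: "separated w T"
      unfolding separated_def T_def
    proof (intro conjI ballI impI)
      fix k assume "k \<in> g ` {..<r}"
      then show "w \<le> k" using J gJ by (auto simp: spread_family_def)
    next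
      fix k k' assume "k \<in> g ` {..<r}" "k' \<in> g ` {..<r}" "k < k'"
      then obtain i i' where i: "i < r" "i' < r" "k = g i" "k' = g i'" by auto
      then have "i < i'" using less[of i' i] \<open>k < k'\<close> by (cases i i' rule: linorder_cases) auto
      then show "k + w \<le> k'" using gap i by auto
    qed
    have card: "card T \<le> 2 * r" using card_image_le[of "{..<r}" g] by (simp add: T_def)
    have "\<bar>(\<integral>y. F y * (\<Prod>k\<in>T. H (b y) ((f ^^ k) y)) \<partial>\<mu>) -
          (\<integral>y. F y * (\<Prod>k\<in>T. \<integral>z. H (b y) z \<partial>\<mu>) \<partial>\<mu>)\<bar> \<le> err"
      unfolding err_def using card sep H by (intro mixing_times F \<Lambda> b) (auto simp: T_def)
    then show ?thesis using inj by (simp add: one T_def prod.reindex W_def[abs_def])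
  qed
  have "(\<integral>y. F y * tuple_average J N H b y \<partial>\<mu>) - (\<integral>y. F y \<partial>\<mu>)
      = (1 / real N) ^ r * (\<Sum>g\<in>\<G>. (\<integral>y. W g y \<partial>\<mu>) - (\<integral>y. F y \<partial>\<mu>))"
    unfolding avg using Wi N card\<G> by (simp add: sum_subtractf right_diff_distrib power_divide)
  also have "\<bar>\<dots>\<bar> \<le> (1 / real N) ^ r * (\<Sum>g\<in>\<G>. err)"
    unfolding abs_mult
  proof (rule mult_mono)
    show "\<bar>\<Sum>g\<in>\<G>. (\<integral>y. W g y \<partial>\<mu>) - (\<integral>y. F y \<partial>\<mu>)\<bar> \<le> (\<Sum>g\<in>\<G>. err)"
      using each by (intro order_trans[OF sum_abs] sum_mono) auto
  qed auto
  also have "\<dots> = err" using card\<G> N by (simp add: power_divide)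
  finally show ?thesis by (simp add: err_def)
qed

text \<open>
  In the square each set contributes a pair of times. If the two times differ they are independent and contribute \<open>1\<close>; if they
  coincide, the factor \<open>H\<^sup>2\<close> contributes at most \<open>U\<close>. Of the \<open>N\<^sup>2\<close> pairs only \<open>N\<close> coincide, so a set contributes
  \<open>1 + U / N\<close> altogether. There are at most \<open>2 r\<close> different times in each term.
\<close>
lemma tuple_average_second_moment:
  fixes \<Lambda> :: real
  assumes J: "spread_family J N s w" and H: "lip2 \<Lambda> H" and \<Lambda>: "1 \<le> \<Lambda>"
    and b: "nonexpansive b" and nonneg: "\<And>x y. 0 \<le> H x y" and one: "\<And>x. (\<integral>y. H x y \<partial>\<mu>) = 1"
    and sq: "\<And>x. (\<integral>y. H x y * H x y \<partial>\<mu>) \<le> U x" and Um: "(\<lambda>y. U (b y)) \<in> borel_measurable \<mu>"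
    and Ub: "\<And>x. U x \<le> u"
  shows "(\<integral>y. (tuple_average J N H b y)\<^sup>2 \<partial>\<mu>)
    \<le> (\<integral>y. (1 + U (b y) / real N) ^ r \<partial>\<mu>) + mixing_const * \<theta> ^ s * (2 * \<Lambda> * \<Lambda>) ^ (2 * r + 2)"
proof -
  define \<G> where "\<G> = PiE {..<r} (\<lambda>i. J i \<times> J i)"
  define err where "err = mixing_const * \<theta> ^ s * (2 * \<Lambda> * \<Lambda>) ^ (2 * r + 2)"
  define W where "W g y = (\<Prod>i<r. H (b y) ((f ^^ fst (g i)) y) * H (b y) ((f ^^ snd (g i)) y))"
    for g :: "nat \<Rightarrow> nat \<times> nat" and y
  define \<kappa> where "\<kappa> p x = (if fst p = snd p then U x else 1)" for p :: "nat \<times> nat" and x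
  have N: "1 \<le> N" and s: "1 \<le> s" "s \<le> w" using J by (auto simp: spread_family_def)
  have Jf: "finite (J i)" "card (J i) = N" if "i < r" for i using J that by (auto simp: spread_family_def)
  have Hb: "\<bar>H x y\<bar> \<le> \<Lambda>" for x y using H by (auto simp: lip2_def)
  have U0: "0 \<le> U x" for x
    using order_trans[OF integral_nonneg_AE sq, of x] nonneg by (auto intro!: mult_nonneg_nonneg)
  have \<kappa>0: "0 \<le> \<kappa> p x" for p x using U0 by (simp add: \<kappa>_def)
  have \<kappa>b: "\<kappa> p x \<le> max 1 u" for p x using Ub[of x] by (auto simp: \<kappa>_def)
  have \<kappa>m [measurable]: "(\<lambda>y. \<kappa> p (b y)) \<in> borel_measurable \<mu>" for p
    unfolding \<kappa>_def using Um by (cases "fst p = snd p") auto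
  have Hm [measurable]: "(\<lambda>y. H (b y) ((f ^^ k) y)) \<in> borel_measurable \<mu>" for k
    using observable_measurable[OF H _ b] \<Lambda> by simp
  have Wi: "integrable \<mu> (W g)" for g
  proof (rule integrable_bounded)
    show "W g \<in> borel_measurable \<mu>" unfolding W_def by measurable
    show "\<bar>W g y\<bar> \<le> (\<Lambda> * \<Lambda>) ^ r" for y
    proof -
      have "(\<Prod>i<r. \<bar>H (b y) ((f ^^ fst (g i)) y) * H (b y) ((f ^^ snd (g i)) y)\<bar>) \<le> (\<Prod>i<r. \<Lambda> * \<Lambda>)"
        using Hb \<Lambda> by (intro prod_mono) (auto simp: abs_mult intro!: mult_mono)
      then show ?thesis unfolding W_def abs_prod by simp
    qed
  qed
  have \<kappa>i: "integrable \<mu> (\<lambda>y. \<Prod>i<r. \<kappa> (g i) (b y))" for g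
  proof (rule integrable_bounded)
    show "\<bar>\<Prod>i<r. \<kappa> (g i) (b y)\<bar> \<le> (max 1 u) ^ r" for y
    proof -
      have "(\<Prod>i<r. \<bar>\<kappa> (g i) (b y)\<bar>) \<le> (\<Prod>i<r. max 1 u)"
        using \<kappa>0 \<kappa>b by (intro prod_mono) auto
      then show ?thesis unfolding abs_prod by simp
    qed
  qed measurable
  have card\<G>: "card \<G> = (N * N) ^ r" "finite \<G>"
    using Jf by (auto simp: \<G>_def card_PiE card_cartesian_product intro!: finite_PiE)
  have avg: "(tuple_average J N H b y)\<^sup>2 = (1 / real N) ^ (2 * r) * (\<Sum>g\<in>\<G>. W g y)" for y
  proof -
    have "(tuple_average J N H b y)\<^sup>2 = (\<Prod>i<r. (1 / real N)\<^sup>2 * (\<Sum>k\<in>J i. H (b y) ((f ^^ k) y))\<^sup>2)"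
      unfolding tuple_average_def prod_power_distrib power_mult_distrib ..
    also have "\<dots> = (\<Prod>i<r. (1 / real N)\<^sup>2) * (\<Prod>i<r. \<Sum>p\<in>J i \<times> J i. H (b y) ((f ^^ fst p) y) * H (b y) ((f ^^ snd p) y))"
    proof -
      have "(\<Sum>k\<in>J i. H (b y) ((f ^^ k) y))\<^sup>2
          = (\<Sum>p\<in>J i \<times> J i. H (b y) ((f ^^ fst p) y) * H (b y) ((f ^^ snd p) y))" for i
        by (simp add: power2_eq_square sum_product sum.cartesian_product case_prod_beta)
      then show ?thesis by (simp only: prod.distrib)
    qed
    also have "(\<Prod>i<r. (1 / real N)\<^sup>2) = (1 / real N) ^ (2 * r)" by (simp only: prod_constant card_lessThan power_mult)
    also have "(\<Prod>i<r. \<Sum>p\<in>J i \<times> J i. H (b y) ((f ^^ fst p) y) * H (b y) ((f ^^ snd p) y)) = (\<Sum>g\<in>\<G>. W g y)"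
      unfolding \<G>_def W_def using Jf by (subst prod_sum_PiE) auto
    finally show ?thesis .
  qed
  have each: "(\<integral>y. W g y \<partial>\<mu>) \<le> (\<integral>y. (\<Prod>i<r. \<kappa> (g i) (b y)) \<partial>\<mu>) + err" if g: "g \<in> \<G>" for g
  proof -
    define P where "P i = {fst (g i), snd (g i)}" for i
    define T where "T = (\<Union>i\<in>{..<r}. P i)"
    \<comment> \<open>The observable attached to a time is squared when both members of its pair coincide.\<close>
    define G where "G k = (if \<exists>i<r. g i = (k, k) then (\<lambda>x y. H x y * H x y) else H)" for k
    have gJ: "fst (g i) \<in> J i" "snd (g i) \<in> J i" if "i < r" for i using g that by (auto simp: \<G>_def PiE_def Pi_def mem_Times_iff)
    have PJ: "P i \<subseteq> J i" if "i < r" for i using gJ[OF that] by (auto simp: P_def)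
    have across: "k + w \<le> k'" if "i < i'" "i' < r" "k \<in> J i" "k' \<in> J i'" for i i' k k'
      using J that less_trans[of i i' r] unfolding spread_family_def by blast
    have disjJ: "i = i'" if "k \<in> J i" "k \<in> J i'" "i < r" "i' < r" for i i' k
      using across[of i i' k k] across[of i' i k k] that s by (cases i i' rule: linorder_cases) auto
    have prodT: "(\<Prod>k\<in>T. u k) = (\<Prod>i<r. \<Prod>k\<in>P i. u k)" for u :: "nat \<Rightarrow> real"
      unfolding T_def
    proof (rule prod.UNION_disjoint)
      show "\<forall>i\<in>{..<r}. \<forall>j\<in>{..<r}. i \<noteq> j \<longrightarrow> P i \<inter> P j = {}"
        using disjJ PJ by (meson disjoint_iff lessThan_iff subsetD)
    qed (auto simp: P_def)
    have sep: "separated s T"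
      unfolding separated_def
    proof (intro conjI ballI impI)
      fix k assume "k \<in> T"
      then obtain i where "i < r" "k \<in> J i" using PJ by (auto simp: T_def)
      then show "s \<le> k" using J s by (auto simp: spread_family_def intro: order_trans)
    next
      fix k k' assume "k \<in> T" "k' \<in> T" "k < k'"
      then obtain i i' where i: "i < r" "i' < r" "k \<in> J i" "k' \<in> J i'" using PJ by (auto simp: T_def)
      consider "i < i'" | "i = i'" | "i' < i" by linarith
      then show "k + s \<le> k'"
      proof cases
        case 1 then show ?thesis using across[of i i' k k'] i s by auto
      next
        case 2 then show ?thesis using J i \<open>k < k'\<close> by (auto simp: spread_family_def)
      next
        case 3 then show ?thesis using across[of i' i k' k] i \<open>k < k'\<close> by auto
      qed
    qed
    have fin: "finite T" by (auto simp: T_def P_def)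
    have card: "card T \<le> 2 * r"
    proof -
      have "card T \<le> (\<Sum>i<r. card (P i))" unfolding T_def by (rule card_UN_le) auto
      also have "\<dots> \<le> (\<Sum>i<r. 2)" by (intro sum_mono) (auto simp: P_def card_insert_if)
      finally show ?thesis by simp
    qed
    have Gl: "lip2 (2 * \<Lambda> * \<Lambda>) (G k)" for k
    proof (cases "\<exists>i<r. g i = (k, k)")
      case True
      then show ?thesis unfolding G_def using lip2_mult[OF H H \<Lambda> \<Lambda>] by simp
    next
      case False
      have "\<Lambda> * 1 \<le> \<Lambda> * (2 * \<Lambda>)" using \<Lambda> by (intro mult_left_mono) auto
      then have "\<Lambda> \<le> 2 * \<Lambda> * \<Lambda>" by simp
      then have "lip2 (2 * \<Lambda> * \<Lambda>) H" by (rule lip2_mono[OF H])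
      then show ?thesis unfolding G_def by (simp only: False if_False)
    qed
    have Geq: "G k = (\<lambda>x y. H x y * H x y)" if "i < r" "g i = (k, k)" for i k
      using that by (auto simp: G_def)
    have Gneq: "G k = H" if "i < r" "fst (g i) \<noteq> snd (g i)" "k \<in> P i" for i k
    proof -
      have "\<not> (\<exists>i'<r. g i' = (k, k))"
      proof
        assume "\<exists>i'<r. g i' = (k, k)"
        then obtain i' where i': "i' < r" "g i' = (k, k)" by blast
        then have "k \<in> J i'" using gJ[of i'] by simp
        moreover have "k \<in> J i" using PJ that by auto
        ultimately have "i = i'" using disjJ that i' by blast
        then show False using i' that by simp
      qed
      then show ?thesis unfolding G_def by (simp only: if_False)
    qed
    have WT: "W g y = 1 * (\<Prod>k\<in>T. G k (b y) ((f ^^ k) y))" for y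
      unfolding prodT W_def mult_1_left
    proof (rule prod.cong[OF refl])
      fix i assume i: "i \<in> {..<r}"
      show "H (b y) ((f ^^ fst (g i)) y) * H (b y) ((f ^^ snd (g i)) y) = (\<Prod>k\<in>P i. G k (b y) ((f ^^ k) y))"
      proof (cases "fst (g i) = snd (g i)")
        case True
        then show ?thesis using Geq[of i "fst (g i)"] i by (simp add: P_def prod_eq_iff)
      next
        case False
        then show ?thesis using Gneq[of i] i by (simp add: P_def)
      qed
    qed
    have int0: "0 \<le> (\<integral>z. G k x z \<partial>\<mu>)" for k x
      using nonneg by (auto simp: G_def intro!: integral_nonneg_AE)
    have intT: "(\<Prod>k\<in>T. \<integral>z. G k x z \<partial>\<mu>) \<le> (\<Prod>i<r. \<kappa> (g i) x)" for x
      unfolding prodT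
    proof (rule prod_mono, intro conjI)
      fix i assume i: "i \<in> {..<r}"
      show "0 \<le> (\<Prod>k\<in>P i. \<integral>z. G k x z \<partial>\<mu>)" using int0 by (intro prod_nonneg) auto
      show "(\<Prod>k\<in>P i. \<integral>z. G k x z \<partial>\<mu>) \<le> \<kappa> (g i) x"
      proof (cases "fst (g i) = snd (g i)")
        case True
        then show ?thesis using Geq[of i "fst (g i)"] i sq by (simp add: P_def \<kappa>_def prod_eq_iff)
      next
        case False
        then show ?thesis using Gneq[of i] i by (simp add: P_def \<kappa>_def one)
      qed
    qed
    have \<Lambda>2: "1 \<le> 2 * \<Lambda> * \<Lambda>" using mult_mono[OF \<Lambda> \<Lambda>] \<Lambda> by simp
    have intTi: "integrable \<mu> (\<lambda>y. \<Prod>k\<in>T. \<integral>z. G k (b y) z \<partial>\<mu>)"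
    proof (rule integrable_bounded)
      have "lip1 (2 * \<Lambda> * \<Lambda>) (\<lambda>y. \<integral>z. G k (b y) z \<partial>\<mu>)" for k
        using lip2_integral[OF lip2_nonexpansive[OF Gl b]] \<Lambda>2 by simp
      then have "(\<lambda>y. \<integral>z. G k (b y) z \<partial>\<mu>) \<in> borel_measurable \<mu>" for k
        using dlip_measurable by (auto simp: lip1_def)
      then show "(\<lambda>y. \<Prod>k\<in>T. \<integral>z. G k (b y) z \<partial>\<mu>) \<in> borel_measurable \<mu>" by (intro borel_measurable_prod)
      show "\<bar>\<Prod>k\<in>T. \<integral>z. G k (b y) z \<partial>\<mu>\<bar> \<le> (max 1 u) ^ r" for y
      proof -
        have "\<bar>\<Prod>k\<in>T. \<integral>z. G k (b y) z \<partial>\<mu>\<bar> = (\<Prod>k\<in>T. \<integral>z. G k (b y) z \<partial>\<mu>)"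
          using int0 by (intro abs_of_nonneg prod_nonneg) auto
        also have "\<dots> \<le> (\<Prod>i<r. \<kappa> (g i) (b y))" by (rule intT)
        also have "\<dots> \<le> (\<Prod>i<r. max 1 u)" using \<kappa>0 \<kappa>b by (intro prod_mono) auto
        finally show ?thesis by simp
      qed
    qed
    have l1: "lip1 (2 * \<Lambda> * \<Lambda>) (\<lambda>_. 1)" using \<Lambda>2 by (intro lip1_const) auto
    have "\<bar>(\<integral>y. 1 * (\<Prod>k\<in>T. G k (b y) ((f ^^ k) y)) \<partial>\<mu>) - (\<integral>y. 1 * (\<Prod>k\<in>T. \<integral>z. G k (b y) z \<partial>\<mu>) \<partial>\<mu>)\<bar> \<le> err"
      unfolding err_def by (rule mixing_times[OF l1 Gl \<Lambda>2 b fin card sep])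
    then have "(\<integral>y. W g y \<partial>\<mu>) \<le> (\<integral>y. (\<Prod>k\<in>T. \<integral>z. G k (b y) z \<partial>\<mu>) \<partial>\<mu>) + err"
      unfolding WT[symmetric] by simp
    also have "(\<integral>y. (\<Prod>k\<in>T. \<integral>z. G k (b y) z \<partial>\<mu>) \<partial>\<mu>) \<le> (\<integral>y. (\<Prod>i<r. \<kappa> (g i) (b y)) \<partial>\<mu>)"
      by (intro integral_mono intTi \<kappa>i intT)
    finally show ?thesis by simp
  qed
  have "(\<integral>y. (tuple_average J N H b y)\<^sup>2 \<partial>\<mu>) = (1 / real N) ^ (2 * r) * (\<Sum>g\<in>\<G>. \<integral>y. W g y \<partial>\<mu>)"
    unfolding avg using Wi by simp
  also have "\<dots> \<le> (1 / real N) ^ (2 * r) * (\<Sum>g\<in>\<G>. (\<integral>y. (\<Prod>i<r. \<kappa> (g i) (b y)) \<partial>\<mu>) + err)"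
    using each by (intro mult_left_mono sum_mono) auto
  also have "\<dots> = (\<integral>y. (1 / real N) ^ (2 * r) * (\<Sum>g\<in>\<G>. \<Prod>i<r. \<kappa> (g i) (b y)) \<partial>\<mu>)
      + (1 / real N) ^ (2 * r) * (real (card \<G>) * err)"
    using \<kappa>i by (simp add: sum.distrib distrib_left)
  also have "(1 / real N) ^ (2 * r) * (real (card \<G>) * err) = err"
    using N card\<G> by (simp add: power_divide power_mult power2_eq_square)
  also have "(\<integral>y. (1 / real N) ^ (2 * r) * (\<Sum>g\<in>\<G>. \<Prod>i<r. \<kappa> (g i) (b y)) \<partial>\<mu>)
      \<le> (\<integral>y. (1 + U (b y) / real N) ^ r \<partial>\<mu>)"
  proof (rule integral_mono)
    show "integrable \<mu> (\<lambda>y. (1 / real N) ^ (2 * r) * (\<Sum>g\<in>\<G>. \<Prod>i<r. \<kappa> (g i) (b y)))" using \<kappa>i by auto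
    show "integrable \<mu> (\<lambda>y. (1 + U (b y) / real N) ^ r)"
    proof (rule integrable_bounded)
      show "(\<lambda>y. (1 + U (b y) / real N) ^ r) \<in> borel_measurable \<mu>" using Um by measurable
      show "\<bar>(1 + U (b y) / real N) ^ r\<bar> \<le> (1 + u / real N) ^ r" for y
        using U0[of "b y"] Ub[of "b y"] by (simp add: power_mono divide_right_mono)
    qed
    fix y
    define a where "a = U (b y)"
    have a0: "0 \<le> a" using U0 by (simp add: a_def)
    have "(\<Sum>g\<in>\<G>. \<Prod>i<r. \<kappa> (g i) (b y)) = (\<Prod>i<r. \<Sum>p\<in>J i \<times> J i. \<kappa> p (b y))"
      unfolding \<G>_def using Jf by (subst prod_sum_PiE) auto
    also have "\<dots> \<le> (\<Prod>i<r. real N * real N + real N * a)"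
    proof (rule prod_mono, intro conjI)
      fix i assume i: "i \<in> {..<r}"
      show "0 \<le> (\<Sum>p\<in>J i \<times> J i. \<kappa> p (b y))" using \<kappa>0 by (intro sum_nonneg) auto
      have "(\<Sum>p\<in>J i \<times> J i. \<kappa> p (b y)) \<le> (\<Sum>p\<in>J i \<times> J i. 1 + (if fst p = snd p then a else 0))"
        using a0 by (intro sum_mono) (auto simp: \<kappa>_def a_def)
      also have "\<dots> = real N * real N + (\<Sum>k\<in>J i. \<Sum>k'\<in>J i. if k = k' then a else 0)"
      proof -
        have "(\<Sum>p\<in>J i \<times> J i. if fst p = snd p then a else 0) = (\<Sum>k\<in>J i. \<Sum>k'\<in>J i. if k = k' then a else 0)"
          unfolding sum.cartesian_product by (rule sum.cong) auto
        then show ?thesis using Jf[of i] i by (simp only: sum.distrib) (simp add: card_cartesian_product)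
      qed
      also have "\<dots> = real N * real N + real N * a" using Jf[of i] i by simp
      finally show "(\<Sum>p\<in>J i \<times> J i. \<kappa> p (b y)) \<le> real N * real N + real N * a" .
    qed
    finally have "(1 / real N) ^ (2 * r) * (\<Sum>g\<in>\<G>. \<Prod>i<r. \<kappa> (g i) (b y))
        \<le> (1 / real N) ^ (2 * r) * (real N * real N + real N * a) ^ r"
      by (intro mult_left_mono) auto
    also have "\<dots> = (1 + a / real N) ^ r"
    proof -
      have "(1 / real N) ^ (2 * r) * (real N * real N + real N * a) ^ r = ((1 / real N)\<^sup>2 * (real N * real N + real N * a)) ^ r"
        by (simp add: power_mult power_mult_distrib)
      also have "(1 / real N)\<^sup>2 * (real N * real N + real N * a) = 1 + a / real N"
        using N by (simp add: power2_eq_square field_simps)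
      finally show ?thesis .
    qed
    finally show "(1 / real N) ^ (2 * r) * (\<Sum>g\<in>\<G>. \<Prod>i<r. \<kappa> (g i) (b y)) \<le> (1 + U (b y) / real N) ^ r"
      by (simp add: a_def)
  qed
  finally show ?thesis by (simp add: err_def)
qed

text \<open>
  Over the time \<open>M\<close> the map \<open>f\<^sup>k\<close> multiplies Lipschitz constants by at most \<open>L\<^sup>M\<close>.
\<close>
lemma tuple_average_lip1:
  fixes \<Lambda> :: real
  assumes J: "spread_family J N s w" and H: "lip2 \<Lambda> H" and \<Lambda>: "1 \<le> \<Lambda>" and b: "nonexpansive b"
    and M: "\<And>i k. i < r \<Longrightarrow> k \<in> J i \<Longrightarrow> k \<le> M"
  shows "lip1 (real r * (2 * \<Lambda> * L ^ M) ^ (r + 1)) (tuple_average J N H b)"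
proof -
  define \<Lambda>' where "\<Lambda>' = 2 * \<Lambda> * L ^ M"
  have N: "1 \<le> N" using J by (auto simp: spread_family_def)
  have Jf: "finite (J i)" "card (J i) = N" if "i < r" for i using J that by (auto simp: spread_family_def)
  have LM: "1 \<le> L ^ M" using L_ge_1 by simp
  have \<Lambda>\<Lambda>': "\<Lambda> \<le> \<Lambda>'" "1 \<le> \<Lambda>'"
  proof -
    have "1 * \<Lambda> \<le> (2 * L ^ M) * \<Lambda>" using LM \<Lambda> by (intro mult_right_mono) auto
    then show "\<Lambda> \<le> \<Lambda>'" by (simp add: \<Lambda>'_def mult_ac)
    then show "1 \<le> \<Lambda>'" using \<Lambda> by linarith
  qed
  define a where "a y i = (1 / real N) * (\<Sum>k\<in>J i. H (b y) ((f ^^ k) y))" for y i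
  have ab: "\<bar>a y i\<bar> \<le> \<Lambda>'" if "i < r" for y i
  proof -
    have "\<bar>a y i\<bar> \<le> (1 / real N) * (\<Sum>k\<in>J i. \<bar>H (b y) ((f ^^ k) y)\<bar>)"
      unfolding a_def abs_mult by (intro mult_mono sum_abs) auto
    also have "\<dots> \<le> (1 / real N) * (\<Sum>k\<in>J i. \<Lambda>')"
      using H by (intro mult_left_mono sum_mono order_trans[OF _ \<Lambda>\<Lambda>'(1)]) (auto simp: lip2_def)
    also have "\<dots> = \<Lambda>'" using N Jf that by simp
    finally show ?thesis .
  qed
  have al: "\<bar>a x i - a y i\<bar> \<le> \<Lambda>' * D x y" if i: "i < r" for x y i
  proof -
    have "\<bar>a x i - a y i\<bar> = \<bar>(1 / real N) * (\<Sum>k\<in>J i. H (b x) ((f ^^ k) x) - H (b y) ((f ^^ k) y))\<bar>"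
      by (simp only: a_def sum_subtractf right_diff_distrib)
    also have "\<dots> \<le> (1 / real N) * (\<Sum>k\<in>J i. \<bar>H (b x) ((f ^^ k) x) - H (b y) ((f ^^ k) y)\<bar>)"
      unfolding abs_mult by (intro mult_mono sum_abs) auto
    also have "\<dots> \<le> (1 / real N) * (\<Sum>k\<in>J i. \<Lambda>' * D x y)"
    proof (intro mult_left_mono sum_mono)
      fix k assume k: "k \<in> J i"
      have "\<bar>H (b x) ((f ^^ k) x) - H (b y) ((f ^^ k) y)\<bar> \<le> \<Lambda> * (D (b x) (b y) + D ((f ^^ k) x) ((f ^^ k) y))"
        using H by (auto simp: lip2_def)
      also have "\<dots> \<le> \<Lambda> * (L ^ M * D x y + L ^ M * D x y)"
      proof (intro mult_left_mono add_mono)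
        have "D (b x) (b y) \<le> 1 * D x y" using b by (simp add: nonexpansive_def)
        also have "\<dots> \<le> L ^ M * D x y" using LM by (intro mult_right_mono) auto
        finally show "D (b x) (b y) \<le> L ^ M * D x y" .
        have "D ((f ^^ k) x) ((f ^^ k) y) \<le> L ^ k * D x y" by (rule iterate_lipschitz)
        also have "\<dots> \<le> L ^ M * D x y" using M[OF i k] L_ge_1 by (intro mult_right_mono power_increasing) auto
        finally show "D ((f ^^ k) x) ((f ^^ k) y) \<le> L ^ M * D x y" .
      qed (use \<Lambda> in auto)
      finally show "\<bar>H (b x) ((f ^^ k) x) - H (b y) ((f ^^ k) y)\<bar> \<le> \<Lambda>' * D x y" by (simp add: \<Lambda>'_def algebra_simps)
    qed auto
    also have "\<dots> = \<Lambda>' * D x y" using N Jf i by simp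
    finally show ?thesis .
  qed
  have bound: "\<bar>tuple_average J N H b y\<bar> \<le> real r * \<Lambda>' ^ (r + 1)" for y
  proof -
    have "\<bar>tuple_average J N H b y\<bar> = (\<Prod>i<r. \<bar>a y i\<bar>)" by (simp only: tuple_average_def a_def abs_prod)
    also have "\<dots> \<le> (\<Prod>i<r. \<Lambda>')" using ab by (intro prod_mono) auto
    also have "\<dots> = 1 * (\<Lambda>' ^ r * 1)" by simp
    also have "\<dots> \<le> real r * (\<Lambda>' ^ r * \<Lambda>')" using r_pos \<Lambda>\<Lambda>' by (intro mult_mono) auto
    finally show ?thesis by (simp add: mult_ac)
  qed
  have "\<bar>tuple_average J N H b x - tuple_average J N H b y\<bar> \<le> real r * \<Lambda>' ^ (r + 1) * D x y" for x y
  proof -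
    have "\<bar>(\<Prod>i<r. a x i) - (\<Prod>i<r. a y i)\<bar> \<le> \<Lambda>' ^ card {..<r} * (\<Sum>i<r. \<bar>a x i - a y i\<bar>)"
      using ab \<Lambda>\<Lambda>' by (intro abs_prod_diff_le) auto
    also have "\<dots> \<le> \<Lambda>' ^ card {..<r} * (\<Sum>i<r. \<Lambda>' * D x y)"
      using al \<Lambda>\<Lambda>' by (intro mult_left_mono sum_mono) auto
    also have "\<dots> = real r * \<Lambda>' ^ (r + 1) * D x y" by simp
    finally show ?thesis by (simp only: tuple_average_def a_def)
  qed
  then show ?thesis using bound unfolding lip1_def dlip_def \<Lambda>'_def by blast
qed

lemma tuple_average_pos:
  assumes "0 < tuple_average J N H b y" and nonneg: "\<And>x y. 0 \<le> H x y" and i: "i < r"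
  shows "\<exists>k\<in>J i. 0 < H (b y) ((f ^^ k) y)"
proof (rule ccontr)
  assume "\<not> ?thesis"
  then have "\<forall>k\<in>J i. H (b y) ((f ^^ k) y) = 0" using nonneg by (auto simp: not_less intro: antisym)
  then have "(1 / real N) * (\<Sum>k\<in>J i. H (b y) ((f ^^ k) y)) = 0" by simp
  then have "tuple_average J N H b y = 0" unfolding tuple_average_def using i by (intro prod_zero) auto
  then show False using assms(1) by simp
qed

lemma tuple_average_nonneg:
  assumes "\<And>x y. 0 \<le> H x y" shows "0 \<le> tuple_average J N H b y"
  unfolding tuple_average_def using assms by (intro prod_nonneg mult_nonneg_nonneg sum_nonneg) auto

end

section \<open>Many visits infinitely often: the lower bound\<close>

text \<open>
  The \<open>i\<close>-th window starts at \<open>t + 2 i w\<close> and has length \<open>w\<close>; the factor \<open>2\<close> leaves a gap of length \<open>w\<close> between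
  consecutive windows.
\<close>
definition lattice_times :: "nat \<Rightarrow> nat \<Rightarrow> nat \<Rightarrow> nat \<Rightarrow> nat \<Rightarrow> nat set" where
  "lattice_times t w s N i = (\<lambda>j. t + 2 * i * w + j * s) ` {..<N}"

lemma lattice_times_bounds:
  assumes "N * s \<le> w" "k \<in> lattice_times t w s N i"
  shows "t + 2 * i * w \<le> k" "k + s \<le> t + 2 * i * w + w"
proof -
  obtain j where j: "j < N" "k = t + 2 * i * w + j * s" using assms by (auto simp: lattice_times_def)
  have "(j + 1) * s \<le> N * s" using j by (intro mult_le_mono1) auto
  then have "j * s + s \<le> w" using assms(1) by simp
  then show "t + 2 * i * w \<le> k" "k + s \<le> t + 2 * i * w + w" using j by auto
qed

context mixing_system
begin

lemma spread_family_lattice_times: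
  assumes "1 \<le> N" "1 \<le> s" "N * s \<le> w" "w \<le> t"
  shows "spread_family (lattice_times t w s N) N s w"
  unfolding spread_family_def
proof (intro conjI allI impI ballI)
  have "s \<le> N * s" using assms(1) by simp
  then show "s \<le> w" using assms(3) by (rule order_trans)
  fix i
  show "finite (lattice_times t w s N i)" by (simp add: lattice_times_def)
  show "card (lattice_times t w s N i) = N"
    unfolding lattice_times_def using assms by (subst card_image) (auto simp: inj_on_def)
  show "w \<le> k" if "k \<in> lattice_times t w s N i" for k
    using lattice_times_bounds(1)[OF assms(3) that] assms by simp
  show "k + s \<le> k'" if k: "k \<in> lattice_times t w s N i" "k' \<in> lattice_times t w s N i" "k < k'" for k k'
  proof -
    obtain j j' where j: "k = t + 2 * i * w + j * s" "k' = t + 2 * i * w + j' * s"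
      using k by (auto simp: lattice_times_def)
    then have "j < j'" using k(3) by (simp add: mult_less_cancel2)
    then have "(j + 1) * s \<le> j' * s" by (intro mult_le_mono1) auto
    then show ?thesis using j by simp
  qed
  show "k + w \<le> k'" if k: "i < i'" "k \<in> lattice_times t w s N i" "k' \<in> lattice_times t w s N i'" for i' k k'
  proof -
    have "(i + 1) * (2 * w) \<le> i' * (2 * w)" using k(1) by (intro mult_le_mono1) auto
    then show ?thesis
      using lattice_times_bounds[OF assms(3) k(2)] lattice_times_bounds[OF assms(3) k(3)] by (simp add: algebra_simps)
  qed
qed (use assms in auto)

lemma normalised_hit_growth:
  assumes \<rho>: "radius_scale \<rho>"
  obtains \<Gamma> where "1 \<le> \<Gamma>" "\<forall>\<^sub>F m in sequentially. lip2 (\<Gamma> ^ m) (normalised_hit (\<rho> m) m)"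
proof -
  have rh: "0 < \<rho> m" "\<rho> m \<le> 1" for m using radius_scaleD[OF \<rho>] by auto
  obtain \<alpha> where \<alpha>: "0 < \<alpha>" "\<alpha> < 1" and ev\<alpha>: "\<forall>\<^sub>F m in sequentially. \<alpha> ^ m \<le> \<rho> m"
  proof -
    obtain a1 a2 where a: "0 < a1" "a1 < 1" and ev: "\<forall>\<^sub>F m in sequentially. a1 ^ m \<le> \<rho> m \<and> \<rho> m \<le> a2 ^ m"
      using \<rho> by (auto simp: radius_scale_def)
    show thesis by (rule that[OF a eventually_mono[OF ev]]) simp
  qed
  define \<Gamma> where "\<Gamma> = 4 * L * (1 / \<alpha>) ^ (2 * d + 1)"
  have ia: "1 \<le> 1 / \<alpha>" using \<alpha> by simp
  have \<Gamma>1: "1 \<le> \<Gamma>"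
  proof -
    have "1 * 1 * 1 \<le> 4 * L * (1 / \<alpha>) ^ (2 * d + 1)"
      using L_ge_1 ia by (intro mult_mono one_le_power) auto
    then show ?thesis by (simp add: \<Gamma>_def)
  qed
  have "\<forall>\<^sub>F m in sequentially. 2 / c\<^sup>2 * 1 ^ m \<le> 2 ^ m"
    by (rule eventually_const_times_power_le) auto
  then have "\<forall>\<^sub>F m in sequentially. lip2 (\<Gamma> ^ m) (normalised_hit (\<rho> m) m)"
    using ev\<alpha> eventually_ge_at_top[of 1]
  proof eventually_elim
    case (elim m)
    have inv: "1 / \<rho> m \<le> (1 / \<alpha>) ^ m"
      using elim \<alpha> by (simp add: power_one_over frac_le)
    have "2 * (real m * L ^ m / \<rho> m) / (c * \<rho> m ^ d)\<^sup>2 = 2 / c\<^sup>2 * real m * L ^ m * (1 / \<rho> m) ^ (2 * d + 1)"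
      by (simp add: power_mult_distrib power_divide power_mult[symmetric] mult_ac)
    also have "\<dots> \<le> 2 ^ m * 2 ^ m * L ^ m * ((1 / \<alpha>) ^ m) ^ (2 * d + 1)"
    proof (intro mult_mono power_mono inv)
      show "2 / c\<^sup>2 \<le> 2 ^ m" using elim by simp
      show "real m \<le> 2 ^ m" using of_nat_less_two_power[of m] by simp
    qed (use L_ge_1 rh[of m] in \<open>auto simp: less_imp_le\<close>)
    also have "\<dots> = \<Gamma> ^ m"
    proof -
      have "(4::real) ^ m = 2 ^ m * 2 ^ m" by (simp add: power_mult_distrib[symmetric])
      moreover have "((1 / \<alpha>) ^ m) ^ (2 * d + 1) = ((1 / \<alpha>) ^ (2 * d + 1)) ^ m"
        by (simp only: power_mult[symmetric] mult.commute)
      ultimately show ?thesis unfolding \<Gamma>_def power_mult_distrib by simp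
    qed
    finally show ?case
      using lip2_mono[OF normalised_hit_lip2[OF rh elim(3)]] by simp
  qed
  then show thesis using that \<Gamma>1 by blast
qed

text \<open>
  Outside the set \<open>A\<close> of points whose centre has many close pairs, a block of length \<open>m\<close> is hit with \<open>m\<close> times the probability of a
  single visit. By Markov's inequality \<open>A\<close> has measure of order \<open>m \<eta>\<close>, and on it the trivial bound is used.
\<close>
lemma inverse_hit_prob_moment:
  assumes \<rho>: "0 < \<rho>" "\<rho> \<le> 1" and m: "1 \<le> m" and N: "1 \<le> N" and b: "nonexpansive b"
    and pair_rate: "\<And>l. l \<in> {1..m} \<Longrightarrow> (\<integral>y. pair_rate \<rho> l (b y) \<partial>\<mu>) \<le> \<eta> * \<rho> ^ d"
  shows "(\<integral>y. (1 + 1 / hit_prob \<rho> m (b y) / real N) ^ r \<partial>\<mu>)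
    \<le> (1 + 2 / (real N * real m * (c * \<rho> ^ d))) ^ r + 2 * real m * \<eta> / c * (1 + 1 / (real N * (c * \<rho> ^ d))) ^ r"
proof -
  define v where "v = c * \<rho> ^ d"
  have v: "0 < v" using \<rho> c_pos by (simp add: v_def)
  define S where "S y = (\<Sum>l\<in>{1..m}. pair_rate \<rho> l (b y))" for y
  have l0: "0 \<le> 4 * L ^ l / \<rho>\<^sup>2" for l using L_ge_1 by simp
  have Qm [measurable]: "(\<lambda>y. pair_rate \<rho> l (b y)) \<in> borel_measurable \<mu>" for l
    using lip1_compose_nonexpansive[OF pair_rate_lip1[OF \<rho>] b l0] dlip_measurable unfolding lip1_def by blast
  have Qi: "integrable \<mu> (\<lambda>y. pair_rate \<rho> l (b y))" for l
    using pair_rate_le_1[OF \<rho>] by (intro integrable_bounded[of _ 1]) auto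
  have Sm [measurable]: "S \<in> borel_measurable \<mu>" unfolding S_def by measurable
  have Si: "integrable \<mu> S" unfolding S_def using Qi by auto
  define A where "A = {y. v / 2 \<le> S y}"
  have As: "A \<in> sets \<mu>"
  proof -
    have "{y \<in> space \<mu>. v / 2 \<le> S y} \<in> sets \<mu>" by measurable
    then show ?thesis by (simp add: A_def)
  qed
  have "prob {y \<in> space \<mu>. S y \<ge> v / 2} \<le> (\<integral>y. S y \<partial>\<mu>) / (v / 2)"
    by (rule integral_Markov_inequality_measure[OF Si sets.empty_sets]) (use v in \<open>auto simp: S_def sum_nonneg\<close>)
  also have "(\<integral>y. S y \<partial>\<mu>) = (\<Sum>l\<in>{1..m}. \<integral>y. pair_rate \<rho> l (b y) \<partial>\<mu>)"
    unfolding S_def using Qi by (intro Bochner_Integration.integral_sum) auto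
  also have "\<dots> \<le> (\<Sum>l\<in>{1..m}. \<eta> * \<rho> ^ d)" using pair_rate by (intro sum_mono) auto
  finally have pA: "prob A \<le> 2 * real m * \<eta> / c"
    using v \<rho> c_pos by (simp add: A_def v_def divide_right_mono field_simps)
  have Vl: "lip1 (real m * L ^ m / \<rho>) (\<lambda>y. hit_prob \<rho> m (b y))"
    unfolding hit_prob_def using \<rho> L_ge_1 by (intro lip2_integral lip2_nonexpansive[OF hit_lip2] b m) auto
  have Vm [measurable]: "(\<lambda>y. hit_prob \<rho> m (b y)) \<in> borel_measurable \<mu>"
    using Vl dlip_measurable unfolding lip1_def by blast
  have Vv: "v \<le> hit_prob \<rho> m x" for x unfolding v_def by (rule hit_prob_lower[OF \<rho> m])
  define g where "g y = (1 + 1 / hit_prob \<rho> m (b y) / real N) ^ r" for y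
  define B where "B = (1 + 1 / (real N * v)) ^ r"
  define B' where "B' = (1 + 2 / (real N * real m * v)) ^ r"
  have Vp: "0 < hit_prob \<rho> m x" for x using Vv[of x] v by linarith
  have gB: "g y \<le> B" for y
    unfolding g_def B_def using Vv[of "b y"] Vp[of "b y"] v N
    by (intro power_mono add_left_mono) (auto simp: frac_le)
  have g0: "0 \<le> g y" for y unfolding g_def using Vp[of "b y"] by simp
  have gB': "g y \<le> B'" if "y \<notin> A" for y
  proof -
    have "real m * (c * \<rho> ^ d / 2) \<le> hit_prob \<rho> m (b y)"
      using that by (intro hit_prob_lower_good \<rho> m) (auto simp: A_def S_def v_def)
    then have "real m * (v / 2) \<le> hit_prob \<rho> m (b y)" by (simp add: v_def)
    then have "1 / hit_prob \<rho> m (b y) / real N \<le> 1 / (real m * (v / 2)) / real N"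
      using v m by (intro divide_right_mono divide_left_mono) (auto intro!: mult_pos_pos Vp)
    also have "\<dots> = 2 / (real N * real m * v)" by simp
    finally show ?thesis unfolding g_def B'_def using Vp[of "b y"] by (intro power_mono) auto
  qed
  have B0: "0 \<le> B" "0 \<le> B'" using v by (auto simp: B_def B'_def)
  have "(\<integral>y. g y \<partial>\<mu>) \<le> (\<integral>y. B' + B * indicator A y \<partial>\<mu>)"
  proof (rule integral_mono)
    show "integrable \<mu> g"
      using g0 gB by (intro integrable_bounded[of _ B]) (auto simp: g_def[abs_def])
    show "integrable \<mu> (\<lambda>y. B' + B * indicator A y)" using As by (auto simp: emeasure_eq_measure)
    show "g y \<le> B' + B * indicator A y" for y
      using gB[of y] gB'[of y] B0 by (cases "y \<in> A") auto
  qed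
  also have "\<dots> = B' + B * prob A" using As by (simp add: emeasure_eq_measure)
  also have "\<dots> \<le> B' + B * (2 * real m * \<eta> / c)" using pA B0 by (intro add_left_mono mult_left_mono)
  finally show ?thesis unfolding g_def B_def B'_def v_def by (simp add: mult_ac)
qed

text \<open>
  Scale \<open>m\<close> uses times between \<open>2\<^sup>m\<close> and \<open>2\<^bsup>m+1\<^esup>\<close>. The hypothesis \<open>large\<close> says \<open>u\<^bsup>-r\<^esup> \<le> m\<close> for the expected number
  \<open>u = 2\<^sup>m \<rho>\<^sub>m\<^sup>d\<close> of visits, and \<open>u\<^bsup>-r\<^esup>\<close> is the order of the second moment of \<open>X\<^sub>m\<close>; so it supplies the
  second-moment bound of the criterion above. The scales that are compared are multiples \<open>\<delta> j\<close> of a constant: the Lipschitz constant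
  of \<open>X\<^bsub>m\<^esub>\<close> is of the form \<open>\<Gamma>\<^bsup>2^m\<^esup>\<close>, doubly exponential, and only beyond a fixed number of doublings is it beaten
  by the mixing error \<open>\<theta>\<^bsup>w\<^esup>\<close> with \<open>w = 2\<^bsup>m'-\<kappa>\<^esup>\<close>.
\<close>
theorem infinitely_often_many_visits:
  assumes \<rho>: "radius_scale \<rho>" and adm: "admissible \<rho> b"
    and small: "\<forall>\<^sub>F m in sequentially. 2 ^ m * \<rho> m ^ d \<le> 1"
    and large: "\<forall>\<^sub>F m in sequentially. 1 \<le> real m * (2 ^ m * \<rho> m ^ d) ^ r"
  shows "AE y in \<mu>. \<exists>\<^sub>F m in sequentially.
    r \<le> card {k \<in> {1..2 ^ (m + 1)}. D (b y) ((f ^^ k) y) \<le> 2 * \<rho> m}"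
proof -
  have rh: "0 < \<rho> m" "\<rho> m \<le> 1" for m using radius_scaleD[OF \<rho>] by auto
  have b: "nonexpansive b" using adm by (simp add: admissible_def)
  obtain \<beta> where \<beta>: "0 < \<beta>" "\<beta> < 1" and H: "\<forall>\<^sub>F m in sequentially. \<forall>k\<in>{1..m\<^sup>2}.
        prob {y. D (b y) ((f ^^ k) y) \<le> \<rho> m} \<le> \<beta> ^ m \<and>
        (\<integral>y. pair_rate (\<rho> m) k (b y) \<partial>\<mu>) \<le> \<beta> ^ m * \<rho> m ^ d"
    using adm by (auto simp: admissible_def)
  obtain \<Gamma> where \<Gamma>: "1 \<le> \<Gamma>" and lipH: "\<forall>\<^sub>F m in sequentially. lip2 (\<Gamma> ^ m) (normalised_hit (\<rho> m) m)"
    using normalised_hit_growth[OF \<rho>] by blast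
  define q where "q = 2 * r + 2"
  \<comment> \<open>The windows and gaps, \<open>2 r\<close> intervals of length \<open>2\<^bsup>m-\<kappa>\<^esup>\<close>, fit between \<open>2\<^sup>m\<close> and \<open>2\<^bsup>m+1\<^esup>\<close>.\<close>
  define \<kappa> where "\<kappa> = 2 * r"
  have \<kappa>: "2 * r \<le> 2 ^ \<kappa>" using less_exp[of "2 * r"] by (simp add: \<kappa>_def)
  \<comment> \<open>At the lattice step \<open>P m\<close> mixing beats the Lipschitz constant of products of two normalised hits.\<close>
  obtain P where P: "\<theta> ^ P < 1 / (2 * \<Gamma> * \<Gamma>) ^ q"
    using real_arch_pow_inv[of "1 / (2 * \<Gamma> * \<Gamma>) ^ q" \<theta>] \<Gamma> \<theta>_less_1 by auto
  have P1: "1 \<le> P"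
  proof (rule ccontr)
    assume "\<not> 1 \<le> P"
    then have "P = 0" by simp
    then have "1 < 1 / (2 * \<Gamma> * \<Gamma>) ^ q" using P by simp
    moreover have "1 \<le> (2 * \<Gamma> * \<Gamma>) ^ q" using \<Gamma> mult_mono[OF \<Gamma> \<Gamma>] by (intro one_le_power) auto
    ultimately show False by (simp add: divide_simps split: if_splits)
  qed
  \<comment> \<open>\<open>\<Gamma>\<^sub>1\<^bsup>2^m\<^esup>\<close> will bound the Lipschitz constant of \<open>X m\<close>.\<close>
  define \<Gamma>\<^sub>1 where "\<Gamma>\<^sub>1 = real r * (2 * \<Gamma> * L ^ 2) ^ (r + 1)"
  have \<Gamma>\<^sub>1: "1 \<le> \<Gamma>\<^sub>1"
  proof -
    have "1 * 1 * 1 \<le> 2 * \<Gamma> * L ^ 2" using \<Gamma> L_ge_1 by (intro mult_mono one_le_power) auto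
    then have "1 * 1 \<le> real r * (2 * \<Gamma> * L ^ 2) ^ (r + 1)"
      using r_pos by (intro mult_mono one_le_power) auto
    then show ?thesis by (simp add: \<Gamma>\<^sub>1_def)
  qed
  define \<Gamma>\<^sub>2 where "\<Gamma>\<^sub>2 = \<Gamma>\<^sub>1 * \<Gamma>"
  have \<Gamma>\<^sub>2: "1 \<le> \<Gamma>\<^sub>2" "\<Gamma>\<^sub>1 \<le> \<Gamma>\<^sub>2" "\<Gamma> \<le> \<Gamma>\<^sub>2"
    using mult_mono[OF \<Gamma>\<^sub>1 \<Gamma>] mult_left_mono[OF \<Gamma>, of \<Gamma>\<^sub>1] mult_right_mono[OF \<Gamma>\<^sub>1, of \<Gamma>] \<Gamma> \<Gamma>\<^sub>1
    by (auto simp: \<Gamma>\<^sub>2_def)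
  obtain e where e: "\<theta> ^ e < 1 / (2 * \<Gamma>\<^sub>2 ^ q)"
    using real_arch_pow_inv[of "1 / (2 * \<Gamma>\<^sub>2 ^ q)" \<theta>] \<Gamma>\<^sub>2 \<theta>_less_1 by auto
  \<comment> \<open>Chosen so that \<open>e 2\<^bsup>m-\<sigma>\<^esup> \<le> 2\<^bsup>m-\<kappa>\<^esup>\<close>, the gap between windows at scale \<open>m\<close>.\<close>
  define \<sigma> where "\<sigma> = \<kappa> + e + 1"
  define w where "w m = (2::nat) ^ (m - \<kappa>)" for m
  define s where "s m = P * m" for m
  define N where "N m = w m div s m" for m
  define J where "J m = lattice_times (2 ^ m) (w m) (s m) (N m)" for m
  define X where "X m = tuple_average (J m) (N m) (normalised_hit (\<rho> m) m) b" for m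
  define B1 where "B1 = 2 * 2 ^ \<kappa> * real P"
  have B1: "0 < B1" using P1 by (simp add: B1_def)
  define A0 where "A0 = (1 + 2 * B1 / c) ^ r + 1 + mixing_const"
  have ev_lattice: "\<forall>\<^sub>F m in sequentially. 2 * s m \<le> w m"
  proof -
    have "\<forall>\<^sub>F m in sequentially. 2 * 2 ^ \<kappa> * real P * real m ^ 1 * 1 ^ m \<le> 2 ^ m"
      by (rule eventually_poly_times_power_le) auto
    then show ?thesis using eventually_ge_at_top[of \<kappa>]
    proof eventually_elim
      case (elim m)
      have "real (2 ^ \<kappa> * (2 * s m)) \<le> real (2 ^ \<kappa> * w m)"
        using elim by (simp add: s_def w_def power_add[symmetric] mult_ac)
      then have "2 ^ \<kappa> * (2 * s m) \<le> 2 ^ \<kappa> * w m" using of_nat_le_iff by blast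
      then show ?case by simp
    qed
  qed
  have ev_tail: "\<forall>\<^sub>F m in sequentially. 2 / c * (1 + B1 / c) ^ r * real m ^ (r + 2) * \<beta> ^ m \<le> 1 ^ m"
    using \<beta> by (intro eventually_poly_times_power_le) auto
  have ev_exp: "\<forall>\<^sub>F m in sequentially. m \<le> (2::nat) ^ (m - \<sigma>)"
  proof -
    have "\<forall>\<^sub>F m in sequentially. 2 ^ \<sigma> * real m ^ 1 * 1 ^ m \<le> 2 ^ m"
      by (rule eventually_poly_times_power_le) auto
    then show ?thesis using eventually_ge_at_top[of \<sigma>]
    proof eventually_elim
      case (elim m)
      have "real (2 ^ \<sigma> * m) \<le> real (2 ^ \<sigma> * 2 ^ (m - \<sigma>))" using elim by (simp add: power_add[symmetric])
      then have "2 ^ \<sigma> * m \<le> 2 ^ \<sigma> * (2::nat) ^ (m - \<sigma>)" using of_nat_le_iff by blast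
      then show ?case by simp
    qed
  qed
  define good where "good m \<longleftrightarrow> max 1 \<sigma> \<le> m \<and> 2 * s m \<le> w m \<and> lip2 (\<Gamma> ^ m) (normalised_hit (\<rho> m) m) \<and>
      m \<le> 2 ^ (m - \<sigma>) \<and> 2 ^ m * \<rho> m ^ d \<le> 1 \<and> 1 \<le> real m * (2 ^ m * \<rho> m ^ d) ^ r \<and>
      2 / c * (1 + B1 / c) ^ r * real m ^ (r + 2) * \<beta> ^ m \<le> 1 \<and>
      (\<forall>k\<in>{1..m\<^sup>2}. (\<integral>y. pair_rate (\<rho> m) k (b y) \<partial>\<mu>) \<le> \<beta> ^ m * \<rho> m ^ d)" for m
  have "\<forall>\<^sub>F m in sequentially. good m"
    using eventually_ge_at_top[of "max 1 \<sigma>"] ev_lattice lipH ev_exp small large ev_tail H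
    by eventually_elim (auto simp: good_def)
  then obtain M\<^sub>0 where M\<^sub>0: "\<And>m. M\<^sub>0 \<le> m \<Longrightarrow> good m" unfolding eventually_sequentially by blast
  have spread: "spread_family (J m) (N m) (s m) (w m)" and Nlow: "real (w m) \<le> 2 * real (N m * s m)"
    and m1: "1 \<le> m" if "good m" for m
  proof -
    show m1: "1 \<le> m" using that by (auto simp: good_def)
    then have s1: "1 \<le> s m" using P1 by (simp add: s_def)
    have sw: "2 * s m \<le> w m" using that by (auto simp: good_def)
    have N1: "1 \<le> N m"
      unfolding N_def using s1 sw div_le_mono[of "s m" "w m" "s m"] by auto
    have "N m * s m \<le> w m" by (simp add: N_def)
    then show "spread_family (J m) (N m) (s m) (w m)"
      unfolding J_def using N1 s1 by (intro spread_family_lattice_times) (auto simp: w_def)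
    have "w m < N m * s m + s m" unfolding N_def using s1 dividend_less_div_times[of "s m" "w m"] by simp
    then have "w m \<le> 2 * (N m * s m)" using sw by linarith
    then show "real (w m) \<le> 2 * real (N m * s m)"
      by (metis of_nat_le_iff of_nat_mult of_nat_numeral)
  qed
  have times: "1 \<le> k" "k + m \<le> 2 ^ (m + 1)" if "good m" "i < r" "k \<in> J m i" for m i k
  proof -
    have Ns: "N m * s m \<le> w m" by (simp add: N_def)
    have m\<kappa>: "\<kappa> \<le> m" using that(1) by (auto simp: good_def \<sigma>_def)
    note lb = lattice_times_bounds[OF Ns that(3)[unfolded J_def]]
    have "(1::nat) \<le> 2 ^ m" by simp
    then show "1 \<le> k" using lb by linarith
    have "2 * i * w m + w m \<le> (2 * r) * w m"
    proof -
      have "(2 * i + 1) * w m \<le> (2 * r) * w m" using that(2) by (intro mult_le_mono1) auto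
      then show ?thesis by simp
    qed
    also have "\<dots> \<le> 2 ^ \<kappa> * w m" using \<kappa> by (intro mult_le_mono1)
    also have "\<dots> = 2 ^ m" using m\<kappa> by (simp add: w_def power_add[symmetric])
    finally have "k + s m \<le> 2 ^ (m + 1)" using lb by simp
    moreover have "m \<le> s m" using P1 by (simp add: s_def)
    ultimately show "k + m \<le> 2 ^ (m + 1)" by simp
  qed
  have Xlip: "lip1 (\<Gamma>\<^sub>1 ^ (2 ^ m)) (X m)" if "good m" for m
  proof -
    have \<Gamma>m: "1 \<le> \<Gamma> ^ m" using \<Gamma> by simp
    have "lip1 (real r * (2 * \<Gamma> ^ m * L ^ (2 ^ (m + 1))) ^ (r + 1)) (X m)"
      unfolding X_def
    proof (rule tuple_average_lip1[OF spread[OF that] _ \<Gamma>m b])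
      show "lip2 (\<Gamma> ^ m) (normalised_hit (\<rho> m) m)" using that by (simp add: good_def)
      show "k \<le> 2 ^ (m + 1)" if "i < r" "k \<in> J m i" for i k
        using times(2)[OF \<open>good m\<close> that] by linarith
    qed
    moreover have "real r * (2 * \<Gamma> ^ m * L ^ (2 ^ (m + 1))) ^ (r + 1) \<le> \<Gamma>\<^sub>1 ^ (2 ^ m)"
    proof -
      have e1: "real r \<le> real r ^ (2 ^ m)" using r_pos by (intro self_le_power) auto
      have e2: "(2::real) \<le> 2 ^ (2 ^ m)" by (intro self_le_power) auto
      have "m \<le> 2 ^ m" using less_exp[of m] by simp
      then have e3: "\<Gamma> ^ m \<le> \<Gamma> ^ (2 ^ m)" using \<Gamma> by (intro power_increasing) auto
      have e4: "L ^ (2 ^ (m + 1)) = (L ^ 2) ^ (2 ^ m)" by (simp only: power_mult[symmetric] power_Suc Suc_eq_plus1[symmetric])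
      have "2 * \<Gamma> ^ m * L ^ (2 ^ (m + 1)) \<le> 2 ^ (2 ^ m) * \<Gamma> ^ (2 ^ m) * (L ^ 2) ^ (2 ^ m)"
        unfolding e4 using e2 e3 L_ge_1 \<Gamma> by (intro mult_mono) auto
      also have "\<dots> = (2 * \<Gamma> * L ^ 2) ^ (2 ^ m)" by (simp only: power_mult_distrib)
      finally have "(2 * \<Gamma> ^ m * L ^ (2 ^ (m + 1))) ^ (r + 1) \<le> ((2 * \<Gamma> * L ^ 2) ^ (2 ^ m)) ^ (r + 1)"
        using \<Gamma> L_ge_1 by (intro power_mono) auto
      also have "\<dots> = ((2 * \<Gamma> * L ^ 2) ^ (r + 1)) ^ (2 ^ m)" by (simp only: power_mult[symmetric] mult.commute)
      finally have "real r * (2 * \<Gamma> ^ m * L ^ (2 ^ (m + 1))) ^ (r + 1) \<le> real r ^ (2 ^ m) * ((2 * \<Gamma> * L ^ 2) ^ (r + 1)) ^ (2 ^ m)"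
        using e1 \<Gamma> L_ge_1 by (intro mult_mono) auto
      then show ?thesis by (simp only: \<Gamma>\<^sub>1_def power_mult_distrib)
    qed
    ultimately show ?thesis
      unfolding lip1_def dlip_def by (meson D_nonneg mult_right_mono order_trans)
  qed
  have mean: "\<bar>(\<integral>y. F y * X m y \<partial>\<mu>) - (\<integral>y. F y \<partial>\<mu>)\<bar> \<le> mixing_const * (1 / 2) ^ m"
    if gm: "good m" and F: "lip1 (\<Gamma>\<^sub>1 ^ (2 ^ (m - \<sigma>))) F" for m F
  proof -
    define h where "h = (2::nat) ^ (m - \<sigma>)"
    have h: "m \<le> h" "\<sigma> \<le> m" using gm by (auto simp: good_def h_def)
    have \<Lambda>: "1 \<le> \<Gamma>\<^sub>2 ^ h" using \<Gamma>\<^sub>2 by simp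
    have F': "lip1 (\<Gamma>\<^sub>2 ^ h) F"
    proof -
      have "\<Gamma>\<^sub>1 ^ h \<le> \<Gamma>\<^sub>2 ^ h" using \<Gamma>\<^sub>2 \<Gamma>\<^sub>1 by (intro power_mono) auto
      then show ?thesis using F unfolding lip1_def dlip_def h_def[symmetric]
        by (meson D_nonneg mult_right_mono order_trans)
    qed
    have "\<Gamma> ^ m \<le> \<Gamma> ^ h" using \<Gamma> h by (intro power_increasing) auto
    also have "\<dots> \<le> \<Gamma>\<^sub>2 ^ h" using \<Gamma>\<^sub>2 \<Gamma> by (intro power_mono) auto
    finally have H': "lip2 (\<Gamma>\<^sub>2 ^ h) (normalised_hit (\<rho> m) m)" using gm lip2_mono by (auto simp: good_def)
    have "\<bar>(\<integral>y. F y * X m y \<partial>\<mu>) - (\<integral>y. F y \<partial>\<mu>)\<bar> \<le> mixing_const * \<theta> ^ w m * (\<Gamma>\<^sub>2 ^ h) ^ q"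
      unfolding X_def q_def using m1[OF gm]
      by (intro tuple_average_mean[OF spread[OF gm] F' H' \<Lambda> b] normalised_hit_integral rh)
    also have "\<dots> = mixing_const * (\<theta> ^ w m * (\<Gamma>\<^sub>2 ^ q) ^ h)"
      by (simp add: power_mult[symmetric] mult.commute)
    also have "\<dots> \<le> mixing_const * (1 / 2) ^ m"
    proof (rule mult_left_mono[OF _ mixing_const_nonneg])
      have "e * h \<le> w m"
      proof -
        have "e * h \<le> 2 ^ (e + 1) * h" using less_exp[of "e + 1"] by (intro mult_le_mono1) simp
        also have "\<dots> = 2 ^ (e + 1 + (m - \<sigma>))" by (simp add: h_def power_add)
        also have "e + 1 + (m - \<sigma>) = m - \<kappa>" using h by (simp add: \<sigma>_def)
        finally show ?thesis by (simp add: w_def)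
      qed
      then have "\<theta> ^ w m \<le> \<theta> ^ (e * h)" using \<theta>_pos \<theta>_less_1 by (intro power_decreasing) auto
      also have "\<dots> = (\<theta> ^ e) ^ h" by (simp add: power_mult)
      finally have "\<theta> ^ w m * (\<Gamma>\<^sub>2 ^ q) ^ h \<le> (\<theta> ^ e) ^ h * (\<Gamma>\<^sub>2 ^ q) ^ h"
        using \<Gamma>\<^sub>2 by (intro mult_right_mono) auto
      also have "\<dots> = (\<theta> ^ e * \<Gamma>\<^sub>2 ^ q) ^ h" by (simp add: power_mult_distrib)
      also have "\<dots> \<le> (1 / 2) ^ h"
      proof (rule power_mono)
        have "0 < \<Gamma>\<^sub>2 ^ q" using \<Gamma>\<^sub>2 by simp
        then show "\<theta> ^ e * \<Gamma>\<^sub>2 ^ q \<le> 1 / 2" using e by (simp add: field_simps)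
      qed (use \<theta>_pos \<Gamma>\<^sub>2 in auto)
      also have "\<dots> \<le> (1 / 2) ^ m" using h by (intro power_decreasing) auto
      finally show "\<theta> ^ w m * (\<Gamma>\<^sub>2 ^ q) ^ h \<le> (1 / 2) ^ m" .
    qed
    finally show ?thesis .
  qed
  have second: "(\<integral>y. (X m y)\<^sup>2 \<partial>\<mu>) \<le> A0 * real m" if gm: "good m" for m
  proof -
    define u where "u = 2 ^ m * \<rho> m ^ d"
    have u: "0 < u" "u \<le> 1" "1 \<le> real m * u ^ r" using gm rh[of m] by (auto simp: good_def u_def)
    have N1: "1 \<le> N m" using spread[OF gm] by (simp add: spread_family_def)
    have \<Gamma>m: "1 \<le> \<Gamma> ^ m" using \<Gamma> by simp
    have lipm: "lip2 (\<Gamma> ^ m) (normalised_hit (\<rho> m) m)" using gm by (simp add: good_def)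
    have Vl: "lip1 (real m * L ^ m / \<rho> m) (\<lambda>y. hit_prob (\<rho> m) m (b y))"
      unfolding hit_prob_def using rh[of m] L_ge_1 m1[OF gm] by (intro lip2_integral lip2_nonexpansive[OF hit_lip2] b) auto
    have Vm [measurable]: "(\<lambda>y. hit_prob (\<rho> m) m (b y)) \<in> borel_measurable \<mu>"
      using Vl dlip_measurable unfolding lip1_def by blast
    have Ub: "1 / hit_prob (\<rho> m) m x \<le> 1 / (c * \<rho> m ^ d)" for x
      using hit_prob_lower[OF rh(1)[of m] rh(2)[of m] m1[OF gm], of x] c_pos rh[of m] by (intro divide_left_mono mult_pos_pos hit_prob_pos m1[OF gm]) auto
    \<comment> \<open>The blocks of one window contain at least \<open>2\<^sup>m / B1\<close> times.\<close>
    have uN: "u \<le> B1 * (real (N m) * real m * \<rho> m ^ d)"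
    proof -
      have m\<kappa>: "\<kappa> \<le> m" using gm by (auto simp: good_def \<sigma>_def)
      have "(2::real) ^ m = 2 ^ \<kappa> * real (w m)" using m\<kappa> by (simp add: w_def power_add[symmetric])
      also have "\<dots> \<le> 2 ^ \<kappa> * (2 * real (N m * s m))" using Nlow[OF gm] by (intro mult_left_mono) auto
      also have "\<dots> = B1 * (real (N m) * real m)" by (simp add: B1_def s_def)
      finally have "2 ^ m * \<rho> m ^ d \<le> B1 * (real (N m) * real m) * \<rho> m ^ d"
        using rh[of m] by (intro mult_right_mono) auto
      then show ?thesis by (simp add: u_def mult_ac)
    qed
    define n where "n = real (N m) * real m * \<rho> m ^ d"
    have n: "0 < n" using N1 m1[OF gm] rh[of m] by (simp add: n_def)
    have "u \<le> B1 * n" using uN by (simp only: n_def)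
    then have un: "1 / n \<le> B1 / u" using n u by (simp add: field_simps)
    have inv_u: "(1 / u) ^ r \<le> real m" using u by (simp add: power_divide field_simps)
    have t1: "(1 + 2 / (real (N m) * real m * (c * \<rho> m ^ d))) ^ r \<le> (1 + 2 * B1 / c) ^ r * real m"
    proof -
      have "1 + 2 / (real (N m) * real m * (c * \<rho> m ^ d)) = 1 + 2 / c * (1 / n)" by (simp add: n_def)
      also have "\<dots> \<le> 1 / u + 2 / c * (B1 / u)" using un u c_pos by (intro add_mono mult_left_mono) auto
      also have "\<dots> = (1 + 2 * B1 / c) * (1 / u)" by (simp add: algebra_simps add_divide_distrib)
      finally have "(1 + 2 / (real (N m) * real m * (c * \<rho> m ^ d))) ^ r \<le> ((1 + 2 * B1 / c) * (1 / u)) ^ r"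
        using c_pos rh[of m] by (intro power_mono) auto
      also have "\<dots> = (1 + 2 * B1 / c) ^ r * (1 / u) ^ r" by (rule power_mult_distrib)
      also have "\<dots> \<le> (1 + 2 * B1 / c) ^ r * real m" using inv_u B1 c_pos by (intro mult_left_mono) auto
      finally show ?thesis .
    qed
    \<comment> \<open>On the exceptional set only powers of \<open>m\<close> are lost, which \<open>\<beta>\<^sup>m\<close> absorbs.\<close>
    have t2: "2 * real m * \<beta> ^ m / c * (1 + 1 / (real (N m) * (c * \<rho> m ^ d))) ^ r \<le> 1"
    proof -
      have "1 + 1 / (real (N m) * (c * \<rho> m ^ d)) = 1 + real m / c * (1 / n)" using m1[OF gm] by (simp add: n_def)
      also have "\<dots> \<le> real m / u + real m / c * (B1 / u)"
        using un u c_pos m1[OF gm] by (intro add_mono mult_left_mono) (auto simp: le_divide_eq)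
      also have "\<dots> = (1 + B1 / c) * real m * (1 / u)" by (simp add: algebra_simps add_divide_distrib)
      finally have "(1 + 1 / (real (N m) * (c * \<rho> m ^ d))) ^ r \<le> ((1 + B1 / c) * real m * (1 / u)) ^ r"
        using c_pos rh[of m] by (intro power_mono) auto
      also have "\<dots> = (1 + B1 / c) ^ r * real m ^ r * (1 / u) ^ r" by (simp only: power_mult_distrib)
      also have "\<dots> \<le> (1 + B1 / c) ^ r * real m ^ r * real m" using inv_u B1 c_pos by (intro mult_left_mono) auto
      finally have "2 * real m * \<beta> ^ m / c * (1 + 1 / (real (N m) * (c * \<rho> m ^ d))) ^ r
          \<le> 2 * real m * \<beta> ^ m / c * ((1 + B1 / c) ^ r * real m ^ r * real m)"
        using \<beta> c_pos by (intro mult_left_mono) auto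
      also have "\<dots> = 2 / c * (1 + B1 / c) ^ r * real m ^ (r + 2) * \<beta> ^ m" by (simp add: power2_eq_square power_add)
      also have "\<dots> \<le> 1" using gm by (simp add: good_def)
      finally show ?thesis .
    qed
    have t3: "mixing_const * \<theta> ^ s m * (2 * \<Gamma> ^ m * \<Gamma> ^ m) ^ (2 * r + 2) \<le> mixing_const"
    proof -
      have "2 * \<Gamma> ^ m * \<Gamma> ^ m \<le> (2 * \<Gamma> * \<Gamma>) ^ m"
      proof -
        have "(2::real) \<le> 2 ^ m" using m1[OF gm] by (intro self_le_power) auto
        then have "2 * (\<Gamma> ^ m * \<Gamma> ^ m) \<le> 2 ^ m * (\<Gamma> ^ m * \<Gamma> ^ m)" using \<Gamma> by (intro mult_right_mono) auto
        then show ?thesis by (simp add: power_mult_distrib mult_ac)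
      qed
      then have "(2 * \<Gamma> ^ m * \<Gamma> ^ m) ^ q \<le> ((2 * \<Gamma> * \<Gamma>) ^ m) ^ q" using \<Gamma> by (intro power_mono) auto
      then have "\<theta> ^ s m * (2 * \<Gamma> ^ m * \<Gamma> ^ m) ^ q \<le> (\<theta> ^ P) ^ m * ((2 * \<Gamma> * \<Gamma>) ^ m) ^ q"
        using \<theta>_pos by (simp add: s_def power_mult mult_left_mono)
      also have "\<dots> = (\<theta> ^ P * (2 * \<Gamma> * \<Gamma>) ^ q) ^ m"
        by (simp only: power_mult_distrib power_mult[symmetric] mult.commute)
      also have "\<dots> \<le> 1"
      proof (rule power_le_one)
        have "0 < (2 * \<Gamma> * \<Gamma>) ^ q" using \<Gamma> by simp
        then show "\<theta> ^ P * (2 * \<Gamma> * \<Gamma>) ^ q \<le> 1" using P by (simp add: field_simps)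
        show "0 \<le> \<theta> ^ P * (2 * \<Gamma> * \<Gamma>) ^ q" using \<theta>_pos \<Gamma> by simp
      qed
      finally have "mixing_const * (\<theta> ^ s m * (2 * \<Gamma> ^ m * \<Gamma> ^ m) ^ q) \<le> mixing_const * 1"
        using mixing_const_nonneg by (intro mult_left_mono) auto
      then show ?thesis by (simp only: q_def mult.assoc mult_1_right)
    qed
    have "(\<integral>y. (X m y)\<^sup>2 \<partial>\<mu>) \<le> (\<integral>y. (1 + 1 / hit_prob (\<rho> m) m (b y) / real (N m)) ^ r \<partial>\<mu>)
        + mixing_const * \<theta> ^ s m * (2 * \<Gamma> ^ m * \<Gamma> ^ m) ^ (2 * r + 2)"
      unfolding X_def
    proof (rule tuple_average_second_moment[OF spread[OF gm] lipm \<Gamma>m b _ _ _ _ Ub])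
      show "(\<lambda>y. 1 / hit_prob (\<rho> m) m (b y)) \<in> borel_measurable \<mu>" by measurable
    qed (use normalised_hit_nonneg normalised_hit_integral normalised_hit_square_integral rh m1[OF gm] in auto)
    also have "(\<integral>y. (1 + 1 / hit_prob (\<rho> m) m (b y) / real (N m)) ^ r \<partial>\<mu>)
        \<le> (1 + 2 / (real (N m) * real m * (c * \<rho> m ^ d))) ^ r
          + 2 * real m * \<beta> ^ m / c * (1 + 1 / (real (N m) * (c * \<rho> m ^ d))) ^ r"
    proof (rule inverse_hit_prob_moment[OF rh m1[OF gm] N1 b])
      fix l assume "l \<in> {1..m}"
      moreover have "m \<le> m\<^sup>2" using m1[OF gm] by (simp add: power2_eq_square)
      ultimately show "(\<integral>y. pair_rate (\<rho> m) l (b y) \<partial>\<mu>) \<le> \<beta> ^ m * \<rho> m ^ d" using gm by (auto simp: good_def)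
    qed
    finally have "(\<integral>y. (X m y)\<^sup>2 \<partial>\<mu>) \<le> (1 + 2 * B1 / c) ^ r * real m + 1 + mixing_const"
      using t1 t2 t3 by linarith
    also have "\<dots> \<le> (1 + 2 * B1 / c) ^ r * real m + 1 * real m + mixing_const * real m"
      using m1[OF gm] mixing_const_nonneg mult_left_mono[of 1 "real m" mixing_const] by (intro add_mono) auto
    finally show ?thesis by (simp add: A0_def algebra_simps)
  qed
  define \<delta> where "\<delta> = \<sigma> + 1"
  \<comment> \<open>At bad scales the function is set to \<open>0\<close>, so that it is bounded and measurable for every \<open>j\<close>.\<close>
  define X' where "X' j = (if good (\<delta> * j) then X (\<delta> * j) else (\<lambda>_. 0))" for j
  have nonnegX: "0 \<le> X m y" if "good m" for m y
    unfolding X_def using m1[OF that] by (intro tuple_average_nonneg normalised_hit_nonneg rh)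
  have "AE y in \<mu>. \<exists>\<^sub>F j in sequentially. 0 < X' j y"
  proof (rule second_moment_frequently)
    fix j
    show "X' j \<in> borel_measurable \<mu>"
      unfolding X'_def using Xlip dlip_measurable unfolding lip1_def by auto
    show "0 \<le> X' j y" for y unfolding X'_def using nonnegX by simp
    show "\<exists>B. \<forall>y. X' j y \<le> B"
      unfolding X'_def using Xlip[of "\<delta> * j"] unfolding lip1_def by (auto simp: abs_le_iff)
  next
    fix \<epsilon> :: real assume \<epsilon>: "0 < \<epsilon>"
    have "(\<lambda>m. mixing_const * (1 / 2) ^ m) \<longlonglongrightarrow> 0"
      by (intro tendsto_mult_right_zero LIMSEQ_power_zero) auto
    then have "\<forall>\<^sub>F m in sequentially. mixing_const * (1 / 2) ^ m < \<epsilon> / 2"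
      using \<epsilon> by (intro order_tendstoD) auto
    then obtain M\<^sub>1 where M\<^sub>1: "\<And>m. M\<^sub>1 \<le> m \<Longrightarrow> mixing_const * (1 / 2) ^ m < \<epsilon> / 2"
      unfolding eventually_sequentially by blast
    have \<delta>j: "j \<le> \<delta> * j" for j by (simp add: \<delta>_def)
    have m1': "\<bar>(\<integral>y. X m y \<partial>\<mu>) - 1\<bar> \<le> mixing_const * (1 / 2) ^ m" if "good m" for m
    proof -
      have "lip1 (\<Gamma>\<^sub>1 ^ (2 ^ (m - \<sigma>))) (\<lambda>_. 1)" using \<Gamma>\<^sub>1 by (intro lip1_const) auto
      from mean[OF that this] show ?thesis by simp
    qed
    show "\<forall>\<^sub>F n in sequentially. \<forall>j\<ge>n. \<bar>expectation (X' j) - 1\<bar> \<le> \<epsilon> \<and>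
        expectation (\<lambda>y. (X' j y)\<^sup>2) \<le> (A0 * \<delta>) * real j \<and>
        (\<forall>i. n \<le> i \<and> i < j \<longrightarrow> expectation (\<lambda>y. X' i y * X' j y) \<le> 1 + \<epsilon>)"
      unfolding eventually_sequentially
    proof (intro exI[of _ "max M\<^sub>0 M\<^sub>1"] allI impI conjI)
      fix n j assume n: "max M\<^sub>0 M\<^sub>1 \<le> n" "n \<le> j"
      have "M\<^sub>0 \<le> \<delta> * j" "M\<^sub>1 \<le> \<delta> * j" using n order_trans[OF _ \<delta>j[of j]] by auto
      then have gj: "good (\<delta> * j)" "M\<^sub>1 \<le> \<delta> * j" using M\<^sub>0 by blast+
      have X'j: "X' j = X (\<delta> * j)" using gj by (simp add: X'_def)
      show "\<bar>expectation (X' j) - 1\<bar> \<le> \<epsilon>" unfolding X'j using m1'[OF gj(1)] M\<^sub>1[OF gj(2)] \<epsilon> by linarith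
      show "expectation (\<lambda>y. (X' j y)\<^sup>2) \<le> (A0 * \<delta>) * real j" unfolding X'j using second[OF gj(1)] by (simp add: mult_ac)
      fix i assume i: "n \<le> i \<and> i < j"
      have "M\<^sub>0 \<le> \<delta> * i" "M\<^sub>1 \<le> \<delta> * i" using n i order_trans[OF _ \<delta>j[of i]] by auto
      then have gi: "good (\<delta> * i)" "M\<^sub>1 \<le> \<delta> * i" using M\<^sub>0 by blast+
      have X'i: "X' i = X (\<delta> * i)" using gi by (simp add: X'_def)
      have "\<delta> * i + \<delta> \<le> \<delta> * j"
      proof -
        have "\<delta> * (i + 1) \<le> \<delta> * j" using i by (intro mult_le_mono2) auto
        then show ?thesis by simp
      qed
      then have "\<delta> * i \<le> \<delta> * j - \<sigma>" by (simp add: \<delta>_def)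
      then have "(2::nat) ^ (\<delta> * i) \<le> 2 ^ (\<delta> * j - \<sigma>)" by (intro power_increasing) auto
      then have le: "\<Gamma>\<^sub>1 ^ (2 ^ (\<delta> * i)) \<le> \<Gamma>\<^sub>1 ^ (2 ^ (\<delta> * j - \<sigma>))" using \<Gamma>\<^sub>1 by (intro power_increasing) auto
      have "lip1 (\<Gamma>\<^sub>1 ^ (2 ^ (\<delta> * j - \<sigma>))) (X (\<delta> * i))"
        using Xlip[OF gi(1)] le unfolding lip1_def dlip_def by (meson D_nonneg mult_right_mono order_trans)
      from mean[OF gj(1) this] m1'[OF gi(1)] M\<^sub>1[OF gi(2)] M\<^sub>1[OF gj(2)]
      show "expectation (\<lambda>y. X' i y * X' j y) \<le> 1 + \<epsilon>" unfolding X'i X'j by linarith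
    qed
  qed
  then show ?thesis
  proof (rule AE_mp, intro AE_I2 impI)
    fix y assume fr: "\<exists>\<^sub>F j in sequentially. 0 < X' j y"
    \<comment> \<open>A positive product has a hit block in every window. The windows are disjoint, so the visits happen at \<open>r\<close> different times.\<close>
    have visits: "r \<le> card {k \<in> {1..2 ^ (m + 1)}. D (b y) ((f ^^ k) y) \<le> 2 * \<rho> m}" if gm: "good m" and X: "0 < X m y" for m
    proof -
      have "\<exists>k. i < r \<longrightarrow> (\<exists>k0\<in>J m i. k0 \<le> k \<and> k < k0 + m) \<and> D (b y) ((f ^^ k) y) \<le> 2 * \<rho> m" for i
      proof (cases "i < r")
        case True
        have nn: "0 \<le> normalised_hit (\<rho> m) m x z" for x z using rh m1[OF gm] by (intro normalised_hit_nonneg)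
        obtain k0 where k0: "k0 \<in> J m i" "0 < normalised_hit (\<rho> m) m (b y) ((f ^^ k0) y)"
          using tuple_average_pos[OF X[unfolded X_def] nn True] by blast
        then have "0 < hit (\<rho> m) m (b y) ((f ^^ k0) y)"
          using hit_prob_pos[OF rh(1)[of m] rh(2)[of m] m1[OF gm], of "b y"] by (simp add: normalised_hit_def zero_less_divide_iff)
        then obtain l where l: "l < m" "D (b y) ((f ^^ l) ((f ^^ k0) y)) \<le> 2 * \<rho> m"
          using hit_pos[OF rh(1)] by blast
        have "(f ^^ (k0 + l)) y = (f ^^ l) ((f ^^ k0) y)" by (metis add.commute comp_apply funpow_add)
        then show ?thesis using l k0 by (intro exI[of _ "k0 + l"] impI conjI bexI[of _ k0]) auto
      qed auto
      then obtain k where k: "\<And>i. i < r \<Longrightarrow> (\<exists>k0\<in>J m i. k0 \<le> k i \<and> k i < k0 + m) \<and> D (b y) ((f ^^ k i) y) \<le> 2 * \<rho> m"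
        by metis
      have Ns: "N m * s m \<le> w m" by (simp add: N_def)
      have ms: "m \<le> s m" using P1 by (simp add: s_def)
      have loc: "2 ^ m + 2 * i * w m \<le> k i" "k i < 2 ^ m + 2 * i * w m + w m" if i: "i < r" for i
      proof -
        obtain k0 where k0: "k0 \<in> J m i" "k0 \<le> k i" "k i < k0 + m" using k[OF i] by blast
        note lb = lattice_times_bounds[OF Ns k0(1)[unfolded J_def]]
        show "2 ^ m + 2 * i * w m \<le> k i" "k i < 2 ^ m + 2 * i * w m + w m" using lb k0 ms by linarith+
      qed
      have less: "k i < k i'" if "i < i'" "i' < r" for i i'
      proof -
        have "(i + 1) * (2 * w m) \<le> i' * (2 * w m)" using that(1) by (intro mult_le_mono1) auto
        then have "2 * i * w m + w m \<le> 2 * i' * w m" by (simp add: algebra_simps)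
        then show ?thesis using loc(2)[of i] loc(1)[of i'] that by linarith
      qed
      have inj: "inj_on k {..<r}"
      proof (rule inj_onI)
        fix i i' assume "i \<in> {..<r}" "i' \<in> {..<r}" "k i = k i'"
        then show "i = i'" using less[of i i'] less[of i' i] by (cases i i' rule: linorder_cases) auto
      qed
      have "k ` {..<r} \<subseteq> {k \<in> {1..2 ^ (m + 1)}. D (b y) ((f ^^ k) y) \<le> 2 * \<rho> m}"
      proof safe
        fix i assume i: "i < r"
        obtain k0 where k0: "k0 \<in> J m i" "k0 \<le> k i" "k i < k0 + m" using k[OF i] by blast
        show "k i \<in> {1..2 ^ (m + 1)}" using times[OF gm i k0(1)] k0 by auto
        show "D (b y) ((f ^^ k i) y) \<le> 2 * \<rho> m" using k[OF i] by blast
      qed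
      then have "card (k ` {..<r}) \<le> card {k \<in> {1..2 ^ (m + 1)}. D (b y) ((f ^^ k) y) \<le> 2 * \<rho> m}"
        by (intro card_mono) auto
      then show ?thesis using card_image[OF inj] by simp
    qed
    show "\<exists>\<^sub>F m in sequentially. r \<le> card {k \<in> {1..2 ^ (m + 1)}. D (b y) ((f ^^ k) y) \<le> 2 * \<rho> m}"
      unfolding frequently_sequentially
    proof
      fix n
      obtain j where j: "n \<le> j" "0 < X' j y" using fr unfolding frequently_sequentially by blast
      then have "good (\<delta> * j)" "0 < X (\<delta> * j) y" by (auto simp: X'_def split: if_splits)
      moreover have "n \<le> \<delta> * j" using j(1) by (simp add: \<delta>_def trans_le_add1)
      ultimately show "\<exists>m\<ge>n. r \<le> card {k \<in> {1..2 ^ (m + 1)}. D (b y) ((f ^^ k) y) \<le> 2 * \<rho> m}"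
        using visits by blast
    qed
  qed
qed

end

section \<open>From visits to the growth of order statistics\<close>

lemma sorted_nth_le_iff:
  fixes ys :: "'b::linorder list"
  assumes "sorted ys" "1 \<le> r" "r \<le> length ys"
  shows "ys ! (r - 1) \<le> t \<longleftrightarrow> r \<le> length (filter (\<lambda>x. x \<le> t) ys)"
proof
  assume t: "ys ! (r - 1) \<le> t"
  have "x \<le> t" if x: "x \<in> set (take r ys)" for x
  proof -
    obtain i where i: "i < r" "x = ys ! i" using x assms(3) by (auto simp: in_set_conv_nth)
    then have "x \<le> ys ! (r - 1)" using sorted_nth_mono[OF assms(1), of i "r - 1"] assms by auto
    then show ?thesis using t by simp
  qed
  then have "filter (\<lambda>x. x \<le> t) (take r ys) = take r ys" by simp
  then have "r = length (filter (\<lambda>x. x \<le> t) (take r ys))" using assms(3) by simp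
  also have "\<dots> \<le> length (filter (\<lambda>x. x \<le> t) (take r ys)) + length (filter (\<lambda>x. x \<le> t) (drop r ys))" by simp
  also have "\<dots> = length (filter (\<lambda>x. x \<le> t) ys)"
    by (metis append_take_drop_id filter_append length_append)
  finally show "r \<le> length (filter (\<lambda>x. x \<le> t) ys)" .
next
  assume r: "r \<le> length (filter (\<lambda>x. x \<le> t) ys)"
  show "ys ! (r - 1) \<le> t"
  proof (rule ccontr)
    assume t: "\<not> ys ! (r - 1) \<le> t"
    have "\<not> x \<le> t" if "x \<in> set (drop (r - 1) ys)" for x
    proof -
      obtain i where i': "i < length (drop (r - 1) ys)" "x = drop (r - 1) ys ! i"
        using \<open>x \<in> set (drop (r - 1) ys)\<close> unfolding in_set_conv_nth by blast
      then have i: "r - 1 + i < length ys" "x = ys ! (r - 1 + i)" using assms(3) by auto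
      then have "ys ! (r - 1) \<le> x" using sorted_nth_mono[OF assms(1), of "r - 1" "r - 1 + i"] by auto
      then show ?thesis using t by auto
    qed
    then have "filter (\<lambda>x. x \<le> t) (drop (r - 1) ys) = []" by (simp add: filter_empty_conv)
    then have "length (filter (\<lambda>x. x \<le> t) ys) = length (filter (\<lambda>x. x \<le> t) (take (r - 1) ys))"
      by (metis append_Nil2 append_take_drop_id filter_append)
    also have "\<dots> \<le> length (take (r - 1) ys)" by (rule length_filter_le)
    also have "\<dots> \<le> r - 1" by simp
    finally show False using r assms(2) by linarith
  qed
qed

lemma order_statistic_le_iff:
  fixes a :: "nat \<Rightarrow> 'b::linorder"
  assumes "1 \<le> r" "r \<le> n"
  shows "sort (map a [1..<Suc n]) ! (r - 1) \<le> t \<longleftrightarrow> r \<le> card {k \<in> {1..n}. a k \<le> t}"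
proof -
  have "sort (map a [1..<Suc n]) ! (r - 1) \<le> t \<longleftrightarrow>
      r \<le> length (filter (\<lambda>x. x \<le> t) (sort (map a [1..<Suc n])))"
    using assms by (intro sorted_nth_le_iff) auto
  also have "length (filter (\<lambda>x. x \<le> t) (sort (map a [1..<Suc n])))
      = length (filter (\<lambda>x. x \<le> t) (map a [1..<Suc n]))"
    by (simp only: filter_sort length_sort)
  also have "\<dots> = length (filter (\<lambda>k. a k \<le> t) [1..<Suc n])" by (simp add: filter_map comp_def del: upt_Suc)
  also have "\<dots> = card (set (filter (\<lambda>k. a k \<le> t) [1..<Suc n]))" by (intro distinct_card[symmetric]) auto
  also have "set (filter (\<lambda>k. a k \<le> t) [1..<Suc n]) = {k \<in> {1..n}. a k \<le> t}" by auto
  finally show ?thesis .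
qed

text \<open>
  Purely deterministic. If \<open>2\<^sup>m \<le> n < 2\<^bsup>m+1\<^esup>\<close>, fewer than \<open>r\<close> values below \<open>\<rho> s m / K\<close> up to time \<open>2\<^bsup>m+1\<^esup>\<close> bound
  the order statistic at time \<open>n\<close> from below, and \<open>r\<close> values below \<open>K \<rho> s m\<close> bound it from above at time
  \<open>n = 2\<^bsup>m+1\<^esup>\<close>. The number \<open>ln n\<close> differs from \<open>m ln 2\<close> by at most \<open>ln 2\<close>, and \<open>ln K\<close> is bounded, so only \<open>s ln m\<close>
  survives division by \<open>ln ln n\<close>. For the upper limit, a sequence of exponents decreasing to \<open>s\<^sub>0\<close> is enough.
\<close>
lemma limsup_order_statistic:
  fixes a :: "nat \<Rightarrow> ennreal" and \<rho> :: "real \<Rightarrow> nat \<Rightarrow> real"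
  assumes d: "0 < d" and s\<^sub>0: "0 < s\<^sub>0" and r: "1 \<le> r" and K: "0 < K"
    and \<rho>: "\<And>s m. \<rho> s m = 2 powr (- (real m / d)) * real (max 1 m) powr (- s)"
    and few: "\<And>j. \<forall>\<^sub>F m in sequentially.
      card {k \<in> {1..2 ^ (m + 1)}. a k \<le> ennreal (\<rho> (s\<^sub>0 + 1 / real (Suc j)) m / K)} < r"
    and many: "\<exists>\<^sub>F m in sequentially. r \<le> card {k \<in> {1..2 ^ (m + 1)}. a k \<le> ennreal (K * \<rho> s\<^sub>0 m)}"
  shows "limsup (\<lambda>n. ereal ((\<bar>ln (enn2real (sort (map a [1..<Suc n]) ! (r - 1)))\<bar>
      - 1 / d * ln (real n)) / ln (ln (real n)))) = ereal s\<^sub>0"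
proof -
  define S where "S n = sort (map a [1..<Suc n]) ! (r - 1)" for n
  define \<phi> where "\<phi> n = (\<bar>ln (enn2real (S n))\<bar> - 1 / d * ln (real n)) / ln (ln (real n))" for n
  have S_iff: "S n \<le> t \<longleftrightarrow> r \<le> card {k \<in> {1..n}. a k \<le> t}" if "r \<le> n" for n t
    unfolding S_def using order_statistic_le_iff[OF r that] .
  have S_anti: "S n' \<le> S n" if "r \<le> n" "n \<le> n'" for n n'
  proof -
    have "r \<le> card {k \<in> {1..n}. a k \<le> S n}" using S_iff[OF that(1)] by blast
    also have "\<dots> \<le> card {k \<in> {1..n'}. a k \<le> S n}" using that by (intro card_mono) auto
    finally show ?thesis using S_iff[of n' "S n"] that by simp
  qed
  have \<rho>_pos: "0 < \<rho> s m" for s m by (simp add: \<rho>)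
  have ln\<rho>: "ln (\<rho> s m) = - (real m / d * ln 2) - s * ln (real m)" if "1 \<le> m" for s m
    using that by (simp add: \<rho> ln_mult ln_powr max_def)
  have big: "r \<le> 2 ^ (m + 1)" if "r \<le> m" for m
    using that less_exp[of "m + 1"] by linarith
  \<comment> \<open>The statistic tends to \<open>0\<close>, hence it is eventually at most \<open>1\<close>.\<close>
  have ev1: "\<forall>\<^sub>F n in sequentially. S n \<le> 1"
  proof -
    have "(\<lambda>m. K * (2 powr (- (real m / d)) * real m powr (- s\<^sub>0))) \<longlonglongrightarrow> 0"
      using d s\<^sub>0 by real_asymp
    then have "\<forall>\<^sub>F m in sequentially. K * (2 powr (- (real m / d)) * real m powr (- s\<^sub>0)) < 1"
      by (rule order_tendstoD) simp
    then have "\<forall>\<^sub>F m in sequentially. K * \<rho> s\<^sub>0 m < 1 \<and> r \<le> m"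
      using eventually_ge_at_top[of 1] eventually_ge_at_top[of r]
      by eventually_elim (simp add: \<rho> max_absorb2)
    then obtain m where m: "r \<le> card {k \<in> {1..2 ^ (m + 1)}. a k \<le> ennreal (K * \<rho> s\<^sub>0 m)}" "K * \<rho> s\<^sub>0 m < 1" "r \<le> m"
      using frequently_ex[OF frequently_eventually_conj[OF many]] by blast
    have "S (2 ^ (m + 1)) \<le> ennreal (K * \<rho> s\<^sub>0 m)" using m S_iff[OF big] by blast
    also have "\<dots> \<le> 1" using m(2) by (metis ennreal_1 ennreal_leI less_imp_le)
    finally have S1: "S (2 ^ (m + 1)) \<le> 1" .
    show ?thesis
      using eventually_ge_at_top[of "2 ^ (m + 1) :: nat"]
    proof (eventually_elim)
      case (elim n)
      then show ?case using S_anti[OF big[OF m(3)], of n] S1 by (meson order_trans)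
    qed
  qed
  have lower: "\<forall>\<^sub>F m in sequentially. ennreal (\<rho> (s\<^sub>0 + 1 / real (Suc j)) m / K) < S (2 ^ (m + 1))" for j
    using few[of j] eventually_ge_at_top[of r]
  proof eventually_elim
    case (elim m)
    then show ?case using S_iff[OF big, of m] by (metis not_le)
  qed
  have upper_bound: "limsup (\<lambda>n. ereal (\<phi> n)) \<le> ereal (s\<^sub>0 + 1 / real (Suc j) + \<epsilon>)" if \<epsilon>: "0 < \<epsilon>" for j \<epsilon>
  proof (rule Limsup_bounded)
    define s where "s = s\<^sub>0 + 1 / real (Suc j)"
    have s: "0 < s" using s\<^sub>0 by (simp add: s_def add_pos_pos)
    define \<psi> where "\<psi> m = (s * ln (real m) + ln K) / ln (real m * ln 2)" for m
    have "\<psi> \<longlonglongrightarrow> s" unfolding \<psi>_def using s by real_asymp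
    then have e1: "\<forall>\<^sub>F m in sequentially. \<psi> m < s + \<epsilon>" using \<epsilon> by (intro order_tendstoD) auto
    have e2: "\<forall>\<^sub>F m in sequentially. 0 < ln (real m * ln 2)" by real_asymp
    have e3: "\<forall>\<^sub>F m in sequentially. 0 \<le> s * ln (real m) + ln K" using s by real_asymp
    have "\<forall>\<^sub>F m in sequentially. \<psi> m < s + \<epsilon> \<and> 0 < ln (real m * ln 2) \<and> 0 \<le> s * ln (real m) + ln K \<and>
        ennreal (\<rho> s m / K) < S (2 ^ (m + 1)) \<and> r \<le> m \<and> 1 \<le> m"
      using e1 e2 e3 lower[of j] eventually_ge_at_top[of r] eventually_ge_at_top[of 1]
      by eventually_elim (simp add: s_def)
    then obtain M where M: "\<And>m. M \<le> m \<Longrightarrow> \<psi> m < s + \<epsilon> \<and> 0 < ln (real m * ln 2) \<and> 0 \<le> s * ln (real m) + ln K \<and>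
        ennreal (\<rho> s m / K) < S (2 ^ (m + 1)) \<and> r \<le> m \<and> 1 \<le> m"
      unfolding eventually_sequentially by blast
    show "\<forall>\<^sub>F n in sequentially. ereal (\<phi> n) \<le> ereal (s\<^sub>0 + 1 / real (Suc j) + \<epsilon>)"
      using ev1 eventually_ge_at_top[of "2 ^ M :: nat"]
    proof eventually_elim
      case (elim n)
      have "1 \<le> n" using elim(2) by (metis one_le_numeral one_le_power order_trans)
      then obtain m where m: "2 ^ m \<le> n" "n < 2 ^ (m + 1)"
        using ex_power_ivl1[of 2 n] by auto
      have "M \<le> m"
      proof (rule ccontr)
        assume "\<not> M \<le> m"
        then have "(2::nat) ^ (m + 1) \<le> 2 ^ M" by (intro power_increasing) auto
        then show False using m elim by simp
      qed
      note Mm = M[OF this]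
      have rn: "r \<le> n" using Mm m(1) less_exp[of m] by linarith
      have lo: "ennreal (\<rho> s m / K) < S n" using Mm S_anti[OF rn, of "2 ^ (m + 1)"] m(2)
        by (meson less_imp_le less_le_trans)
      have fin: "S n \<noteq> \<infinity>" using elim(1) by (auto simp: top_unique)
      define D where "D = enn2real (S n)"
      have SD: "S n = ennreal D" using fin by (simp add: D_def less_top)
      have D: "\<rho> s m / K < D" "D \<le> 1"
      proof -
        show "\<rho> s m / K < D"
          using lo \<rho>_pos[of s m] K unfolding SD by (subst (asm) ennreal_less_iff) auto
        show "D \<le> 1" using elim(1) unfolding SD by simp
      qed
      have pos: "0 < \<rho> s m / K" using \<rho>_pos K by simp
      have "- ln D \<le> - ln (\<rho> s m / K)" using D pos by (simp add: ln_mono)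
      also have "ln (\<rho> s m / K) = ln (\<rho> s m) - ln K" using \<rho>_pos[of s m] K by (simp add: ln_div)
      also have "- (ln (\<rho> s m) - ln K) = real m / d * ln 2 + s * ln (real m) + ln K" using ln\<rho>[of m s] Mm by simp
      finally have "- ln D \<le> real m / d * ln 2 + s * ln (real m) + ln K" .
      moreover have "ln D \<le> 0" using D pos less_trans[OF pos D(1)] by simp
      ultimately have 1: "\<bar>ln D\<bar> \<le> real m / d * ln 2 + s * ln (real m) + ln K" by linarith
      have mn: "real m * ln 2 \<le> ln (real n)"
      proof -
        have "real (2 ^ m) \<le> real n" using m(1) of_nat_le_iff by blast
        then have "ln (2 ^ m) \<le> ln (real n)" by (intro ln_mono) auto
        then show ?thesis by (simp add: ln_realpow)
      qed
      have "1 / d * (real m * ln 2) \<le> 1 / d * ln (real n)" using mn d by (intro mult_left_mono) auto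
      then have 2: "\<bar>ln D\<bar> - 1 / d * ln (real n) \<le> s * ln (real m) + ln K" using 1 by simp
      have lm: "0 < real m * ln 2" using Mm by simp
      have 3: "ln (real m * ln 2) \<le> ln (ln (real n))" using lm mn by (intro ln_mono) auto
      have "\<phi> n \<le> (s * ln (real m) + ln K) / ln (ln (real n))"
        unfolding \<phi>_def D_def[symmetric] using 2 3 Mm by (intro divide_right_mono) auto
      also have "\<dots> \<le> \<psi> m" unfolding \<psi>_def using 3 Mm by (intro divide_left_mono) auto
      also have "\<dots> \<le> s + \<epsilon>" using Mm by simp
      finally show ?case by (simp add: s_def)
    qed
  qed
  have lower_bound: "ereal (s\<^sub>0 - \<epsilon>) \<le> limsup (\<lambda>n. ereal (\<phi> n))" if \<epsilon>: "0 < \<epsilon>" for \<epsilon>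
  proof (rule ccontr)
    assume "\<not> ?thesis"
    then have "limsup (\<lambda>n. ereal (\<phi> n)) < ereal (s\<^sub>0 - \<epsilon>)" by simp
    then have "\<forall>\<^sub>F n in sequentially. ereal (\<phi> n) < ereal (s\<^sub>0 - \<epsilon>)" by (rule Limsup_lessD)
    then obtain N where N: "\<And>n. N \<le> n \<Longrightarrow> \<phi> n < s\<^sub>0 - \<epsilon>" unfolding eventually_sequentially by auto
    define \<psi> where "\<psi> m = (s\<^sub>0 * ln (real m) - ln K - 1 / d * ln 2) / ln (real (m + 1) * ln 2)" for m
    have "\<psi> \<longlonglongrightarrow> s\<^sub>0" unfolding \<psi>_def using s\<^sub>0 by real_asymp
    then have e1: "\<forall>\<^sub>F m in sequentially. s\<^sub>0 - \<epsilon> < \<psi> m" using \<epsilon> by (intro order_tendstoD) auto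
    have e2: "\<forall>\<^sub>F m in sequentially. 0 < ln (real (m + 1) * ln 2)" by real_asymp
    have "\<forall>\<^sub>F m in sequentially. s\<^sub>0 - \<epsilon> < \<psi> m \<and> 0 < ln (real (m + 1) * ln 2) \<and>
        ennreal (\<rho> (s\<^sub>0 + 1 / real (Suc 0)) m / K) < S (2 ^ (m + 1)) \<and> r \<le> m \<and> 1 \<le> m \<and> N \<le> m"
      using e1 e2 lower[of 0] eventually_ge_at_top[of N] eventually_ge_at_top[of r] eventually_ge_at_top[of 1]
      by eventually_elim simp
    then obtain m where m: "s\<^sub>0 - \<epsilon> < \<psi> m" "0 < ln (real (m + 1) * ln 2)"
        "ennreal (\<rho> (s\<^sub>0 + 1 / real (Suc 0)) m / K) < S (2 ^ (m + 1))" "r \<le> m" "1 \<le> m" "N \<le> m"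
        "r \<le> card {k \<in> {1..2 ^ (m + 1)}. a k \<le> ennreal (K * \<rho> s\<^sub>0 m)}"
      using frequently_ex[OF frequently_eventually_conj[OF many]] by blast
    define n where "n = (2::nat) ^ (m + 1)"
    have "S n \<le> ennreal (K * \<rho> s\<^sub>0 m)" using m S_iff[OF big] unfolding n_def by blast
    define D where "D = enn2real (S n)"
    have fin: "S n \<noteq> \<infinity>" using \<open>S n \<le> _\<close> by (auto simp: top_unique)
    have SD: "S n = ennreal D" using fin by (simp add: D_def less_top)
    have D: "0 < D" "D \<le> K * \<rho> s\<^sub>0 m"
    proof -
      have "0 < S n" using m(3) unfolding n_def by (meson le_less_trans zero_le)
      then show "0 < D" unfolding SD by simp
      show "D \<le> K * \<rho> s\<^sub>0 m" using \<open>S n \<le> _\<close> K \<rho>_pos[of s\<^sub>0 m] unfolding SD by (simp add: ennreal_le_iff)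
    qed
    have "ln D \<le> ln (K * \<rho> s\<^sub>0 m)" using D by (intro ln_mono) auto
    also have "\<dots> = ln K + ln (\<rho> s\<^sub>0 m)" using K \<rho>_pos[of s\<^sub>0 m] by (simp add: ln_mult)
    also have "ln (\<rho> s\<^sub>0 m) = - (real m / d * ln 2) - s\<^sub>0 * ln (real m)" using m by (intro ln\<rho>)
    finally have 1: "real m / d * ln 2 + s\<^sub>0 * ln (real m) - ln K \<le> \<bar>ln D\<bar>" by simp
    have "ln (real n) = ln (2 ^ (m + 1))" by (simp add: n_def)
    also have "\<dots> = real (m + 1) * ln 2" by (rule ln_realpow)
    finally have lnn: "ln (real n) = real (m + 1) * ln 2" .
    have "s\<^sub>0 * ln (real m) - ln K - 1 / d * ln 2 \<le> \<bar>ln D\<bar> - 1 / d * ln (real n)"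
      using 1 unfolding lnn by (simp add: algebra_simps add_divide_distrib)
    then have "\<psi> m \<le> \<phi> n"
      unfolding \<psi>_def \<phi>_def D_def[symmetric] lnn using m(2) by (intro divide_right_mono) auto
    moreover have "N \<le> n" using m(6) less_exp[of "m + 1"] unfolding n_def by linarith
    ultimately show False using m(1) N[of n] by simp
  qed
  have le: "limsup (\<lambda>n. ereal (\<phi> n)) \<le> ereal s\<^sub>0"
  proof (rule ereal_le_epsilon2)
    fix \<epsilon> :: real assume \<epsilon>: "0 < \<epsilon>"
    obtain j where j: "1 / real (Suc j) < \<epsilon> / 2" using nat_approx_posE[of "\<epsilon> / 2"] \<epsilon> by auto
    have "limsup (\<lambda>n. ereal (\<phi> n)) \<le> ereal (s\<^sub>0 + 1 / real (Suc j) + \<epsilon> / 2)" using \<epsilon> by (intro upper_bound) auto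
    also have "\<dots> \<le> ereal s\<^sub>0 + ereal \<epsilon>" using j by simp
    finally show "limsup (\<lambda>n. ereal (\<phi> n)) \<le> ereal s\<^sub>0 + ereal \<epsilon>" .
  qed
  have ge: "ereal s\<^sub>0 \<le> limsup (\<lambda>n. ereal (\<phi> n))"
  proof (rule ereal_le_epsilon2)
    fix \<epsilon> :: real assume \<epsilon>: "0 < \<epsilon>"
    have "ereal (s\<^sub>0 - \<epsilon>) + ereal \<epsilon> \<le> limsup (\<lambda>n. ereal (\<phi> n)) + ereal \<epsilon>"
      using lower_bound[OF \<epsilon>] by (intro add_right_mono)
    then show "ereal s\<^sub>0 \<le> limsup (\<lambda>n. ereal (\<phi> n)) + ereal \<epsilon>" by simp
  qed
  show ?thesis using le ge unfolding \<phi>_def S_def by (rule antisym)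
qed

context mixing_system
begin

definition log_radius :: "real \<Rightarrow> nat \<Rightarrow> real" where
  "log_radius s m = 2 powr (- (real m / real d)) * real (max 1 m) powr (- s)"

text \<open>
  The expected number of visits among \<open>2\<^sup>m\<close> times is \<open>m\<^bsup>-sd\<^esup>\<close>.
\<close>
lemma log_radius_power: "2 ^ m * log_radius s m ^ d = real (max 1 m) powr (- (s * real d))"
proof -
  have "(2 powr (- (real m / real d))) ^ d = 2 powr (- real m)" using d_pos by (simp add: powr_power)
  also have "\<dots> = 1 / 2 ^ m" by (simp add: powr_minus powr_realpow divide_inverse)
  finally have 1: "(2 powr (- (real m / real d))) ^ d = 1 / 2 ^ m" .
  have "(real (max 1 m) powr (- s)) ^ d = real (max 1 m) powr (- (s * real d))"
    by (simp add: powr_power mult.commute)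
  then show ?thesis using 1 by (simp add: log_radius_def power_mult_distrib)
qed

lemma log_radius_scale:
  assumes s: "0 < s" shows "radius_scale (log_radius s)"
  unfolding radius_scale_def
proof (intro conjI allI)
  fix m
  show "0 < log_radius s m" by (simp add: log_radius_def)
  have "2 powr (- (real m / real d)) \<le> 2 powr 0" by (intro powr_mono) auto
  moreover have "real (max 1 m) powr (- s) \<le> real (max 1 m) powr 0" using s by (intro powr_mono) auto
  ultimately show "log_radius s m \<le> 1" unfolding log_radius_def by (intro mult_le_one) auto
next
  define \<alpha>\<^sub>2 :: real where "\<alpha>\<^sub>2 = 2 powr (- (1 / real d))"
  define \<alpha>\<^sub>1 :: real where "\<alpha>\<^sub>1 = \<alpha>\<^sub>2 * 2 powr (- s)"
  have p: "2 powr (- (real m / real d)) = \<alpha>\<^sub>2 ^ m" for m by (simp add: \<alpha>\<^sub>2_def powr_power)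
  have \<alpha>\<^sub>2: "0 < \<alpha>\<^sub>2" "\<alpha>\<^sub>2 < 1"
    using d_pos powr_less_mono[of "- (1 / real d)" 0 2] by (auto simp: \<alpha>\<^sub>2_def)
  have s2: "0 < 2 powr (- s)" "2 powr (- s) < (1::real)" using s powr_less_mono[of "- s" 0 2] by auto
  have "0 < \<alpha>\<^sub>1" "\<alpha>\<^sub>1 < 1" using \<alpha>\<^sub>2 s2 mult_strict_mono[of \<alpha>\<^sub>2 1 "2 powr (- s)" 1] by (auto simp: \<alpha>\<^sub>1_def)
  moreover have "\<forall>\<^sub>F m in sequentially. \<alpha>\<^sub>1 ^ m \<le> log_radius s m \<and> log_radius s m \<le> \<alpha>\<^sub>2 ^ m"
    using eventually_ge_at_top[of 1]
  proof eventually_elim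
    case (elim m)
    have "real m \<le> 2 ^ m" using of_nat_less_two_power[of m] by simp
    then have "(2 ^ m) powr (- s) \<le> real m powr (- s)" using elim s by (intro powr_mono2') auto
    moreover have "((2::real) ^ m) powr (- s) = (2 powr (- s)) ^ m"
      by (simp add: powr_power powr_powr mult.commute flip: powr_realpow)
    ultimately have "(2 powr (- s)) ^ m \<le> real (max 1 m) powr (- s)" using elim by (simp add: max_def)
    then have "\<alpha>\<^sub>1 ^ m \<le> log_radius s m"
      unfolding \<alpha>\<^sub>1_def log_radius_def p power_mult_distrib using \<alpha>\<^sub>2 by (intro mult_left_mono) auto
    moreover have "real (max 1 m) powr (- s) \<le> real (max 1 m) powr 0" using s by (intro powr_mono) auto
    then have "log_radius s m \<le> \<alpha>\<^sub>2 ^ m * 1"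
      unfolding log_radius_def p using \<alpha>\<^sub>2 by (intro mult_left_mono) auto
    ultimately show ?case by simp
  qed
  ultimately show "\<exists>\<alpha>\<^sub>1 \<alpha>\<^sub>2. 0 < \<alpha>\<^sub>1 \<and> \<alpha>\<^sub>1 < 1 \<and> 0 < \<alpha>\<^sub>2 \<and> \<alpha>\<^sub>2 < 1 \<and>
      (\<forall>\<^sub>F m in sequentially. \<alpha>\<^sub>1 ^ m \<le> log_radius s m \<and> log_radius s m \<le> \<alpha>\<^sub>2 ^ m)"
    using \<alpha>\<^sub>2 by blast
qed

lemma log_radius_small:
  assumes "0 < s" shows "\<forall>\<^sub>F m in sequentially. 2 ^ m * log_radius s m ^ d \<le> 1"
proof (rule always_eventually, rule allI)
  fix m
  have "real (max 1 m) powr (- (s * real d)) \<le> real (max 1 m) powr 0" using assms by (intro powr_mono) auto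
  then show "2 ^ m * log_radius s m ^ d \<le> 1" unfolding log_radius_power by simp
qed

text \<open>
  The \<open>r\<close>-th power of the expected number of visits is \<open>m\<^bsup>-srd\<^esup>\<close>: summable for \<open>s > 1/(r d)\<close>, equal to \<open>1/m\<close> for
  \<open>s = 1/(r d)\<close>. The distance \<open>\<delta>\<close> may take the value \<open>\<infinity>\<close>, hence it is bounded by a multiple of \<open>D\<close> at small scales only.
\<close>
theorem multilog_law:
  fixes \<delta> :: "'a \<Rightarrow> 'a \<Rightarrow> ennreal"
  assumes adm: "\<And>s. s \<in> insert (1 / (real r * real d)) (range (\<lambda>j. 1 / (real r * real d) + 1 / real (Suc j))) \<Longrightarrow>
      admissible (log_radius s) b"
    and M: "0 < M" and \<eta>: "0 < \<eta>"
    and far: "\<And>x y. ennreal (D x y) \<le> ennreal M * \<delta> x y"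
    and near: "\<And>x y. D x y < \<eta> \<Longrightarrow> \<delta> x y \<le> ennreal (M * D x y)"
  shows "AE y in \<mu>. limsup (\<lambda>n. ereal ((\<bar>ln (closest_return \<delta> f r n (b y) y)\<bar>
      - 1 / real d * ln (real n)) / ln (ln (real n)))) = ereal (1 / (real r * real d))"
proof -
  define s\<^sub>0 where "s\<^sub>0 = 1 / (real r * real d)"
  have rd: "0 < real r * real d" using r_pos d_pos by simp
  have s\<^sub>0: "0 < s\<^sub>0" using rd by (simp add: s\<^sub>0_def)
  have many: "AE y in \<mu>. \<exists>\<^sub>F m in sequentially.
    r \<le> card {k \<in> {1..2 ^ (m + 1)}. D (b y) ((f ^^ k) y) \<le> 2 * log_radius s\<^sub>0 m}"
  proof (rule infinitely_often_many_visits)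
    show "radius_scale (log_radius s\<^sub>0)" using s\<^sub>0 by (rule log_radius_scale)
    show "admissible (log_radius s\<^sub>0) b" by (rule adm) (simp add: s\<^sub>0_def)
    show "\<forall>\<^sub>F m in sequentially. 2 ^ m * log_radius s\<^sub>0 m ^ d \<le> 1" using s\<^sub>0 by (rule log_radius_small)
    show "\<forall>\<^sub>F m in sequentially. 1 \<le> real m * (2 ^ m * log_radius s\<^sub>0 m ^ d) ^ r"
      using eventually_ge_at_top[of 1]
    proof eventually_elim
      case (elim m)
      have "real r * (s\<^sub>0 * real d) = 1" using r_pos d_pos by (simp add: s\<^sub>0_def)
      then have "(2 ^ m * log_radius s\<^sub>0 m ^ d) ^ r = real m powr (- 1)"
        unfolding log_radius_power using elim by (simp add: powr_power max_def)
      then show ?case using elim by (simp add: powr_minus)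
    qed
  qed
  have few: "AE y in \<mu>. \<forall>j. \<forall>\<^sub>F m in sequentially.
      card {k \<in> {1..2 ^ (m + 1)}. D (b y) ((f ^^ k) y) \<le> log_radius (s\<^sub>0 + 1 / real (Suc j)) m} < r"
    unfolding AE_all_countable
  proof
    fix j
    define s where "s = s\<^sub>0 + 1 / real (Suc j)"
    have s: "0 < s" "s\<^sub>0 < s" using s\<^sub>0 by (auto simp: s_def intro: add_pos_pos)
    show "AE y in \<mu>. \<forall>\<^sub>F m in sequentially.
      card {k \<in> {1..2 ^ (m + 1)}. D (b y) ((f ^^ k) y) \<le> log_radius (s\<^sub>0 + 1 / real (Suc j)) m} < r"
      unfolding s_def[symmetric]
    proof (rule eventually_few_visits)
      show "radius_scale (log_radius s)" using s(1) by (rule log_radius_scale)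
      show "admissible (log_radius s) b" by (rule adm) (simp add: s\<^sub>0_def s_def)
      show "\<forall>\<^sub>F m in sequentially. 2 ^ m * log_radius s m ^ d \<le> 1" using s(1) by (rule log_radius_small)
      have "1 = s\<^sub>0 * (real r * real d)" using r_pos d_pos by (simp add: s\<^sub>0_def)
      also have "\<dots> < s * (real r * real d)" using s rd by (intro mult_strict_right_mono) auto
      finally have ex: "1 < s * (real r * real d)" .
      show "summable (\<lambda>m. (2 ^ m * log_radius s m ^ d) ^ r)"
      proof (rule summable_comparison_test_ev)
        show "summable (\<lambda>m. real m powr (- (s * (real r * real d))))"
          using ex by (simp add: summable_real_powr_iff)
        show "\<forall>\<^sub>F m in sequentially. norm ((2 ^ m * log_radius s m ^ d) ^ r) \<le> real m powr (- (s * (real r * real d)))"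
          using eventually_ge_at_top[of 1]
        proof eventually_elim
          case (elim m)
          then have "(2 ^ m * log_radius s m ^ d) ^ r = real m powr (- (s * (real r * real d)))"
            unfolding log_radius_power by (simp add: powr_power max_def mult_ac)
          then show ?case by simp
        qed
      qed
    qed
  qed
  define K' where "K' = max (2 * M) M"
  have K': "0 < K'" "M \<le> K'" "2 * M \<le> K'" using M by (auto simp: K'_def)
  show ?thesis
    using many few
  proof eventually_elim
    case (elim y)
    show ?case
      unfolding closest_return_def s\<^sub>0_def[symmetric]
    proof (rule limsup_order_statistic[where \<rho> = log_radius and K = K'])
      show "0 < real d" using d_pos by simp
      show "log_radius s m = 2 powr (- (real m / real d)) * real (max 1 m) powr (- s)" for s m
        by (simp add: log_radius_def)
      have pos: "0 < log_radius s m" for s m by (simp add: log_radius_def)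
      show "\<forall>\<^sub>F m in sequentially. card {k \<in> {1..2 ^ (m + 1)}.
          \<delta> (b y) ((f ^^ k) y) \<le> ennreal (log_radius (s\<^sub>0 + 1 / real (Suc j)) m / K')} < r" for j
        using elim(2)[rule_format, of j]
      proof eventually_elim
        case (elim m)
        let ?\<rho> = "log_radius (s\<^sub>0 + 1 / real (Suc j)) m"
        have "D x z \<le> ?\<rho>" if "\<delta> x z \<le> ennreal (?\<rho> / K')" for x z
        proof -
          have "ennreal (D x z) \<le> ennreal M * \<delta> x z" by (rule far)
          also have "\<dots> \<le> ennreal M * ennreal (?\<rho> / K')" using that by (intro mult_left_mono) auto
          also have "\<dots> = ennreal (M * (?\<rho> / K'))" using M pos K' by (intro ennreal_mult[symmetric]) (auto simp: less_imp_le)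
          finally have "D x z \<le> M * (?\<rho> / K')" using M pos K' by (simp add: ennreal_le_iff less_imp_le)
          also have "\<dots> \<le> K' * (?\<rho> / K')" using K' pos by (intro mult_right_mono) (auto simp: less_imp_le)
          also have "\<dots> = ?\<rho>" using K' by simp
          finally show ?thesis .
        qed
        then have "card {k \<in> {1..2 ^ (m + 1)}. \<delta> (b y) ((f ^^ k) y) \<le> ennreal (?\<rho> / K')}
            \<le> card {k \<in> {1..2 ^ (m + 1)}. D (b y) ((f ^^ k) y) \<le> ?\<rho>}"
          by (intro card_mono) auto
        then show ?case using elim by linarith
      qed
      have "\<forall>\<^sub>F m in sequentially. 2 * log_radius s\<^sub>0 m < \<eta>"
      proof -
        obtain a1 a2 where a2: "0 < a2" "a2 < 1" and ev: "\<forall>\<^sub>F m in sequentially. a1 ^ m \<le> log_radius s\<^sub>0 m \<and> log_radius s\<^sub>0 m \<le> a2 ^ m"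
          using log_radius_scale[OF s\<^sub>0] by (auto simp: radius_scale_def)
        have "(\<lambda>m. 2 * a2 ^ m) \<longlonglongrightarrow> 0" using a2 by (intro tendsto_mult_right_zero LIMSEQ_power_zero) auto
        then have "\<forall>\<^sub>F m in sequentially. 2 * a2 ^ m < \<eta>" using \<eta> by (intro order_tendstoD) auto
        then show ?thesis using ev by eventually_elim auto
      qed
      from frequently_eventually_conj[OF elim(1) this]
      show "\<exists>\<^sub>F m in sequentially. r \<le> card {k \<in> {1..2 ^ (m + 1)}. \<delta> (b y) ((f ^^ k) y) \<le> ennreal (K' * log_radius s\<^sub>0 m)}"
      proof (rule frequently_elim1)
        fix m
        let ?\<rho> = "log_radius s\<^sub>0 m"
        assume m: "2 * ?\<rho> < \<eta> \<and> r \<le> card {k \<in> {1..2 ^ (m + 1)}. D (b y) ((f ^^ k) y) \<le> 2 * ?\<rho>}"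
        have "\<delta> x z \<le> ennreal (K' * ?\<rho>)" if "D x z \<le> 2 * ?\<rho>" for x z
        proof -
          have "\<delta> x z \<le> ennreal (M * D x z)" using that m by (intro near) auto
          also have "M * D x z \<le> M * (2 * ?\<rho>)" using that M by (intro mult_left_mono) auto
          also have "\<dots> \<le> K' * ?\<rho>" using K' pos[of s\<^sub>0 m] mult_right_mono[of "2 * M" K' ?\<rho>] by simp
          finally show ?thesis by (simp add: ennreal_leI)
        qed
        then have "card {k \<in> {1..2 ^ (m + 1)}. D (b y) ((f ^^ k) y) \<le> 2 * ?\<rho>}
            \<le> card {k \<in> {1..2 ^ (m + 1)}. \<delta> (b y) ((f ^^ k) y) \<le> ennreal (K' * ?\<rho>)}"
          by (intro card_mono) auto
        then show "r \<le> card {k \<in> {1..2 ^ (m + 1)}. \<delta> (b y) ((f ^^ k) y) \<le> ennreal (K' * ?\<rho>)}" using m by linarith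
      qed
    qed (use s\<^sub>0 r_pos K' in auto)
  qed
qed

text \<open>
  The exceptional set of centres depends on the exponent \<open>s\<close>; countably many exponents suffice.
\<close>
theorem multilog_law_hitting:
  fixes \<delta> :: "'a \<Rightarrow> 'a \<Rightarrow> ennreal"
  assumes "0 < M" "0 < \<eta>" "\<And>x y. ennreal (D x y) \<le> ennreal M * \<delta> x y"
    "\<And>x y. D x y < \<eta> \<Longrightarrow> \<delta> x y \<le> ennreal (M * D x y)"
  shows "AE x in \<mu>. AE y in \<mu>. limsup (\<lambda>n. ereal ((\<bar>ln (closest_return \<delta> f r n x y)\<bar>
      - 1 / real d * ln (real n)) / ln (ln (real n)))) = ereal (1 / (real r * real d))"
proof -
  let ?I = "insert (1 / (real r * real d)) (range (\<lambda>j. 1 / (real r * real d) + 1 / real (Suc j)))"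
  have pos: "0 < s" if "s \<in> ?I" for s using that r_pos d_pos by (auto intro: add_pos_pos add_nonneg_pos)
  have "AE x in \<mu>. \<forall>s\<in>?I. admissible (log_radius s) (\<lambda>_. x)"
    using admissible_const[OF log_radius_scale[OF pos]] by (subst AE_ball_countable) auto
  then show ?thesis
  proof eventually_elim
    case (elim x)
    show ?case by (rule multilog_law[of "\<lambda>_. x" M \<eta> \<delta>]) (use elim assms in auto)
  qed
qed

theorem multilog_law_recurrence:
  fixes \<delta> :: "'a \<Rightarrow> 'a \<Rightarrow> ennreal"
  assumes "0 < M" "0 < \<eta>" "\<And>x y. ennreal (D x y) \<le> ennreal M * \<delta> x y"
    "\<And>x y. D x y < \<eta> \<Longrightarrow> \<delta> x y \<le> ennreal (M * D x y)"
  shows "AE x in \<mu>. limsup (\<lambda>n. ereal ((\<bar>ln (closest_return \<delta> f r n x x)\<bar>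
      - 1 / real d * ln (real n)) / ln (ln (real n)))) = ereal (1 / (real r * real d))"
proof (rule multilog_law[of "\<lambda>x. x" M \<eta> \<delta>])
  fix s assume "s \<in> insert (1 / (real r * real d)) (range (\<lambda>j. 1 / (real r * real d) + 1 / real (Suc j)))"
  then have "0 < s" using r_pos d_pos by (auto intro: add_pos_pos add_nonneg_pos)
  then show "admissible (log_radius s) (\<lambda>x. x)" by (intro admissible_id log_radius_scale)
qed (use assms in auto)

end

section \<open>A metric built from finitely many charts\<close>

text \<open>
  Class \<open>C\<^sup>1\<close> is given by continuity of the directional derivatives; on a compact ball those along a basis are bounded, and
  they control the operator norm of the derivative.
\<close>
lemma Ck_1_locally_lipschitz:
  fixes h :: "'v::euclidean_space \<Rightarrow> 'w::real_normed_vector"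
  assumes "Ck_on (Suc 0) S h" "open S" "u \<in> S"
  shows "\<exists>e>0. \<exists>L. cball u e \<subseteq> S \<and> L-lipschitz_on (cball u e) h"
proof -
  obtain e where e: "0 < e" "cball u e \<subseteq> S" using open_contains_cball assms(2,3) by blast
  have der: "(h has_derivative frechet_derivative h (at v)) (at v)" if "v \<in> cball u e" for v
    using assms(1) e that by (auto simp: frechet_derivative_works[symmetric])
  have "\<exists>B. \<forall>v\<in>cball u e. norm (frechet_derivative h (at v) b) \<le> B" for b
  proof -
    have "continuous_on (cball u e) (\<lambda>v. frechet_derivative h (at v) b)"
      using assms(1) e by (auto intro: continuous_on_subset)
    then have "bounded ((\<lambda>v. frechet_derivative h (at v) b) ` cball u e)"
      by (intro compact_imp_bounded compact_continuous_image) auto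
    then show ?thesis by (auto simp: bounded_iff)
  qed
  then obtain B where B: "\<And>b v. v \<in> cball u e \<Longrightarrow> norm (frechet_derivative h (at v) b) \<le> B b" by metis
  define L where "L = (\<Sum>b\<in>Basis. B b)"
  have B0: "0 \<le> B b" for b using B[of u b] e order_trans[OF norm_ge_zero] by (auto simp: less_imp_le)
  have on: "onorm (frechet_derivative h (at v)) \<le> L" if v: "v \<in> cball u e" for v
  proof (rule onorm_le)
    fix w :: 'v
    interpret bounded_linear "frechet_derivative h (at v)" using has_derivative_bounded_linear[OF der[OF v]] .
    have "frechet_derivative h (at v) w = frechet_derivative h (at v) (\<Sum>b\<in>Basis. (w \<bullet> b) *\<^sub>R b)"
      by (simp add: euclidean_representation)
    also have "\<dots> = (\<Sum>b\<in>Basis. (w \<bullet> b) *\<^sub>R frechet_derivative h (at v) b)" by (simp add: sum scaleR)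
    also have "norm \<dots> \<le> (\<Sum>b\<in>Basis. norm ((w \<bullet> b) *\<^sub>R frechet_derivative h (at v) b))" by (rule norm_sum)
    also have "\<dots> \<le> (\<Sum>b\<in>Basis. norm w * B b)"
    proof (rule sum_mono)
      fix b :: 'v assume "b \<in> Basis"
      then show "norm ((w \<bullet> b) *\<^sub>R frechet_derivative h (at v) b) \<le> norm w * B b"
        using B[OF v, of b] B0 by (auto intro!: mult_mono simp: Basis_le_norm)
    qed
    also have "\<dots> = L * norm w" by (simp add: L_def sum_distrib_left mult.commute)
    finally show "norm (frechet_derivative h (at v) w) \<le> L * norm w" .
  qed
  have "L-lipschitz_on (cball u e) h"
  proof (rule lipschitz_onI)
    fix x y assume "x \<in> cball u e" "y \<in> cball u e"
    then show "dist (h x) (h y) \<le> L * dist x y"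
      unfolding dist_norm
      by (intro differentiable_bound[of "cball u e" h "\<lambda>v. frechet_derivative h (at v)"] on
          has_derivative_at_withinI[OF der]) auto
  next
    show "0 \<le> L" unfolding L_def using B0 by (intro sum_nonneg)
  qed
  then show ?thesis using e by blast
qed

lemma smooth_locally_lipschitz:
  fixes h :: "'v::euclidean_space \<Rightarrow> 'w::real_normed_vector"
  assumes "smooth_on S h" "open S" "u \<in> S"
  shows "\<exists>e>0. \<exists>L. cball u e \<subseteq> S \<and> L-lipschitz_on (cball u e) h"
proof -
  have "Ck_on (Suc 0) S h" using assms(1) unfolding smooth_on_def by blast
  then show ?thesis using assms(2,3) by (rule Ck_1_locally_lipschitz)
qed

text \<open>
  A Lipschitz map of Euclidean space that is injective on the ball of radius \<open>r\<close> and sends the complement of the ball of radius \<open>2 r\<close> to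
  a single point. Composed with a chart it extends to the whole manifold.
\<close>
definition collapse :: "real \<Rightarrow> 'v::real_normed_vector \<Rightarrow> 'v \<times> real" where
  "collapse r z = (bump r (norm z) *\<^sub>R z, bump r (norm z))"

lemma collapse_inner: "0 < r \<Longrightarrow> norm z \<le> r \<Longrightarrow> collapse r z = (z, 1)"
  by (simp add: collapse_def bump_eq_1)

lemma collapse_outer: "0 < r \<Longrightarrow> 2 * r \<le> norm z \<Longrightarrow> collapse r z = 0"
  by (simp add: collapse_def bump_eq_0 zero_prod_def)

lemma collapse_lipschitz:
  assumes r: "0 < r" shows "dist (collapse r z) (collapse r z') \<le> (3 + 1 / r) * dist z z'"
proof -
  have scal: "dist (bump r (norm z) *\<^sub>R z) (bump r (norm z') *\<^sub>R z') \<le> 3 * dist z z'" for z z' :: 'a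
  proof -
    have main: "dist (bump r (norm z) *\<^sub>R z) (bump r (norm z') *\<^sub>R z') \<le> 3 * dist z z'"
      if z': "norm z' \<le> 2 * r" for z z' :: 'a
    proof -
      have "bump r (norm z) *\<^sub>R z - bump r (norm z') *\<^sub>R z'
          = bump r (norm z) *\<^sub>R (z - z') + (bump r (norm z) - bump r (norm z')) *\<^sub>R z'"
        by (simp add: algebra_simps)
      also have "norm \<dots> \<le> bump r (norm z) * norm (z - z') + \<bar>bump r (norm z) - bump r (norm z')\<bar> * norm z'"
        by (rule order_trans[OF norm_triangle_ineq]) simp
      also have "\<dots> \<le> 1 * norm (z - z') + norm (z - z') / r * (2 * r)"
      proof (intro add_mono mult_mono z')
        have "\<bar>bump r (norm z) - bump r (norm z')\<bar> \<le> \<bar>norm z - norm z'\<bar> / r" by (rule bump_diff_le[OF r])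
        also have "\<dots> \<le> norm (z - z') / r" using r by (intro divide_right_mono norm_triangle_ineq3) auto
        finally show "\<bar>bump r (norm z) - bump r (norm z')\<bar> \<le> norm (z - z') / r" .
      qed (use r in auto)
      also have "\<dots> = 3 * norm (z - z')" using r by simp
      finally show ?thesis by (simp add: dist_norm)
    qed
    consider "norm z' \<le> 2 * r" | "norm z \<le> 2 * r" | "2 * r \<le> norm z" "2 * r \<le> norm z'" by linarith
    then show ?thesis
    proof cases
      case 1 then show ?thesis by (rule main)
    next
      case 2 then show ?thesis using main[of z z'] by (simp add: dist_commute)
    next
      case 3 then show ?thesis using r by (simp add: bump_eq_0)
    qed
  qed
  have "dist (bump r (norm z)) (bump r (norm z')) \<le> \<bar>norm z - norm z'\<bar> / r"
    unfolding dist_real_def by (rule bump_diff_le[OF r])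
  also have "\<dots> \<le> dist z z' / r" unfolding dist_norm using r by (intro divide_right_mono norm_triangle_ineq3) auto
  finally have 2: "dist (bump r (norm z)) (bump r (norm z')) \<le> dist z z' / r" .
  have "dist (collapse r z) (collapse r z') \<le> dist (bump r (norm z) *\<^sub>R z) (bump r (norm z') *\<^sub>R z')
      + dist (bump r (norm z)) (bump r (norm z'))"
    unfolding collapse_def dist_prod_def by (rule order_trans[OF sqrt_sum_squares_le_sum]) auto
  then show ?thesis using scal[of z z'] 2 by (simp add: algebra_simps)
qed

text \<open>
  Points of the half ball stay away from all points outside the ball: either the second coordinate has dropped visibly
  below \<open>1\<close>, or the first one is still large.
\<close>
lemma collapse_separates:
  assumes r: "0 < r" and z: "norm z < r / 2" and w: "r \<le> norm w"
  shows "min (r / 4) (1 / 4) \<le> dist (collapse r z) (collapse r w)"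
proof -
  have cz: "collapse r z = (z, 1)" using r z by (intro collapse_inner) auto
  show ?thesis
  proof (cases "bump r (norm w) \<le> 3 / 4")
    case True
    have "1 / 4 \<le> dist (snd (collapse r z)) (snd (collapse r w))"
      using True by (simp add: cz dist_real_def) (simp add: collapse_def)
    also have "\<dots> \<le> dist (collapse r z) (collapse r w)" by (rule dist_snd_le)
    finally show ?thesis by simp
  next
    case False
    have "3 / 4 * r \<le> bump r (norm w) * norm w" using False w r by (intro mult_mono) auto
    also have "\<dots> = norm (fst (collapse r w))" by (simp add: collapse_def)
    also have "\<dots> \<le> norm z + dist z (fst (collapse r w))"
      using norm_triangle_ineq2[of "fst (collapse r w)" z] by (simp add: dist_norm norm_minus_commute)
    finally have "r / 4 \<le> dist (fst (collapse r z)) (fst (collapse r w))" using z by (simp add: cz)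
    also have "\<dots> \<le> dist (collapse r z) (collapse r w)" by (rule dist_fst_le)
    finally show ?thesis by simp
  qed
qed

type_synonym ('a, 'd) patch = "('a, 'd) chart \<times> (real ^ 'd) \<times> real"

text \<open>
  A patch is a chart with a ball in its image. The three radii are used as follows: half balls cover the manifold, the balls of radius \<open>r\<close> are
  where coordinates are compared, and the cut-off takes place up to radius \<open>2 r\<close>, with room to spare.
\<close>
locale patched_manifold =
  fixes \<A> :: "('a::{t2_space, second_countable_topology}, 'd::finite) chart set"
    and P :: "('a, 'd) patch set"
  assumes compact_space: "compact (UNIV :: 'a set)" and atlas: "smooth_atlas \<A>"
    and finite_P: "finite P"
    and valid: "\<And>c a r. (c, a, r) \<in> P \<Longrightarrow> c \<in> \<A> \<and> 0 < r \<and> cball a (3 * r) \<subseteq> snd c ` fst c"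
    and cover: "\<And>x. \<exists>c a r. (c, a, r) \<in> P \<and> x \<in> fst c \<and> dist (snd c x) a < r / 2"

lemma chart_facts:
  assumes "smooth_atlas \<A>" "c \<in> \<A>"
  shows "open (fst c)" "open (snd c ` fst c)" "continuous_on (fst c) (snd c)"
    "continuous_on (snd c ` fst c) (chart_inv c)"
    "\<And>x. x \<in> fst c \<Longrightarrow> chart_inv c (snd c x) = x"
    "\<And>u. u \<in> snd c ` fst c \<Longrightarrow> snd c (chart_inv c u) = u"
    "\<And>u. u \<in> snd c ` fst c \<Longrightarrow> chart_inv c u \<in> fst c"
  using assms by (auto simp: smooth_atlas_def is_chart_def homeomorphism_def)

lemma chart_at:
  assumes "smooth_atlas \<A>" shows "\<exists>c\<in>\<A>. x \<in> fst c"
proof -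
  have "x \<in> (\<Union>c\<in>\<A>. fst c)" using assms unfolding smooth_atlas_def by blast
  then show ?thesis by blast
qed

lemma chart_preimage_open:
  assumes "smooth_atlas \<A>" "c \<in> \<A>" "open W"
  shows "open (snd c ` (fst c \<inter> W))"
proof -
  note cf = chart_facts[OF assms(1,2)]
  have "snd c ` (fst c \<inter> W) = (snd c ` fst c) \<inter> chart_inv c -` W"
    using cf(5,6,7) by force
  then show ?thesis using continuous_open_preimage[OF cf(4,2) assms(3)] by simp
qed

lemma exists_patches:
  fixes \<A> :: "('a::{t2_space, second_countable_topology}, 'd::finite) chart set"
  assumes "compact (UNIV :: 'a set)" "smooth_atlas \<A>"
  shows "\<exists>P. patched_manifold \<A> P"
proof -
  have "\<exists>c r. c \<in> \<A> \<and> x \<in> fst c \<and> 0 < r \<and> cball (snd c x) (3 * r) \<subseteq> snd c ` fst c" for x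
  proof -
    obtain c where c: "c \<in> \<A>" "x \<in> fst c" using chart_at[OF assms(2)] by blast
    obtain e where "0 < e" "cball (snd c x) e \<subseteq> snd c ` fst c"
      using open_contains_cball chart_facts(2)[OF assms(2) c(1)] c(2) by blast
    then show ?thesis using c by (intro exI[of _ c] exI[of _ "e / 3"]) auto
  qed
  then obtain c r where cr: "\<And>x. c x \<in> \<A>" "\<And>x. x \<in> fst (c x)" "\<And>x. 0 < r x"
      "\<And>x. cball (snd (c x) x) (3 * r x) \<subseteq> snd (c x) ` fst (c x)" by metis
  define W where "W x = fst (c x) \<inter> snd (c x) -` ball (snd (c x) x) (r x / 2)" for x
  have "open (W x)" for x
    unfolding W_def using chart_facts[OF assms(2) cr(1)[of x]] by (intro continuous_open_preimage) auto
  moreover have "x \<in> W x" for x using cr by (simp add: W_def)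
  ultimately obtain X where X: "finite X" "UNIV \<subseteq> (\<Union>x\<in>X. W x)"
    using compactE_image[OF assms(1), of UNIV W] by (metis UNIV_I UN_I subsetI)
  define P where "P = (\<lambda>x. (c x, snd (c x) x, r x)) ` X"
  have "patched_manifold \<A> P"
  proof
    show "\<exists>c a r. (c, a, r) \<in> P \<and> x \<in> fst c \<and> dist (snd c x) a < r / 2" for x
    proof -
      obtain x0 where "x0 \<in> X" "x \<in> W x0" using X by blast
      then show ?thesis unfolding P_def
        by (intro exI[of _ "c x0"] exI[of _ "snd (c x0) x0"] exI[of _ "r x0"]) (auto simp: W_def dist_commute)
    qed
    show "c' \<in> \<A> \<and> 0 < r' \<and> cball a' (3 * r') \<subseteq> snd c' ` fst c'" if "(c', a', r') \<in> P" for c' a' r'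
    proof -
      obtain x where "c' = c x" "a' = snd (c x) x" "r' = r x" using \<open>(c', a', r') \<in> P\<close> by (auto simp: P_def)
      then show ?thesis using cr by simp
    qed
  qed (use assms X in \<open>auto simp: P_def\<close>)
  then show ?thesis by blast
qed

context patched_manifold
begin

abbreviation dom :: "('a, 'd) patch \<Rightarrow> 'a set" where "dom \<pi> \<equiv> fst (fst \<pi>)"
abbreviation coord :: "('a, 'd) patch \<Rightarrow> 'a \<Rightarrow> real ^ 'd" where "coord \<pi> \<equiv> snd (fst \<pi>)"
abbreviation param :: "('a, 'd) patch \<Rightarrow> real ^ 'd \<Rightarrow> 'a" where "param \<pi> \<equiv> chart_inv (fst \<pi>)"
abbreviation center :: "('a, 'd) patch \<Rightarrow> real ^ 'd" where "center \<pi> \<equiv> fst (snd \<pi>)"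
abbreviation radius :: "('a, 'd) patch \<Rightarrow> real" where "radius \<pi> \<equiv> snd (snd \<pi>)"

definition core :: "('a, 'd) patch \<Rightarrow> 'a set" where
  "core \<pi> = {x \<in> dom \<pi>. dist (coord \<pi> x) (center \<pi>) < radius \<pi> / 2}"

definition inner :: "('a, 'd) patch \<Rightarrow> 'a set" where
  "inner \<pi> = {x \<in> dom \<pi>. dist (coord \<pi> x) (center \<pi>) < radius \<pi>}"

definition emb :: "('a, 'd) patch \<Rightarrow> 'a \<Rightarrow> (real ^ 'd) \<times> real" where
  "emb \<pi> x = (if x \<in> dom \<pi> then collapse (radius \<pi>) (coord \<pi> x - center \<pi>) else 0)"

definition D :: "'a \<Rightarrow> 'a \<Rightarrow> real" where
  "D x y = (\<Sum>\<pi>\<in>P. dist (emb \<pi> x) (emb \<pi> y))"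

lemma patchD:
  assumes "\<pi> \<in> P"
  shows "fst \<pi> \<in> \<A>" "0 < radius \<pi>" "cball (center \<pi>) (3 * radius \<pi>) \<subseteq> coord \<pi> ` dom \<pi>"
  using valid[of "fst \<pi>" "center \<pi>" "radius \<pi>"] assms by auto

lemma core_cover: "\<exists>\<pi>\<in>P. x \<in> core \<pi>"
  using cover[of x] unfolding core_def by force

lemma P_nonempty: "P \<noteq> {}" using core_cover by blast

lemmas patch_chart = chart_facts[OF atlas patchD(1)]

lemma core_inner: "\<pi> \<in> P \<Longrightarrow> core \<pi> \<subseteq> inner \<pi>"
  using patchD(2)[of \<pi>] by (auto simp: core_def inner_def)

lemma inner_open: "\<pi> \<in> P \<Longrightarrow> open (inner \<pi>)"
proof -
  assume \<pi>: "\<pi> \<in> P"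
  have "inner \<pi> = dom \<pi> \<inter> coord \<pi> -` ball (center \<pi>) (radius \<pi>)" by (auto simp: inner_def dist_commute)
  then show ?thesis using patch_chart(1,3)[OF \<pi>] by (auto intro: continuous_open_preimage)
qed

lemma D_sym: "D x y = D y x" by (simp add: D_def dist_commute)
lemma D_triangle: "D x z \<le> D x y + D y z"
  unfolding D_def sum.distrib[symmetric] by (intro sum_mono dist_triangle)
lemma D_self [simp]: "D x x = 0" by (simp add: D_def)
lemma D_nonneg [simp]: "0 \<le> D x y" by (simp add: D_def sum_nonneg)

lemma emb_le_D: "\<pi> \<in> P \<Longrightarrow> dist (emb \<pi> x) (emb \<pi> y) \<le> D x y"
  unfolding D_def using finite_P by (intro member_le_sum) auto

lemma inner_dist_le_D:
  assumes \<pi>: "\<pi> \<in> P" and x: "x \<in> inner \<pi>" "y \<in> inner \<pi>"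
  shows "dist (coord \<pi> x) (coord \<pi> y) \<le> D x y"
proof -
  have "emb \<pi> z = (coord \<pi> z - center \<pi>, 1)" if "z \<in> inner \<pi>" for z
    using that patchD(2)[OF \<pi>] by (auto simp: emb_def inner_def dist_norm intro!: collapse_inner)
  then have "dist (emb \<pi> x) (emb \<pi> y) = dist (coord \<pi> x) (coord \<pi> y)"
    using x by (simp add: dist_Pair_Pair dist_norm)
  then show ?thesis using emb_le_D[OF \<pi>, of x y] by simp
qed

lemma support_compact:
  assumes \<pi>: "\<pi> \<in> P"
  shows "compact (param \<pi> ` cball (center \<pi>) (2 * radius \<pi>))"
    and "x \<notin> param \<pi> ` cball (center \<pi>) (2 * radius \<pi>) \<Longrightarrow> emb \<pi> x = 0"
proof -
  have sub: "cball (center \<pi>) (2 * radius \<pi>) \<subseteq> coord \<pi> ` dom \<pi>"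
    using patchD(2,3)[OF \<pi>] subset_cball[of "2 * radius \<pi>" "3 * radius \<pi>" "center \<pi>"] by simp
  show "compact (param \<pi> ` cball (center \<pi>) (2 * radius \<pi>))"
    by (intro compact_continuous_image continuous_on_subset[OF patch_chart(4)[OF \<pi>] sub]) auto
  assume x: "x \<notin> param \<pi> ` cball (center \<pi>) (2 * radius \<pi>)"
  show "emb \<pi> x = 0"
  proof (cases "x \<in> dom \<pi>")
    case True
    have "coord \<pi> x \<notin> cball (center \<pi>) (2 * radius \<pi>)"
      using x patch_chart(5)[OF \<pi> True] by (metis image_eqI)
    then show ?thesis using True patchD(2)[OF \<pi>]
      by (auto simp: emb_def dist_norm norm_minus_commute intro!: collapse_outer)
  qed (simp add: emb_def)
qed

lemma emb_continuous:
  assumes \<pi>: "\<pi> \<in> P" shows "continuous_on UNIV (emb \<pi>)"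
proof -
  let ?K = "param \<pi> ` cball (center \<pi>) (2 * radius \<pi>)"
  have sub: "cball (center \<pi>) (2 * radius \<pi>) \<subseteq> coord \<pi> ` dom \<pi>"
    using patchD(2,3)[OF \<pi>] subset_cball[of "2 * radius \<pi>" "3 * radius \<pi>" "center \<pi>"] by simp
  have op: "open (- ?K)" using support_compact(1)[OF \<pi>] by (simp add: compact_imp_closed open_Compl)
  have 1: "continuous_on (dom \<pi>) (emb \<pi>)"
  proof -
    have "continuous_on UNIV (collapse (radius \<pi>) :: real ^ 'd \<Rightarrow> _)"
      using collapse_lipschitz[OF patchD(2)[OF \<pi>]] patchD(2)[OF \<pi>]
      by (intro lipschitz_on_continuous_on[of "3 + 1 / radius \<pi>"] lipschitz_onI) auto
    then have "continuous_on (dom \<pi>) (\<lambda>x. collapse (radius \<pi>) (coord \<pi> x - center \<pi>))"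
      by (rule continuous_on_compose2) (auto intro!: continuous_intros patch_chart(3)[OF \<pi>])
    then show ?thesis by (rule continuous_on_eq) (simp add: emb_def)
  qed
  have 2: "continuous_on (- ?K) (emb \<pi>)"
    by (rule continuous_on_eq[of _ "\<lambda>_. 0"]) (use support_compact(2)[OF \<pi>] in auto)
  have "dom \<pi> \<union> - ?K = UNIV" using patch_chart(7)[OF \<pi>] sub by auto
  then show ?thesis using continuous_on_open_Un[OF patch_chart(1)[OF \<pi>] op 1 2] by simp
qed

lemma D_continuous: "continuous_on UNIV (D x)"
  unfolding D_def using emb_continuous by (intro continuous_intros) auto

text \<open>
  Below this \<open>D\<close>-distance two points always share a patch, in which the first one is well inside.
\<close>
definition sep_radius :: real where
  "sep_radius = Min ((\<lambda>\<pi>. min (radius \<pi> / 4) (1 / 4)) ` P)"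

lemma sep_radius_pos: "0 < sep_radius"
  unfolding sep_radius_def using finite_P P_nonempty patchD(2) by (subst Min_gr_iff) auto

lemma sep_radius_le: "\<pi> \<in> P \<Longrightarrow> sep_radius \<le> min (radius \<pi> / 4) (1 / 4)"
  unfolding sep_radius_def using finite_P by (intro Min_le) auto

lemma D_small_inner:
  assumes \<pi>: "\<pi> \<in> P" and x: "x \<in> core \<pi>" and D: "D x y < sep_radius"
  shows "y \<in> inner \<pi>"
proof (rule ccontr)
  assume y: "y \<notin> inner \<pi>"
  note r = patchD(2)[OF \<pi>]
  have ex: "emb \<pi> x = collapse (radius \<pi>) (coord \<pi> x - center \<pi>)" "norm (coord \<pi> x - center \<pi>) < radius \<pi> / 2"
    using x by (auto simp: core_def emb_def dist_norm)
  \<comment> \<open>A point outside the chart domain has the same image as a vector of norm \<open>2 r\<close>.\<close>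
  have "\<exists>w. radius \<pi> \<le> norm w \<and> emb \<pi> y = collapse (radius \<pi>) w"
  proof (cases "y \<in> dom \<pi>")
    case True
    then show ?thesis using y by (intro exI[of _ "coord \<pi> y - center \<pi>"]) (auto simp: emb_def inner_def dist_norm)
  next
    case False
    obtain i :: 'd where True by simp
    define z :: "real ^ 'd" where "z = (2 * radius \<pi>) *\<^sub>R axis i 1"
    have nz: "norm z = 2 * radius \<pi>" unfolding z_def norm_scaleR norm_axis_1 using r by simp
    then have "collapse (radius \<pi>) z = 0" using r by (intro collapse_outer) auto
    then show ?thesis using False r nz by (intro exI[of _ z]) (simp add: emb_def)
  qed
  then obtain w where w: "radius \<pi> \<le> norm w" "emb \<pi> y = collapse (radius \<pi>) w" by blast
  have "sep_radius \<le> dist (emb \<pi> x) (emb \<pi> y)"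
    unfolding ex(1) w(2) by (rule order_trans[OF sep_radius_le[OF \<pi>] collapse_separates[OF r ex(2) w(1)]])
  also have "\<dots> \<le> D x y" by (rule emb_le_D[OF \<pi>])
  finally show False using D by simp
qed

text \<open>
  \<open>D\<close> induces the topology of the manifold; the converse inclusion is the continuity of \<open>D\<close>.
\<close>
lemma D_ball_in_open:
  assumes "open W" "x \<in> W" shows "\<exists>\<epsilon>>0. \<forall>y. D x y < \<epsilon> \<longrightarrow> y \<in> W"
proof -
  obtain \<pi> where \<pi>: "\<pi> \<in> P" "x \<in> core \<pi>" using core_cover by blast
  have xi: "x \<in> inner \<pi>" using core_inner \<pi> by blast
  have "open (coord \<pi> ` (dom \<pi> \<inter> W))" using chart_preimage_open[OF atlas patchD(1)[OF \<pi>(1)] assms(1)] .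
  moreover have "coord \<pi> x \<in> coord \<pi> ` (dom \<pi> \<inter> W)" using \<pi> assms by (auto simp: core_def)
  ultimately obtain e where e: "0 < e" "ball (coord \<pi> x) e \<subseteq> coord \<pi> ` (dom \<pi> \<inter> W)"
    using open_contains_ball by blast
  show ?thesis
  proof (intro exI[of _ "min e sep_radius"] conjI allI impI)
    fix y assume y: "D x y < min e sep_radius"
    then have yi: "y \<in> inner \<pi>" using D_small_inner[OF \<pi>] by simp
    have "dist (coord \<pi> x) (coord \<pi> y) < e" using inner_dist_le_D[OF \<pi>(1) xi yi] y by simp
    then obtain z where z: "z \<in> dom \<pi>" "z \<in> W" "coord \<pi> y = coord \<pi> z" using e by (auto simp: subset_iff)
    moreover have "y \<in> dom \<pi>" using yi by (simp add: inner_def)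
    ultimately have "y = z" using patch_chart(5)[OF \<pi>(1)] by metis
    then show "y \<in> W" using z by simp
  qed (use e sep_radius_pos in auto)
qed

text \<open>
  Locally, this map is either a transition map followed by \<open>collapse\<close>, or identically \<open>0\<close> near points whose image avoids the
  compact support of the second patch. Local Lipschitz bounds on a compact set give a global one.
\<close>
lemma emb_param_lipschitz:
  assumes \<pi>: "\<pi> \<in> P" and \<tau>: "\<tau> \<in> P"
  shows "\<exists>L. L-lipschitz_on (cball (center \<pi>) (radius \<pi>)) (\<lambda>u. emb \<tau> (param \<pi> u))"
proof -
  note r = patchD(2)[OF \<pi>] and r\<tau> = patchD(2)[OF \<tau>]
  let ?S = "cball (center \<pi>) (radius \<pi>)" and ?g = "\<lambda>u. emb \<tau> (param \<pi> u)"
  have sub: "?S \<subseteq> coord \<pi> ` dom \<pi>"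
    using patchD(3)[OF \<pi>] r subset_cball[of "radius \<pi>" "3 * radius \<pi>" "center \<pi>"] by simp
  have loc: "\<exists>e>0. \<exists>L. L-lipschitz_on (cball u e \<inter> ?S) ?g" if u: "u \<in> ?S" for u
  proof (cases "param \<pi> u \<in> dom \<tau>")
    case True
    let ?O = "coord \<pi> ` (dom \<pi> \<inter> dom \<tau>)"
    have op: "open ?O" using chart_preimage_open[OF atlas patchD(1)[OF \<pi>] patch_chart(1)[OF \<tau>]] .
    have uU: "u \<in> coord \<pi> ` dom \<pi>" using u sub by blast
    have "coord \<pi> (param \<pi> u) \<in> ?O" using True patch_chart(7)[OF \<pi> uU] by blast
    then have uO: "u \<in> ?O" by (simp only: patch_chart(6)[OF \<pi> uU])
    have "smooth_on ?O (transition (fst \<pi>) (fst \<tau>))"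
      using atlas patchD(1)[OF \<pi>] patchD(1)[OF \<tau>] by (auto simp: smooth_atlas_def)
    from smooth_locally_lipschitz[OF this op uO] obtain e L where e: "0 < e" "cball u e \<subseteq> ?O"
        "L-lipschitz_on (cball u e) (transition (fst \<pi>) (fst \<tau>))" by blast
    have "((3 + 1 / radius \<tau>) * L)-lipschitz_on (cball u e) ?g"
    proof (rule lipschitz_onI)
      fix v v' assume v: "v \<in> cball u e" "v' \<in> cball u e"
      have eq: "?g v = collapse (radius \<tau>) (transition (fst \<pi>) (fst \<tau>) v - center \<tau>)" if "v \<in> cball u e" for v
      proof -
        have "v \<in> ?O" using that e by blast
        then have "param \<pi> v \<in> dom \<tau>" using patch_chart(5)[OF \<pi>] by auto
        then show ?thesis by (simp add: emb_def transition_def)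
      qed
      have "dist (?g v) (?g v') \<le> (3 + 1 / radius \<tau>) * dist (transition (fst \<pi>) (fst \<tau>) v - center \<tau>) (transition (fst \<pi>) (fst \<tau>) v' - center \<tau>)"
        unfolding eq[OF v(1)] eq[OF v(2)] by (rule collapse_lipschitz[OF r\<tau>])
      also have "\<dots> = (3 + 1 / radius \<tau>) * dist (transition (fst \<pi>) (fst \<tau>) v) (transition (fst \<pi>) (fst \<tau>) v')"
        by (simp add: dist_norm)
      also have "\<dots> \<le> (3 + 1 / radius \<tau>) * (L * dist v v')"
        using r\<tau> lipschitz_onD[OF e(3) v] by (intro mult_left_mono) auto
      finally show "dist (?g v) (?g v') \<le> (3 + 1 / radius \<tau>) * L * dist v v'" by simp
    qed (use r\<tau> lipschitz_on_nonneg[OF e(3)] in auto)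
    then show ?thesis using e(1) lipschitz_on_subset by blast
  next
    case False
    let ?K = "param \<tau> ` cball (center \<tau>) (2 * radius \<tau>)"
    have "param \<pi> u \<notin> ?K"
    proof
      assume "param \<pi> u \<in> ?K"
      moreover have "cball (center \<tau>) (2 * radius \<tau>) \<subseteq> coord \<tau> ` dom \<tau>"
        using patchD(3)[OF \<tau>] r\<tau> subset_cball[of "2 * radius \<tau>" "3 * radius \<tau>" "center \<tau>"] by simp
      ultimately have "param \<pi> u \<in> dom \<tau>" using patch_chart(7)[OF \<tau>] by auto
      then show False using False by simp
    qed
    have opK: "open (- ?K)" using support_compact(1)[OF \<tau>] by (simp add: compact_imp_closed open_Compl)
    have uU: "u \<in> coord \<pi> ` dom \<pi>" using u sub by blast
    have "coord \<pi> (param \<pi> u) \<in> coord \<pi> ` (dom \<pi> \<inter> - ?K)"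
      using \<open>param \<pi> u \<notin> ?K\<close> patch_chart(7)[OF \<pi> uU] by blast
    then have uO: "u \<in> coord \<pi> ` (dom \<pi> \<inter> - ?K)" by (simp only: patch_chart(6)[OF \<pi> uU])
    obtain e where e: "0 < e" "cball u e \<subseteq> coord \<pi> ` (dom \<pi> \<inter> - ?K)"
      using open_contains_cball chart_preimage_open[OF atlas patchD(1)[OF \<pi>] opK] uO by blast
    have "?g v = 0" if "v \<in> cball u e" for v
    proof -
      have "v \<in> coord \<pi> ` (dom \<pi> \<inter> - ?K)" using that e by blast
      then have "param \<pi> v \<notin> ?K" using patch_chart(5)[OF \<pi>] by auto
      then show ?thesis by (rule support_compact(2)[OF \<tau>])
    qed
    then have "0-lipschitz_on (cball u e \<inter> ?S) ?g" by (intro lipschitz_onI) auto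
    then show ?thesis using e(1) by blast
  qed
  have "local_lipschitz {0::real} ?S (\<lambda>_. ?g)"
  proof (rule local_lipschitzI)
    fix t :: real and u assume "u \<in> ?S"
    from loc[OF this] show "\<exists>e>0. \<exists>L. \<forall>t\<in>cball t e \<inter> {0}. L-lipschitz_on (cball u e \<inter> ?S) ?g" by blast
  qed
  then show ?thesis by (rule local_lipschitz_compact_implies_lipschitz) auto
qed

lemma D_upper: "\<exists>C\<ge>1. \<forall>\<pi>\<in>P. \<forall>x\<in>inner \<pi>. \<forall>y\<in>inner \<pi>. D x y \<le> C * dist (coord \<pi> x) (coord \<pi> y)"
proof -
  obtain L where L: "\<And>\<pi> \<tau>. \<pi> \<in> P \<Longrightarrow> \<tau> \<in> P \<Longrightarrow> (L \<pi> \<tau>)-lipschitz_on (cball (center \<pi>) (radius \<pi>)) (\<lambda>u. emb \<tau> (param \<pi> u))"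
    using emb_param_lipschitz by metis
  have L0: "0 \<le> L \<pi> \<tau>" if "\<pi> \<in> P" "\<tau> \<in> P" for \<pi> \<tau> using lipschitz_on_nonneg[OF L[OF that]] .
  define C where "C = 1 + (\<Sum>\<pi>\<in>P. \<Sum>\<tau>\<in>P. L \<pi> \<tau>)"
  have "D x y \<le> C * dist (coord \<pi> x) (coord \<pi> y)" if \<pi>: "\<pi> \<in> P" and x: "x \<in> inner \<pi>" "y \<in> inner \<pi>" for \<pi> x y
  proof -
    have e: "dist (emb \<tau> x) (emb \<tau> y) \<le> L \<pi> \<tau> * dist (coord \<pi> x) (coord \<pi> y)" if \<tau>: "\<tau> \<in> P" for \<tau>
      using lipschitz_onD[OF L[OF \<pi> \<tau>], of "coord \<pi> x" "coord \<pi> y"] x patch_chart(5)[OF \<pi>]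
      by (auto simp: inner_def dist_commute)
    have "D x y \<le> (\<Sum>\<tau>\<in>P. L \<pi> \<tau> * dist (coord \<pi> x) (coord \<pi> y))" unfolding D_def using e by (rule sum_mono)
    also have "\<dots> = (\<Sum>\<tau>\<in>P. L \<pi> \<tau>) * dist (coord \<pi> x) (coord \<pi> y)" by (simp add: sum_distrib_right)
    also have "\<dots> \<le> C * dist (coord \<pi> x) (coord \<pi> y)"
    proof (rule mult_right_mono)
      have "(\<Sum>\<tau>\<in>P. L \<pi> \<tau>) \<le> (\<Sum>\<pi>\<in>P. \<Sum>\<tau>\<in>P. L \<pi> \<tau>)"
        using \<pi> finite_P L0 by (intro member_le_sum[of \<pi> P "\<lambda>\<pi>. \<Sum>\<tau>\<in>P. L \<pi> \<tau>"] sum_nonneg) auto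
      then show "(\<Sum>\<tau>\<in>P. L \<pi> \<tau>) \<le> C" by (simp add: C_def)
    qed simp
    finally show ?thesis .
  qed
  moreover have "1 \<le> C" unfolding C_def using L0 by (simp add: sum_nonneg)
  ultimately show ?thesis by blast
qed

lemma D_bounded: "\<exists>B. \<forall>x y. D x y \<le> B"
proof -
  have "\<exists>B. \<forall>x. norm (emb \<pi> x) \<le> B" if "\<pi> \<in> P" for \<pi>
    using compact_imp_bounded[OF compact_continuous_image[OF emb_continuous[OF that] compact_space]]
    by (auto simp: bounded_iff)
  then obtain B where B: "\<And>\<pi> x. \<pi> \<in> P \<Longrightarrow> norm (emb \<pi> x) \<le> B \<pi>" by metis
  have "D x y \<le> (\<Sum>\<pi>\<in>P. B \<pi> + B \<pi>)" for x y
    unfolding D_def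
  proof (rule sum_mono)
    fix \<pi> assume \<pi>: "\<pi> \<in> P"
    have "dist (emb \<pi> x) (emb \<pi> y) \<le> norm (emb \<pi> x) + norm (emb \<pi> y)"
      unfolding dist_norm by (rule norm_triangle_ineq4)
    then show "dist (emb \<pi> x) (emb \<pi> y) \<le> B \<pi> + B \<pi>" using B[OF \<pi>, of x] B[OF \<pi>, of y] by linarith
  qed
  then show ?thesis by blast
qed

text \<open>
  A Lebesgue number argument for \<open>D\<close>: at small distances one of finitely many local constants applies, at large distances
  boundedness of \<open>D\<close> suffices.
\<close>
lemma locally_lipschitz_imp_lipschitz:
  assumes loc: "\<And>x. \<exists>\<epsilon>>0. \<exists>L. \<forall>y z. D x y < \<epsilon> \<longrightarrow> D x z < \<epsilon> \<longrightarrow> D (g y) (g z) \<le> L * D y z"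
  shows "\<exists>L\<ge>1. \<forall>y z. D (g y) (g z) \<le> L * D y z"
proof -
  obtain \<epsilon> L where \<epsilon>: "\<And>x. 0 < \<epsilon> x"
    and L: "\<And>x y z. D x y < \<epsilon> x \<Longrightarrow> D x z < \<epsilon> x \<Longrightarrow> D (g y) (g z) \<le> L x * D y z"
    using loc by metis
  obtain B where B: "\<And>x y. D x y \<le> B" using D_bounded by blast
  define W where "W x = {y. D x y < \<epsilon> x / 2}" for x
  have "open (W x)" for x
    unfolding W_def using open_Collect_less[OF D_continuous[of x] continuous_on_const] .
  moreover have "x \<in> W x" for x using \<epsilon> by (simp add: W_def)
  ultimately obtain X where X: "finite X" "UNIV \<subseteq> (\<Union>x\<in>X. W x)"
    using compactE_image[OF compact_space, of UNIV W] by (metis UNIV_I UN_I subsetI)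
  have Xne: "X \<noteq> {}" using X by auto
  define \<epsilon>\<^sub>0 where "\<epsilon>\<^sub>0 = Min ((\<lambda>x. \<epsilon> x / 2) ` X)"
  have \<epsilon>\<^sub>0: "0 < \<epsilon>\<^sub>0" "\<And>x. x \<in> X \<Longrightarrow> \<epsilon>\<^sub>0 \<le> \<epsilon> x / 2"
  proof -
    show "0 < \<epsilon>\<^sub>0" unfolding \<epsilon>\<^sub>0_def using X Xne \<epsilon> by (subst Min_gr_iff) auto
    show "\<epsilon>\<^sub>0 \<le> \<epsilon> x / 2" if "x \<in> X" for x
      unfolding \<epsilon>\<^sub>0_def using X that by (intro Min_le) auto
  qed
  define M where "M = 1 + \<bar>B\<bar> / \<epsilon>\<^sub>0 + (\<Sum>x\<in>X. \<bar>L x\<bar>)"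
  have M: "1 \<le> M" "\<bar>B\<bar> / \<epsilon>\<^sub>0 \<le> M" "\<And>x. x \<in> X \<Longrightarrow> L x \<le> M"
  proof -
    have nn: "0 \<le> (\<Sum>x\<in>X. \<bar>L x\<bar>)" "0 \<le> \<bar>B\<bar> / \<epsilon>\<^sub>0" using \<epsilon>\<^sub>0 by (auto intro: sum_nonneg)
    then show "1 \<le> M" "\<bar>B\<bar> / \<epsilon>\<^sub>0 \<le> M" unfolding M_def by linarith+
    fix x assume "x \<in> X"
    then have "\<bar>L x\<bar> \<le> (\<Sum>x\<in>X. \<bar>L x\<bar>)" using X by (intro member_le_sum) auto
    then show "L x \<le> M" using nn abs_ge_self[of "L x"] unfolding M_def by linarith
  qed
  have "D (g y) (g z) \<le> M * D y z" for y z
  proof (cases "D y z < \<epsilon>\<^sub>0")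
    case True
    obtain x where x: "x \<in> X" "D x y < \<epsilon> x / 2" using X unfolding W_def by blast
    have "D x z < \<epsilon> x" using D_triangle[of x z y] x True \<epsilon>\<^sub>0(2)[OF x(1)] by linarith
    moreover have "D x y < \<epsilon> x" using x \<epsilon>[of x] by linarith
    ultimately have "D (g y) (g z) \<le> L x * D y z" using L by blast
    also have "\<dots> \<le> M * D y z" using M(3)[OF x(1)] by (intro mult_right_mono) auto
    finally show ?thesis .
  next
    case False
    have "D (g y) (g z) \<le> \<bar>B\<bar> / \<epsilon>\<^sub>0 * \<epsilon>\<^sub>0" using B[of "g y" "g z"] \<epsilon>\<^sub>0 by simp
    also have "\<dots> \<le> M * D y z" using False M \<epsilon>\<^sub>0 by (intro mult_mono) auto
    finally show ?thesis .
  qed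
  then show ?thesis using M(1) by blast
qed

text \<open>
  Near each point the map is smooth, hence Lipschitz, in patch coordinates, and there \<open>D\<close> is comparable to the coordinate distance.
\<close>
lemma smooth_map_lipschitz:
  assumes f: "smooth_map \<A> f"
  shows "\<exists>L\<ge>1. \<forall>y z. D (f y) (f z) \<le> L * D y z"
proof (rule locally_lipschitz_imp_lipschitz)
  fix x
  obtain C where C: "1 \<le> C" "\<And>\<pi> x y. \<pi> \<in> P \<Longrightarrow> x \<in> inner \<pi> \<Longrightarrow> y \<in> inner \<pi> \<Longrightarrow> D x y \<le> C * dist (coord \<pi> x) (coord \<pi> y)"
    using D_upper by blast
  have fc: "continuous_on UNIV f" using f by (simp add: smooth_map_def)
  obtain \<pi> where \<pi>: "\<pi> \<in> P" "x \<in> core \<pi>" using core_cover by blast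
  obtain \<tau> where \<tau>: "\<tau> \<in> P" "f x \<in> core \<tau>" using core_cover by blast
  let ?h = "coord \<tau> \<circ> f \<circ> param \<pi>"
  let ?O = "coord \<pi> ` (dom \<pi> \<inter> f -` dom \<tau>)"
  have fo: "open (f -` W)" if "open W" for W
    using fc that by (simp add: continuous_on_open_vimage[OF open_UNIV])
  have "open (f -` dom \<tau>)" by (intro fo patch_chart(1)[OF \<tau>(1)])
  then have op: "open ?O" by (rule chart_preimage_open[OF atlas patchD(1)[OF \<pi>(1)]])
  have uO: "coord \<pi> x \<in> ?O" using \<pi> \<tau> by (auto simp: core_def)
  have "smooth_on ?O ?h" using f patchD(1)[OF \<pi>(1)] patchD(1)[OF \<tau>(1)] by (auto simp: smooth_map_def)
  from smooth_locally_lipschitz[OF this op uO] obtain e L where e: "0 < e"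
      "L-lipschitz_on (cball (coord \<pi> x) e) ?h" by blast
  have xi: "x \<in> inner \<pi>" "f x \<in> inner \<tau>" using core_inner \<pi> \<tau> by blast+
  obtain \<epsilon>1 where \<epsilon>1: "0 < \<epsilon>1" "\<And>y. D x y < \<epsilon>1 \<Longrightarrow> y \<in> f -` inner \<tau>"
    using D_ball_in_open[of "f -` inner \<tau>" x] fo inner_open[OF \<tau>(1)] xi by auto
  define \<epsilon> where "\<epsilon> = min \<epsilon>1 (min e sep_radius)"
  have \<epsilon>: "0 < \<epsilon>" using \<epsilon>1 e sep_radius_pos by (simp add: \<epsilon>_def)
  have main: "D (f y) (f z) \<le> C * L * D y z" if yz: "D x y < \<epsilon>" "D x z < \<epsilon>" for y z
  proof -
    have i: "y \<in> inner \<pi>" "z \<in> inner \<pi>" using yz D_small_inner[OF \<pi>] by (auto simp: \<epsilon>_def)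
    have fi: "f y \<in> inner \<tau>" "f z \<in> inner \<tau>" using yz \<epsilon>1 by (auto simp: \<epsilon>_def)
    have b: "coord \<pi> y \<in> cball (coord \<pi> x) e" "coord \<pi> z \<in> cball (coord \<pi> x) e"
      using inner_dist_le_D[OF \<pi>(1) xi(1) i(1)] inner_dist_le_D[OF \<pi>(1) xi(1) i(2)] yz by (auto simp: \<epsilon>_def)
    have p: "param \<pi> (coord \<pi> y) = y" "param \<pi> (coord \<pi> z) = z"
      using i patch_chart(5)[OF \<pi>(1)] by (auto simp: inner_def)
    have "D (f y) (f z) \<le> C * dist (coord \<tau> (f y)) (coord \<tau> (f z))" using C(2)[OF \<tau>(1) fi] .
    also have "dist (coord \<tau> (f y)) (coord \<tau> (f z)) \<le> L * dist (coord \<pi> y) (coord \<pi> z)"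
      using lipschitz_onD[OF e(2) b] by (simp add: p)
    also have "L * dist (coord \<pi> y) (coord \<pi> z) \<le> L * D y z"
      using inner_dist_le_D[OF \<pi>(1) i] lipschitz_on_nonneg[OF e(2)] by (intro mult_left_mono) auto
    finally show ?thesis using C(1) by (simp add: mult_left_mono mult.assoc)
  qed
  show "\<exists>\<epsilon>>0. \<exists>L. \<forall>y z. D x y < \<epsilon> \<longrightarrow> D x z < \<epsilon> \<longrightarrow> D (f y) (f z) \<le> L * D y z"
    using \<epsilon> main by blast
qed

end

section \<open>Volumes of balls\<close>

lemma continuous_on_det:
  fixes M :: "'b::topological_space \<Rightarrow> real ^ 'n ^ 'n"
  assumes "\<And>i j. continuous_on S (\<lambda>x. M x $ i $ j)"
  shows "continuous_on S (\<lambda>x. det (M x))"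
  unfolding det_def by (intro continuous_intros assms)

text \<open>
  The determinant does not vanish along the segment from the identity matrix to \<open>M\<close>, which consists of positive definite
  matrices, and so keeps its sign.
\<close>
lemma positive_definite_det_pos:
  fixes M :: "real ^ 'n ^ 'n"
  assumes pd: "\<And>v. v \<noteq> 0 \<Longrightarrow> v \<bullet> (M *v v) > 0" shows "det M > 0"
proof -
  define N where "N t = (1 - t) *\<^sub>R mat 1 + t *\<^sub>R M" for t :: real
  have Nv: "v \<bullet> (N t *v v) = (1 - t) * (v \<bullet> v) + t * (v \<bullet> (M *v v))" for t v
    by (simp add: N_def matrix_vector_mult_add_rdistrib scaleR_matrix_vector_assoc[symmetric] inner_add_right)
  have nz: "det (N t) \<noteq> 0" if t: "0 \<le> t" "t \<le> 1" for t
  proof -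
    have "v = 0" if "N t *v v = 0" for v
    proof (rule ccontr)
      assume v: "v \<noteq> 0"
      have "0 < (1 - t) * (v \<bullet> v) + t * (v \<bullet> (M *v v))"
      proof (cases "t = 1")
        case False
        then show ?thesis using t v pd[OF v] by (intro add_pos_nonneg mult_pos_pos mult_nonneg_nonneg) auto
      qed (use pd[OF v] in simp)
      then show False using Nv[of v t] that by simp
    qed
    then have "\<exists>B. B ** N t = mat 1" using matrix_left_invertible_ker by blast
    then show ?thesis using invertible_det_nz invertible_left_inverse by blast
  qed
  have cont: "continuous_on {0..1} (\<lambda>t. det (N t))"
    by (rule continuous_on_det) (auto simp: N_def intro!: continuous_intros)
  show ?thesis
  proof (rule ccontr)
    assume "\<not> det M > 0"
    then have "det (N 1) \<le> 0" "0 \<le> det (N 0)" by (simp_all add: N_def)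
    then obtain t where "0 \<le> t" "t \<le> 1" "det (N t) = 0"
      using IVT2'[of "\<lambda>t. det (N t)" 1 0 0] cont by auto
    then show False using nz by blast
  qed
qed

locale riemannian_patches = patched_manifold \<A> P
  for \<A> :: "('a::{t2_space, second_countable_topology}, 'd::finite) chart set"
    and P :: "('a, 'd) patch set" +
  fixes G :: "('a, 'd) chart \<Rightarrow> 'a \<Rightarrow> real ^ 'd ^ 'd"
  assumes metric: "riemannian_metric \<A> G"
begin

abbreviation patch_ball :: "('a, 'd) patch \<Rightarrow> (real ^ 'd) set" where
  "patch_ball \<pi> \<equiv> cball (center \<pi>) (radius \<pi>)"

abbreviation gram :: "('a, 'd) patch \<Rightarrow> real ^ 'd \<Rightarrow> real ^ 'd ^ 'd" where
  "gram \<pi> u \<equiv> G (fst \<pi>) (param \<pi> u)"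

lemma patch_ball_subset: "\<pi> \<in> P \<Longrightarrow> patch_ball \<pi> \<subseteq> coord \<pi> ` dom \<pi>"
  using patchD(2,3)[of \<pi>] subset_cball[of "radius \<pi>" "3 * radius \<pi>" "center \<pi>"] by auto

lemma gram_entry_continuous:
  assumes "c \<in> \<A>" shows "continuous_on (snd c ` fst c) (\<lambda>u. G c (chart_inv c u) $ i $ j)"
proof -
  have "smooth_on (snd c ` fst c) (\<lambda>u. G c (chart_inv c u) $ i $ j)"
    using metric assms by (auto simp: riemannian_metric_def)
  then have "Ck_on 0 (snd c ` fst c) (\<lambda>u. G c (chart_inv c u) $ i $ j)" unfolding smooth_on_def by blast
  then show ?thesis by simp
qed

lemma gram_positive:
  assumes "c \<in> \<A>" "x \<in> fst c" "v \<noteq> 0" shows "0 < v \<bullet> (G c x *v v)"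
  using metric assms by (auto simp: riemannian_metric_def)

text \<open>
  Compactness of the unit sphere times a closed ball of coordinates.
\<close>
lemma gram_bounds: "\<exists>\<Lambda>\<ge>1. \<forall>\<pi>\<in>P. \<forall>u\<in>patch_ball \<pi>. \<forall>v.
  norm v \<le> \<Lambda> * sqrt (v \<bullet> (gram \<pi> u *v v)) \<and> sqrt (v \<bullet> (gram \<pi> u *v v)) \<le> \<Lambda> * norm v"
proof -
  have "\<exists>\<Lambda>\<ge>1. \<forall>u\<in>patch_ball \<pi>. \<forall>v.
      norm v \<le> \<Lambda> * sqrt (v \<bullet> (gram \<pi> u *v v)) \<and> sqrt (v \<bullet> (gram \<pi> u *v v)) \<le> \<Lambda> * norm v"
    if \<pi>: "\<pi> \<in> P" for \<pi>
  proof -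
    let ?S = "patch_ball \<pi> \<times> sphere (0 :: real ^ 'd) 1"
    define q where "q u v = v \<bullet> (gram \<pi> u *v v)" for u v
    have ent: "continuous_on ?S (\<lambda>p. gram \<pi> (fst p) $ i $ j)" for i j
      by (rule continuous_on_compose2[OF gram_entry_continuous[OF patchD(1)[OF \<pi>]]])
        (use patch_ball_subset[OF \<pi>] in \<open>auto intro!: continuous_intros\<close>)
    have cq: "continuous_on ?S (\<lambda>p. q (fst p) (snd p))"
      unfolding q_def inner_vec_def matrix_vector_mult_def by (auto intro!: continuous_intros ent)
    have comp: "compact ?S" by (intro compact_Times) auto
    have ne: "?S \<noteq> {}"
    proof -
      obtain i :: 'd where True by simp
      have "(center \<pi>, axis i 1) \<in> ?S" using patchD(2)[OF \<pi>] by simp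
      then show ?thesis by blast
    qed
    obtain p0 where p0: "p0 \<in> ?S" "\<And>p. p \<in> ?S \<Longrightarrow> q (fst p0) (snd p0) \<le> q (fst p) (snd p)"
      using continuous_attains_inf[OF comp ne cq] by blast
    obtain p1 where p1: "p1 \<in> ?S" "\<And>p. p \<in> ?S \<Longrightarrow> q (fst p) (snd p) \<le> q (fst p1) (snd p1)"
      using continuous_attains_sup[OF comp ne cq] by blast
    define m where "m = q (fst p0) (snd p0)"
    define M where "M = q (fst p1) (snd p1)"
    have inU: "param \<pi> u \<in> dom \<pi>" if "u \<in> patch_ball \<pi>" for u
      using that patch_ball_subset[OF \<pi>] patch_chart(7)[OF \<pi>] by blast
    have m: "0 < m" unfolding m_def q_def
      using p0(1) by (intro gram_positive patchD(1)[OF \<pi>] inU) (auto simp: mem_Times_iff)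
    have mM: "m \<le> M" using p1(2)[OF p0(1)] by (simp add: m_def M_def)
    define \<Lambda> where "\<Lambda> = max 1 (max (sqrt M) (1 / sqrt m))"
    have \<Lambda>: "1 \<le> \<Lambda>" "sqrt M \<le> \<Lambda>" "1 / sqrt m \<le> \<Lambda>" by (auto simp: \<Lambda>_def)
    have "norm v \<le> \<Lambda> * sqrt (q u v) \<and> sqrt (q u v) \<le> \<Lambda> * norm v" if u: "u \<in> patch_ball \<pi>" for u v
    proof (cases "v = 0")
      case False
      define w where "w = (1 / norm v) *\<^sub>R v"
      have v: "v = norm v *\<^sub>R w" using False by (simp add: w_def)
      have uw: "(u, w) \<in> ?S" using u False by (simp add: w_def)
      have "q u v = (norm v)\<^sup>2 * q u w"
        unfolding q_def by (subst (1 2) v) (simp add: matrix_vector_mult_scaleR power2_eq_square)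
      then have sq: "sqrt (q u v) = norm v * sqrt (q u w)" by (simp add: real_sqrt_mult)
      have b: "sqrt m \<le> sqrt (q u w)" "sqrt (q u w) \<le> sqrt M"
        using p0(2)[OF uw] p1(2)[OF uw] by (auto simp: m_def M_def)
      have "1 = 1 / sqrt m * sqrt m" using m by simp
      also have "\<dots> \<le> \<Lambda> * sqrt (q u w)" using b \<Lambda> m by (intro mult_mono) auto
      finally have "norm v * 1 \<le> norm v * (\<Lambda> * sqrt (q u w))" by (intro mult_left_mono) auto
      moreover have "norm v * sqrt (q u w) \<le> norm v * \<Lambda>" using order_trans[OF b(2) \<Lambda>(2)] by (intro mult_left_mono) auto
      ultimately show ?thesis unfolding sq by (simp add: mult_ac)
    qed (simp add: q_def)
    then show ?thesis using \<Lambda>(1) unfolding q_def by blast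
  qed
  then obtain \<Lambda> where \<Lambda>: "\<And>\<pi>. \<pi> \<in> P \<Longrightarrow> 1 \<le> \<Lambda> \<pi>" "\<And>\<pi> u v. \<pi> \<in> P \<Longrightarrow> u \<in> patch_ball \<pi> \<Longrightarrow>
      norm v \<le> \<Lambda> \<pi> * sqrt (v \<bullet> (gram \<pi> u *v v)) \<and> sqrt (v \<bullet> (gram \<pi> u *v v)) \<le> \<Lambda> \<pi> * norm v" by metis
  define M where "M = Max (\<Lambda> ` P)"
  have M: "\<Lambda> \<pi> \<le> M" if "\<pi> \<in> P" for \<pi> unfolding M_def using that finite_P by (intro Max_ge) auto
  have "1 \<le> M" using M \<Lambda>(1) P_nonempty by (meson all_not_in_conv order_trans)
  moreover have "norm v \<le> M * sqrt (v \<bullet> (gram \<pi> u *v v)) \<and> sqrt (v \<bullet> (gram \<pi> u *v v)) \<le> M * norm v"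
    if \<pi>: "\<pi> \<in> P" and u: "u \<in> patch_ball \<pi>" for \<pi> u v
  proof -
    have u': "param \<pi> u \<in> dom \<pi>" using u patch_ball_subset[OF \<pi>] patch_chart(7)[OF \<pi>] by blast
    have "0 \<le> v \<bullet> (gram \<pi> u *v v)"
      using gram_positive[OF patchD(1)[OF \<pi>] u', of v] by (cases "v = 0") auto
    then have "\<Lambda> \<pi> * sqrt (v \<bullet> (gram \<pi> u *v v)) \<le> M * sqrt (v \<bullet> (gram \<pi> u *v v))"
      using M[OF \<pi>] by (intro mult_right_mono) auto
    moreover have "\<Lambda> \<pi> * norm v \<le> M * norm v" using M[OF \<pi>] by (intro mult_right_mono) auto
    ultimately show ?thesis using \<Lambda>(2)[OF \<pi> u, of v] by linarith
  qed
  ultimately show ?thesis by blast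
qed

text \<open>
  In the coordinates of a patch, \<open>\<mu>\<close> has a density with respect to Lebesgue measure that is continuous and positive on a compact
  ball.
\<close>
lemma patch_ball_volume:
  assumes \<mu>: "smooth_measure \<A> G \<mu>" and \<pi>: "\<pi> \<in> P"
  shows "\<exists>m M. 0 < m \<and> 0 < M \<and> (\<forall>B\<in>sets borel. B \<subseteq> param \<pi> ` patch_ball \<pi> \<and> coord \<pi> ` B \<in> sets borel \<longrightarrow>
    ennreal m * emeasure lborel (coord \<pi> ` B) \<le> emeasure \<mu> B \<and>
    emeasure \<mu> B \<le> ennreal M * emeasure lborel (coord \<pi> ` B))"
proof -
  obtain \<nu> \<psi> where \<nu>: "is_riemannian_volume \<A> G \<nu>" and \<psi>: "smooth_function \<A> \<psi>" "\<And>x. 0 < \<psi> x"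
    and \<mu>eq: "\<mu> = density \<nu> (\<lambda>x. ennreal (\<psi> x))"
    using \<mu> by (auto simp: smooth_measure_def)
  let ?S = "patch_ball \<pi>" and ?D = "\<lambda>u. sqrt (det (gram \<pi> u))"
  have \<psi>c: "continuous_on (snd c ` fst c) (\<psi> \<circ> chart_inv c)" if "c \<in> \<A>" for c
  proof -
    have "smooth_on (snd c ` fst c) (\<psi> \<circ> chart_inv c)" using \<psi> that by (auto simp: smooth_function_def)
    then have "Ck_on 0 (snd c ` fst c) (\<psi> \<circ> chart_inv c)" unfolding smooth_on_def by blast
    then show ?thesis by simp
  qed
  have \<psi>cont: "continuous_on UNIV \<psi>"
  proof -
    have "continuous_on (fst c) \<psi>" if "c \<in> \<A>" for c
    proof -
      note cf = chart_facts[OF atlas that]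
      have "continuous_on (fst c) ((\<psi> \<circ> chart_inv c) \<circ> snd c)"
        by (rule continuous_on_compose[OF cf(3) \<psi>c[OF that]])
      then show ?thesis by (rule continuous_on_eq) (simp add: cf(5))
    qed
    then have "continuous_on (\<Union>c\<in>\<A>. fst c) \<psi>"
      using chart_facts(1)[OF atlas] by (intro continuous_on_open_UN) auto
    then show ?thesis using atlas by (simp add: smooth_atlas_def)
  qed
  have s\<nu>: "sets \<nu> = sets borel" using \<nu> by (simp add: is_riemannian_volume_def)
  have \<psi>m [measurable]: "\<psi> \<in> borel_measurable \<nu>"
    using borel_measurable_continuous_onI[OF \<psi>cont] measurable_cong_sets[OF s\<nu> refl] by blast
  have S: "compact ?S" "?S \<noteq> {}" using patchD(2)[OF \<pi>] by auto
  have dc: "continuous_on ?S ?D"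
  proof -
    have "continuous_on ?S (\<lambda>u. det (gram \<pi> u))"
      by (intro continuous_on_det continuous_on_subset[OF gram_entry_continuous[OF patchD(1)[OF \<pi>]] patch_ball_subset[OF \<pi>]])
    then show ?thesis by (intro continuous_intros)
  qed
  have pc: "continuous_on ?S (\<lambda>u. \<psi> (param \<pi> u))"
    using continuous_on_subset[OF \<psi>c[OF patchD(1)[OF \<pi>]] patch_ball_subset[OF \<pi>]] by (simp add: comp_def)
  have inU: "param \<pi> u \<in> dom \<pi>" if "u \<in> ?S" for u
    using that patch_ball_subset[OF \<pi>] patch_chart(7)[OF \<pi>] by blast
  have dpos: "0 < ?D u" if "u \<in> ?S" for u
    using positive_definite_det_pos[of "gram \<pi> u"] gram_positive[OF patchD(1)[OF \<pi>] inU[OF that]] by simp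
  obtain u0 where u0: "u0 \<in> ?S" "\<And>u. u \<in> ?S \<Longrightarrow> ?D u0 \<le> ?D u" using continuous_attains_inf[OF S dc] by blast
  obtain u1 where u1: "u1 \<in> ?S" "\<And>u. u \<in> ?S \<Longrightarrow> ?D u \<le> ?D u1" using continuous_attains_sup[OF S dc] by blast
  obtain w0 where w0: "w0 \<in> ?S" "\<And>u. u \<in> ?S \<Longrightarrow> \<psi> (param \<pi> w0) \<le> \<psi> (param \<pi> u)" using continuous_attains_inf[OF S pc] by blast
  obtain w1 where w1: "w1 \<in> ?S" "\<And>u. u \<in> ?S \<Longrightarrow> \<psi> (param \<pi> u) \<le> \<psi> (param \<pi> w1)" using continuous_attains_sup[OF S pc] by blast
  define m where "m = \<psi> (param \<pi> w0) * ?D u0"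
  define M where "M = \<psi> (param \<pi> w1) * ?D u1"
  have pos: "0 < m" "0 < M" unfolding m_def M_def using \<psi>(2) dpos[OF u0(1)] dpos[OF u1(1)] by auto
  have "ennreal m * emeasure lborel (coord \<pi> ` B) \<le> emeasure \<mu> B \<and> emeasure \<mu> B \<le> ennreal M * emeasure lborel (coord \<pi> ` B)"
    if B: "B \<in> sets borel" "B \<subseteq> param \<pi> ` ?S" "coord \<pi> ` B \<in> sets borel" for B
  proof -
    have Bdom: "B \<subseteq> dom \<pi>" using B(2) inU by blast
    have coordB: "coord \<pi> ` B \<subseteq> ?S"
    proof
      fix u assume "u \<in> coord \<pi> ` B"
      then obtain v where v: "v \<in> ?S" "u = coord \<pi> (param \<pi> v)" using B(2) by auto
      then have "v \<in> coord \<pi> ` dom \<pi>" using patch_ball_subset[OF \<pi>] by blast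
      then show "u \<in> ?S" using v patch_chart(6)[OF \<pi>] by simp
    qed
    have \<mu>B: "emeasure \<mu> B = (\<integral>\<^sup>+x. ennreal (\<psi> x) * indicator B x \<partial>\<nu>)"
      unfolding \<mu>eq using B(1) s\<nu> by (subst emeasure_density) auto
    have \<nu>B: "emeasure \<nu> B = (\<integral>\<^sup>+u. ennreal (?D u) * indicator (coord \<pi> ` B) u \<partial>lborel)"
      using \<nu> patchD(1)[OF \<pi>] B(1) Bdom by (auto simp: is_riemannian_volume_def)
    have \<psi>B: "\<psi> (param \<pi> w0) \<le> \<psi> x" "\<psi> x \<le> \<psi> (param \<pi> w1)" if x: "x \<in> B" for x
    proof -
      obtain v where "v \<in> ?S" "x = param \<pi> v" using B(2) x by blast
      then show "\<psi> (param \<pi> w0) \<le> \<psi> x" "\<psi> x \<le> \<psi> (param \<pi> w1)" using w0(2) w1(2) by auto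
    qed
    have up1: "emeasure \<mu> B \<le> ennreal (\<psi> (param \<pi> w1)) * emeasure \<nu> B"
    proof -
      have "emeasure \<mu> B \<le> (\<integral>\<^sup>+x. ennreal (\<psi> (param \<pi> w1)) * indicator B x \<partial>\<nu>)"
        unfolding \<mu>B using \<psi>B by (intro nn_integral_mono) (auto simp: indicator_def ennreal_leI)
      then show ?thesis using B(1) s\<nu> by (simp add: nn_integral_cmult_indicator)
    qed
    have lo1: "ennreal (\<psi> (param \<pi> w0)) * emeasure \<nu> B \<le> emeasure \<mu> B"
    proof -
      have "(\<integral>\<^sup>+x. ennreal (\<psi> (param \<pi> w0)) * indicator B x \<partial>\<nu>) \<le> emeasure \<mu> B"
        unfolding \<mu>B using \<psi>B by (intro nn_integral_mono) (auto simp: indicator_def ennreal_leI)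
      then show ?thesis using B(1) s\<nu> by (simp add: nn_integral_cmult_indicator)
    qed
    have up2: "emeasure \<nu> B \<le> ennreal (?D u1) * emeasure lborel (coord \<pi> ` B)"
    proof -
      have "emeasure \<nu> B \<le> (\<integral>\<^sup>+u. ennreal (?D u1) * indicator (coord \<pi> ` B) u \<partial>lborel)"
        unfolding \<nu>B using u1(2) coordB by (intro nn_integral_mono) (auto simp: indicator_def intro!: ennreal_leI)
      then show ?thesis using B(3) by (simp add: nn_integral_cmult_indicator)
    qed
    have lo2: "ennreal (?D u0) * emeasure lborel (coord \<pi> ` B) \<le> emeasure \<nu> B"
    proof -
      have "(\<integral>\<^sup>+u. ennreal (?D u0) * indicator (coord \<pi> ` B) u \<partial>lborel) \<le> emeasure \<nu> B"
        unfolding \<nu>B using u0(2) coordB by (intro nn_integral_mono) (auto simp: indicator_def intro!: ennreal_leI)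
      then show ?thesis using B(3) by (simp add: nn_integral_cmult_indicator)
    qed
    have "ennreal m * emeasure lborel (coord \<pi> ` B)
        = ennreal (\<psi> (param \<pi> w0)) * (ennreal (?D u0) * emeasure lborel (coord \<pi> ` B))"
      unfolding m_def using \<psi>(2) dpos[OF u0(1)] by (simp add: ennreal_mult less_imp_le mult.assoc)
    also have "\<dots> \<le> ennreal (\<psi> (param \<pi> w0)) * emeasure \<nu> B" by (intro mult_left_mono lo2) auto
    also note lo1
    finally have lo: "ennreal m * emeasure lborel (coord \<pi> ` B) \<le> emeasure \<mu> B" .
    note up1
    also have "ennreal (\<psi> (param \<pi> w1)) * emeasure \<nu> B
        \<le> ennreal (\<psi> (param \<pi> w1)) * (ennreal (?D u1) * emeasure lborel (coord \<pi> ` B))"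
      by (intro mult_left_mono up2) auto
    also have "\<dots> = ennreal M * emeasure lborel (coord \<pi> ` B)"
      unfolding M_def using \<psi>(2) dpos[OF u1(1)] by (simp add: ennreal_mult less_imp_le mult.assoc)
    finally show ?thesis using lo by blast
  qed
  then show ?thesis using pos by blast
qed

lemma D_ball_closed: "closed {y. D x y \<le> \<rho>}"
  using closed_Collect_le[OF D_continuous[of x] continuous_on_const] .

text \<open>
  For small \<open>\<rho>\<close> the \<open>D\<close>-ball lies between coordinate balls of comparable radii. For larger radii the bounds follow by
  adjusting constants, as \<open>\<mu>\<close> is a probability measure.
\<close>
lemma D_ball_measure:
  assumes \<mu>: "smooth_measure \<A> G \<mu>" and prob: "prob_space \<mu>"
  shows "\<exists>c C. 0 < c \<and>
    (\<forall>x \<rho>. 0 < \<rho> \<longrightarrow> \<rho> \<le> 1 \<longrightarrow> c * \<rho> ^ CARD('d) \<le> measure \<mu> {y. D x y \<le> \<rho>}) \<and>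
    (\<forall>x \<rho>. 0 < \<rho> \<longrightarrow> measure \<mu> {y. D x y \<le> \<rho>} \<le> C * \<rho> ^ CARD('d))"
proof -
  interpret prob_space \<mu> by (rule prob)
  have s\<mu>: "sets \<mu> = sets borel"
    using \<mu> by (auto simp: smooth_measure_def is_riemannian_volume_def)
  have bs: "{y. D x y \<le> \<rho>} \<in> sets \<mu>" for x \<rho> using D_ball_closed s\<mu> by auto
  obtain A where A: "1 \<le> A" "\<And>\<pi> x y. \<pi> \<in> P \<Longrightarrow> x \<in> inner \<pi> \<Longrightarrow> y \<in> inner \<pi> \<Longrightarrow> D x y \<le> A * dist (coord \<pi> x) (coord \<pi> y)"
    using D_upper by blast
  obtain m M where mM: "\<And>\<pi>. \<pi> \<in> P \<Longrightarrow> 0 < m \<pi>" "\<And>\<pi>. \<pi> \<in> P \<Longrightarrow> 0 < M \<pi>"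
    "\<And>\<pi> B. \<pi> \<in> P \<Longrightarrow> B \<in> sets borel \<Longrightarrow> B \<subseteq> param \<pi> ` patch_ball \<pi> \<Longrightarrow> coord \<pi> ` B \<in> sets borel \<Longrightarrow>
      ennreal (m \<pi>) * emeasure lborel (coord \<pi> ` B) \<le> emeasure \<mu> B \<and>
      emeasure \<mu> B \<le> ennreal (M \<pi>) * emeasure lborel (coord \<pi> ` B)"
    using patch_ball_volume[OF \<mu>] by metis
  define m\<^sub>0 where "m\<^sub>0 = Min (m ` P)"
  define M\<^sub>0 where "M\<^sub>0 = Max (M ` P)"
  have m0: "0 < m\<^sub>0" "\<And>\<pi>. \<pi> \<in> P \<Longrightarrow> m\<^sub>0 \<le> m \<pi>" unfolding m\<^sub>0_def using finite_P P_nonempty mM(1) by (auto simp: Min_gr_iff)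
  have M0: "\<And>\<pi>. \<pi> \<in> P \<Longrightarrow> M \<pi> \<le> M\<^sub>0" unfolding M\<^sub>0_def using finite_P by auto
  define \<omega> where "\<omega> = measure lborel (ball (0 :: real ^ 'd) 1)"
  have \<omega>: "0 < \<omega>" unfolding \<omega>_def by (rule content_ball_pos) simp
  have vol: "m\<^sub>0 * (\<omega> * \<rho> ^ CARD('d)) \<le> measure \<mu> (param \<pi> ` cball (coord \<pi> x) \<rho>) \<and>
      measure \<mu> (param \<pi> ` cball (coord \<pi> x) \<rho>) \<le> M\<^sub>0 * (\<omega> * \<rho> ^ CARD('d)) \<and> param \<pi> ` cball (coord \<pi> x) \<rho> \<in> sets \<mu>"
    if \<pi>: "\<pi> \<in> P" "x \<in> core \<pi>" and \<rho>: "0 < \<rho>" "\<rho> \<le> sep_radius" for \<pi> x \<rho>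
  proof -
    let ?K = "cball (coord \<pi> x) \<rho>" and ?B = "param \<pi> ` cball (coord \<pi> x) \<rho>"
    have "\<rho> \<le> radius \<pi> / 4" using \<rho> sep_radius_le[OF \<pi>(1)] by simp
    then have sub: "?K \<subseteq> patch_ball \<pi>"
    proof (intro subsetI)
      fix u assume \<rho>r: "\<rho> \<le> radius \<pi> / 4" and u: "u \<in> ?K"
      have "dist (center \<pi>) u \<le> dist (center \<pi>) (coord \<pi> x) + dist (coord \<pi> x) u" by (rule dist_triangle)
      also have "\<dots> \<le> radius \<pi> / 2 + radius \<pi> / 4"
        using \<pi>(2) u \<rho>r by (intro add_mono) (auto simp: core_def dist_commute)
      also have "\<dots> \<le> radius \<pi>" using patchD(2)[OF \<pi>(1)] by simp
      finally show "u \<in> patch_ball \<pi>" by simp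
    qed
    have sub': "?K \<subseteq> coord \<pi> ` dom \<pi>" using sub patch_ball_subset[OF \<pi>(1)] by blast
    have cB: "compact ?B"
      by (intro compact_continuous_image continuous_on_subset[OF patch_chart(4)[OF \<pi>(1)] sub']) auto
    then have Bb: "?B \<in> sets borel" by (simp add: compact_imp_closed borel_closed)
    have cK: "coord \<pi> ` ?B = ?K"
    proof -
      have "coord \<pi> ` ?B = (\<lambda>u. coord \<pi> (param \<pi> u)) ` ?K" by (simp add: image_image)
      also have "\<dots> = (\<lambda>u. u) ` ?K" using sub' patch_chart(6)[OF \<pi>(1)] by (intro image_cong) auto
      finally show ?thesis by simp
    qed
    have "emeasure lborel ?K = ennreal (measure lborel ?K)"
      using emeasure_lborel_cball_finite[of "coord \<pi> x" \<rho>] by (intro emeasure_eq_ennreal_measure) auto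
    also have "measure lborel ?K = \<omega> * \<rho> ^ CARD('d)"
      using \<rho>(1) content_ball_conv_unit_ball[of \<rho> "coord \<pi> x"] by (simp add: content_cball_conv_ball \<omega>_def mult.commute)
    finally have K: "emeasure lborel ?K = ennreal (\<omega> * \<rho> ^ CARD('d))" .
    have nn: "0 \<le> \<omega> * \<rho> ^ CARD('d)" using \<omega> \<rho> by simp
    have v: "ennreal (m \<pi>) * ennreal (\<omega> * \<rho> ^ CARD('d)) \<le> emeasure \<mu> ?B"
        "emeasure \<mu> ?B \<le> ennreal (M \<pi>) * ennreal (\<omega> * \<rho> ^ CARD('d))"
      using mM(3)[OF \<pi>(1) Bb] sub cK K by auto
    have "m \<pi> * (\<omega> * \<rho> ^ CARD('d)) \<le> measure \<mu> ?B"
      using v(1) nn mM(1)[OF \<pi>(1)] by (simp add: emeasure_eq_measure ennreal_mult[symmetric] less_imp_le ennreal_le_iff)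
    moreover have "measure \<mu> ?B \<le> M \<pi> * (\<omega> * \<rho> ^ CARD('d))"
      using v(2) nn mM(2)[OF \<pi>(1)] by (simp add: emeasure_eq_measure ennreal_mult[symmetric] less_imp_le ennreal_le_iff)
    moreover have "m\<^sub>0 * (\<omega> * \<rho> ^ CARD('d)) \<le> m \<pi> * (\<omega> * \<rho> ^ CARD('d))" using m0(2)[OF \<pi>(1)] nn by (intro mult_right_mono)
    moreover have "M \<pi> * (\<omega> * \<rho> ^ CARD('d)) \<le> M\<^sub>0 * (\<omega> * \<rho> ^ CARD('d))" using M0[OF \<pi>(1)] nn by (intro mult_right_mono)
    ultimately show ?thesis using Bb s\<mu> by auto
  qed
  define s where "s = sep_radius / 2"
  have s: "0 < s" "s < sep_radius" "s \<le> 1"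
  proof -
    obtain \<pi> where "\<pi> \<in> P" using P_nonempty by blast
    then show "0 < s" "s < sep_radius" "s \<le> 1" using sep_radius_pos sep_radius_le[of \<pi>] by (auto simp: s_def)
  qed
  have upper: "measure \<mu> {y. D x y \<le> \<rho>} \<le> M\<^sub>0 * \<omega> * \<rho> ^ CARD('d)" if \<rho>: "0 < \<rho>" "\<rho> \<le> s" for x \<rho>
  proof -
    obtain \<pi> where \<pi>: "\<pi> \<in> P" "x \<in> core \<pi>" using core_cover by blast
    have xi: "x \<in> inner \<pi>" using core_inner \<pi> by blast
    have "{y. D x y \<le> \<rho>} \<subseteq> param \<pi> ` cball (coord \<pi> x) \<rho>"
    proof
      fix y assume "y \<in> {y. D x y \<le> \<rho>}"
      then have y: "D x y \<le> \<rho>" by simp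
      then have yi: "y \<in> inner \<pi>" using D_small_inner[OF \<pi>] \<rho> s by auto
      then have "y = param \<pi> (coord \<pi> y)" using patch_chart(5)[OF \<pi>(1)] by (auto simp: inner_def)
      moreover have "coord \<pi> y \<in> cball (coord \<pi> x) \<rho>" using inner_dist_le_D[OF \<pi>(1) xi yi] y by simp
      ultimately show "y \<in> param \<pi> ` cball (coord \<pi> x) \<rho>" by blast
    qed
    then have "measure \<mu> {y. D x y \<le> \<rho>} \<le> measure \<mu> (param \<pi> ` cball (coord \<pi> x) \<rho>)"
      using vol[OF \<pi> \<rho>(1)] \<rho> s by (intro finite_measure_mono) auto
    also have "\<dots> \<le> M\<^sub>0 * (\<omega> * \<rho> ^ CARD('d))" using vol[OF \<pi> \<rho>(1)] \<rho> s by auto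
    finally show ?thesis by simp
  qed
  have lower: "m\<^sub>0 * \<omega> * (\<rho> / A) ^ CARD('d) \<le> measure \<mu> {y. D x y \<le> \<rho>}" if \<rho>: "0 < \<rho>" "\<rho> \<le> s" for x \<rho>
  proof -
    obtain \<pi> where \<pi>: "\<pi> \<in> P" "x \<in> core \<pi>" using core_cover by blast
    have xi: "x \<in> inner \<pi>" using core_inner \<pi> by blast
    have \<rho>A: "0 < \<rho> / A" "\<rho> / A \<le> sep_radius"
    proof -
      show "0 < \<rho> / A" using \<rho> A(1) by simp
      have "\<rho> / A \<le> \<rho> / 1" using \<rho> A(1) by (intro divide_left_mono) auto
      then show "\<rho> / A \<le> sep_radius" using \<rho> s by simp
    qed
    have "param \<pi> ` cball (coord \<pi> x) (\<rho> / A) \<subseteq> {y. D x y \<le> \<rho>}"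
    proof
      fix y assume "y \<in> param \<pi> ` cball (coord \<pi> x) (\<rho> / A)"
      then obtain u where u: "y = param \<pi> u" "dist (coord \<pi> x) u \<le> \<rho> / A" by auto
      have "sep_radius \<le> radius \<pi> / 4" using sep_radius_le[OF \<pi>(1)] by simp
      with \<rho>A(2) have "\<rho> / A \<le> radius \<pi> / 4" by (rule order_trans)
      have ur: "dist u (center \<pi>) < radius \<pi>"
      proof -
        have "dist u (center \<pi>) \<le> dist u (coord \<pi> x) + dist (coord \<pi> x) (center \<pi>)" by (rule dist_triangle)
        also have "\<dots> < radius \<pi> / 4 + radius \<pi> / 2"
        proof (rule add_le_less_mono)
          show "dist u (coord \<pi> x) \<le> radius \<pi> / 4"
            using order_trans[OF u(2) \<open>\<rho> / A \<le> radius \<pi> / 4\<close>] by (simp only: dist_commute)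
          show "dist (coord \<pi> x) (center \<pi>) < radius \<pi> / 2" using \<pi>(2) by (simp add: core_def)
        qed
        also have "\<dots> \<le> radius \<pi>" using patchD(2)[OF \<pi>(1)] by simp
        finally show ?thesis .
      qed
      then have uS: "u \<in> coord \<pi> ` dom \<pi>" using patch_ball_subset[OF \<pi>(1)] by (auto simp: dist_commute less_imp_le subset_iff)
      then have cy: "coord \<pi> y = u" "y \<in> dom \<pi>" using patch_chart(6,7)[OF \<pi>(1)] u by auto
      then have "y \<in> inner \<pi>" using ur by (simp add: inner_def)
      from A(2)[OF \<pi>(1) xi this] have "D x y \<le> A * dist (coord \<pi> x) u" by (simp add: cy)
      also have "\<dots> \<le> A * (\<rho> / A)" using u A(1) by (intro mult_left_mono) auto
      finally show "y \<in> {y. D x y \<le> \<rho>}" using A(1) by simp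
    qed
    then have "measure \<mu> (param \<pi> ` cball (coord \<pi> x) (\<rho> / A)) \<le> measure \<mu> {y. D x y \<le> \<rho>}"
      using bs by (intro finite_measure_mono)
    then show ?thesis using vol[OF \<pi> \<rho>A] by (simp add: mult.assoc)
  qed
  define c where "c = m\<^sub>0 * \<omega> * (s / A) ^ CARD('d)"
  define C where "C = M\<^sub>0 * \<omega> + 1 / s ^ CARD('d)"
  have c: "0 < c" using m0 \<omega> s A by (simp add: c_def)
  have "c * \<rho> ^ CARD('d) \<le> measure \<mu> {y. D x y \<le> \<rho>}" if \<rho>: "0 < \<rho>" "\<rho> \<le> 1" for x \<rho>
  proof -
    have s\<rho>: "0 < s * \<rho>" "s * \<rho> \<le> s" "s * \<rho> \<le> \<rho>" using s \<rho> by (auto simp: mult_le_cancel_left1 mult_le_cancel_right1)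
    have "c * \<rho> ^ CARD('d) = m\<^sub>0 * \<omega> * ((s * \<rho>) / A) ^ CARD('d)"
      by (simp add: c_def power_mult_distrib power_divide)
    also have "\<dots> \<le> measure \<mu> {y. D x y \<le> s * \<rho>}" by (rule lower[OF s\<rho>(1,2)])
    also have "\<dots> \<le> measure \<mu> {y. D x y \<le> \<rho>}" using bs s\<rho>(3) by (intro finite_measure_mono) auto
    finally show ?thesis .
  qed
  moreover have "measure \<mu> {y. D x y \<le> \<rho>} \<le> C * \<rho> ^ CARD('d)" if \<rho>: "0 < \<rho>" for x \<rho>
  proof (cases "\<rho> \<le> s")
    case True
    have "measure \<mu> {y. D x y \<le> \<rho>} \<le> M\<^sub>0 * \<omega> * \<rho> ^ CARD('d)" using upper[OF \<rho> True] .
    also have "\<dots> \<le> C * \<rho> ^ CARD('d)" using \<rho> s by (intro mult_right_mono) (auto simp: C_def)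
    finally show ?thesis .
  next
    case False
    obtain \<pi> where \<pi>: "\<pi> \<in> P" using P_nonempty by blast
    have M00: "0 \<le> M\<^sub>0 * \<omega>" using M0[OF \<pi>] mM(2)[OF \<pi>] \<omega> by simp
    have "1 \<le> (\<rho> / s) ^ CARD('d)" using False s by (intro one_le_power) simp
    also have "\<dots> = 1 / s ^ CARD('d) * \<rho> ^ CARD('d)" by (simp add: power_divide)
    also have "\<dots> \<le> C * \<rho> ^ CARD('d)" using \<rho> M00 by (intro mult_right_mono) (auto simp: C_def)
    finally show ?thesis using prob_le_1 order_trans by blast
  qed
  ultimately show ?thesis using c by blast
qed

end

section \<open>Comparison with the Riemannian distance\<close>

lemma quadratic_form_transform:
  fixes J M :: "real ^ 'n ^ 'n"
  shows "v \<bullet> ((transpose J ** M ** J) *v v) = (J *v v) \<bullet> (M *v (J *v v))"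
proof -
  have "(transpose J ** M ** J) *v v = transpose J *v (M *v (J *v v))"
    by (simp add: matrix_vector_mul_assoc[symmetric])
  then have "v \<bullet> ((transpose J ** M ** J) *v v) = ((M *v (J *v v)) v* J) \<bullet> v"
    by (simp add: inner_commute)
  also have "\<dots> = (M *v (J *v v)) \<bullet> (J *v v)" by (rule dot_lmul_matrix)
  finally show ?thesis by (simp add: inner_commute)
qed

lemma break_interval:
  fixes S :: "real set"
  assumes S: "finite S" "{0, 1} \<subseteq> S" and uv: "0 \<le> u" "u < v" "v \<le> 1" "S \<inter> {u<..<v} = {}"
  obtains a b where "a \<in> S" "b \<in> S" "a \<le> u" "v \<le> b" "S \<inter> {a<..<b} = {}"
proof -
  define a where "a = Max {s \<in> S. s \<le> u}"
  define b where "b = Min {s \<in> S. v \<le> s}"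
  have fa: "finite {s \<in> S. s \<le> u}" "{s \<in> S. s \<le> u} \<noteq> {}" using S uv by auto
  have fb: "finite {s \<in> S. v \<le> s}" "{s \<in> S. v \<le> s} \<noteq> {}" using S uv by auto
  have a: "a \<in> S" "a \<le> u" "\<And>s. s \<in> S \<Longrightarrow> s \<le> u \<Longrightarrow> s \<le> a"
    using Max_in[OF fa] Max_ge[OF fa(1)] by (auto simp: a_def)
  have b: "b \<in> S" "v \<le> b" "\<And>s. s \<in> S \<Longrightarrow> v \<le> s \<Longrightarrow> b \<le> s"
    using Min_in[OF fb] Min_le[OF fb(1)] by (auto simp: b_def)
  have "S \<inter> {a<..<b} = {}"
  proof (rule ccontr)
    assume "S \<inter> {a<..<b} \<noteq> {}"
    then obtain s where s: "s \<in> S" "a < s" "s < b" by auto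
    then have "u < s" "s < v" using a(3)[of s] b(3)[of s] by (meson not_le)+
    then show False using s uv(4) by auto
  qed
  then show thesis using that a b by blast
qed

context riemannian_patches
begin

lemma transition_differentiable:
  assumes c: "c \<in> \<A>" "c' \<in> \<A>" and u: "u \<in> snd c ` (fst c \<inter> fst c')"
  shows "(transition c c' has_derivative frechet_derivative (transition c c') (at u)) (at u)"
    and "continuous_on (snd c ` (fst c \<inter> fst c')) (\<lambda>u. frechet_derivative (transition c c') (at u) v)"
proof -
  have "smooth_on (snd c ` (fst c \<inter> fst c')) (transition c c')"
    using atlas c by (auto simp: smooth_atlas_def)
  then have "Ck_on (Suc 0) (snd c ` (fst c \<inter> fst c')) (transition c c')" unfolding smooth_on_def by blast
  then show "(transition c c' has_derivative frechet_derivative (transition c c') (at u)) (at u)"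
    and "continuous_on (snd c ` (fst c \<inter> fst c')) (\<lambda>u. frechet_derivative (transition c c') (at u) v)"
    using u by (auto simp: frechet_derivative_works[symmetric])
qed

text \<open>
  The chain rule for the transition map and the transformation law of the metric cancel each other.
\<close>
lemma speed_independent_of_chart:
  assumes c: "c \<in> \<A>" "c' \<in> \<A>" and \<gamma>t: "\<gamma> t \<in> fst c" "\<gamma> t \<in> fst c'" and cont: "isCont \<gamma> t"
    and v: "((snd c \<circ> \<gamma>) has_vector_derivative v) (at t)"
  obtains v' where "((snd c' \<circ> \<gamma>) has_vector_derivative v') (at t)"
    "v' \<bullet> (G c' (\<gamma> t) *v v') = v \<bullet> (G c (\<gamma> t) *v v)"
proof -
  let ?\<tau> = "transition c c'" and ?u = "snd c (\<gamma> t)"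
  let ?D = "frechet_derivative ?\<tau> (at ?u)"
  have uO: "?u \<in> snd c ` (fst c \<inter> fst c')" using \<gamma>t by blast
  have der: "(?\<tau> has_derivative ?D) (at ((snd c \<circ> \<gamma>) t))" using transition_differentiable(1)[OF c uO] by simp
  have lin: "linear ?D" using has_derivative_linear[OF der] .
  have "((?\<tau> \<circ> (snd c \<circ> \<gamma>)) has_derivative (?D \<circ> (\<lambda>x. x *\<^sub>R v))) (at t)"
    using v der unfolding has_vector_derivative_def by (rule diff_chain_at)
  moreover have "?D \<circ> (\<lambda>x. x *\<^sub>R v) = (\<lambda>x. x *\<^sub>R ?D v)" by (auto simp: linear_scale[OF lin])
  ultimately have 1: "((?\<tau> \<circ> (snd c \<circ> \<gamma>)) has_vector_derivative ?D v) (at t)"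
    unfolding has_vector_derivative_def by simp
  have "\<forall>\<^sub>F s in nhds t. \<gamma> s \<in> fst c"
  proof -
    have "(\<gamma> \<longlongrightarrow> \<gamma> t) (nhds t)" using cont by (simp add: isCont_def tendsto_at_iff_tendsto_nhds)
    then show ?thesis using chart_facts(1)[OF atlas c(1)] \<gamma>t(1) by (rule topological_tendstoD)
  qed
  then have ev: "\<forall>\<^sub>F s in nhds t. (?\<tau> \<circ> (snd c \<circ> \<gamma>)) s = (snd c' \<circ> \<gamma>) s"
    by eventually_elim (simp add: transition_def chart_facts(5)[OF atlas c(1)])
  have 2: "((snd c' \<circ> \<gamma>) has_vector_derivative ?D v) (at t)"
  proof -
    obtain T where T: "open T" "t \<in> T" "\<And>s. s \<in> T \<Longrightarrow> (?\<tau> \<circ> (snd c \<circ> \<gamma>)) s = (snd c' \<circ> \<gamma>) s"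
      using ev unfolding eventually_nhds by blast
    show ?thesis by (rule has_vector_derivative_transform_within_open[OF 1 T])
  qed
  have Dv: "?D v = matrix ?D *v v"
  proof -
    have "(*s) = ((*\<^sub>R) :: real \<Rightarrow> real ^ 'd \<Rightarrow> real ^ 'd)"
      by (intro ext) (simp add: scalar_mult_eq_scaleR)
    then show ?thesis using lin matrix_works[of ?D v] by simp
  qed
  have "G c (\<gamma> t) = transpose (matrix ?D) ** G c' (\<gamma> t) ** matrix ?D"
    using metric c \<gamma>t unfolding riemannian_metric_def Let_def by blast
  then have "v \<bullet> (G c (\<gamma> t) *v v) = ?D v \<bullet> (G c' (\<gamma> t) *v ?D v)"
    unfolding Dv by (simp add: quadratic_form_transform)
  then show thesis using that[OF 2] by simp
qed

lemma curve_speed_eq: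
  assumes c: "c \<in> \<A>" and \<gamma>t: "\<gamma> t \<in> fst c" and cont: "isCont \<gamma> t"
    and v: "((snd c \<circ> \<gamma>) has_vector_derivative v) (at t)"
  shows "curve_speed \<A> G \<gamma> t = sqrt (v \<bullet> (G c (\<gamma> t) *v v))"
proof -
  define c' where "c' = (SOME c. c \<in> \<A> \<and> \<gamma> t \<in> fst c)"
  have c': "c' \<in> \<A> \<and> \<gamma> t \<in> fst c'" unfolding c'_def by (rule someI[of _ c]) (use c \<gamma>t in blast)
  obtain v' where v': "((snd c' \<circ> \<gamma>) has_vector_derivative v') (at t)"
      "v' \<bullet> (G c' (\<gamma> t) *v v') = v \<bullet> (G c (\<gamma> t) *v v)"
    using speed_independent_of_chart[OF c _ \<gamma>t _ cont v] c' by blast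
  have "vector_derivative (snd c' \<circ> \<gamma>) (at t) = v'" using v'(1) by (rule vector_derivative_at)
  then show ?thesis unfolding curve_speed_def Let_def c'_def[symmetric] using v'(2) by simp
qed

text \<open>
  Inside a patch \<open>D\<close> is at most a multiple of the coordinate distance, which the fundamental theorem of calculus bounds by
  the integral of the coordinate speed, hence by the Riemannian length. Pieces inside patches are put together by a bisection argument, so no
  subdivision of the curve has to be chosen. The speed is continuous away from the break points, so that it is
  measurable and the length is additive.
\<close>
lemma D_le_curve_length:
  "\<exists>K\<ge>1. \<forall>\<gamma>. piecewise_C1_curve \<A> \<gamma> \<longrightarrow> ennreal (D (\<gamma> 0) (\<gamma> 1)) \<le> ennreal K * curve_length \<A> G \<gamma>"
proof -
  obtain C where C: "1 \<le> C" "\<And>\<pi> x y. \<pi> \<in> P \<Longrightarrow> x \<in> inner \<pi> \<Longrightarrow> y \<in> inner \<pi> \<Longrightarrow> D x y \<le> C * dist (coord \<pi> x) (coord \<pi> y)"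
    using D_upper by blast
  obtain \<Lambda> where \<Lambda>: "1 \<le> \<Lambda>" "\<And>\<pi> u v. \<pi> \<in> P \<Longrightarrow> u \<in> patch_ball \<pi> \<Longrightarrow> norm v \<le> \<Lambda> * sqrt (v \<bullet> (gram \<pi> u *v v))"
    using gram_bounds by blast
  define K where "K = C * \<Lambda>"
  have K: "1 \<le> K" using mult_mono[OF C(1) \<Lambda>(1)] C \<Lambda> by (simp add: K_def)
  have "ennreal (D (\<gamma> 0) (\<gamma> 1)) \<le> ennreal K * curve_length \<A> G \<gamma>" if pw: "piecewise_C1_curve \<A> \<gamma>" for \<gamma>
  proof -
    obtain S where \<gamma>c: "continuous_on {0..1} \<gamma>" and S: "finite S" "S \<subseteq> {0..1}" "{0, 1} \<subseteq> S"
      and C1': "\<forall>a\<in>S. \<forall>b\<in>S. a < b \<and> S \<inter> {a<..<b} = {} \<longrightarrow> C1_curve_on \<A> a b \<gamma>"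
      using pw unfolding piecewise_C1_curve_def by (elim conjE exE)
    have C1: "C1_curve_on \<A> a b \<gamma>" if "a \<in> S" "b \<in> S" "a < b" "S \<inter> {a<..<b} = {}" for a b
      using C1' that by simp
    define U where "U = {0<..<1} - S"
    have Uo: "open U" unfolding U_def using S by (intro open_Diff finite_imp_closed) auto
    have isC: "isCont \<gamma> t" if "t \<in> {0<..<1}" for t
      using continuous_on_interior[OF \<gamma>c, of t] that by simp
    have C1_near: "\<exists>a b. C1_curve_on \<A> a b \<gamma> \<and> a < t \<and> t < b \<and> {a<..<b} \<subseteq> U" if t: "t \<in> U" for t
    proof -
      obtain e where e: "0 < e" "ball t e \<subseteq> U" using Uo t open_contains_ball by blast
      define e' where "e' = min (e / 2) (min (t / 2) ((1 - t) / 2))"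
      have "e' \<le> t / 2" "e' \<le> (1 - t) / 2"
        unfolding e'_def by (meson min.cobounded1 min.cobounded2 order_trans)+
      have t01: "0 < t" "t < 1" using t by (auto simp: U_def)
      have e': "0 < e'" "0 \<le> t - e'" "t + e' \<le> 1" "t - e' < t + e'"
      proof -
        show pos: "0 < e'" using e t by (auto simp: e'_def U_def)
        show "0 \<le> t - e'" using \<open>e' \<le> t / 2\<close> t01 by simp
        have "t + e' \<le> t + (1 - t) / 2" using \<open>e' \<le> (1 - t) / 2\<close> by simp
        also have "\<dots> \<le> 1" using t01 by (simp add: field_simps)
        finally show "t + e' \<le> 1" .
        show "t - e' < t + e'" using pos by simp
      qed
      have "S \<inter> {t - e'<..<t + e'} = {}"
      proof -
        have "{t - e'<..<t + e'} \<subseteq> ball t e" using e by (auto simp: e'_def dist_real_def)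
        then show ?thesis using e(2) by (auto simp: U_def)
      qed
      then obtain a b where ab: "a \<in> S" "b \<in> S" "a \<le> t - e'" "t + e' \<le> b" "S \<inter> {a<..<b} = {}"
        using break_interval[OF S(1,3) e'(2,4,3)] by blast
      have "{a<..<b} \<subseteq> U" using ab S(2) unfolding U_def by fastforce
      then show ?thesis using C1[OF ab(1,2)] ab e' by (intro exI[of _ a] exI[of _ b]) auto
    qed
    have speed_cont: "continuous_on U (curve_speed \<A> G \<gamma>)"
      unfolding continuous_on_eq_continuous_at[OF Uo]
    proof
      fix t assume t: "t \<in> U"
      obtain a b where ab: "C1_curve_on \<A> a b \<gamma>" "a < t" "t < b" "{a<..<b} \<subseteq> U" using C1_near[OF t] by (elim exE conjE)
      obtain c where c: "c \<in> \<A>" "\<gamma> t \<in> fst c" using chart_at[OF atlas] by blast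
      obtain Dc where Dc: "continuous_on ({a..b} \<inter> \<gamma> -` fst c) Dc"
          "\<And>s. s \<in> {a..b} \<inter> \<gamma> -` fst c \<Longrightarrow> ((snd c \<circ> \<gamma>) has_vector_derivative Dc s) (at s within {a..b})"
        using ab(1) c(1) unfolding C1_curve_on_def by metis
      have \<gamma>ab: "continuous_on {a<..<b} \<gamma>"
        using ab(1) unfolding C1_curve_on_def by (meson continuous_on_subset greaterThanLessThan_subseteq_atLeastAtMost_iff order_refl)
      define W where "W = {a<..<b} \<inter> \<gamma> -` fst c"
      have Wo: "open W" unfolding W_def
        using continuous_open_preimage[OF \<gamma>ab _ chart_facts(1)[OF atlas c(1)]] by simp
      have tW: "t \<in> W" using ab c by (simp add: W_def)
      have eq: "curve_speed \<A> G \<gamma> s = sqrt (Dc s \<bullet> (G c (\<gamma> s) *v Dc s))" if s: "s \<in> W" for s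
      proof (rule curve_speed_eq[OF c(1)])
        show "\<gamma> s \<in> fst c" using s by (simp add: W_def)
        show "isCont \<gamma> s" using s ab(4) by (intro isC) (auto simp: W_def U_def)
        have "((snd c \<circ> \<gamma>) has_vector_derivative Dc s) (at s within {a..b})" using s by (intro Dc(2)) (auto simp: W_def)
        moreover have "at s within {a..b} = at s" using s by (intro at_within_interior) (auto simp: W_def)
        ultimately show "((snd c \<circ> \<gamma>) has_vector_derivative Dc s) (at s)" by simp
      qed
      have Dcc: "continuous_on W Dc" by (rule continuous_on_subset[OF Dc(1)]) (auto simp: W_def)
      have zc: "continuous_on W (\<lambda>s. snd c (\<gamma> s))"
        by (rule continuous_on_compose2[OF chart_facts(3)[OF atlas c(1)] continuous_on_subset[OF \<gamma>ab]]) (auto simp: W_def)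
      have Gc: "continuous_on W (\<lambda>s. G c (\<gamma> s) $ i $ j)" for i j
      proof -
        have "continuous_on W (\<lambda>s. G c (chart_inv c (snd c (\<gamma> s))) $ i $ j)"
          by (rule continuous_on_compose2[OF gram_entry_continuous[OF c(1)] zc]) (auto simp: W_def)
        then show ?thesis
          by (rule continuous_on_eq) (simp add: W_def chart_facts(5)[OF atlas c(1)])
      qed
      have "continuous_on W (\<lambda>s. sqrt (Dc s \<bullet> (G c (\<gamma> s) *v Dc s)))"
        unfolding inner_vec_def matrix_vector_mult_def by (auto intro!: continuous_intros Gc Dcc)
      then have "continuous_on W (curve_speed \<A> G \<gamma>)"
        by (rule continuous_on_eq) (simp add: eq)
      then show "isCont (curve_speed \<A> G \<gamma>) t" using continuous_on_eq_continuous_at[OF Wo] tW by blast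
    qed
    \<comment> \<open>The speed is arbitrary at break points; removing this null set makes it measurable.\<close>
    define m where "m t = ennreal (curve_speed \<A> G \<gamma> t) * indicator U t" for t
    have mm [measurable]: "m \<in> borel_measurable borel"
    proof -
      have "(\<lambda>t. indicator U t *\<^sub>R curve_speed \<A> G \<gamma> t) \<in> borel_measurable borel"
        using Uo speed_cont by (intro borel_measurable_continuous_on_indicator) auto
      then have "(\<lambda>t. ennreal (indicator U t *\<^sub>R curve_speed \<A> G \<gamma> t)) \<in> borel_measurable borel" by measurable
      moreover have "(\<lambda>t. ennreal (indicator U t *\<^sub>R curve_speed \<A> G \<gamma> t)) = m"
        by (auto simp: m_def indicator_def)
      ultimately show ?thesis by simp
    qed
    have null: "AE t in lborel. t \<notin> S" using S(1) by (intro AE_not_in finite_imp_null_set_lborel)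
    have len: "curve_length \<A> G \<gamma> = (\<integral>\<^sup>+t. m t * indicator {0..1} t \<partial>lborel)"
      unfolding curve_length_def
    proof (rule nn_integral_cong_AE)
      show "AE t in lborel. ennreal (curve_speed \<A> G \<gamma> t) * indicator {0..1} t = m t * indicator {0..1} t"
        using null
      proof eventually_elim
        case (elim t)
        then show ?case using S(3) by (auto simp: m_def U_def indicator_def)
      qed
    qed
    define I where "I u v = (\<integral>\<^sup>+t. m t * indicator {u..v} t \<partial>lborel)" for u v
    have Iadd: "I u v + I v w \<le> I u w" if "u \<le> v" "v \<le> w" for u v w
    proof -
      have "I u v + I v w = (\<integral>\<^sup>+t. m t * indicator {u..v} t + m t * indicator {v..w} t \<partial>lborel)"
        unfolding I_def by (subst nn_integral_add) auto
      also have "\<dots> \<le> I u w"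
        unfolding I_def
      proof (rule nn_integral_mono_AE)
        show "AE t in lborel. m t * indicator {u..v} t + m t * indicator {v..w} t \<le> m t * indicator {u..w} t"
          using AE_lborel_singleton[of v] by eventually_elim (use that in \<open>auto simp: indicator_def\<close>)
      qed
      finally show ?thesis .
    qed
    have seg: "ennreal (D (\<gamma> u) (\<gamma> v)) \<le> ennreal K * I u v"
      if uv: "0 \<le> u" "u < v" "v \<le> 1" "S \<inter> {u<..<v} = {}" and \<pi>: "\<pi> \<in> P" and inn: "\<And>t. t \<in> {u..v} \<Longrightarrow> \<gamma> t \<in> inner \<pi>" for u v \<pi>
    proof -
      obtain a b where ab: "a \<in> S" "b \<in> S" "a \<le> u" "v \<le> b" "S \<inter> {a<..<b} = {}"
        using break_interval[OF S(1,3) uv] by blast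
      have C1ab: "C1_curve_on \<A> a b \<gamma>" using C1[OF ab(1,2)] ab uv by auto
      obtain Dc where Dc: "continuous_on ({a..b} \<inter> \<gamma> -` dom \<pi>) Dc"
          "\<And>s. s \<in> {a..b} \<inter> \<gamma> -` dom \<pi> \<Longrightarrow> ((coord \<pi> \<circ> \<gamma>) has_vector_derivative Dc s) (at s within {a..b})"
        using C1ab patchD(1)[OF \<pi>] unfolding C1_curve_on_def by blast
      have sub: "{u..v} \<subseteq> {a..b} \<inter> \<gamma> -` dom \<pi>" using inn ab by (auto simp: inner_def)
      have hb: "has_bochner_integral lborel (\<lambda>t. indicator {u..v} t *\<^sub>R Dc t) ((coord \<pi> \<circ> \<gamma>) v - (coord \<pi> \<circ> \<gamma>) u)"
      proof (rule has_bochner_integral_FTC_Icc)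
        show "u \<le> v" using uv by simp
        show "continuous_on {u..v} Dc" using Dc(1) sub by (rule continuous_on_subset)
        fix t assume "u \<le> t" "t \<le> v"
        then have "t \<in> {a..b} \<inter> \<gamma> -` dom \<pi>" using sub by auto
        from Dc(2)[OF this] show "((coord \<pi> \<circ> \<gamma>) has_vector_derivative Dc t) (at t within {u..v})"
          by (rule has_vector_derivative_within_subset) (use ab in auto)
      qed
      have "ennreal (norm ((coord \<pi> \<circ> \<gamma>) v - (coord \<pi> \<circ> \<gamma>) u)) \<le> (\<integral>\<^sup>+t. norm (indicator {u..v} t *\<^sub>R Dc t) \<partial>lborel)"
        using has_bochner_integral_norm_bound[OF hb] .
      also have "\<dots> \<le> (\<integral>\<^sup>+t. ennreal \<Lambda> * (m t * indicator {u..v} t) \<partial>lborel)"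
      proof (rule nn_integral_mono_AE)
        show "AE t in lborel. ennreal (norm (indicator {u..v} t *\<^sub>R Dc t)) \<le> ennreal \<Lambda> * (m t * indicator {u..v} t)"
          using AE_lborel_singleton[of u] AE_lborel_singleton[of v]
        proof eventually_elim
          case (elim t)
          show ?case
          proof (cases "t \<in> {u..v}")
            case True
            then have t: "t \<in> {u<..<v}" using elim by auto
            then have tU: "t \<in> U" using uv by (auto simp: U_def)
            have \<gamma>t: "\<gamma> t \<in> inner \<pi>" using inn True by blast
            have "((coord \<pi> \<circ> \<gamma>) has_vector_derivative Dc t) (at t within {a..b})" using Dc(2) sub True by blast
            moreover have "at t within {a..b} = at t" using t ab by (intro at_within_interior) auto
            ultimately have dv: "((coord \<pi> \<circ> \<gamma>) has_vector_derivative Dc t) (at t)" by simp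
            have "curve_speed \<A> G \<gamma> t = sqrt (Dc t \<bullet> (G (fst \<pi>) (\<gamma> t) *v Dc t))"
              using \<gamma>t tU by (intro curve_speed_eq[OF patchD(1)[OF \<pi>] _ _ dv] isC) (auto simp: inner_def U_def)
            moreover have "param \<pi> (coord \<pi> (\<gamma> t)) = \<gamma> t" "coord \<pi> (\<gamma> t) \<in> patch_ball \<pi>"
              using \<gamma>t patch_chart(5)[OF \<pi>] by (auto simp: inner_def dist_commute)
            ultimately have "norm (Dc t) \<le> \<Lambda> * curve_speed \<A> G \<gamma> t" using \<Lambda>(2)[OF \<pi>, of "coord \<pi> (\<gamma> t)" "Dc t"] by simp
            then have "ennreal (norm (Dc t)) \<le> ennreal (\<Lambda> * curve_speed \<A> G \<gamma> t)" by (rule ennreal_leI)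
            also have "\<dots> = ennreal \<Lambda> * ennreal (curve_speed \<A> G \<gamma> t)" using \<Lambda>(1) by (intro ennreal_mult') simp
            finally show ?thesis using True tU by (simp add: m_def)
          qed simp
        qed
      qed
      also have "\<dots> = ennreal \<Lambda> * I u v" unfolding I_def by (rule nn_integral_cmult) simp
      finally have n: "ennreal (dist (coord \<pi> (\<gamma> v)) (coord \<pi> (\<gamma> u))) \<le> ennreal \<Lambda> * I u v" by (simp add: dist_norm)
      have "D (\<gamma> u) (\<gamma> v) \<le> C * dist (coord \<pi> (\<gamma> v)) (coord \<pi> (\<gamma> u))"
        using C(2)[OF \<pi> inn inn, of u v] uv by (simp add: dist_commute)
      then have "ennreal (D (\<gamma> u) (\<gamma> v)) \<le> ennreal (C * dist (coord \<pi> (\<gamma> v)) (coord \<pi> (\<gamma> u)))" by (rule ennreal_leI)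
      also have "\<dots> = ennreal C * ennreal (dist (coord \<pi> (\<gamma> v)) (coord \<pi> (\<gamma> u)))" using C(1) by (intro ennreal_mult) auto
      also have "\<dots> \<le> ennreal C * (ennreal \<Lambda> * I u v)" by (intro mult_left_mono n) auto
      also have "\<dots> = ennreal K * I u v" unfolding K_def using C(1) \<Lambda>(1) by (simp add: ennreal_mult mult.assoc)
      finally show ?thesis .
    qed
    define Q where "Q u v \<longleftrightarrow> (0 \<le> u \<and> u \<le> v \<and> v \<le> 1 \<longrightarrow> ennreal (D (\<gamma> u) (\<gamma> v)) \<le> ennreal K * I u v)" for u v
    have Qtrans: "ennreal (D (\<gamma> u) (\<gamma> w)) \<le> ennreal K * I u w"
      if "ennreal (D (\<gamma> u) (\<gamma> v)) \<le> ennreal K * I u v" "ennreal (D (\<gamma> v) (\<gamma> w)) \<le> ennreal K * I v w" "u \<le> v" "v \<le> w" for u v w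
    proof -
      have "ennreal (D (\<gamma> u) (\<gamma> w)) \<le> ennreal (D (\<gamma> u) (\<gamma> v) + D (\<gamma> v) (\<gamma> w))" by (intro ennreal_leI D_triangle)
      also have "\<dots> = ennreal (D (\<gamma> u) (\<gamma> v)) + ennreal (D (\<gamma> v) (\<gamma> w))" by (intro ennreal_plus) auto
      also have "\<dots> \<le> ennreal K * I u v + ennreal K * I v w" by (intro add_mono that)
      also have "\<dots> = ennreal K * (I u v + I v w)" by (simp add: distrib_left)
      also have "\<dots> \<le> ennreal K * I u w" by (intro mult_left_mono Iadd that) auto
      finally show ?thesis .
    qed
    have "Q 0 1"
    proof (rule Bolzano)
      show "Q u w" if "Q u v" "Q v w" "u \<le> v" "v \<le> w" for u v w
        using Qtrans[of u v w] that unfolding Q_def by auto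
    next
      fix t :: real assume t: "0 \<le> t" "t \<le> 1"
      obtain \<pi> where \<pi>: "\<pi> \<in> P" "\<gamma> t \<in> core \<pi>" using core_cover by blast
      have "\<gamma> t \<in> inner \<pi>" using core_inner \<pi> by blast
      then obtain e1 where e1: "0 < e1" "\<And>s. s \<in> {0..1} \<Longrightarrow> dist s t < e1 \<Longrightarrow> \<gamma> s \<in> inner \<pi>"
      proof -
        have "\<forall>\<^sub>F s in at t within {0..1}. \<gamma> s \<in> inner \<pi>"
          using \<gamma>c t inner_open[OF \<pi>(1)] \<open>\<gamma> t \<in> inner \<pi>\<close> unfolding continuous_on_def
          by (auto intro: topological_tendstoD)
        then obtain e where "0 < e" "\<forall>s\<in>{0..1}. s \<noteq> t \<and> dist s t < e \<longrightarrow> \<gamma> s \<in> inner \<pi>"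
          unfolding eventually_at by blast
        then show thesis using that[of e] \<open>\<gamma> t \<in> inner \<pi>\<close> by metis
      qed
      obtain e2 where e2: "0 < e2" "\<And>s. s \<in> S \<Longrightarrow> s \<noteq> t \<Longrightarrow> e2 \<le> dist s t"
      proof -
        have "open (- (S - {t}))" using S(1) by (intro open_Compl finite_imp_closed) auto
        then obtain e where "0 < e" "ball t e \<subseteq> - (S - {t})" using open_contains_ball by (metis ComplI Diff_iff singletonI)
        then show thesis using that[of e] by (force simp: dist_commute not_less)
      qed
      show "\<exists>d>0. \<forall>u v. u \<le> t \<and> t \<le> v \<and> v - u < d \<longrightarrow> Q u v"
      proof (intro exI[of _ "min e1 e2"] conjI allI impI)
        show "0 < min e1 e2" using e1 e2 by simp
        fix u v assume uv: "u \<le> t \<and> t \<le> v \<and> v - u < min e1 e2"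
        show "Q u v"
          unfolding Q_def
        proof
          assume r: "0 \<le> u \<and> u \<le> v \<and> v \<le> 1"
          have inn: "\<gamma> s \<in> inner \<pi>" if "s \<in> {u..v}" for s
            using that uv r by (intro e1(2)) (auto simp: dist_real_def)
          have emp: "S \<inter> {u<..<t} = {}" "S \<inter> {t<..<v} = {}"
            using e2(2) uv by (force simp: dist_real_def)+
          have self: "ennreal (D (\<gamma> s) (\<gamma> s)) \<le> ennreal K * I s s" for s by simp
          have 1: "ennreal (D (\<gamma> u) (\<gamma> t)) \<le> ennreal K * I u t"
          proof (cases "u = t")
            case False
            then show ?thesis using r uv t inn by (intro seg[OF _ _ _ emp(1) \<pi>(1)]) auto
          qed (use self in simp)
          have 2: "ennreal (D (\<gamma> t) (\<gamma> v)) \<le> ennreal K * I t v"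
          proof (cases "t = v")
            case False
            then show ?thesis using r uv t inn by (intro seg[OF _ _ _ emp(2) \<pi>(1)]) auto
          qed (use self in simp)
          show "ennreal (D (\<gamma> u) (\<gamma> v)) \<le> ennreal K * I u v" using Qtrans[OF 1 2] uv by blast
        qed
      qed
    qed simp
    then show ?thesis unfolding Q_def len I_def by simp
  qed
  then show ?thesis using K by blast
qed

lemma D_le_rdist: "\<exists>K\<ge>1. \<forall>x y. ennreal (D x y) \<le> ennreal K * rdist \<A> G x y"
proof -
  obtain K where K: "1 \<le> K" "\<And>\<gamma>. piecewise_C1_curve \<A> \<gamma> \<Longrightarrow> ennreal (D (\<gamma> 0) (\<gamma> 1)) \<le> ennreal K * curve_length \<A> G \<gamma>"
    using D_le_curve_length by blast
  have "ennreal (D x y) \<le> ennreal K * rdist \<A> G x y" for x y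
  proof -
    have "ennreal (D x y) / ennreal K \<le> rdist \<A> G x y"
      unfolding rdist_def
    proof (rule INF_greatest)
      fix \<gamma> assume "\<gamma> \<in> {\<gamma>. piecewise_C1_curve \<A> \<gamma> \<and> \<gamma> 0 = x \<and> \<gamma> 1 = y}"
      then have "ennreal (D x y) \<le> ennreal K * curve_length \<A> G \<gamma>" using K(2)[of \<gamma>] by auto
      then show "ennreal (D x y) / ennreal K \<le> curve_length \<A> G \<gamma>"
        using K(1) by (intro divide_le_posI_ennreal) auto
    qed
    then have "ennreal K * (ennreal (D x y) / ennreal K) \<le> ennreal K * rdist \<A> G x y" by (intro mult_left_mono) auto
    moreover have "ennreal K * (ennreal (D x y) / ennreal K) = ennreal (D x y)"
      using K(1) by (subst divide_ennreal) (auto simp: ennreal_mult[symmetric])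
    ultimately show ?thesis by simp
  qed
  then show ?thesis using K(1) by blast
qed

text \<open>
  The competitor is a straight segment in the coordinates of a patch; a ball is convex, so it does not leave the patch.
\<close>
lemma rdist_le_D: "\<exists>K\<ge>1. \<forall>x y. D x y < sep_radius \<longrightarrow> rdist \<A> G x y \<le> ennreal (K * D x y)"
proof -
  obtain \<Lambda> where \<Lambda>: "1 \<le> \<Lambda>" "\<And>\<pi> u v. \<pi> \<in> P \<Longrightarrow> u \<in> patch_ball \<pi> \<Longrightarrow> sqrt (v \<bullet> (gram \<pi> u *v v)) \<le> \<Lambda> * norm v"
    using gram_bounds by blast
  have "rdist \<A> G x y \<le> ennreal (\<Lambda> * D x y)" if xy: "D x y < sep_radius" for x y
  proof -
    obtain \<pi> where \<pi>: "\<pi> \<in> P" "x \<in> core \<pi>" using core_cover by blast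
    have xi: "x \<in> inner \<pi>" and yi: "y \<in> inner \<pi>" using core_inner \<pi> D_small_inner[OF \<pi> xy] by blast+
    define w where "w = coord \<pi> y - coord \<pi> x"
    define l where "l t = coord \<pi> x + t *\<^sub>R w" for t :: real
    define \<gamma> where "\<gamma> t = param \<pi> (l t)" for t
    have lS: "l t \<in> ball (center \<pi>) (radius \<pi>)" if "t \<in> {0..1}" for t
    proof -
      have "l t = (1 - t) *\<^sub>R coord \<pi> x + t *\<^sub>R coord \<pi> y" by (simp add: l_def w_def algebra_simps)
      then show ?thesis
        using convexD_alt[OF convex_ball, of "coord \<pi> x" "center \<pi>" "radius \<pi>" "coord \<pi> y" t] xi yi that
        by (auto simp: inner_def dist_commute)
    qed
    have lU: "l t \<in> coord \<pi> ` dom \<pi>" if "t \<in> {0..1}" for t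
      using lS[OF that] patch_ball_subset[OF \<pi>(1)] ball_subset_cball by blast
    have ld: "(l has_vector_derivative w) (at t within T)" for t T
      unfolding l_def by (auto intro!: derivative_eq_intros)
    have lc: "continuous_on T l" for T unfolding l_def by (intro continuous_intros)
    have \<gamma>c: "continuous_on {0..1} \<gamma>"
      unfolding \<gamma>_def by (rule continuous_on_compose2[OF patch_chart(4)[OF \<pi>(1)] lc]) (use lU in blast)
    have \<gamma>dom: "\<gamma> t \<in> dom \<pi>" if "t \<in> {0..1}" for t unfolding \<gamma>_def using patch_chart(7)[OF \<pi>(1) lU[OF that]] .
    \<comment> \<open>Differentiability is required in every chart of the atlas, which is where transition maps come in.\<close>
    have C1: "C1_curve_on \<A> 0 1 \<gamma>"
      unfolding C1_curve_on_def
    proof (intro conjI \<gamma>c ballI)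
      fix c' assume c': "c' \<in> \<A>"
      let ?O = "coord \<pi> ` (dom \<pi> \<inter> fst c')" and ?\<tau> = "transition (fst \<pi>) c'"
      define Dc where "Dc t = frechet_derivative ?\<tau> (at (l t)) w" for t
      have lO: "l t \<in> ?O" if "t \<in> {0..1} \<inter> \<gamma> -` fst c'" for t
      proof -
        have "l t = coord \<pi> (\<gamma> t)" unfolding \<gamma>_def using patch_chart(6)[OF \<pi>(1) lU] that by simp
        then show ?thesis using that \<gamma>dom by blast
      qed
      have "continuous_on ({0..1} \<inter> \<gamma> -` fst c') Dc"
      proof (cases "{0..1} \<inter> \<gamma> -` fst c' = {}")
        case False
        then obtain t0 where t0: "t0 \<in> {0..1} \<inter> \<gamma> -` fst c'" by blast
        show ?thesis unfolding Dc_def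
          by (rule continuous_on_compose2[OF transition_differentiable(2)[OF patchD(1)[OF \<pi>(1)] c' lO[OF t0]] lc]) (use lO in blast)
      qed simp
      moreover have "((snd c' \<circ> \<gamma>) has_vector_derivative Dc t) (at t within {0..1})" if t: "t \<in> {0..1} \<inter> \<gamma> -` fst c'" for t
      proof -
        have der: "(?\<tau> has_derivative frechet_derivative ?\<tau> (at (l t))) (at (l t))"
          by (rule transition_differentiable(1)[OF patchD(1)[OF \<pi>(1)] c' lO[OF t]])
        have lin: "linear (frechet_derivative ?\<tau> (at (l t)))" using has_derivative_linear[OF der] .
        have "((?\<tau> \<circ> l) has_derivative (frechet_derivative ?\<tau> (at (l t)) \<circ> (\<lambda>x. x *\<^sub>R w))) (at t within {0..1})"
          using ld[of t "{0..1}"] has_derivative_at_withinI[OF der] unfolding has_vector_derivative_def by (rule diff_chain_within)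
        moreover have "frechet_derivative ?\<tau> (at (l t)) \<circ> (\<lambda>x. x *\<^sub>R w) = (\<lambda>x. x *\<^sub>R Dc t)"
          by (auto simp: linear_scale[OF lin] Dc_def)
        moreover have "?\<tau> \<circ> l = snd c' \<circ> \<gamma>" by (auto simp: transition_def \<gamma>_def)
        ultimately show ?thesis unfolding has_vector_derivative_def by simp
      qed
      ultimately show "\<exists>Dc. continuous_on ({0..1} \<inter> \<gamma> -` fst c') Dc \<and>
          (\<forall>t\<in>{0..1} \<inter> \<gamma> -` fst c'. ((snd c' \<circ> \<gamma>) has_vector_derivative Dc t) (at t within {0..1}))" by blast
    qed
    have pw: "piecewise_C1_curve \<A> \<gamma>"
      unfolding piecewise_C1_curve_def using \<gamma>c C1 by (intro conjI exI[of _ "{0, 1}"]) auto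
    have ends: "\<gamma> 0 = x" "\<gamma> 1 = y"
      using xi yi patch_chart(5)[OF \<pi>(1)] by (auto simp: \<gamma>_def l_def w_def inner_def)
    have speed: "curve_speed \<A> G \<gamma> t \<le> \<Lambda> * norm w" if t: "t \<in> {0<..<1}" for t
    proof -
      have t01: "t \<in> {0..1}" using t by simp
      have "((coord \<pi> \<circ> \<gamma>) has_vector_derivative w) (at t)"
      proof (rule has_vector_derivative_transform_within_open[OF ld[of t UNIV], of "{0<..<1}"])
        show "l s = (coord \<pi> \<circ> \<gamma>) s" if "s \<in> {0<..<1}" for s
          using patch_chart(6)[OF \<pi>(1) lU[of s]] that by (simp add: \<gamma>_def)
      qed (use t in auto)
      moreover have "isCont \<gamma> t" using continuous_on_interior[OF \<gamma>c, of t] t by simp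
      ultimately have "curve_speed \<A> G \<gamma> t = sqrt (w \<bullet> (G (fst \<pi>) (\<gamma> t) *v w))"
        using \<gamma>dom[OF t01] by (intro curve_speed_eq[OF patchD(1)[OF \<pi>(1)]])
      also have "\<dots> \<le> \<Lambda> * norm w"
        unfolding \<gamma>_def using lS[OF t01] ball_subset_cball by (intro \<Lambda>(2)[OF \<pi>(1)]) blast
      finally show ?thesis .
    qed
    have "rdist \<A> G x y \<le> curve_length \<A> G \<gamma>"
      unfolding rdist_def using pw ends by (intro INF_lower) auto
    also have "\<dots> \<le> (\<integral>\<^sup>+t. ennreal (\<Lambda> * norm w) * indicator {0..1 :: real} t \<partial>lborel)"
      unfolding curve_length_def
    proof (rule nn_integral_mono_AE)
      show "AE t in lborel. ennreal (curve_speed \<A> G \<gamma> t) * indicator {0..1} t \<le> ennreal (\<Lambda> * norm w) * indicator {0..1} t"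
        using AE_lborel_singleton[of "0::real"] AE_lborel_singleton[of "1::real"]
        by eventually_elim (use speed in \<open>auto simp: indicator_def intro!: ennreal_leI\<close>)
    qed
    also have "\<dots> = ennreal (\<Lambda> * norm w)" by (simp add: nn_integral_cmult_indicator)
    also have "\<dots> \<le> ennreal (\<Lambda> * D x y)"
      using inner_dist_le_D[OF \<pi>(1) xi yi] \<Lambda>(1) by (intro ennreal_leI mult_left_mono) (auto simp: w_def dist_norm norm_minus_commute)
    finally show ?thesis .
  qed
  then show ?thesis using \<Lambda>(1) by blast
qed

end

section \<open>Multiple logarithm laws\<close>

text \<open>
  The rate of mixing is only assumed to be below \<open>1\<close>. It cannot be negative: for the constant observable \<open>1\<close> and \<open>m = 1\<close> the
  left-hand side vanishes, and the right-hand side is \<open>C \<theta>\<close>.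
\<close>
lemma mixing_rate_nonneg:
  fixes \<mu> :: "'a measure"
  assumes "prob_space \<mu>" "0 < C"
    and mix: "\<And>A k m. lipschitz_observable \<delta> q A \<Longrightarrow> k 0 = (0::nat) \<and> (\<forall>j. Suc j < q \<longrightarrow> k j + m \<le> k (Suc j)) \<Longrightarrow>
      \<bar>(\<integral>x. A (\<lambda>i\<in>{..<q}. (f ^^ k i) x) \<partial>\<mu>) - (\<integral>x. A x \<partial>(\<Pi>\<^sub>M i\<in>{..<q}. \<mu>))\<bar> \<le> C * \<theta> ^ m * lip_norm \<delta> q A"
  shows "0 \<le> \<theta>"
proof -
  interpret prob_space \<mu> by fact
  interpret PQ: prob_space "\<Pi>\<^sub>M i\<in>{..<q}. \<mu>" by (intro prob_space_PiM) unfold_locales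
  let ?A = "\<lambda>_ :: nat \<Rightarrow> 'a. 1 :: real"
  have hl: "has_lip_const \<delta> q ?A L \<longleftrightarrow> 0 \<le> L" for L
    by (auto simp: has_lip_const_def L2_set_nonneg)
  then have lo: "lipschitz_observable \<delta> q ?A" by (auto simp: lipschitz_observable_def)
  have "prod_space q \<noteq> ({} :: (nat \<Rightarrow> 'a) set)" by (simp add: prod_space_def PiE_eq_empty_iff)
  moreover have "{L. has_lip_const \<delta> q ?A L} = {0..}" by (auto simp: hl)
  ultimately have ln: "lip_norm \<delta> q ?A = 1" by (simp add: lip_norm_def)
  show ?thesis using mix[OF lo, of "\<lambda>j. j" 1] ln assms(2) by (simp add: prob_space PQ.prob_space zero_le_mult_iff)
qed

text \<open>
  The sum of the \<open>q\<close> distances in \<open>d\<close> is at most \<open>K q\<close> times the Euclidean norm of the distances in \<open>\<delta>\<close>, and where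
  some \<open>\<delta>\<close> is infinite nothing is required.
\<close>
lemma lip_norm_le:
  assumes K: "0 \<le> K" and \<Lambda>: "\<And>x. \<bar>A x\<bar> \<le> \<Lambda>" "\<And>x y. \<bar>A x - A y\<bar> \<le> \<Lambda> * (\<Sum>i<q. d (x i) (y i))"
    and d: "\<And>x y. ennreal (d x y) \<le> ennreal K * \<delta> x y"
  shows "lipschitz_observable \<delta> q A" and "lip_norm \<delta> q A \<le> (1 + K * real q) * \<Lambda>"
proof -
  have \<Lambda>0: "0 \<le> \<Lambda>" using order_trans[OF abs_ge_zero \<Lambda>(1)[of undefined]] .
  have hl: "has_lip_const \<delta> q A (\<Lambda> * (K * real q))"
    unfolding has_lip_const_def
  proof (intro conjI ballI impI)
    show "0 \<le> \<Lambda> * (K * real q)" using \<Lambda>0 K by simp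
    fix x y assume fin: "\<forall>i<q. \<delta> (x i) (y i) < \<infinity>"
    let ?a = "\<lambda>i. enn2real (\<delta> (x i) (y i))"
    have "d (x i) (y i) \<le> K * L2_set ?a {..<q}" if i: "i < q" for i
    proof -
      have "ennreal (d (x i) (y i)) \<le> ennreal K * ennreal (?a i)" using d[of "x i" "y i"] fin i by simp
      also have "\<dots> = ennreal (K * ?a i)" using K by (simp add: ennreal_mult)
      finally have "d (x i) (y i) \<le> K * ?a i" using K by (simp add: ennreal_le_iff)
      also have "\<dots> \<le> K * L2_set ?a {..<q}"
        using i K by (intro mult_left_mono member_le_L2_set) auto
      finally show ?thesis .
    qed
    then have "(\<Sum>i<q. d (x i) (y i)) \<le> (\<Sum>i<q. K * L2_set ?a {..<q})" by (intro sum_mono) auto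
    then have "\<Lambda> * (\<Sum>i<q. d (x i) (y i)) \<le> \<Lambda> * (K * real q * L2_set ?a {..<q})"
      using \<Lambda>0 by (intro mult_left_mono) (auto simp: mult_ac)
    then show "\<bar>A x - A y\<bar> \<le> \<Lambda> * (K * real q) * L2_set ?a {..<q}" using \<Lambda>(2)[of x y] by (simp add: mult_ac)
  qed
  then show "lipschitz_observable \<delta> q A" by (auto simp: lipschitz_observable_def)
  have ne: "prod_space q \<noteq> ({} :: (nat \<Rightarrow> 'a) set)" by (simp add: prod_space_def PiE_eq_empty_iff)
  have "(SUP x\<in>prod_space q. \<bar>A x\<bar>) \<le> \<Lambda>" using ne \<Lambda>(1) by (intro cSUP_least) auto
  moreover have "Inf {L. has_lip_const \<delta> q A L} \<le> \<Lambda> * (K * real q)"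
    using hl by (intro cInf_lower bdd_belowI[of _ 0]) (auto simp: has_lip_const_def)
  ultimately show "lip_norm \<delta> q A \<le> (1 + K * real q) * \<Lambda>" unfolding lip_norm_def by (simp add: algebra_simps)
qed

theorem theorem4p4:
  fixes \<A> :: "('a::{t2_space, second_countable_topology}, 'd::finite) chart set"
    and G :: "('a, 'd) chart \<Rightarrow> 'a \<Rightarrow> real ^ 'd ^ 'd"
    and \<mu> :: "'a measure" and f :: "'a \<Rightarrow> 'a" and r :: nat
  assumes "compact (UNIV :: 'a set)"
    and "smooth_atlas \<A>"
    and "riemannian_metric \<A> G"
    and "smooth_diffeo \<A> f"
    and "prob_space \<mu>"
    and "smooth_measure \<A> G \<mu>"
    and "distr \<mu> \<mu> f = \<mu>"
    and "r \<ge> 1"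
    and "fold_exp_mixing (rdist \<A> G) \<mu> f (2 * r + 1)"
  shows "(AE x in \<mu>. AE y in \<mu>.
            limsup (\<lambda>n. ereal ((\<bar>ln (closest_return (rdist \<A> G) f r n x y)\<bar>
                - 1 / real CARD('d) * ln (real n)) / ln (ln (real n))))
              = ereal (1 / (real r * real CARD('d))))
       \<and> (AE x in \<mu>.
            limsup (\<lambda>n. ereal ((\<bar>ln (closest_return (rdist \<A> G) f r n x x)\<bar>
                - 1 / real CARD('d) * ln (real n)) / ln (ln (real n))))
              = ereal (1 / (real r * real CARD('d))))"
proof -
  obtain P where P: "patched_manifold \<A> P" using exists_patches[OF assms(1,2)] by blast
  interpret R: riemannian_patches \<A> P G
    by (intro riemannian_patches.intro P riemannian_patches_axioms.intro assms(3))
  have smooth: "smooth_map \<A> f" using assms(4) by (simp add: smooth_diffeo_def)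
  obtain L where L: "1 \<le> L" "\<And>x y. R.D (f x) (f y) \<le> L * R.D x y"
    using R.smooth_map_lipschitz[OF smooth] by blast
  obtain c C where c: "0 < c"
    and lower: "\<And>x \<rho>. 0 < \<rho> \<Longrightarrow> \<rho> \<le> 1 \<Longrightarrow> c * \<rho> ^ CARD('d) \<le> measure \<mu> {y. R.D x y \<le> \<rho>}"
    and upper: "\<And>x \<rho>. 0 < \<rho> \<Longrightarrow> measure \<mu> {y. R.D x y \<le> \<rho>} \<le> C * \<rho> ^ CARD('d)"
    using R.D_ball_measure[OF assms(6,5)] by blast
  obtain K\<^sub>1 where K\<^sub>1: "1 \<le> K\<^sub>1" "\<And>x y. ennreal (R.D x y) \<le> ennreal K\<^sub>1 * rdist \<A> G x y"
    using R.D_le_rdist by blast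
  obtain K\<^sub>2 where K\<^sub>2: "1 \<le> K\<^sub>2" "\<And>x y. R.D x y < R.sep_radius \<Longrightarrow> rdist \<A> G x y \<le> ennreal (K\<^sub>2 * R.D x y)"
    using R.rdist_le_D by blast
  define q where "q = 2 * r + 1"
  obtain C\<^sub>0 \<theta>\<^sub>0 where C\<^sub>0: "0 < C\<^sub>0" "\<theta>\<^sub>0 < 1"
    and mix: "\<And>A k m. lipschitz_observable (rdist \<A> G) q A \<Longrightarrow>
      k 0 = (0::nat) \<and> (\<forall>j. Suc j < q \<longrightarrow> k j + m \<le> k (Suc j)) \<Longrightarrow>
      \<bar>(\<integral>x. A (\<lambda>i\<in>{..<q}. (f ^^ k i) x) \<partial>\<mu>) - (\<integral>x. A x \<partial>(\<Pi>\<^sub>M i\<in>{..<q}. \<mu>))\<bar>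
        \<le> C\<^sub>0 * \<theta>\<^sub>0 ^ m * lip_norm (rdist \<A> G) q A"
    using assms(9) unfolding fold_exp_mixing_def q_def by blast
  have \<theta>\<^sub>0: "0 \<le> \<theta>\<^sub>0" using mixing_rate_nonneg[OF assms(5) C\<^sub>0(1) mix] .
  \<comment> \<open>A rate \<open>0\<close> is increased, so that powers of the rate never vanish.\<close>
  define \<theta> where "\<theta> = max \<theta>\<^sub>0 (1 / 2)"
  define K where "K = C\<^sub>0 * (1 + K\<^sub>1 * real q)"
  have sets: "sets \<mu> = sets borel"
    using assms(6) by (auto simp: smooth_measure_def is_riemannian_volume_def)
  have fm: "f \<in> borel \<rightarrow>\<^sub>M borel"
    using smooth by (intro borel_measurable_continuous_onI) (simp add: smooth_map_def)
  interpret M: mixing_system \<mu> R.D f "CARD('d)" r L c C K \<theta>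
  proof (intro mixing_system.intro mixing_system_axioms.intro assms(5) sets fm assms(7) L c assms(8)
      R.D_triangle R.D_continuous R.D_self)
    show "R.D x y = R.D y x" for x y by (rule R.D_sym)
    show "1 \<le> CARD('d)" using zero_less_card_finite[where 'a = 'd] by linarith
    show "0 \<le> K" using C\<^sub>0 K\<^sub>1 by (simp add: K_def)
    show "0 < \<theta>" "\<theta> < 1" using C\<^sub>0 by (auto simp: \<theta>_def)
    show "\<bar>(\<integral>x. A (\<lambda>i\<in>{..<2 * r + 1}. (f ^^ k i) x) \<partial>\<mu>) - (\<integral>x. A x \<partial>(\<Pi>\<^sub>M i\<in>{..<2 * r + 1}. \<mu>))\<bar>
        \<le> K * \<theta> ^ m * \<Lambda>"
      if A: "\<And>x. \<bar>A x\<bar> \<le> \<Lambda>" "\<And>x y. \<bar>A x - A y\<bar> \<le> \<Lambda> * (\<Sum>i<2 * r + 1. R.D (x i) (y i))"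
        and k: "k 0 = 0" "\<And>j. Suc j < 2 * r + 1 \<Longrightarrow> k j + m \<le> k (Suc j)" for A \<Lambda> k m
    proof -
      have "0 \<le> K\<^sub>1" using K\<^sub>1 by simp
      note lip = lip_norm_le[OF this A[folded q_def] K\<^sub>1(2)]
      have \<Lambda>0: "0 \<le> \<Lambda>" using order_trans[OF abs_ge_zero A(1)[of undefined]] .
      have "\<bar>(\<integral>x. A (\<lambda>i\<in>{..<q}. (f ^^ k i) x) \<partial>\<mu>) - (\<integral>x. A x \<partial>(\<Pi>\<^sub>M i\<in>{..<q}. \<mu>))\<bar>
          \<le> C\<^sub>0 * \<theta>\<^sub>0 ^ m * lip_norm (rdist \<A> G) q A"
        using k by (intro mix lip(1)) (auto simp: q_def)
      also have "\<dots> \<le> C\<^sub>0 * \<theta>\<^sub>0 ^ m * ((1 + K\<^sub>1 * real q) * \<Lambda>)"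
        using C\<^sub>0 \<theta>\<^sub>0 by (intro mult_left_mono lip(2)) auto
      also have "\<dots> \<le> C\<^sub>0 * \<theta> ^ m * ((1 + K\<^sub>1 * real q) * \<Lambda>)"
        using C\<^sub>0 \<theta>\<^sub>0 K\<^sub>1 \<Lambda>0 by (intro mult_right_mono mult_left_mono power_mono) (auto simp: \<theta>_def)
      also have "\<dots> = K * \<theta> ^ m * \<Lambda>" by (simp add: K_def mult_ac)
      finally show ?thesis by (simp only: q_def)
    qed
  qed (use lower upper in auto)
  define M where "M = max K\<^sub>1 K\<^sub>2"
  have M: "0 < M" "K\<^sub>1 \<le> M" "K\<^sub>2 \<le> M" using K\<^sub>1 by (auto simp: M_def)
  have far: "ennreal (R.D x y) \<le> ennreal M * rdist \<A> G x y" for x y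
    using K\<^sub>1(2)[of x y] mult_right_mono[OF ennreal_leI[OF M(2)], of "rdist \<A> G x y"] order_trans by force
  have close: "rdist \<A> G x y \<le> ennreal (M * R.D x y)" if "R.D x y < R.sep_radius" for x y
    using K\<^sub>2(2)[OF that] ennreal_leI[OF mult_right_mono[OF M(3) R.D_nonneg[of x y]]] by (rule order_trans)
  show ?thesis
    using M.multilog_law_hitting[OF M(1) R.sep_radius_pos far close]
      M.multilog_law_recurrence[OF M(1) R.sep_radius_pos far close] by blast
qed

end
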